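(* Let $\Gamma$ be a discrete quantum group and let $A:\ell^\infty(\Gamma)\to\ell^\infty(\Gamma)$ be given by $Ax:=P\ast x$ for some $P\in c_{00}(\Gamma)$. Then $A$ is a quantum adjacency matrix if and only if $P$ is a projection. Moreover, $A$ is GNS symmetric if $P$ is invariant under the antipode of $\Gamma$ (i.e. $S(P)=P$), and it is KMS symmetric if $P$ is invariant under the unitary antipode (i.e. $R(P)=P$).
   Context: $\Gamma$ is the discrete dual of a compact quantum group $\mathbb G$. For $\alpha\in\mathrm{Irr}(\mathbb G)$ fix a unitary representative $u^\alpha=(u^\alpha_{ij})$ of dimension $n_\alpha$; $\rho_\alpha\in M_{n_\alpha}$ is the unique positive definite matrix with $\mathrm{Tr}(\rho_\alpha)=\mathrm{Tr}(\rho_\alpha^{-1})=:\dim_q(\alpha)$ implementing the equivalence between $u^\alpha$ and its double contragredient, $(\mathrm{id}\otimes S_{\mathbb G}^2)(u^\alpha)=\rho_\alpha u^\alpha\rho_\alpha^{-1}$. Put $\ell^\infty(\Gamma)=\ell^\infty\text{-}\bigoplus_{\alpha}M_{n_\alpha}$, $c_{00}(\Gamma)=c_{00}\text{-}\bigoplus_\alpha M_{n_\alpha}$ (algebraic direct sum), $W=\sum_\alpha\sum_{i,j}e^\alpha_{ij}\otimes u^\alpha_{ij}$. The comultiplication $\Delta:\ell^\infty(\Gamma)\to\ell^\infty(\Gamma)\overline\otimes\ell^\infty(\Gamma)$ is the normal $*$-homomorphism with $(\Delta\otimes\mathrm{id})(W)=W_{23}W_{13}$. The right Haar weight is $\widehat{h_R}(x)=\sum_\alpha\mathrm{Tr}(\rho_\alpha)\mathrm{Tr}(\rho_\alpha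 x_\alpha)$; it is the reference weight on $\ell^\infty(\Gamma)$. With $\rho=(\rho_\alpha)_\alpha$, its modular group is $\sigma_z(x)=\rho^{iz}x\rho^{-iz}$, $x\in c_{00}(\Gamma)$, $z\in\mathbb C$. $S$ is the antipode of $(\ell^\infty(\Gamma),\Delta)$ and $R$ the unitary antipode, $S=\tau_{-i/2}R$ where the scaling group is $\tau_t=\sigma_{-t}$; thus $R=S\circ\sigma_{-i/2}$ on $c_{00}(\Gamma)$. Convolution: for $P\in c_{00}(\Gamma)$, $x\in\ell^\infty(\Gamma)$, $P\ast x$ is the element with $\widehat{h_R}(y(P\ast x))=(\widehat{h_R}\otimes\widehat{h_R})(\Delta(y)(P\otimes x))$ for all $y\in c_{00}(\Gamma)$ (elements are identified with functionals $\widehat{h_R}(\cdot\,x)$, and $\varphi_1\ast\varphi_2=(\varphi_1\otimes\varphi_2)\circ\Delta$). A quantum adjacency matrix is a completely positive map $A$ satisfying $\frac1{\dim_q(\alpha)}\sum_lA(e^\alpha_{il}\rho_\alpha^{-1})A(e^\alpha_{lj})=A(e^\alpha_{ij})$ for all $\alpha,i,j$. $A$ is GNS symmetric if $\widehat{h_R}(A(x)y)=\widehat{h_R}(xA(y))$ for all $x,y\in c_{00}(\Gamma)$, and KMS symmetric if $\widehat{h_R}(A(x)\sigma_{-i/2}(y))=\widehat{h_R}(x\,\sigma_{-i/2}(A(y)))$ for all $x,y\in c_{00}(\Gamma)$. A projection is a self-adjoint idempotent. *)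

theory Defs
  imports
    "HOL-Analysis.Infinite_Sum"
    "Jordan_Normal_Form.Schur_Decomposition"
    "Jordan_Normal_Form.Gauss_Jordan_Elimination"
begin

section \<open>Complex *-algebras and their algebraic tensor product\<close>

class complex_star_algebra = ring_1 +
  fixes scaleC :: "complex \<Rightarrow> 'a \<Rightarrow> 'a" (infixr "*\<^sub>C" 75)
    and star :: "'a \<Rightarrow> 'a"
  assumes scaleC_add_right: "c *\<^sub>C (x + y) = c *\<^sub>C x + c *\<^sub>C y"
    and scaleC_add_left: "(c + d) *\<^sub>C x = c *\<^sub>C x + d *\<^sub>C x"
    and scaleC_scaleC: "c *\<^sub>C d *\<^sub>C x = (c * d) *\<^sub>C x"
    and scaleC_one: "1 *\<^sub>C x = x"
    and mult_scaleC_left: "(c *\<^sub>C x) * y = c *\<^sub>C (x * y)"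
    and mult_scaleC_right: "x * (c *\<^sub>C y) = c *\<^sub>C (x * y)"
    and star_star: "star (star x) = x"
    and star_add: "star (x + y) = star x + star y"
    and star_mult: "star (x * y) = star y * star x"
    and star_scaleC: "star (c *\<^sub>C x) = cnj c *\<^sub>C star x"

instantiation complex :: complex_star_algebra
begin
definition scaleC_complex :: "complex \<Rightarrow> complex \<Rightarrow> complex" where "scaleC_complex = (*)"
definition star_complex :: "complex \<Rightarrow> complex" where "star_complex = cnj"
instance
  by standard (auto simp: scaleC_complex_def star_complex_def algebra_simps)
end

definition clinear :: "('a::complex_star_algebra \<Rightarrow> 'b::complex_star_algebra) \<Rightarrow> bool" where
  "clinear f \<longleftrightarrow> (\<forall>x y. f (x + y) = f x + f y) \<and> (\<forall>c x. f (c *\<^sub>C x) = c *\<^sub>C f x)"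

definition cbilinear ::
  "('a::complex_star_algebra \<Rightarrow> 'b::complex_star_algebra \<Rightarrow> 'c::complex_star_algebra) \<Rightarrow> bool" where
  "cbilinear f \<longleftrightarrow> (\<forall>y. clinear (\<lambda>x. f x y)) \<and> (\<forall>x. clinear (f x))"

interpretation star_alg: vector_space "scaleC :: complex \<Rightarrow> 'a \<Rightarrow> 'a::complex_star_algebra"
  by standard (auto simp: scaleC_add_right scaleC_add_left scaleC_scaleC scaleC_one)

interpretation star_alg_pair: vector_space_pair
  "scaleC :: complex \<Rightarrow> 'a \<Rightarrow> 'a::complex_star_algebra"
  "scaleC :: complex \<Rightarrow> complex \<Rightarrow> complex"
  by unfold_locales

lemma separating_functional:
  fixes v :: "'a::complex_star_algebra"
  assumes "v \<noteq> 0"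
  obtains f :: "'a \<Rightarrow> complex" where "clinear f" "f v = 1"
proof -
  have "star_alg.independent {v}"
    using assms by simp
  from star_alg_pair.linear_independent_extend[OF this, of "\<lambda>_. 1"]
  obtain g where g: "Vector_Spaces.linear (*\<^sub>C) (*\<^sub>C) g" "g v = (1::complex)" by auto
  have "clinear g"
    using g(1) unfolding clinear_def
    by (auto simp: star_alg_pair.linear_add star_alg_pair.linear_scale)
  thus ?thesis using g(2) that by blast
qed

definition tsum :: "('a \<Rightarrow> 'b \<Rightarrow> 'c::comm_monoid_add) \<Rightarrow> ('a \<times> 'b) list \<Rightarrow> 'c" where
  "tsum f xs = sum_list (map (\<lambda>(a, b). f a b) xs)"

lemma tsum_simps [simp]:
  "tsum f [] = 0" "tsum f ((a, b) # xs) = f a b + tsum f xs"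
  "tsum f (xs @ ys) = tsum f xs + tsum f ys"
  by (auto simp: tsum_def)

lemma tsum_swap:
  "tsum (\<lambda>a b. tsum (g a b) ys) xs = tsum (\<lambda>c d. tsum (\<lambda>a b. g a b c d) xs) ys"
  for g :: "_ \<Rightarrow> _ \<Rightarrow> _ \<Rightarrow> _ \<Rightarrow> 'c::comm_monoid_add"
proof (induction xs)
  case Nil
  show ?case by (induction ys) (auto simp: tsum_def)
next
  case (Cons p xs)
  obtain a b where p: "p = (a, b)" by fastforce
  have "tsum (\<lambda>c d. g a b c d + h c d) ys = tsum (g a b) ys + tsum h ys" for h
    by (induction ys) (auto simp: algebra_simps)
  thus ?case using Cons by (simp add: p)
qed

text \<open>
  Two formal sums of elementary tensors represent the same element of the algebraic tensor product
  iff every bilinear form takes the same value on them.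
\<close>

definition tensor_eq ::
  "('a::complex_star_algebra \<times> 'b::complex_star_algebra) list \<Rightarrow> ('a \<times> 'b) list \<Rightarrow> bool" where
  "tensor_eq xs ys \<longleftrightarrow>
     (\<forall>f :: 'a \<Rightarrow> 'b \<Rightarrow> complex. cbilinear f \<longrightarrow> tsum f xs = tsum f ys)"

quotient_type (overloaded) ('a, 'b) tensor =
  "('a::complex_star_algebra \<times> 'b::complex_star_algebra) list" / tensor_eq
  by (intro equivpI reflpI sympI transpI) (auto simp: tensor_eq_def)

definition list_mult ::
  "('a::times \<times> 'b::times) list \<Rightarrow> ('a \<times> 'b) list \<Rightarrow> ('a \<times> 'b) list" where
  "list_mult xs ys = concat (map (\<lambda>(a, b). map (\<lambda>(c, d). (a * c, b * d)) ys) xs)"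

lemma tsum_map: "tsum f (map (\<lambda>(a, b). (g a b, h a b)) xs) = tsum (\<lambda>a b. f (g a b) (h a b)) xs"
  by (induction xs) auto

lemma tsum_list_mult:
  "tsum f (list_mult xs ys) = tsum (\<lambda>a b. tsum (\<lambda>c d. f (a * c) (b * d)) ys) xs"
  by (induction xs) (auto simp: list_mult_def tsum_map)

lemma cbilinearI:
  assumes "\<And>x x' y. f (x + x') y = f x y + f x' y" "\<And>x y y'. f x (y + y') = f x y + f x y'"
    "\<And>c x y. f (c *\<^sub>C x) y = c *\<^sub>C f x y" "\<And>c x y. f x (c *\<^sub>C y) = c *\<^sub>C f x y"
  shows "cbilinear f"
  using assms by (auto simp: cbilinear_def clinear_def)

lemma cbilinearD:
  assumes "cbilinear f"
  shows "f (x + x') y = f x y + f x' y" "f x (y + y') = f x y + f x y'"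
    "f (c *\<^sub>C x) y = c *\<^sub>C f x y" "f x (c *\<^sub>C y) = c *\<^sub>C f x y"
  using assms by (auto simp: cbilinear_def clinear_def)

lemma tsum_scaleC: "tsum (\<lambda>a b. c *\<^sub>C f a b) xs = c *\<^sub>C tsum f xs"
  for f :: "_ \<Rightarrow> _ \<Rightarrow> 'c::complex_star_algebra"
  by (induction xs) (auto simp: scaleC_add_right)

lemma tsum_cbilinear_scale:
  assumes f: "cbilinear f"
  shows "tsum (\<lambda>a b. f (c *\<^sub>C a) b) xs = c *\<^sub>C tsum f xs"
    "tsum (\<lambda>a b. f a (c *\<^sub>C b)) xs = c *\<^sub>C tsum f xs"
  by (simp_all add: cbilinearD[OF f] tsum_scaleC)

lemma tsum_cnj: "tsum (\<lambda>a b. cnj (f a b)) xs = cnj (tsum f xs)"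
  by (induction xs) auto

lemma tensor_eq_mult:
  assumes "tensor_eq xs xs'" "tensor_eq ys ys'"
  shows "tensor_eq (list_mult xs ys) (list_mult xs' ys')"
  unfolding tensor_eq_def
proof (intro allI impI)
  fix f :: "'a \<Rightarrow> 'b \<Rightarrow> complex" assume f: "cbilinear f"
  have 1: "cbilinear (\<lambda>c d. f (a * c) (b * d))" for a b
    by (rule cbilinearI) (auto simp: distrib_left mult_scaleC_right cbilinearD[OF f])
  have 2: "cbilinear (\<lambda>a b. f (a * c) (b * d))" for c d
    by (rule cbilinearI) (auto simp: distrib_right mult_scaleC_left cbilinearD[OF f])
  have "tsum f (list_mult xs ys) = tsum (\<lambda>a b. tsum (\<lambda>c d. f (a * c) (b * d)) ys') xs"
    using assms(2) 1 unfolding tsum_list_mult tensor_eq_def by metis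
  also have "\<dots> = tsum (\<lambda>c d. tsum (\<lambda>a b. f (a * c) (b * d)) xs) ys'"
    by (rule tsum_swap)
  also have "\<dots> = tsum (\<lambda>c d. tsum (\<lambda>a b. f (a * c) (b * d)) xs') ys'"
    using assms(1) 2 unfolding tensor_eq_def by metis
  also have "\<dots> = tsum (\<lambda>a b. tsum (\<lambda>c d. f (a * c) (b * d)) ys') xs'"
    by (rule tsum_swap)
  finally show "tsum f (list_mult xs ys) = tsum f (list_mult xs' ys')"
    by (simp add: tsum_list_mult)
qed

lemma tensor_eq_scale:
  assumes "tensor_eq xs ys"
  shows "tensor_eq (map (\<lambda>(a, b). (c *\<^sub>C a, b)) xs) (map (\<lambda>(a, b). (c *\<^sub>C a, b)) ys)"
  using assms by (auto simp: tensor_eq_def tsum_map tsum_cbilinear_scale)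

lemma tensor_eq_star:
  assumes "tensor_eq xs ys"
  shows "tensor_eq (map (\<lambda>(a, b). (star a, star b)) xs) (map (\<lambda>(a, b). (star a, star b)) ys)"
  unfolding tensor_eq_def tsum_map
proof (intro allI impI)
  fix f :: "'a \<Rightarrow> 'b \<Rightarrow> complex" assume f: "cbilinear f"
  have "cbilinear (\<lambda>a b. cnj (f (star a) (star b)))"
    by (rule cbilinearI)
      (auto simp: star_add star_scaleC cbilinearD[OF f] scaleC_complex_def)
  hence "tsum (\<lambda>a b. cnj (f (star a) (star b))) xs = tsum (\<lambda>a b. cnj (f (star a) (star b))) ys"
    using assms by (auto simp: tensor_eq_def)
  thus "tsum (\<lambda>a b. f (star a) (star b)) xs = tsum (\<lambda>a b. f (star a) (star b)) ys"
    by (simp add: tsum_cnj)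
qed

lift_definition elem_tensor ::
  "'a::complex_star_algebra \<Rightarrow> 'b::complex_star_algebra \<Rightarrow> ('a, 'b) tensor" (infixr "\<otimes>\<^sub>t" 72)
  is "\<lambda>a b. [(a, b)]" .

instantiation tensor :: (complex_star_algebra, complex_star_algebra) complex_star_algebra
begin

lift_definition zero_tensor :: "('a, 'b) tensor" is "[]" .
lift_definition one_tensor :: "('a, 'b) tensor" is "[(1, 1)]" .
lift_definition plus_tensor :: "('a, 'b) tensor \<Rightarrow> ('a, 'b) tensor \<Rightarrow> ('a, 'b) tensor"
  is "(@)" by (auto simp: tensor_eq_def)
lift_definition scaleC_tensor :: "complex \<Rightarrow> ('a, 'b) tensor \<Rightarrow> ('a, 'b) tensor"
  is "\<lambda>c. map (\<lambda>(a, b). (c *\<^sub>C a, b))" by (rule tensor_eq_scale)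
lift_definition uminus_tensor :: "('a, 'b) tensor \<Rightarrow> ('a, 'b) tensor"
  is "map (\<lambda>(a, b). (- a, b))" using tensor_eq_scale[of _ _ "-1"] by simp
lift_definition minus_tensor :: "('a, 'b) tensor \<Rightarrow> ('a, 'b) tensor \<Rightarrow> ('a, 'b) tensor"
  is "\<lambda>xs ys. xs @ map (\<lambda>(a, b). (- a, b)) ys"
proof -
  fix xs xs' :: "('a \<times> 'b) list" and ys ys' :: "('a \<times> 'b) list"
  assume "tensor_eq xs xs'" "tensor_eq ys ys'"
  with tensor_eq_scale[OF this(2), of "-1", simplified]
  show "tensor_eq (xs @ map (\<lambda>(a, b). (- a, b)) ys)
          (xs' @ map (\<lambda>(a, b). (- a, b)) ys')"
    unfolding tensor_eq_def tsum_simps by metis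
qed
lift_definition times_tensor :: "('a, 'b) tensor \<Rightarrow> ('a, 'b) tensor \<Rightarrow> ('a, 'b) tensor"
  is list_mult by (rule tensor_eq_mult)
lift_definition star_tensor :: "('a, 'b) tensor \<Rightarrow> ('a, 'b) tensor"
  is "map (\<lambda>(a, b). (star a, star b))" by (rule tensor_eq_star)

instance
proof
  fix x y z :: "('a, 'b) tensor" and c d :: complex
  have neg: "tsum f (map (\<lambda>(a, b). (- a, b)) xs) = - tsum f xs"
    if "cbilinear f" for f :: "'a \<Rightarrow> 'b \<Rightarrow> complex" and xs
    using tsum_cbilinear_scale(1)[OF that, of "-1" xs] by (simp add: tsum_map)
  have add: "tsum (\<lambda>a b. f a b + g a b) xs = tsum f xs + tsum g xs"
    for f g :: "'a \<Rightarrow> 'b \<Rightarrow> complex" and xs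
    by (induction xs) auto
  show "x + y + z = x + (y + z)" by transfer (simp add: tensor_eq_def add.assoc)
  show "x + y = y + x" by transfer (simp add: tensor_eq_def add.commute)
  show "0 + x = x" by transfer (simp add: tensor_eq_def)
  show "- x + x = 0" by transfer (simp add: tensor_eq_def neg)
  show "x - y = x + - y" by transfer (simp add: tensor_eq_def)
  show "x * y * z = x * (y * z)"
    by transfer (simp add: tensor_eq_def tsum_list_mult mult.assoc)
  show "1 * x = x" by transfer (simp add: tensor_eq_def tsum_list_mult)
  show "x * 1 = x" by transfer (simp add: tensor_eq_def tsum_list_mult)
  show "(x + y) * z = x * z + y * z" by transfer (simp add: tensor_eq_def tsum_list_mult)
  show "x * (y + z) = x * y + x * z" by transfer (simp add: tensor_eq_def tsum_list_mult add)
  show "(0 :: ('a, 'b) tensor) \<noteq> 1"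
  proof (transfer, rule notI)
    assume eq: "tensor_eq [] [(1 :: 'a, 1 :: 'b)]"
    obtain f :: "'a \<Rightarrow> complex" where f: "clinear f" "f 1 = 1"
      using separating_functional[of "1 :: 'a"] by auto
    obtain g :: "'b \<Rightarrow> complex" where g: "clinear g" "g 1 = 1"
      using separating_functional[of "1 :: 'b"] by auto
    have "cbilinear (\<lambda>a b. f a * g b)"
      using f(1) g(1)
      by (intro cbilinearI) (simp_all add: clinear_def algebra_simps scaleC_complex_def)
    with eq have "tsum (\<lambda>a b. f a * g b) [] = tsum (\<lambda>a b. f a * g b) [(1, 1)]"
      unfolding tensor_eq_def by blast
    thus False using f g by simp
  qed
  show "c *\<^sub>C (x + y) = c *\<^sub>C x + c *\<^sub>C y" by transfer (simp add: tensor_eq_def)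
  show "(c + d) *\<^sub>C x = c *\<^sub>C x + d *\<^sub>C x"
    by (transfer, unfold tensor_eq_def tsum_simps tsum_map, intro allI impI)
      (simp only: tsum_cbilinear_scale(1), rule scaleC_add_left)
  show "c *\<^sub>C d *\<^sub>C x = (c * d) *\<^sub>C x"
    by transfer (simp add: tensor_eq_def tsum_map scaleC_scaleC del: map_map)
  show "1 *\<^sub>C x = x"
    by transfer (simp add: tensor_eq_def tsum_map scaleC_one)
  show "(c *\<^sub>C x) * y = c *\<^sub>C (x * y)"
    by transfer (simp add: tensor_eq_def tsum_map tsum_list_mult mult_scaleC_left)
  show "x * (c *\<^sub>C y) = c *\<^sub>C (x * y)"
    by transfer (simp add: tensor_eq_def tsum_map tsum_list_mult mult_scaleC_right)
  show "star (star x) = x"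
    by transfer (simp add: tensor_eq_def tsum_map star_star del: map_map)
  show "star (x + y) = star x + star y" by transfer (simp add: tensor_eq_def)
  show "star (x * y) = star y * star x"
  proof (transfer, unfold tensor_eq_def tsum_map tsum_list_mult star_mult, intro allI impI)
    fix f :: "'a \<Rightarrow> 'b \<Rightarrow> complex" and xs ys
    show "tsum (\<lambda>a b. tsum (\<lambda>c d. f (star c * star a) (star d * star b)) ys) xs
        = tsum (\<lambda>a b. tsum (\<lambda>c d. f (star a * star c) (star b * star d)) xs) ys"
      by (rule tsum_swap)
  qed
  show "star (c *\<^sub>C x) = cnj c *\<^sub>C star x"
    by transfer (simp add: tensor_eq_def tsum_map star_scaleC del: map_map)
qed

end

text \<open>
  For bilinear \<open>f\<close>, \<open>tlift f\<close> is the induced linear map on the tensor product; the value for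
  other \<open>f\<close> is irrelevant.
\<close>

definition tlift ::
  "('a::complex_star_algebra \<Rightarrow> 'b::complex_star_algebra \<Rightarrow> 'c::complex_star_algebra) \<Rightarrow> ('a, 'b) tensor \<Rightarrow> 'c"
  where "tlift f t = tsum f (rep_tensor t)"

lemma tlift_abs_tensor:
  fixes f :: "'a::complex_star_algebra \<Rightarrow> 'b::complex_star_algebra \<Rightarrow> 'c::complex_star_algebra"
  assumes f: "cbilinear f"
  shows "tlift f (abs_tensor xs) = tsum f xs"
proof (rule ccontr)
  let ?ys = "rep_tensor (abs_tensor xs)"
  assume "tlift f (abs_tensor xs) \<noteq> tsum f xs"
  hence "tsum f ?ys - tsum f xs \<noteq> 0" by (simp add: tlift_def)
  then obtain g where g: "clinear g" "g (tsum f ?ys - tsum f xs) = (1::complex)"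
    using separating_functional by blast
  have "tensor_eq ?ys xs"
    using Quotient_rep_abs[OF Quotient_tensor, of xs] by (simp add: tensor_eq_def)
  moreover have "cbilinear (\<lambda>a b. g (f a b))"
    using g(1) by (intro cbilinearI) (auto simp: clinear_def cbilinearD[OF f])
  ultimately have eq: "tsum (\<lambda>a b. g (f a b)) ?ys = tsum (\<lambda>a b. g (f a b)) xs"
    unfolding tensor_eq_def by blast
  have g0: "g 0 = 0" using g(1) unfolding clinear_def by (metis add_cancel_left_right)
  have g_add: "g (v + w) = g v + g w" for v w using g(1) by (simp add: clinear_def)
  have gs: "tsum (\<lambda>a b. g (f a b)) zs = g (tsum f zs)" for zs
    by (induction zs) (auto simp: g0 g_add)
  have "g (tsum f ?ys - tsum f xs) + g (tsum f xs) = g (tsum f ?ys)"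
    by (simp flip: g_add)
  with eq g(2) show False by (simp add: gs)
qed

lemma tlift_elem_tensor: "cbilinear f \<Longrightarrow> tlift f (a \<otimes>\<^sub>t b) = f a b"
  by (simp add: elem_tensor.abs_eq tlift_abs_tensor)

lemma tlift_add: "cbilinear f \<Longrightarrow> tlift f (s + t) = tlift f s + tlift f t"
  by (induction s rule: tensor.abs_induct; induction t rule: tensor.abs_induct)
    (simp add: plus_tensor.abs_eq tlift_abs_tensor)

lemma tlift_scaleC: "cbilinear f \<Longrightarrow> tlift f (c *\<^sub>C t) = c *\<^sub>C tlift f t"
  by (induction t rule: tensor.abs_induct)
    (simp add: scaleC_tensor.abs_eq tlift_abs_tensor tsum_map tsum_cbilinear_scale)


section \<open>Matrices\<close>

definition mat_trace :: "'a::comm_monoid_add mat \<Rightarrow> 'a" where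
  "mat_trace A = (\<Sum>i<dim_row A. A $$ (i, i))"

definition psd :: "complex mat \<Rightarrow> bool" where
  "psd A \<longleftrightarrow> mat_adjoint A = A \<and>
     (\<forall>v \<in> carrier_vec (dim_row A). 0 \<le> Re ((A *\<^sub>v v) \<bullet>c v))"

definition pos_def :: "complex mat \<Rightarrow> bool" where
  "pos_def A \<longleftrightarrow> mat_adjoint A = A \<and>
     (\<forall>v \<in> carrier_vec (dim_row A). v \<noteq> 0\<^sub>v (dim_row A) \<longrightarrow> 0 < Re ((A *\<^sub>v v) \<bullet>c v))"

definition minv :: "complex mat \<Rightarrow> complex mat" where
  "minv A = the (mat_inverse A)"

text \<open>Complex powers of a positive definite matrix, by functional calculus.\<close>

definition mat_cpow :: "complex mat \<Rightarrow> complex \<Rightarrow> complex mat" where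
  "mat_cpow A z = (let n = dim_row A in
     THE B. \<exists>U d. U \<in> carrier_mat n n \<and> U * mat_adjoint U = 1\<^sub>m n \<and> (\<forall>i<n. 0 < d i) \<and>
       A = U * mat_diag n (\<lambda>i. complex_of_real (d i)) * mat_adjoint U \<and>
       B = U * mat_diag n (\<lambda>i. exp (z * complex_of_real (ln (d i)))) * mat_adjoint U)"

definition kron :: "'a::semiring_1 mat \<Rightarrow> 'a mat \<Rightarrow> 'a mat" where
  "kron A B = mat (dim_row A * dim_row B) (dim_col A * dim_col B)
     (\<lambda>(r, s). A $$ (r div dim_row B, s div dim_col B) * B $$ (r mod dim_row B, s mod dim_col B))"

definition star_mat :: "'a::complex_star_algebra mat \<Rightarrow> 'a mat" where
  "star_mat A = mat (dim_col A) (dim_row A) (\<lambda>(i, j). star (A $$ (j, i)))"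

definition scalar_mat :: "complex mat \<Rightarrow> 'a::complex_star_algebra mat" where
  "scalar_mat A = map_mat (\<lambda>c. c *\<^sub>C 1) A"


section \<open>Compact quantum groups\<close>

text \<open>A unitary representation of dimension \<open>n\<close>, as a matrix over the function algebra.\<close>

definition unitary_rep ::
  "('a::complex_star_algebra \<Rightarrow> ('a, 'a) tensor) \<Rightarrow> nat \<Rightarrow> 'a mat \<Rightarrow> bool" where
  "unitary_rep comul n u \<longleftrightarrow> u \<in> carrier_mat n n \<and>
     (\<forall>i<n. \<forall>j<n. comul (u $$ (i, j)) = (\<Sum>k<n. u $$ (i, k) \<otimes>\<^sub>t u $$ (k, j))) \<and>
     u * star_mat u = 1\<^sub>m n \<and> star_mat u * u = 1\<^sub>m n"

definition intertwiners :: "'a::complex_star_algebra mat \<Rightarrow> 'a mat \<Rightarrow> complex mat set" where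
  "intertwiners u v = {T \<in> carrier_mat (dim_row v) (dim_row u). scalar_mat T * u = v * scalar_mat T}"

definition irreducible_rep :: "'a::complex_star_algebra mat \<Rightarrow> bool" where
  "irreducible_rep u \<longleftrightarrow> 0 < dim_row u \<and>
     intertwiners u u = {c \<cdot>\<^sub>m 1\<^sub>m (dim_row u) | c. True}"

definition equivalent_rep :: "'a::complex_star_algebra mat \<Rightarrow> 'a mat \<Rightarrow> bool" where
  "equivalent_rep u v \<longleftrightarrow> (\<exists>T \<in> intertwiners u v. invertible_mat T)"

text \<open>
  A compact quantum group is given by its Hopf *-algebra of representative functions, that is, by a
  Hopf *-algebra spanned by the matrix coefficients of its finite-dimensional unitary
  representations (a CQG algebra in the sense of Dijkhuizen and Koornwinder).
\<close>

locale compact_quantum_group =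
  fixes comul :: "'a::complex_star_algebra \<Rightarrow> ('a, 'a) tensor"
    and counit :: "'a \<Rightarrow> complex"
    and antipode :: "'a \<Rightarrow> 'a"
  assumes comul_linear: "clinear comul"
    and comul_mult: "comul (x * y) = comul x * comul y"
    and comul_one: "comul 1 = 1"
    and comul_star: "comul (star x) = star (comul x)"
    and coassoc: "tlift (\<lambda>a b. tlift (\<lambda>c d. c \<otimes>\<^sub>t d \<otimes>\<^sub>t b) (comul a)) (comul x)
                  = tlift (\<lambda>a b. a \<otimes>\<^sub>t comul b) (comul x)"
    and counit_linear: "clinear counit"
    and counit_mult: "counit (x * y) = counit x * counit y"
    and counit_one: "counit 1 = 1"
    and counit_left: "tlift (\<lambda>a b. counit a *\<^sub>C b) (comul x) = x"
    and counit_right: "tlift (\<lambda>a b. counit b *\<^sub>C a) (comul x) = x"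
    and antipode_linear: "clinear antipode"
    and antipode_left: "tlift (\<lambda>a b. antipode a * b) (comul x) = counit x *\<^sub>C 1"
    and antipode_right: "tlift (\<lambda>a b. a * antipode b) (comul x) = counit x *\<^sub>C 1"
    and coefficients_span:
      "star_alg.span {u $$ (i, j) | n u i j. unitary_rep comul n u \<and> i < n \<and> j < n} = UNIV"

text \<open>\<open>u\<close> picks one unitary representative from each class in \<open>Irr\<close>, which is indexed by \<open>'i\<close>.\<close>

definition complete_irreps ::
  "('a::complex_star_algebra \<Rightarrow> ('a, 'a) tensor) \<Rightarrow> ('i \<Rightarrow> nat) \<Rightarrow> ('i \<Rightarrow> 'a mat) \<Rightarrow> bool" where
  "complete_irreps comul n u \<longleftrightarrow>
     (\<forall>\<alpha>. unitary_rep comul (n \<alpha>) (u \<alpha>) \<and> irreducible_rep (u \<alpha>)) \<and>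
     (\<forall>\<alpha> \<beta>. equivalent_rep (u \<alpha>) (u \<beta>) \<longrightarrow> \<alpha> = \<beta>) \<and>
     (\<forall>m v. unitary_rep comul m v \<and> irreducible_rep v \<longrightarrow> (\<exists>\<alpha>. equivalent_rep (u \<alpha>) v))"


section \<open>Direct sums of matrix algebras\<close>

text \<open>
  Elements of the \<open>\<ell>\<^sup>\<infinity>\<close>-direct sum of the algebras \<open>M\<^bsub>n k\<^esub>\<close> are uniformly bounded families of matrices.
  The von Neumann tensor product \<open>\<ell>\<^sup>\<infinity>(\<Gamma>) \<otimes> \<ell>\<^sup>\<infinity>(\<Gamma>)\<close> is the direct sum of the
  \<open>M\<^bsub>n \<alpha>\<^esub> \<otimes> M\<^bsub>n \<beta>\<^esub> = M\<^bsub>n \<alpha> * n \<beta>\<^esub>\<close> over pairs \<open>(\<alpha>, \<beta>)\<close>.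
\<close>

definition linf :: "('k \<Rightarrow> nat) \<Rightarrow> ('k \<Rightarrow> complex mat) set" where
  "linf n = {x. (\<forall>k. x k \<in> carrier_mat (n k) (n k)) \<and>
     (\<exists>C. \<forall>k. \<forall>v \<in> carrier_vec (n k). Re ((x k *\<^sub>v v) \<bullet>c (x k *\<^sub>v v)) \<le> C * Re (v \<bullet>c v))}"

definition c00 :: "('k \<Rightarrow> nat) \<Rightarrow> ('k \<Rightarrow> complex mat) set" where
  "c00 n = {x. (\<forall>k. x k \<in> carrier_mat (n k) (n k)) \<and> finite {k. x k \<noteq> 0\<^sub>m (n k) (n k)}}"

definition fam_add :: "('k \<Rightarrow> complex mat) \<Rightarrow> ('k \<Rightarrow> complex mat) \<Rightarrow> 'k \<Rightarrow> complex mat" where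
  "fam_add x y = (\<lambda>k. x k + y k)"

definition fam_scale :: "complex \<Rightarrow> ('k \<Rightarrow> complex mat) \<Rightarrow> 'k \<Rightarrow> complex mat" where
  "fam_scale c x = (\<lambda>k. c \<cdot>\<^sub>m x k)"

definition fam_mult :: "('k \<Rightarrow> complex mat) \<Rightarrow> ('k \<Rightarrow> complex mat) \<Rightarrow> 'k \<Rightarrow> complex mat" where
  "fam_mult x y = (\<lambda>k. x k * y k)"

definition fam_star :: "('k \<Rightarrow> complex mat) \<Rightarrow> 'k \<Rightarrow> complex mat" where
  "fam_star x = (\<lambda>k. mat_adjoint (x k))"

definition fam_one :: "('k \<Rightarrow> nat) \<Rightarrow> 'k \<Rightarrow> complex mat" where
  "fam_one n = (\<lambda>k. 1\<^sub>m (n k))"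

definition fam_kron ::
  "('k \<Rightarrow> complex mat) \<Rightarrow> ('l \<Rightarrow> complex mat) \<Rightarrow> 'k \<times> 'l \<Rightarrow> complex mat" where
  "fam_kron x y = (\<lambda>(k, l). kron (x k) (y l))"

definition dim2 :: "('k \<Rightarrow> nat) \<Rightarrow> 'k \<times> 'k \<Rightarrow> nat" where
  "dim2 n = (\<lambda>(\<alpha>, \<beta>). n \<alpha> * n \<beta>)"

definition mat_unit :: "('k \<Rightarrow> nat) \<Rightarrow> 'k \<Rightarrow> nat \<Rightarrow> nat \<Rightarrow> 'k \<Rightarrow> complex mat" where
  "mat_unit n \<alpha> i j = (\<lambda>\<beta>. mat (n \<beta>) (n \<beta>)
     (\<lambda>(r, s). if \<beta> = \<alpha> \<and> r = i \<and> s = j then 1 else 0))"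

definition is_projection :: "('k \<Rightarrow> complex mat) \<Rightarrow> bool" where
  "is_projection P \<longleftrightarrow> fam_star P = P \<and> fam_mult P P = P"

definition linear_map_on ::
  "('k \<Rightarrow> complex mat) set \<Rightarrow> ('l \<Rightarrow> complex mat) set
    \<Rightarrow> (('k \<Rightarrow> complex mat) \<Rightarrow> 'l \<Rightarrow> complex mat) \<Rightarrow> bool" where
  "linear_map_on X Y f \<longleftrightarrow> (\<forall>x\<in>X. f x \<in> Y) \<and>
     (\<forall>x\<in>X. \<forall>y\<in>X. f (fam_add x y) = fam_add (f x) (f y)) \<and>
     (\<forall>c. \<forall>x\<in>X. f (fam_scale c x) = fam_scale c (f x))"

definition star_hom_on ::
  "('k \<Rightarrow> complex mat) set \<Rightarrow> ('l \<Rightarrow> complex mat) set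
    \<Rightarrow> (('k \<Rightarrow> complex mat) \<Rightarrow> 'l \<Rightarrow> complex mat) \<Rightarrow> bool" where
  "star_hom_on X Y f \<longleftrightarrow> linear_map_on X Y f \<and>
     (\<forall>x\<in>X. \<forall>y\<in>X. f (fam_mult x y) = fam_mult (f x) (f y)) \<and>
     (\<forall>x\<in>X. f (fam_star x) = fam_star (f x))"

text \<open>Normality: preservation of suprema of bounded increasing nets of self-adjoint elements.\<close>

definition fam_le :: "('k \<Rightarrow> complex mat) \<Rightarrow> ('k \<Rightarrow> complex mat) \<Rightarrow> bool" where
  "fam_le x y \<longleftrightarrow> (\<forall>k. psd (y k - x k))"

definition is_sup :: "('k \<Rightarrow> nat) \<Rightarrow> ('k \<Rightarrow> complex mat) set \<Rightarrow> ('k \<Rightarrow> complex mat) \<Rightarrow> bool" where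
  "is_sup n D s \<longleftrightarrow> s \<in> linf n \<and> (\<forall>x\<in>D. fam_le x s) \<and>
     (\<forall>t\<in>linf n. (\<forall>x\<in>D. fam_le x t) \<longrightarrow> fam_le s t)"

definition normal_map ::
  "('k \<Rightarrow> nat) \<Rightarrow> ('l \<Rightarrow> nat) \<Rightarrow> (('k \<Rightarrow> complex mat) \<Rightarrow> 'l \<Rightarrow> complex mat) \<Rightarrow> bool" where
  "normal_map n m f \<longleftrightarrow> (\<forall>D s. D \<noteq> {} \<and> D \<subseteq> {x \<in> linf n. fam_star x = x} \<and>
     (\<forall>x\<in>D. \<forall>y\<in>D. \<exists>z\<in>D. fam_le x z \<and> fam_le y z) \<and> is_sup n D s \<longrightarrow> is_sup m (f ` D) (f s))"

text \<open>
  The component at \<open>k\<close> of an \<open>N \<times> N\<close> matrix \<open>X\<close> over \<open>linf n\<close>, as a matrix of size \<open>N * n k\<close>;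
  \<open>X\<close> is positive iff all its components are.
\<close>

definition amplification ::
  "('k \<Rightarrow> nat) \<Rightarrow> nat \<Rightarrow> (nat \<Rightarrow> nat \<Rightarrow> 'k \<Rightarrow> complex mat) \<Rightarrow> 'k \<Rightarrow> complex mat" where
  "amplification n N X = (\<lambda>k. mat (N * n k) (N * n k)
     (\<lambda>(r, s). X (r div n k) (s div n k) k $$ (r mod n k, s mod n k)))"

definition completely_positive ::
  "('k \<Rightarrow> nat) \<Rightarrow> (('k \<Rightarrow> complex mat) \<Rightarrow> 'k \<Rightarrow> complex mat) \<Rightarrow> bool" where
  "completely_positive n A \<longleftrightarrow> linear_map_on (linf n) (linf n) A \<and>
     (\<forall>N X. (\<forall>i<N. \<forall>j<N. X i j \<in> linf n) \<and> (\<forall>k. psd (amplification n N X k)) \<longrightarrow>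
        (\<forall>k. psd (amplification n N (\<lambda>i j. A (X i j)) k)))"


section \<open>The discrete dual\<close>

text \<open>
  The last clause is the component of \<open>(\<Delta> \<otimes> id)(W) = W\<^sub>2\<^sub>3 W\<^sub>1\<^sub>3\<close> in
  \<open>M\<^bsub>n \<gamma>\<^esub> \<otimes> M\<^bsub>n \<beta>\<^esub> \<otimes> Pol\<close>. The sum over \<open>\<alpha>\<close> is finite for any *-homomorphism \<open>Delta\<close>, since the
  images of the units of the \<open>M\<^bsub>n \<alpha>\<^esub>\<close> in \<open>M\<^bsub>n \<gamma> * n \<beta>\<^esub>\<close> are mutually orthogonal projections.
\<close>

definition dual_comultiplication ::
  "('i \<Rightarrow> nat) \<Rightarrow> ('i \<Rightarrow> 'a::complex_star_algebra mat)
    \<Rightarrow> (('i \<Rightarrow> complex mat) \<Rightarrow> 'i \<times> 'i \<Rightarrow> complex mat) \<Rightarrow> bool" where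
  "dual_comultiplication n u Delta \<longleftrightarrow>
     star_hom_on (linf n) (linf (dim2 n)) Delta \<and> normal_map n (dim2 n) Delta \<and>
     (\<forall>\<gamma> \<beta>. let d = n \<gamma> * n \<beta> in
        mat d d (\<lambda>(r, s).
          \<Sum>\<alpha> | \<exists>i<n \<alpha>. \<exists>j<n \<alpha>. Delta (mat_unit n \<alpha> i j) (\<gamma>, \<beta>) \<noteq> 0\<^sub>m d d.
            \<Sum>i<n \<alpha>. \<Sum>j<n \<alpha>. Delta (mat_unit n \<alpha> i j) (\<gamma>, \<beta>) $$ (r, s) *\<^sub>C u \<alpha> $$ (i, j))
        = kron (1\<^sub>m (n \<gamma>)) (u \<beta>) * kron (u \<gamma>) (1\<^sub>m (n \<beta>)))"

text \<open>The counit of \<open>\<Gamma>\<close>, determined by \<open>(\<epsilon> \<otimes> id)(W) = 1\<close>: evaluation at the trivial representation.\<close>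

definition dual_counit ::
  "('i \<Rightarrow> 'a::complex_star_algebra mat) \<Rightarrow> ('i \<Rightarrow> complex mat) \<Rightarrow> complex" where
  "dual_counit u x = x (THE \<alpha>. u \<alpha> = 1\<^sub>m 1) $$ (0, 0)"

text \<open>
  For \<open>t\<close> in the algebraic tensor square of \<open>c00 n\<close> and bilinear \<open>F\<close>, the image of \<open>t\<close> under the linear
  map with \<open>a \<otimes> b \<mapsto> F a b\<close>.
\<close>

definition c00_lift ::
  "('i \<Rightarrow> nat) \<Rightarrow> (('i \<Rightarrow> complex mat) \<Rightarrow> ('i \<Rightarrow> complex mat) \<Rightarrow> 'i \<Rightarrow> complex mat)
    \<Rightarrow> ('i \<times> 'i \<Rightarrow> complex mat) \<Rightarrow> 'i \<Rightarrow> complex mat" where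
  "c00_lift n F t = (\<lambda>\<delta>. mat (n \<delta>) (n \<delta>) (\<lambda>(r, s).
     \<Sum>(\<alpha>, \<beta>) | t (\<alpha>, \<beta>) \<noteq> 0\<^sub>m (n \<alpha> * n \<beta>) (n \<alpha> * n \<beta>).
       \<Sum>i<n \<alpha>. \<Sum>j<n \<alpha>. \<Sum>p<n \<beta>. \<Sum>q<n \<beta>.
         t (\<alpha>, \<beta>) $$ (i * n \<beta> + p, j * n \<beta> + q) *
         F (mat_unit n \<alpha> i j) (mat_unit n \<beta> p q) \<delta> $$ (r, s)))"

text \<open>
  The antipode of a discrete quantum group, as that of a multiplier Hopf algebra:
  \<open>m (S \<otimes> id) (\<Delta>(a) (1 \<otimes> b)) = \<epsilon>(a) b\<close> and \<open>m (id \<otimes> S) ((a \<otimes> 1) \<Delta>(b)) = \<epsilon>(b) a\<close> on \<open>c00\<close>.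
\<close>

definition dual_antipode ::
  "('i \<Rightarrow> nat) \<Rightarrow> ('i \<Rightarrow> 'a::complex_star_algebra mat)
    \<Rightarrow> (('i \<Rightarrow> complex mat) \<Rightarrow> 'i \<times> 'i \<Rightarrow> complex mat)
    \<Rightarrow> (('i \<Rightarrow> complex mat) \<Rightarrow> 'i \<Rightarrow> complex mat) \<Rightarrow> bool" where
  "dual_antipode n u Delta S \<longleftrightarrow> linear_map_on (c00 n) (c00 n) S \<and>
     (\<forall>a\<in>c00 n. \<forall>b\<in>c00 n.
        c00_lift n (\<lambda>x y. fam_mult (S x) y) (fam_mult (Delta a) (fam_kron (fam_one n) b))
          = fam_scale (dual_counit u a) b \<and>
        c00_lift n (\<lambda>x y. fam_mult x (S y)) (fam_mult (fam_kron a (fam_one n)) (Delta b))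
          = fam_scale (dual_counit u b) a)"

locale discrete_quantum_group =
  compact_quantum_group comul counit antipode
  for comul :: "'a::complex_star_algebra \<Rightarrow> ('a, 'a) tensor"
    and counit :: "'a \<Rightarrow> complex" and antipode :: "'a \<Rightarrow> 'a" +
  fixes n :: "'i \<Rightarrow> nat" and u :: "'i \<Rightarrow> 'a mat" and rho :: "'i \<Rightarrow> complex mat"
    and Delta :: "('i \<Rightarrow> complex mat) \<Rightarrow> 'i \<times> 'i \<Rightarrow> complex mat"
    and S :: "('i \<Rightarrow> complex mat) \<Rightarrow> 'i \<Rightarrow> complex mat"
  assumes irreps: "complete_irreps comul n u"
    and rho_carrier: "rho \<alpha> \<in> carrier_mat (n \<alpha>) (n \<alpha>)"
    and rho_pos_def: "pos_def (rho \<alpha>)"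
    and rho_trace: "mat_trace (rho \<alpha>) = mat_trace (minv (rho \<alpha>))"
    and rho_intertwines: "map_mat (\<lambda>x. antipode (antipode x)) (u \<alpha>)
                          = scalar_mat (rho \<alpha>) * u \<alpha> * scalar_mat (minv (rho \<alpha>))"
    and Delta: "dual_comultiplication n u Delta"
    and S: "dual_antipode n u Delta S"


section \<open>Haar weight, convolution and quantum adjacency matrices\<close>

definition dimq :: "('i \<Rightarrow> complex mat) \<Rightarrow> 'i \<Rightarrow> complex" where
  "dimq rho \<alpha> = mat_trace (rho \<alpha>)"

definition haar :: "('i \<Rightarrow> complex mat) \<Rightarrow> ('i \<Rightarrow> complex mat) \<Rightarrow> complex" where
  "haar rho x = (\<Sum>\<^sub>\<infinity>\<alpha>. mat_trace (rho \<alpha>) * mat_trace (rho \<alpha> * x \<alpha>))"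

definition haar2 :: "('i \<Rightarrow> complex mat) \<Rightarrow> ('i \<times> 'i \<Rightarrow> complex mat) \<Rightarrow> complex" where
  "haar2 rho t = (\<Sum>\<^sub>\<infinity>(\<alpha>, \<beta>). mat_trace (rho \<alpha>) * mat_trace (rho \<beta>) *
                    mat_trace (kron (rho \<alpha>) (rho \<beta>) * t (\<alpha>, \<beta>)))"

definition convolution ::
  "('i \<Rightarrow> nat) \<Rightarrow> ('i \<Rightarrow> complex mat) \<Rightarrow> (('i \<Rightarrow> complex mat) \<Rightarrow> 'i \<times> 'i \<Rightarrow> complex mat)
    \<Rightarrow> ('i \<Rightarrow> complex mat) \<Rightarrow> ('i \<Rightarrow> complex mat) \<Rightarrow> 'i \<Rightarrow> complex mat" where
  "convolution n rho Delta P x = (THE z. z \<in> linf n \<and>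
     (\<forall>y\<in>c00 n. haar rho (fam_mult y z) = haar2 rho (fam_mult (Delta y) (fam_kron P x))))"

definition modular_group ::
  "('i \<Rightarrow> complex mat) \<Rightarrow> complex \<Rightarrow> ('i \<Rightarrow> complex mat) \<Rightarrow> 'i \<Rightarrow> complex mat" where
  "modular_group rho z x = (\<lambda>\<alpha>. mat_cpow (rho \<alpha>) (\<i> * z) * x \<alpha> * mat_cpow (rho \<alpha>) (- (\<i> * z)))"

text \<open>\<open>R = S \<circ> \<sigma>\<^bsub>-i/2\<^esub>\<close> on \<open>c00\<close>.\<close>

definition unitary_antipode ::
  "('i \<Rightarrow> complex mat) \<Rightarrow> (('i \<Rightarrow> complex mat) \<Rightarrow> 'i \<Rightarrow> complex mat)
    \<Rightarrow> ('i \<Rightarrow> complex mat) \<Rightarrow> 'i \<Rightarrow> complex mat" where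
  "unitary_antipode rho S x = S (modular_group rho (- \<i> / 2) x)"

definition quantum_adjacency_matrix ::
  "('i \<Rightarrow> nat) \<Rightarrow> ('i \<Rightarrow> complex mat) \<Rightarrow> (('i \<Rightarrow> complex mat) \<Rightarrow> 'i \<Rightarrow> complex mat) \<Rightarrow> bool" where
  "quantum_adjacency_matrix n rho A \<longleftrightarrow> completely_positive n A \<and>
     (\<forall>\<alpha>. \<forall>i<n \<alpha>. \<forall>j<n \<alpha>. \<forall>\<gamma>.
        (1 / dimq rho \<alpha>) \<cdot>\<^sub>m
          mat (n \<gamma>) (n \<gamma>) (\<lambda>(r, s). \<Sum>l<n \<alpha>.
            (A (fam_mult (mat_unit n \<alpha> i l) (\<lambda>\<beta>. minv (rho \<beta>))) \<gamma> * A (mat_unit n \<alpha> l j) \<gamma>) $$ (r, s))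
        = A (mat_unit n \<alpha> i j) \<gamma>)"

definition GNS_symmetric ::
  "('i \<Rightarrow> nat) \<Rightarrow> ('i \<Rightarrow> complex mat) \<Rightarrow> (('i \<Rightarrow> complex mat) \<Rightarrow> 'i \<Rightarrow> complex mat) \<Rightarrow> bool" where
  "GNS_symmetric n rho A \<longleftrightarrow>
     (\<forall>x\<in>c00 n. \<forall>y\<in>c00 n. haar rho (fam_mult (A x) y) = haar rho (fam_mult x (A y)))"

definition KMS_symmetric ::
  "('i \<Rightarrow> nat) \<Rightarrow> ('i \<Rightarrow> complex mat) \<Rightarrow> (('i \<Rightarrow> complex mat) \<Rightarrow> 'i \<Rightarrow> complex mat) \<Rightarrow> bool" where
  "KMS_symmetric n rho A \<longleftrightarrow>
     (\<forall>x\<in>c00 n. \<forall>y\<in>c00 n.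
        haar rho (fam_mult (A x) (modular_group rho (- \<i> / 2) y))
        = haar rho (fam_mult x (modular_group rho (- \<i> / 2) (A y))))"

end

theory Submission
  imports Defs "Jordan_Normal_Form.Spectral_Radius" "HOL-Analysis.L2_Norm"
begin

text \<open>
  Families of matrices are the linear functionals on the function algebra, by
  \<open>\<langle>x, u\<^sub>i\<^sub>j\<rangle> = x\<^sub>i\<^sub>j\<close>. The orthogonality relations give a Fourier transform \<open>x \<mapsto> x'\<close> on \<open>c\<^sub>0\<^sub>0\<close> with
  \<open>h\<^sub>R(yx) = \<langle>y, x'\<rangle>\<close>. Since \<open>\<Delta>\<close> is dual to the opposite multiplication of the function algebra,
  \<open>\<langle>P * x, b\<rangle> = \<langle>x, bk\<rangle>\<close> where \<open>k\<close> is the Fourier transform of \<open>T = P \<circ> S\<close>.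

  If \<open>P\<close> is a projection then \<open>T = T\<^sup>2 = \<rho>T\<^sup>*\<rho>\<^sup>-\<^sup>1\<close>, so \<open>T\<rho> = T\<rho>T\<^sup>*\<close> is of the form \<open>ZZ\<^sup>*\<close> and \<open>P * x\<close> is a sum of
  compressions of \<open>\<Delta>(x)\<close>, hence completely positive in \<open>x\<close>. The Schur idempotency follows from \<open>P\<^sup>2 = P\<close>
  because the coefficients of \<open>P * x\<close> are \<open>\<langle>P, S\<^sup>-\<^sup>1(x') u\<^sub>r\<^sub>s\<rangle>\<close> and the \<open>S\<^sup>-\<^sup>1(u\<^sub>k\<^sub>i)\<close> form a corepresentation.
  Conversely the unit \<open>e\<close> of the trivial block has \<open>e' = 1\<close>, so \<open>P * e = P\<close>, and the two conditions on a quantum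
  adjacency matrix, applied to \<open>e\<close>, say that \<open>P\<close> is positive and \<open>P\<^sup>2 = P\<close>.

  For the symmetry statements, \<open>\<langle>y, x'P'\<rangle>\<close> is the weight of \<open>(P * y) x\<close> if \<open>k = P'\<close>, and it equals the weight of
  \<open>y (P * x)\<close> in general. In the KMS case \<open>k\<close> is \<open>P'\<close> conjugated by \<open>\<rho>\<^sup>1\<^sup>/\<^sup>2\<close>, and this conjugation is multiplicative.
\<close>

text \<open>The function algebra is given only as the span of coefficients of unitary
  representations, so the duality rests on making the entries of the \<open>u \<alpha>\<close> a
  basis. Spanning is complete reducibility, obtained by splitting along eigenvectors of Hermitian
  intertwiners; independence uses that relations form an invariant subspace. The Haar state is then
  the coefficient of 1 in this basis, so no integration enters.

  The convolution is a definite description over sums with infinitely many blocks. An element of the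
  function algebra involves finitely many blocks, which makes these sums finite, and the weight
  separates families, which makes the description unique. Normality of \<open>Delta\<close> is what
  reaches all bounded families: the formula for W fixes \<open>Delta\<close> on matrix units alone.

  Neither the weight nor the Haar state need be a trace. The kernel k comes from the modular
  property of the Haar state: moving an element from one end of a product to the other multiplies it
  by \<rho>^-1 on both sides. In the KMS case conjugation by \<rho>^(1/2) must be multiplicative,
  while the Hopf axioms give this for its square, which is the square of the antipode up to
  inversion.\<close>

section \<open>Linear maps and functionals on complex star-algebras\<close>

lemma clinear_add: "clinear f \<Longrightarrow> f (x + y) = f x + f y"
  and clinear_scale: "clinear f \<Longrightarrow> f (c *\<^sub>C x) = c *\<^sub>C f x"
  by (auto simp: clinear_def)

lemma clinear_zero: "clinear f \<Longrightarrow> f 0 = 0"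
  by (metis add_cancel_left_right clinear_add)

lemma clinear_sum: "clinear f \<Longrightarrow> f (sum g A) = (\<Sum>i\<in>A. f (g i))"
  by (induction A rule: infinite_finite_induct) (auto simp: clinear_zero clinear_add)

lemma clinear_diff: "clinear f \<Longrightarrow> f (x - y) = f x - f y"
  using clinear_add[of f "x - y" y] by (simp add: algebra_simps)

lemma scaleC_sum_right: "c *\<^sub>C sum f A = (\<Sum>i\<in>A. c *\<^sub>C f i)"
  and scaleC_sum_left: "sum g A *\<^sub>C x = (\<Sum>i\<in>A. g i *\<^sub>C x)"
  for x :: "'a::complex_star_algebra"
  by (rule star_alg.scale_sum_right, rule star_alg.scale_sum_left)

lemma star_zero [simp]: "star (0::'a::complex_star_algebra) = 0"
  by (metis add_cancel_left_right star_add)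

lemma star_one [simp]: "star (1::'a::complex_star_algebra) = 1"
  by (metis mult.left_neutral mult.right_neutral star_mult star_star)

lemma star_sum: "star (sum f A) = (\<Sum>i\<in>A. star (f i :: 'a::complex_star_algebra))"
  by (induction A rule: infinite_finite_induct) (auto simp: star_add)

lemma scaleC_one_eq_iff: "c *\<^sub>C 1 = d *\<^sub>C (1::'a::complex_star_algebra) \<longleftrightarrow> c = d"
  by simp

text \<open>Functionals separate points by \<open>separating_functional\<close>, so identities in
  the function algebra reduce to identities between complex numbers.\<close>

lemma clinear_eqI:
  fixes v w :: "'a::complex_star_algebra"
  assumes "\<And>f :: 'a \<Rightarrow> complex. clinear f \<Longrightarrow> f v = f w"
  shows "v = w"
proof (rule ccontr)
  assume "v \<noteq> w"
  then obtain f :: "'a \<Rightarrow> complex" where "clinear f" "f (v - w) = 1"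
    using separating_functional[of "v - w"] by auto
  with assms[of f] show False by (simp add: clinear_diff)
qed

lemma clinear_comp: "clinear f \<Longrightarrow> clinear g \<Longrightarrow> clinear (\<lambda>x. f (g x))"
  by (simp add: clinear_def)

lemma clinear_tlift: "cbilinear f \<Longrightarrow> clinear (tlift f)"
  by (simp add: clinear_def tlift_add tlift_scaleC)

section \<open>Elementary tensors and the maps induced on them\<close>

lemma tlift_sum_tensor:
  assumes "cbilinear f"
  shows "tlift f (\<Sum>k\<in>K. a k \<otimes>\<^sub>t b k) = (\<Sum>k\<in>K. f (a k) (b k))"
  using assms by (simp add: clinear_sum[OF clinear_tlift] tlift_elem_tensor)

lemma elem_tensor_scale_left: "(c *\<^sub>C a) \<otimes>\<^sub>t b = c *\<^sub>C (a \<otimes>\<^sub>t b)"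
  by transfer (simp add: tensor_eq_def)

lemma elem_tensor_add_left: "(a + a') \<otimes>\<^sub>t b = a \<otimes>\<^sub>t b + a' \<otimes>\<^sub>t b"
  by (transfer, unfold tensor_eq_def, intro allI impI) (simp add: cbilinearD(1))

lemma elem_tensor_add_right: "a \<otimes>\<^sub>t (b + b') = a \<otimes>\<^sub>t b + a \<otimes>\<^sub>t b'"
  by (transfer, unfold tensor_eq_def, intro allI impI) (simp add: cbilinearD(2))

lemma elem_tensor_scale_right: "a \<otimes>\<^sub>t (c *\<^sub>C b) = c *\<^sub>C (a \<otimes>\<^sub>t b)"
  by (transfer, unfold tensor_eq_def, intro allI impI) (simp add: cbilinearD(3,4))

lemma elem_tensor_mult: "(a \<otimes>\<^sub>t b) * (c \<otimes>\<^sub>t d) = (a * c) \<otimes>\<^sub>t (b * d)"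
  by transfer (simp add: list_mult_def tensor_eq_def)

lemma elem_tensor_star: "star (a \<otimes>\<^sub>t b) = star a \<otimes>\<^sub>t star b"
  by transfer (simp add: tensor_eq_def)

lemma elem_tensor_zero [simp]: "0 \<otimes>\<^sub>t b = 0" "a \<otimes>\<^sub>t 0 = 0"
  using elem_tensor_scale_left[of 0 0 b] elem_tensor_scale_right[of a 0 0] by simp_all

lemma elem_tensor_sum_left: "(\<Sum>i\<in>I. a i) \<otimes>\<^sub>t b = (\<Sum>i\<in>I. a i \<otimes>\<^sub>t b)"
  by (induction I rule: infinite_finite_induct) (auto simp: elem_tensor_add_left)

lemma elem_tensor_sum_right: "a \<otimes>\<^sub>t (\<Sum>i\<in>I. b i) = (\<Sum>i\<in>I. a \<otimes>\<^sub>t b i)"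
  by (induction I rule: infinite_finite_induct) (auto simp: elem_tensor_add_right)

subsection \<open>Matrices\<close>

lemma index_mult_mat_sum:
  "A \<in> carrier_mat m k \<Longrightarrow> B \<in> carrier_mat k l \<Longrightarrow> i < m \<Longrightarrow> j < l \<Longrightarrow>
   (A * B) $$ (i, j) = (\<Sum>r<k. A $$ (i, r) * B $$ (r, j))"
  by (auto simp: scalar_prod_def lessThan_atLeast0 intro!: sum.cong)

lemma dim_mat_adjoint [simp]: "dim_row (mat_adjoint A) = dim_col A" "dim_col (mat_adjoint A) = dim_row A"
  by (simp_all add: mat_adjoint_def)

lemma mat_adjoint_carrier [intro]: "A \<in> carrier_mat m k \<Longrightarrow> mat_adjoint A \<in> carrier_mat k m"
  by (rule carrier_matI) auto

lemma index_mat_adjoint [simp]: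
  "i < dim_col A \<Longrightarrow> j < dim_row A \<Longrightarrow> mat_adjoint (A :: complex mat) $$ (i, j) = cnj (A $$ (j, i))"
  by (simp add: mat_adjoint_def mat_of_rows_index)

lemma mat_adjoint_adjoint [simp]: "mat_adjoint (mat_adjoint A) = (A :: complex mat)"
  by (rule eq_matI) auto

lemma mat_adjoint_mult:
  assumes "A \<in> carrier_mat m k" "B \<in> carrier_mat k l"
  shows "mat_adjoint (A * B) = mat_adjoint B * mat_adjoint (A :: complex mat)"
proof (rule eq_matI)
  fix i j
  assume "i < dim_row (mat_adjoint B * mat_adjoint A)" "j < dim_col (mat_adjoint B * mat_adjoint A)"
  then have ij: "i < l" "j < m" using assms by auto
  have "mat_adjoint (A * B) $$ (i, j) = cnj (\<Sum>r<k. A $$ (j, r) * B $$ (r, i))"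
    using ij assms by (simp add: index_mult_mat_sum[OF assms] del: index_mult_mat(1))
  also have "\<dots> = (\<Sum>r<k. mat_adjoint B $$ (i, r) * mat_adjoint A $$ (r, j))"
    using ij assms by (auto intro!: sum.cong)
  also have "\<dots> = (mat_adjoint B * mat_adjoint A) $$ (i, j)"
    using ij assms by (subst index_mult_mat_sum[where k = k]) auto
  finally show "mat_adjoint (A * B) $$ (i, j) = (mat_adjoint B * mat_adjoint A) $$ (i, j)" .
qed (insert carrier_matD[OF assms(1)] carrier_matD[OF assms(2)], simp_all)

text \<open>Test vectors become arbitrary functions of the index, without dimension conditions.
  Quadratic forms over products of index sets can then be regrouped as plain finite sums.\<close>

lemma psd_iff:
  assumes A: "A \<in> carrier_mat n n"
  shows "psd A \<longleftrightarrow> (\<forall>i<n. \<forall>j<n. A $$ (j, i) = cnj (A $$ (i, j))) \<and>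
    (\<forall>v. 0 \<le> Re (\<Sum>i<n. \<Sum>j<n. cnj (v i) * A $$ (i, j) * v j))"
proof -
  have adj: "mat_adjoint A = A \<longleftrightarrow> (\<forall>i<n. \<forall>j<n. A $$ (j, i) = cnj (A $$ (i, j)))"
  proof
    assume *: "mat_adjoint A = A"
    show "\<forall>i<n. \<forall>j<n. A $$ (j, i) = cnj (A $$ (i, j))"
      using A by (intro allI impI, subst *[symmetric]) auto
  next
    assume *: "\<forall>i<n. \<forall>j<n. A $$ (j, i) = cnj (A $$ (i, j))"
    show "mat_adjoint A = A"
    proof (rule eq_matI)
      fix i j assume "i < dim_row A" "j < dim_col A"
      moreover from this have "A $$ (i, j) = cnj (A $$ (j, i))" using A *[rule_format, of j i] by simp
      ultimately show "mat_adjoint A $$ (i, j) = A $$ (i, j)" using A by simp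
    qed (use A in auto)
  qed
  have q: "(A *\<^sub>v v) \<bullet>c v = (\<Sum>i<n. \<Sum>j<n. cnj (v $ i) * A $$ (i, j) * v $ j)"
    if "v \<in> carrier_vec n" for v
    using A that by (auto simp: scalar_prod_def lessThan_atLeast0 sum_distrib_left sum_distrib_right mult_ac
      intro!: sum.cong)
  have "(\<forall>v \<in> carrier_vec (dim_row A). 0 \<le> Re ((A *\<^sub>v v) \<bullet>c v)) \<longleftrightarrow>
     (\<forall>v. 0 \<le> Re (\<Sum>i<n. \<Sum>j<n. cnj (v i) * A $$ (i, j) * v j))"
  proof safe
    fix v :: "nat \<Rightarrow> complex"
    assume "\<forall>v\<in>carrier_vec (dim_row A). 0 \<le> Re ((A *\<^sub>v v) \<bullet>c v)"
    then have "0 \<le> Re ((A *\<^sub>v vec n v) \<bullet>c vec n v)" using A by auto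
    then show "0 \<le> Re (\<Sum>i<n. \<Sum>j<n. cnj (v i) * A $$ (i, j) * v j)"
      by (subst (asm) q) auto
  next
    fix v :: "complex vec" assume *: "\<forall>v. 0 \<le> Re (\<Sum>i<n. \<Sum>j<n. cnj (v i) * A $$ (i, j) * v j)" and "v \<in> carrier_vec (dim_row A)"
    then have v: "v \<in> carrier_vec n" using A by auto
    show "0 \<le> Re ((A *\<^sub>v v) \<bullet>c v)" unfolding q[OF v] using * by blast
  qed
  with adj show ?thesis by (simp add: psd_def)
qed

section \<open>Orthogonal projections and the spectral theorem for Hermitian matrices\<close>

text \<open>Induction on the coordinate set: the vectors of W that vanish at the new coordinate a
  form a subspace of codimension at most one. If it is proper, W is this subspace plus the line
  through one vector w orthogonal to it, and the projection gains the rank-one term built from w.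
  \<open>E\<close> is the matrix of the projection.\<close>

lemma orthogonal_projection_exists:
  fixes W :: "('b \<Rightarrow> complex) set"
  assumes "finite I"
    and "\<And>v w c. v \<in> W \<Longrightarrow> w \<in> W \<Longrightarrow> (\<lambda>x. v x + c * w x) \<in> W"
    and "(\<lambda>_. 0) \<in> W" and "\<And>w x. w \<in> W \<Longrightarrow> x \<notin> I \<Longrightarrow> w x = 0"
  shows "\<exists>E. (\<forall>y\<in>I. (\<lambda>x. E x y) \<in> W) \<and> (\<forall>w\<in>W. \<forall>x. (\<Sum>y\<in>I. E x y * w y) = w x) \<and>
           (\<forall>x y. E x y = cnj (E y x))"
  using assms
proof (induction I arbitrary: W rule: finite_induct)
  case empty
  then show ?case by (intro exI[of _ "\<lambda>_ _. 0"]) auto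
next
  case (insert a I W)
  let ?W = "{w \<in> W. w a = 0}"
  have lin: "(\<lambda>x. v x + c * w x) \<in> W" if "v \<in> W" "w \<in> W" for v w c
    by (rule insert.prems(1)[OF that])
  have lin0: "(\<lambda>x. v x + c * w x) \<in> ?W" if "v \<in> ?W" "w \<in> ?W" for v w c
    using lin that by auto
  have nul: "w x = 0" if "w \<in> ?W" "x \<notin> I" for w x
    using insert.prems(3)[of w x] that by (cases "x = a") auto
  have z0: "(\<lambda>_. 0) \<in> ?W" using insert.prems(2) by simp
  have "\<exists>E. (\<forall>y\<in>I. (\<lambda>x. E x y) \<in> ?W) \<and> (\<forall>w\<in>?W. \<forall>x. (\<Sum>y\<in>I. E x y * w y) = w x) \<and>
           (\<forall>x y. E x y = cnj (E y x))"
    by (rule insert.IH) (fact lin0, fact z0, fact nul)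
  then obtain E where E': "\<forall>y\<in>I. (\<lambda>x. E x y) \<in> ?W"
    "\<forall>w\<in>?W. \<forall>x. (\<Sum>y\<in>I. E x y * w y) = w x" "\<forall>x y. E x y = cnj (E y x)" by blast
  note E = E'(1)[rule_format] E'(2)[rule_format] E'(3)[rule_format]
  \<comment> \<open>The columns of \<open>E\<close> outside I are uncontrolled. Cutting down to I
    times I puts every column into the smaller subspace without changing the action on it.\<close>
  define F where "F x y = (if x \<in> I \<and> y \<in> I then E x y else 0)" for x y
  have F0: "F x a = 0" "F a x = 0" for x
    using insert(2) by (auto simp: F_def)
  have F1: "(\<lambda>x. F x y) \<in> ?W" for y
  proof (cases "y \<in> I")
    case True
    have "(\<lambda>x. F x y) = (\<lambda>x. E x y)"
      using nul[OF E(1)[OF True]] True by (auto simp: F_def)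
    then show ?thesis using E(1)[OF True] by simp
  qed (use insert.prems(2) in \<open>simp add: F_def\<close>)
  have F2: "(\<Sum>y\<in>insert a I. F x y * w y) = w x" if "w \<in> ?W" for w x
  proof (cases "x \<in> I")
    case True
    then show ?thesis using E(2)[OF that, of x] insert(1,2) by (simp add: F0 F_def)
  next
    case False
    then show ?thesis using nul[OF that, of x] by (simp add: F_def)
  qed
  have F3: "F x y = cnj (F y x)" for x y
    using E(3)[of x y] by (simp add: F_def)
  show ?case
  proof (cases "W \<subseteq> ?W")
    case True
    then have W: "w \<in> ?W" if "w \<in> W" for w using that by blast
    show ?thesis
    proof (intro exI[of _ F] conjI ballI allI)
      show "(\<lambda>x. F x y) \<in> W" for y using F1[of y] by simp
    qed (rule F2[OF W], assumption, rule F3)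
  next
    case False
    then obtain v where v: "v \<in> W" "v a \<noteq> 0" by auto
    \<comment> \<open>p is the projection of v to the smaller subspace, so w = v - p is orthogonal
      to it and keeps the nonzero entry of v at a.\<close>
    define p where "p x = (\<Sum>y\<in>insert a I. F x y * v y)" for x
    have psum: "(\<lambda>x. \<Sum>y\<in>J. F x y * v y) \<in> ?W" if "finite J" for J
      using that
    proof (induction J rule: finite_induct)
      case empty
      then show ?case using insert.prems(2) by simp
    next
      case (insert y J)
      have "(\<lambda>x. (\<Sum>y\<in>J. F x y * v y) + v y * F x y) \<in> ?W"
        using lin0[OF insert.IH F1] .
      then show ?case using insert by (simp add: add.commute mult.commute)
    qed
    have p: "p \<in> ?W" using psum[of "insert a I"] insert(1) unfolding p_def by auto
    define w where "w x = v x - p x" for x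
    have wW: "w \<in> W" using lin[OF v(1), of p "-1"] p by (simp add: w_def[abs_def])
    have wa: "w a \<noteq> 0" using v p by (simp add: w_def)
    have Fw: "(\<Sum>y\<in>insert a I. F x y * w y) = 0" for x
      using F2[OF p, of x] by (simp add: w_def right_diff_distrib sum_subtractf p_def)
    have ortho: "(\<Sum>y\<in>insert a I. cnj (w y) * z y) = 0" if z: "z \<in> ?W" for z
    proof -
      have "(\<Sum>y\<in>insert a I. cnj (w y) * z y)
          = (\<Sum>y\<in>insert a I. cnj (w y) * (\<Sum>x\<in>insert a I. F y x * z x))"
        using F2[OF z] by simp
      also have "\<dots> = (\<Sum>x\<in>insert a I. \<Sum>y\<in>insert a I. cnj (w y) * (F y x * z x))"
        unfolding sum_distrib_left by (rule sum.swap)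
      also have "\<dots> = (\<Sum>x\<in>insert a I. z x * cnj (\<Sum>y\<in>insert a I. F x y * w y))"
        unfolding cnj_sum sum_distrib_left
        by (intro sum.cong refl) (subst F3, simp add: mult_ac)
      finally show ?thesis by (simp add: Fw)
    qed
    define N where "N = (\<Sum>y\<in>insert a I. (cmod (w y))\<^sup>2)"
    have "0 < (cmod (w a))\<^sup>2" using wa by simp
    also have "\<dots> \<le> N" unfolding N_def using insert(1) by (intro member_le_sum) auto
    finally have N: "N > 0" .
    have ww: "(\<Sum>y\<in>insert a I. cnj (w y) * w y) = of_real N"
      unfolding N_def of_real_sum by (intro sum.cong refl) (metis complex_norm_square mult.commute of_real_power)
    define E' where "E' x y = F x y + w x * cnj (w y) / of_real N" for x y
    have "(\<lambda>x. E' x y) \<in> W" for y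
      using lin[of "\<lambda>x. F x y" w "cnj (w y) / of_real N"] F1[of y] wW by (simp add: E'_def[abs_def] mult_ac)
    moreover have "(\<Sum>y\<in>insert a I. E' x y * z y) = z x" if z: "z \<in> W" for z x
    proof -
      \<comment> \<open>Every z in W splits as t + c w with t vanishing at a; the entry at a forces
        the value of c.\<close>
      define c where "c = z a / w a"
      define t where "t y = z y - c * w y" for y
      have t: "t \<in> ?W" using lin[OF z wW, of "-c"] wa by (simp add: t_def[abs_def] c_def)
      have E': "(\<Sum>y\<in>insert a I. E' x y * s y) = (\<Sum>y\<in>insert a I. F x y * s y)
          + w x * (\<Sum>y\<in>insert a I. cnj (w y) * s y) / of_real N" for s
        by (simp only: E'_def distrib_right sum.distrib sum_distrib_left sum_divide_distrib) (simp add: mult_ac)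
      have "z = (\<lambda>y. t y + c * w y)" by (auto simp: t_def)
      then have "(\<Sum>y\<in>insert a I. E' x y * z y)
          = (\<Sum>y\<in>insert a I. E' x y * t y) + c * (\<Sum>y\<in>insert a I. E' x y * w y)"
        by (simp only: distrib_left sum.distrib sum_distrib_left) (simp add: mult_ac)
      also have "\<dots> = t x + c * w x"
        unfolding E' F2[OF t] ortho[OF t] Fw ww using N by simp
      finally show ?thesis by (simp add: t_def)
    qed
    moreover have "E' x y = cnj (E' y x)" for x y
      unfolding E'_def by (subst F3) (simp add: mult_ac)
    ultimately show ?thesis by blast
  qed
qed

lemma eigenvector_exists:
  assumes H: "H \<in> carrier_mat n n" and n: "0 < n"
  obtains e and v :: "nat \<Rightarrow> complex" where "\<exists>i<n. v i \<noteq> 0"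
    "\<And>i. i < n \<Longrightarrow> (\<Sum>j<n. H $$ (i, j) * v j) = e * v i"
proof -
  from spectrum_non_empty[OF H n] obtain e where "eigenvalue H e"
    by (auto simp: spectrum_def)
  then obtain v where v: "v \<in> carrier_vec n" "v \<noteq> 0\<^sub>v n" "H *\<^sub>v v = e \<cdot>\<^sub>v v"
    using H unfolding eigenvalue_def eigenvector_def by auto
  have "\<exists>i<n. v $ i \<noteq> 0"
  proof (rule ccontr)
    assume "\<not> (\<exists>i<n. v $ i \<noteq> 0)"
    then have "v = 0\<^sub>v n" using v(1) by (intro eq_vecI) auto
    with v(2) show False by simp
  qed
  moreover have "(\<Sum>j<n. H $$ (i, j) * v $ j) = e * v $ i" if "i < n" for i
  proof -
    have "(\<Sum>j<n. H $$ (i, j) * v $ j) = (H *\<^sub>v v) $ i"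
      using that H v(1) by (auto simp: scalar_prod_def lessThan_atLeast0 intro!: sum.cong)
    also have "\<dots> = e * v $ i" unfolding v(3) using that v(1) by simp
    finally show ?thesis .
  qed
  ultimately show ?thesis using that[of "\<lambda>i. v $ i" e] by blast
qed

text \<open>A Householder reflection.\<close>

lemma unitary_with_first_column:
  assumes ip: "(\<Sum>i<n. cnj (v i) * v i) = 1" and n: "0 < n"
    and t: "v 0 = complex_of_real t" "t \<le> 0"
  obtains W where "W \<in> carrier_mat n n" "mat_adjoint W = W" "W * W = 1\<^sub>m n"
    "\<And>i. i < n \<Longrightarrow> W $$ (i, 0) = v i"
proof -
  \<comment> \<open>The reflection exchanges v and the first basis vector, so it is taken along
    their difference w. Since |w|^2 = 2 (1 - t), the factor r is 2 / |w|^2, and t \<le> 0 keeps the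
    denominator away from zero.\<close>
  define w where "w i = v i - (if i = 0 then 1 else 0)" for i :: nat
  define r where "r = 1 / (1 - complex_of_real t)"
  define W where "W = mat n n (\<lambda>(i, j). (if i = j then 1 else 0) - r * w i * cnj (w j))"
  have W: "W \<in> carrier_mat n n" by (simp add: W_def)
  have rc: "cnj r = r" by (simp add: r_def)
  have adj: "mat_adjoint W = W" by (rule eq_matI) (auto simp: W_def rc)
  have "1 - t \<noteq> 0" using t(2) by simp
  then have r: "r * (1 - complex_of_real t) = 1"
    unfolding r_def by (metis nonzero_eq_divide_eq of_real_1 of_real_diff of_real_eq_0_iff)
  have ww: "(\<Sum>k<n. cnj (w k) * w k) = 2 * (1 - of_real t)"
  proof -
    have "(\<Sum>k<n. cnj (w k) * w k) = (\<Sum>k<n. cnj (v k) * v k)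
        - (\<Sum>k<n. if k = 0 then v k + cnj (v k) - 1 else 0)"
      unfolding sum_subtractf[symmetric]
      by (intro sum.cong refl) (auto simp: w_def algebra_simps)
    also have "\<dots> = 1 - (v 0 + cnj (v 0) - 1)"
      using n by (simp add: ip sum.delta)
    finally show ?thesis by (simp add: t)
  qed
  have "W * W = 1\<^sub>m n"
  proof (rule eq_matI)
    fix i j assume "i < dim_row (1\<^sub>m n :: complex mat)" "j < dim_col (1\<^sub>m n :: complex mat)"
    then have ij: "i < n" "j < n" by auto
    let ?s = "1 - complex_of_real t"
    have "(W * W) $$ (i, j) = (\<Sum>k<n. W $$ (i, k) * W $$ (k, j))"
      by (rule index_mult_mat_sum[OF W W ij])
    also have "\<dots> = (\<Sum>k<n. (if i = k then (if k = j then 1 else 0) - r * w k * cnj (w j) else 0)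
        - (if k = j then r * w i * cnj (w k) else 0) + r * r * w i * cnj (w j) * (cnj (w k) * w k))"
      using ij by (intro sum.cong refl) (auto simp: W_def algebra_simps)
    also have "\<dots> = (if i = j then 1 else 0) - r * w i * cnj (w j) - r * w i * cnj (w j)
        + r * r * w i * cnj (w j) * (2 * ?s)"
      using ij by (simp add: sum.distrib sum_subtractf sum_distrib_left[symmetric] ww[simplified] sum.delta sum.delta')
    also have "r * r * w i * cnj (w j) * (2 * ?s) = 2 * (r * w i * cnj (w j)) * (r * ?s)"
      by simp
    also have "(if i = j then 1 else 0) - r * w i * cnj (w j) - r * w i * cnj (w j) + \<dots> = (if i = j then 1 else 0)"
      by (simp add: r)
    finally show "(W * W) $$ (i, j) = 1\<^sub>m n $$ (i, j)" using ij by simp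
  qed (simp_all add: W_def)
  moreover have "W $$ (i, 0) = v i" if "i < n" for i
  proof -
    have "W $$ (i, 0) = (if i = 0 then 1 else 0) + w i * (r * (1 - of_real t))"
      using that n t by (simp add: W_def w_def[of 0] algebra_simps)
    then show ?thesis unfolding r by (simp add: w_def)
  qed
  ultimately show ?thesis using that W adj by blast
qed

text \<open>Deflation: a reflection W with a unit eigenvector as first column turns H into the
  direct sum of a real number and a Hermitian matrix of one size less, to which the induction
  applies. Eigenvectors are functions of indices, so that the shift by one is a case
  distinction.\<close>

lemma hermitian_diagonalization_aux:
  notes sum.lessThan_Suc [simp del]
  shows "H \<in> carrier_mat n n \<Longrightarrow> mat_adjoint H = H \<Longrightarrow>
   \<exists>V d. (\<forall>k<n. \<forall>l<n. (\<Sum>i<n. cnj (V i k) * V i l) = (if k = l then 1 else 0)) \<and>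
     (\<forall>k<n. \<forall>i<n. (\<Sum>j<n. H $$ (i, j) * V j k) = complex_of_real (d k) * V i k)"
proof (induction n arbitrary: H)
  case 0
  then show ?case by auto
next
  case (Suc n)
  let ?m = "Suc n"
  note H = Suc.prems(1)
  obtain e v0 where v0: "\<exists>i<?m. v0 i \<noteq> 0" "\<And>i. i < ?m \<Longrightarrow> (\<Sum>j<?m. H $$ (i, j) * v0 j) = e * v0 i"
    using eigenvector_exists[OF H zero_less_Suc] by metis
  define N where "N = (\<Sum>i<?m. (cmod (v0 i))\<^sup>2)"
  have "N > 0"
  proof -
    obtain i where i: "i < ?m" "v0 i \<noteq> 0" using v0(1) by blast
    have "0 < (cmod (v0 i))\<^sup>2" using i by simp
    also have "\<dots> \<le> N" unfolding N_def using i by (intro member_le_sum) auto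
    finally show ?thesis .
  qed
  \<comment> \<open>The phase makes the first entry of the eigenvector real and nonpositive, as the
    reflection requires; a vanishing entry needs no phase.\<close>
  define ph where "ph = (if v0 0 = 0 then 1 else - cnj (v0 0) / of_real (cmod (v0 0)))"
  define v where "v i = ph / of_real (sqrt N) * v0 i" for i
  have ph: "cnj ph * ph = 1"
    using complex_norm_square[of "v0 0"] by (auto simp: ph_def power2_eq_square)
  have "(\<Sum>i<?m. cnj (v i) * v i) = (\<Sum>i<?m. of_real ((cmod (v0 i))\<^sup>2)) / of_real N"
  proof -
    have "cnj (v i) * v i = of_real ((cmod (v0 i))\<^sup>2) / of_real N" for i
    proof -
      have "cnj (v i) * v i = (cnj ph * ph) * (v0 i * cnj (v0 i)) / (of_real (sqrt N) * of_real (sqrt N))"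
        by (simp add: v_def)
      also have "\<dots> = of_real ((cmod (v0 i))\<^sup>2) / of_real N"
        unfolding ph of_real_mult[symmetric] using \<open>N > 0\<close> complex_norm_square[of "v0 i"] by simp
      finally show ?thesis .
    qed
    then show ?thesis by (simp add: sum_divide_distrib)
  qed
  then have ip: "(\<Sum>i<?m. cnj (v i) * v i) = 1"
    unfolding of_real_sum[symmetric] N_def[symmetric] using \<open>N > 0\<close> by simp
  have v: "(\<Sum>j<?m. H $$ (i, j) * v j) = e * v i" if "i < ?m" for i
  proof -
    have "(\<Sum>j<?m. H $$ (i, j) * v j) = ph / of_real (sqrt N) * (\<Sum>j<?m. H $$ (i, j) * v0 j)"
      unfolding sum_distrib_left by (intro sum.cong) (simp_all add: v_def)
    then show ?thesis using v0(2)[OF that] by (simp add: v_def)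
  qed
  have "v 0 = complex_of_real (- cmod (v0 0) / sqrt N)"
  proof (cases "v0 0 = 0")
    case False
    have "v 0 = - (v0 0 * cnj (v0 0)) / (of_real (sqrt N) * of_real (cmod (v0 0)))"
      using False by (simp add: v_def ph_def mult_ac)
    then show ?thesis
      using False unfolding complex_norm_square[symmetric] by (simp add: power2_eq_square mult_ac)
  qed (simp add: v_def ph_def)
  moreover have "- cmod (v0 0) / sqrt N \<le> 0" using \<open>N > 0\<close> by simp
  ultimately obtain W where W: "W \<in> carrier_mat ?m ?m" "mat_adjoint W = W" "W * W = 1\<^sub>m ?m"
    "\<And>i. i < ?m \<Longrightarrow> W $$ (i, 0) = v i"
    using unitary_with_first_column[OF ip] by blast
  define K where "K = W * (H * W)"
  have K: "K \<in> carrier_mat ?m ?m" using W H by (simp add: K_def)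
  have HW: "H * W \<in> carrier_mat ?m ?m" using W H by simp
  have Kadj: "mat_adjoint K = K"
    using W H Suc.prems(2) by (simp add: K_def mat_adjoint_mult[OF W(1) HW] mat_adjoint_mult[OF H W(1)])
  have WK: "W * K = H * W"
    using W H by (simp add: K_def assoc_mult_mat[symmetric, OF W(1) W(1) HW])
  have HW0: "(H * W) $$ (i, 0) = e * v i" if "i < ?m" for i
    using that v[OF that] W H by (subst index_mult_mat_sum[OF H W(1)]) (simp_all)
  have Worth: "(\<Sum>i<?m. cnj (W $$ (i, k)) * W $$ (i, l)) = (if k = l then 1 else 0)" if "k < ?m" "l < ?m" for k l
  proof -
    have "(\<Sum>i<?m. cnj (W $$ (i, k)) * W $$ (i, l)) = (\<Sum>i<?m. mat_adjoint W $$ (k, i) * W $$ (i, l))"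
      using that W(1) by (intro sum.cong refl) simp
    also have "\<dots> = (W * W) $$ (k, l)"
      unfolding W(2) by (rule index_mult_mat_sum[OF W(1) W(1) that, symmetric])
    finally show ?thesis using that by (simp add: W(3))
  qed
  have K0: "K $$ (i, 0) = (if i = 0 then e else 0)" if "i < ?m" for i
  proof -
    have "K $$ (i, 0) = (\<Sum>k<?m. W $$ (i, k) * (H * W) $$ (k, 0))"
      unfolding K_def by (rule index_mult_mat_sum[OF W(1) HW that]) simp
    also have "\<dots> = (\<Sum>k<?m. W $$ (i, k) * (e * W $$ (k, 0)))"
      by (intro sum.cong refl, subst HW0) (auto simp: W(4))
    also have "\<dots> = e * (\<Sum>k<?m. W $$ (i, k) * W $$ (k, 0))"
      unfolding sum_distrib_left by (intro sum.cong refl) simp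
    also have "\<dots> = e * (W * W) $$ (i, 0)"
      by (subst index_mult_mat_sum[OF W(1) W(1) that]) simp_all
    finally show ?thesis using that by (simp add: W(3))
  qed
  have K0': "K $$ (0, Suc i) = 0" if "i < n" for i
  proof -
    have "K $$ (0, Suc i) = mat_adjoint K $$ (0, Suc i)" by (simp add: Kadj)
    also have "\<dots> = cnj (K $$ (Suc i, 0))" using K that by simp
    finally show ?thesis using K0[of "Suc i"] that by simp
  qed
  have e: "e = complex_of_real (Re e)"
  proof -
    have "mat_adjoint K $$ (0, 0) = K $$ (0, 0)" by (simp add: Kadj)
    then have "cnj (K $$ (0, 0)) = K $$ (0, 0)" using K by simp
    then show ?thesis using K0[of 0] by (simp add: complex_eq_iff)
  qed
  define K' where "K' = mat n n (\<lambda>(i, j). K $$ (Suc i, Suc j))"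
  have "mat_adjoint K' = K'"
  proof (rule eq_matI)
    fix i j assume "i < dim_row K'" "j < dim_col K'"
    then have ij: "i < n" "j < n" by (auto simp: K'_def)
    have "mat_adjoint K $$ (Suc i, Suc j) = cnj (K $$ (Suc j, Suc i))" using ij K by simp
    then show "mat_adjoint K' $$ (i, j) = K' $$ (i, j)" using ij by (simp add: Kadj K'_def)
  qed (simp_all add: K'_def)
  moreover have "K' \<in> carrier_mat n n" by (simp add: K'_def)
  ultimately obtain V' d' where V': "\<And>k l. k < n \<Longrightarrow> l < n \<Longrightarrow> (\<Sum>i<n. cnj (V' i k) * V' i l) = (if k = l then 1 else 0)"
    "\<And>k i. k < n \<Longrightarrow> i < n \<Longrightarrow> (\<Sum>j<n. K' $$ (i, j) * V' j k) = complex_of_real (d' k) * V' i k"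
    using Suc.IH[of K'] by blast
  \<comment> \<open>X is the unitary 1 \<oplus> V' in the coordinates given by W; the eigenvectors
    of H are the columns of W X.\<close>
  define X where "X p k = (case k of 0 \<Rightarrow> (if p = 0 then 1 else 0) | Suc k' \<Rightarrow> (case p of 0 \<Rightarrow> 0 | Suc p' \<Rightarrow> V' p' k'))" for p k
  define V where "V i k = (\<Sum>p<?m. W $$ (i, p) * X p k)" for i k
  define d where "d k = (case k of 0 \<Rightarrow> Re e | Suc k' \<Rightarrow> d' k')" for k
  have Xorth: "(\<Sum>p<?m. cnj (X p k) * X p l) = (if k = l then 1 else 0)" if "k < ?m" "l < ?m" for k l
    using that V'(1)[of "k - 1" "l - 1"] unfolding sum.lessThan_Suc_shift
    by (cases k; cases l) (auto simp: X_def)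
  have XK: "(\<Sum>q<?m. K $$ (p, q) * X q k) = of_real (d k) * X p k" if "p < ?m" "k < ?m" for p k
  proof (cases k)
    case 0
    then show ?thesis using K0[OF that(1)] e unfolding sum.lessThan_Suc_shift
      by (auto simp: X_def d_def split: nat.splits)
  next
    case (Suc k')
    show ?thesis
    proof (cases p)
      case 0
      then show ?thesis using Suc K0' unfolding sum.lessThan_Suc_shift by (simp add: X_def)
    next
      case (Suc p')
      have "(\<Sum>j<n. K' $$ (p', j) * V' j k') = (\<Sum>j<n. K $$ (Suc p', Suc j) * V' j k')"
        using that Suc by (intro sum.cong) (auto simp: K'_def)
      then show ?thesis using V'(2)[of k' p'] that Suc \<open>k = Suc k'\<close> unfolding sum.lessThan_Suc_shift
        by (simp add: X_def d_def)
    qed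
  qed
  have 1: "(\<Sum>i<?m. cnj (V i k) * V i l) = (if k = l then 1 else 0)" if "k < ?m" "l < ?m" for k l
  proof -
    have "(\<Sum>i<?m. cnj (V i k) * V i l)
        = (\<Sum>i<?m. \<Sum>p<?m. \<Sum>q<?m. cnj (X p k) * X q l * (cnj (W $$ (i, p)) * W $$ (i, q)))"
      unfolding V_def cnj_sum sum_product by (intro sum.cong refl) simp
    also have "\<dots> = (\<Sum>p<?m. \<Sum>i<?m. \<Sum>q<?m. cnj (X p k) * X q l * (cnj (W $$ (i, p)) * W $$ (i, q)))"
      by (rule sum.swap)
    also have "\<dots> = (\<Sum>p<?m. \<Sum>q<?m. \<Sum>i<?m. cnj (X p k) * X q l * (cnj (W $$ (i, p)) * W $$ (i, q)))"
      by (intro sum.cong refl sum.swap)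
    also have "\<dots> = (\<Sum>p<?m. \<Sum>q<?m. cnj (X p k) * X q l * (if p = q then 1 else 0))"
      unfolding sum_distrib_left[symmetric] by (intro sum.cong refl) (subst Worth, auto)
    also have "\<dots> = (\<Sum>p<?m. cnj (X p k) * X p l)"
      by (intro sum.cong refl) (simp add: if_distrib[of "\<lambda>x. _ * x"] sum.delta cong: if_cong)
    finally show ?thesis using Xorth that by simp
  qed
  have 2: "(\<Sum>j<?m. H $$ (i, j) * V j k) = complex_of_real (d k) * V i k" if "k < ?m" "i < ?m" for k i
  proof -
    have "(\<Sum>j<?m. H $$ (i, j) * V j k) = (\<Sum>j<?m. \<Sum>p<?m. H $$ (i, j) * W $$ (j, p) * X p k)"
      unfolding V_def sum_distrib_left by (simp only: mult.assoc)
    also have "\<dots> = (\<Sum>p<?m. \<Sum>j<?m. H $$ (i, j) * W $$ (j, p) * X p k)"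
      by (rule sum.swap)
    also have "\<dots> = (\<Sum>p<?m. (H * W) $$ (i, p) * X p k)"
      by (intro sum.cong refl) (simp only: index_mult_mat_sum[OF H W(1) that(2)] lessThan_iff sum_distrib_right)
    also have "\<dots> = (\<Sum>p<?m. (W * K) $$ (i, p) * X p k)" by (simp add: WK)
    also have "\<dots> = (\<Sum>p<?m. \<Sum>q<?m. W $$ (i, q) * K $$ (q, p) * X p k)"
      by (intro sum.cong refl) (simp only: index_mult_mat_sum[OF W(1) K that(2)] lessThan_iff sum_distrib_right)
    also have "\<dots> = (\<Sum>q<?m. \<Sum>p<?m. W $$ (i, q) * K $$ (q, p) * X p k)"
      by (rule sum.swap)
    also have "\<dots> = (\<Sum>q<?m. W $$ (i, q) * (of_real (d k) * X q k))"
      by (intro sum.cong refl) (simp only: mult.assoc sum_distrib_left[symmetric] XK lessThan_iff that)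
    also have "\<dots> = of_real (d k) * V i k"
      unfolding V_def sum_distrib_left by (intro sum.cong refl) simp
    finally show ?thesis .
  qed
  show ?case using 1 2 by blast
qed

lemma hermitian_diagonalization:
  assumes H: "H \<in> carrier_mat n n" and adj: "mat_adjoint H = H"
  obtains V d where "V \<in> carrier_mat n n" "V * mat_adjoint V = 1\<^sub>m n" "mat_adjoint V * V = 1\<^sub>m n"
    "H = V * mat_diag n (\<lambda>i. complex_of_real (d i)) * mat_adjoint V"
proof -
  obtain X d where X: "\<And>k l. k < n \<Longrightarrow> l < n \<Longrightarrow> (\<Sum>i<n. cnj (X i k) * X i l) = (if k = l then 1 else 0)"
     "\<And>k i. k < n \<Longrightarrow> i < n \<Longrightarrow> (\<Sum>j<n. H $$ (i, j) * X j k) = complex_of_real (d k) * X i k"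
    using hermitian_diagonalization_aux[OF H adj] by blast
  define V where "V = mat n n (\<lambda>(i, j). X i j)"
  define D where "D = mat_diag n (\<lambda>i. complex_of_real (d i))"
  have V: "V \<in> carrier_mat n n" and V': "mat_adjoint V \<in> carrier_mat n n" and D: "D \<in> carrier_mat n n"
    by (auto simp: V_def D_def carrier_matI)
  have iso: "mat_adjoint V * V = 1\<^sub>m n"
  proof (rule eq_matI)
    fix i j assume "i < dim_row (1\<^sub>m n :: complex mat)" "j < dim_col (1\<^sub>m n :: complex mat)"
    then have ij: "i < n" "j < n" by auto
    have "(mat_adjoint V * V) $$ (i, j) = (\<Sum>k<n. cnj (X k i) * X k j)"
      using ij by (subst index_mult_mat_sum[OF V' V]) (auto simp: V_def intro!: sum.cong)
    then show "(mat_adjoint V * V) $$ (i, j) = 1\<^sub>m n $$ (i, j)" using X(1) ij by simp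
  qed (simp_all add: V_def)
  have uni: "V * mat_adjoint V = 1\<^sub>m n"
    by (rule mat_mult_left_right_inverse[OF V' V iso])
  have "H * V = V * D"
  proof (rule eq_matI)
    fix i j assume "i < dim_row (V * D)" "j < dim_col (V * D)"
    then have ij: "i < n" "j < n" using V D by auto
    have "(H * V) $$ (i, j) = of_real (d j) * X i j"
      using ij X(2)[of j i] by (subst index_mult_mat_sum[OF H V]) (auto simp: V_def)
    moreover have "(V * D) $$ (i, j) = V $$ (i, j) * of_real (d j)"
      using ij V by (simp add: D_def mat_diag_mult_right[OF V])
    ultimately show "(H * V) $$ (i, j) = (V * D) $$ (i, j)" using ij by (simp add: V_def)
  qed (use H V D in auto)
  then have "V * D * mat_adjoint V = H * (V * mat_adjoint V)"
    using H V V' by (metis assoc_mult_mat)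
  then have "H = V * D * mat_adjoint V" using H by (simp add: uni)
  then show ?thesis using that V uni iso by (simp add: D_def)
qed

section \<open>Positive definite matrices, their inverses and complex powers\<close>

lemma mat_diag_carrier [simp]: "mat_diag n f \<in> carrier_mat n n"
  by (simp add: mat_diag_def)

lemma mult_carrier_square:
  "A \<in> carrier_mat n n \<Longrightarrow> B \<in> carrier_mat n n \<Longrightarrow> A * B \<in> carrier_mat n n"
  by simp

lemma assoc_mult_square:
  "A \<in> carrier_mat n n \<Longrightarrow> B \<in> carrier_mat n n \<Longrightarrow> C \<in> carrier_mat n n \<Longrightarrow>
   A * B * C = A * (B * (C :: 'a::semiring_0 mat))"
  by (rule assoc_mult_mat)

text \<open>The quadratic form at the k-th column of V, a unit eigenvector, has the value
  \<open>d k\<close>, which is therefore positive.\<close>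

lemma pos_def_diagonalization:
  assumes A: "A \<in> carrier_mat n n" and pd: "pos_def A"
  obtains V d where "V \<in> carrier_mat n n" "V * mat_adjoint V = 1\<^sub>m n" "mat_adjoint V * V = 1\<^sub>m n"
    "\<And>i. i < n \<Longrightarrow> 0 < d i"
    "A = V * mat_diag n (\<lambda>i. complex_of_real (d i)) * mat_adjoint V"
proof -
  obtain V d where V: "V \<in> carrier_mat n n" "V * mat_adjoint V = 1\<^sub>m n" "mat_adjoint V * V = 1\<^sub>m n"
    "A = V * mat_diag n (\<lambda>i. complex_of_real (d i)) * mat_adjoint V"
    using hermitian_diagonalization[OF A] pd unfolding pos_def_def by blast
  note V' = mat_adjoint_carrier[OF V(1)]
  define D where "D = mat_diag n (\<lambda>i. complex_of_real (d i))"
  have D: "D \<in> carrier_mat n n" by (simp add: D_def)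
  have "A * V = V * D * (mat_adjoint V * V)"
    unfolding V(4) D_def[symmetric] using V(1) V' D by (intro assoc_mult_square[of _ n] mult_carrier_square)
  then have AV: "A * V = V * D" using V(1) D by (simp add: V(3))
  have "0 < d k" if k: "k < n" for k
  proof -
    define v where "v = col V k"
    have v: "v \<in> carrier_vec n" unfolding v_def using V(1) by (metis carrier_matD(1) col_dim)
    have Av: "A *\<^sub>v v = complex_of_real (d k) \<cdot>\<^sub>v v"
    proof (rule eq_vecI)
      fix i assume "i < dim_vec (complex_of_real (d k) \<cdot>\<^sub>v v)"
      then have i: "i < n" using v by simp
      have "(A *\<^sub>v v) $ i = (A * V) $$ (i, k)" using i k A V(1) by (simp add: v_def)
      also have "\<dots> = V $$ (i, k) * of_real (d k)"
        using i k V(1) by (simp add: AV D_def mat_diag_mult_right[OF V(1)])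
      finally show "(A *\<^sub>v v) $ i = (complex_of_real (d k) \<cdot>\<^sub>v v) $ i"
        using i k V(1) by (simp add: v_def)
    qed (use A v in auto)
    have "mat_adjoint V $$ (k, i) = cnj (v $ i)" if "i < n" for i
      using that k V(1) by (simp add: v_def)
    then have "(\<Sum>i<n. cnj (v $ i) * v $ i) = (mat_adjoint V * V) $$ (k, k)"
      using k V(1) by (subst index_mult_mat_sum[OF V' V(1)]) (auto simp: v_def intro!: sum.cong)
    then have 1: "v \<bullet>c v = 1"
      using k v by (simp add: V(3) scalar_prod_def lessThan_atLeast0 mult.commute)
    have "v \<noteq> 0\<^sub>v n" using 1 by auto
    then have "0 < Re ((A *\<^sub>v v) \<bullet>c v)" using pd v A unfolding pos_def_def by auto
    also have "(A *\<^sub>v v) \<bullet>c v = of_real (d k)"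
      unfolding Av using v 1 by (simp add: smult_scalar_prod_distrib[of _ n])
    finally show ?thesis by simp
  qed
  then show ?thesis using V that by blast
qed

lemma unitary_diag_mult:
  assumes V: "V \<in> carrier_mat n n" "mat_adjoint V * V = 1\<^sub>m n"
  shows "(V * mat_diag n f * mat_adjoint V) * (V * mat_diag n g * mat_adjoint V)
    = V * mat_diag n (\<lambda>i. f i * g i :: complex) * mat_adjoint V"
proof -
  note V' = mat_adjoint_carrier[OF V(1)]
  have F: "mat_diag n f \<in> carrier_mat n n" and G: "mat_diag n g \<in> carrier_mat n n" by simp_all
  have "(V * mat_diag n f * mat_adjoint V) * (V * mat_diag n g * mat_adjoint V)
     = V * mat_diag n f * (mat_adjoint V * (V * (mat_diag n g * mat_adjoint V)))"
    using V(1) V' F G by (simp add: assoc_mult_square[of _ n] mult_carrier_square)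
  also have "mat_adjoint V * (V * (mat_diag n g * mat_adjoint V)) = mat_diag n g * mat_adjoint V"
    using V' G V(1) by (simp only: assoc_mult_square[of _ n, symmetric] mult_carrier_square V(2) left_mult_one_mat)
  also have "V * mat_diag n f * (mat_diag n g * mat_adjoint V) = V * (mat_diag n f * mat_diag n g) * mat_adjoint V"
    using V(1) V' F G by (simp add: assoc_mult_square[of _ n] mult_carrier_square del: mat_diag_diag)
  finally show ?thesis by simp
qed

lemma mat_diag_eq_one: "(\<And>i. i < n \<Longrightarrow> f i = (1::complex)) \<Longrightarrow> mat_diag n f = 1\<^sub>m n"
  by (auto simp: mat_diag_def one_mat_def intro!: eq_matI)

text \<open>\<open>minv\<close> unpacks an optional value, so it is meaningful only once A is known
  to be a unit of the matrix ring. The reciprocal eigenvalues supply the inverse that shows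
  this.\<close>

lemma minv_pos_def:
  assumes A: "A \<in> carrier_mat n n" and pd: "pos_def A"
  shows "minv A \<in> carrier_mat n n" "A * minv A = 1\<^sub>m n" "minv A * A = 1\<^sub>m n"
proof -
  obtain V d where V: "V \<in> carrier_mat n n" "V * mat_adjoint V = 1\<^sub>m n" "mat_adjoint V * V = 1\<^sub>m n"
    "\<And>i. i < n \<Longrightarrow> 0 < d i" "A = V * mat_diag n (\<lambda>i. complex_of_real (d i)) * mat_adjoint V"
    by (rule pos_def_diagonalization[OF assms], rule that)
  define B where "B = V * mat_diag n (\<lambda>i. 1 / complex_of_real (d i)) * mat_adjoint V"
  have B: "B \<in> carrier_mat n n" unfolding B_def
    by (intro mult_carrier_square mat_diag_carrier V(1) mat_adjoint_carrier)
  have nz: "i < n \<Longrightarrow> d i \<noteq> 0" for i by (drule V(4)) simp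
  have "A * B = V * 1\<^sub>m n * mat_adjoint V"
    unfolding B_def by (subst V(5), subst unitary_diag_mult[OF V(1,3)], subst mat_diag_eq_one) (simp_all add: nz)
  then have AB: "A * B = 1\<^sub>m n" using V(1,2) by simp
  have BA: "B * A = 1\<^sub>m n" by (rule mat_mult_left_right_inverse[OF A B AB])
  have "A \<in> Units (ring_mat TYPE(complex) n ())"
    unfolding Units_def ring_mat_def using A B AB BA by simp blast
  then obtain C where "mat_inverse A = Some C"
    using mat_inverse(1)[OF A, where b = "()"] by (cases "mat_inverse A") auto
  with mat_inverse(2)[OF A this]
  show "minv A \<in> carrier_mat n n" "A * minv A = 1\<^sub>m n" "minv A * A = 1\<^sub>m n"
    by (simp_all add: minv_def)
qed

text \<open>Independence of the diagonalization: \<open>W\<^sup>*V\<close> intertwines the two diagonal matrices, hence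
  any function of them.\<close>

lemma unitary_functional_calculus_unique:
  fixes d e :: "nat \<Rightarrow> real" and f :: "real \<Rightarrow> complex"
  assumes V: "V \<in> carrier_mat n n" "V * mat_adjoint V = 1\<^sub>m n" "mat_adjoint V * V = 1\<^sub>m n"
    and W: "W \<in> carrier_mat n n" "W * mat_adjoint W = 1\<^sub>m n" "mat_adjoint W * W = 1\<^sub>m n"
    and eq: "V * mat_diag n (\<lambda>i. complex_of_real (d i)) * mat_adjoint V
           = W * mat_diag n (\<lambda>i. complex_of_real (e i)) * mat_adjoint W"
  shows "V * mat_diag n (\<lambda>i. f (d i)) * mat_adjoint V = W * mat_diag n (\<lambda>i. f (e i)) * mat_adjoint W"
proof -
  note V' = mat_adjoint_carrier[OF V(1)] and W' = mat_adjoint_carrier[OF W(1)]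
  define X where "X = mat_adjoint W * V"
  have X: "X \<in> carrier_mat n n" using V(1) W' by (simp add: X_def)
  have move: "mat_adjoint W * (V * F * mat_adjoint V) * V = X * F"
    "mat_adjoint W * (W * F * mat_adjoint W) * V = F * X"
    "W * (X * F) * mat_adjoint V = V * F * mat_adjoint V"
    "W * (F * X) * mat_adjoint V = W * F * mat_adjoint W" if F: "F \<in> carrier_mat n n" for F
  proof -
    note car = V(1) V' W(1) W' F X
    show "mat_adjoint W * (V * F * mat_adjoint V) * V = X * F"
      using car by (simp add: X_def assoc_mult_square[of _ n] mult_carrier_square V(3))
    have "mat_adjoint W * (W * F * mat_adjoint W) * V = (mat_adjoint W * W) * (F * X)"
      using car by (simp only: X_def assoc_mult_square[of _ n] mult_carrier_square)
    then show "mat_adjoint W * (W * F * mat_adjoint W) * V = F * X"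
      using car by (simp add: W(3) left_mult_one_mat[of _ n n])
    have "W * (X * F) * mat_adjoint V = (W * mat_adjoint W) * (V * F * mat_adjoint V)"
      using car by (simp only: X_def assoc_mult_square[of _ n] mult_carrier_square)
    then show "W * (X * F) * mat_adjoint V = V * F * mat_adjoint V"
      using car by (simp add: W(2) left_mult_one_mat[of _ n n])
    show "W * (F * X) * mat_adjoint V = W * F * mat_adjoint W"
      using car by (simp add: X_def assoc_mult_square[of _ n] mult_carrier_square V(2))
  qed
  have "X * mat_diag n (\<lambda>i. complex_of_real (d i)) = mat_diag n (\<lambda>i. complex_of_real (e i)) * X"
    using move(1)[of "mat_diag n (\<lambda>i. complex_of_real (d i))"]
      move(2)[of "mat_diag n (\<lambda>i. complex_of_real (e i))"] eq by simp
  note XD = arg_cong[OF this, of "\<lambda>A. A $$ (i, j)" for i j, unfolded mat_diag_mult_left[OF X] mat_diag_mult_right[OF X]]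
  \<comment> \<open>Where X has a nonzero entry the two eigenvalues agree, and then so do their
    images under f.\<close>
  have ij: "X $$ (i, j) * of_real (d j) = of_real (e i) * X $$ (i, j)" if "i < n" "j < n" for i j
    using XD[of i j] that by simp
  have "X * mat_diag n (\<lambda>i. f (d i)) = mat_diag n (\<lambda>i. f (e i)) * X"
    unfolding mat_diag_mult_left[OF X] mat_diag_mult_right[OF X]
  proof (rule eq_matI)
    fix i j assume "i < dim_row (mat n n (\<lambda>(i, j). f (e i) * X $$ (i, j)))" "j < dim_col (mat n n (\<lambda>(i, j). f (e i) * X $$ (i, j)))"
    then have "i < n" "j < n" by auto
    with ij[OF this] show "mat n n (\<lambda>(i, j). X $$ (i, j) * f (d j)) $$ (i, j) = mat n n (\<lambda>(i, j). f (e i) * X $$ (i, j)) $$ (i, j)"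
      by (cases "X $$ (i, j) = 0") (auto simp: mult.commute)
  qed simp_all
  with move(3)[of "mat_diag n (\<lambda>i. f (d i))"] move(4)[of "mat_diag n (\<lambda>i. f (e i))"]
  show ?thesis by simp
qed

text \<open>Two admissible diagonalizations give the same matrix by uniqueness of the functional
  calculus, so the description in \<open>mat_cpow\<close> denotes and one fixed V computes all
  powers.\<close>

lemma mat_cpow_eq:
  assumes V: "V \<in> carrier_mat n n" "V * mat_adjoint V = 1\<^sub>m n" "mat_adjoint V * V = 1\<^sub>m n"
    and d: "\<And>i. i < n \<Longrightarrow> 0 < d i" and A: "A = V * mat_diag n (\<lambda>i. complex_of_real (d i)) * mat_adjoint V"
  shows "mat_cpow A z = V * mat_diag n (\<lambda>i. exp (z * complex_of_real (ln (d i)))) * mat_adjoint V"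
proof -
  have n: "dim_row A = n" using V(1) by (simp add: A)
  show ?thesis
    unfolding mat_cpow_def Let_def n
  proof (rule the_equality)
    show "\<exists>U d'. U \<in> carrier_mat n n \<and> U * mat_adjoint U = 1\<^sub>m n \<and> (\<forall>i<n. 0 < d' i) \<and>
       A = U * mat_diag n (\<lambda>i. complex_of_real (d' i)) * mat_adjoint U \<and>
       V * mat_diag n (\<lambda>i. exp (z * complex_of_real (ln (d i)))) * mat_adjoint V
         = U * mat_diag n (\<lambda>i. exp (z * complex_of_real (ln (d' i)))) * mat_adjoint U"
      by (rule exI[of _ V], rule exI[of _ d]) (simp only: V d A[symmetric] simp_thms, simp add: d)
  next
    fix B assume "\<exists>U d. U \<in> carrier_mat n n \<and> U * mat_adjoint U = 1\<^sub>m n \<and> (\<forall>i<n. 0 < d i) \<and>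
       A = U * mat_diag n (\<lambda>i. complex_of_real (d i)) * mat_adjoint U \<and>
       B = U * mat_diag n (\<lambda>i. exp (z * complex_of_real (ln (d i)))) * mat_adjoint U"
    then obtain U e where U: "U \<in> carrier_mat n n" "U * mat_adjoint U = 1\<^sub>m n"
      "A = U * mat_diag n (\<lambda>i. complex_of_real (e i)) * mat_adjoint U"
      "B = U * mat_diag n (\<lambda>i. exp (z * complex_of_real (ln (e i)))) * mat_adjoint U" by blast
    have "mat_adjoint U * U = 1\<^sub>m n"
      by (rule mat_mult_left_right_inverse[OF U(1) mat_adjoint_carrier[OF U(1)] U(2)])
    from unitary_functional_calculus_unique[OF U(1,2) this V trans[OF U(3)[symmetric] A],
        of "\<lambda>x. exp (z * complex_of_real (ln x))"]
    show "B = V * mat_diag n (\<lambda>i. exp (z * complex_of_real (ln (d i)))) * mat_adjoint V" unfolding U(4) .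
  qed
qed

subsection \<open>Corepresentations and intertwiners\<close>

lemma star_mat_carrier: "A \<in> carrier_mat m k \<Longrightarrow> star_mat A \<in> carrier_mat k m"
  by (rule carrier_matI) (simp_all add: star_mat_def)

lemma index_star_mat: "A \<in> carrier_mat m k \<Longrightarrow> i < k \<Longrightarrow> j < m \<Longrightarrow> star_mat A $$ (i, j) = star (A $$ (j, i))"
  by (simp add: star_mat_def)

lemma scalar_mat_carrier: "A \<in> carrier_mat m k \<Longrightarrow> scalar_mat A \<in> carrier_mat m k"
  by (simp add: scalar_mat_def)

lemma index_scalar_mat: "A \<in> carrier_mat m k \<Longrightarrow> i < m \<Longrightarrow> j < k \<Longrightarrow> scalar_mat A $$ (i, j) = A $$ (i, j) *\<^sub>C 1"
  by (simp add: scalar_mat_def)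

lemma star_mat_star_mat: "star_mat (star_mat A) = A"
  by (rule eq_matI) (simp_all add: star_mat_def star_star)

lemma star_mat_mult:
  assumes A: "A \<in> carrier_mat m k" and B: "B \<in> carrier_mat k l"
  shows "star_mat (A * B) = star_mat B * star_mat A"
proof (rule eq_matI)
  note AB = mult_carrier_mat[OF A B]
  show "dim_row (star_mat (A * B)) = dim_row (star_mat B * star_mat A)"
    "dim_col (star_mat (A * B)) = dim_col (star_mat B * star_mat A)"
    by (simp_all add: star_mat_def)
  fix i j assume "i < dim_row (star_mat B * star_mat A)" "j < dim_col (star_mat B * star_mat A)"
  then have ij: "i < l" "j < m" using A B by (auto simp: star_mat_def)
  have "star_mat (A * B) $$ (i, j) = star (\<Sum>r<k. A $$ (j, r) * B $$ (r, i))"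
    by (simp only: index_star_mat[OF AB ij] index_mult_mat_sum[OF A B ij(2,1)])
  also have "\<dots> = (\<Sum>r<k. star_mat B $$ (i, r) * star_mat A $$ (r, j))"
    unfolding star_sum star_mult using ij by (intro sum.cong refl) (simp add: index_star_mat[OF A] index_star_mat[OF B])
  also have "\<dots> = (star_mat B * star_mat A) $$ (i, j)"
    by (rule index_mult_mat_sum[OF star_mat_carrier[OF B] star_mat_carrier[OF A] ij, symmetric])
  finally show "star_mat (A * B) $$ (i, j) = (star_mat B * star_mat A) $$ (i, j)" .
qed

lemma star_mat_scalar_mat: "star_mat (scalar_mat A) = (scalar_mat (mat_adjoint A) :: 'a::complex_star_algebra mat)"
  by (rule eq_matI) (simp_all add: star_mat_def scalar_mat_def star_scaleC)

lemma index_scalar_mat_mult: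
  fixes v :: "'a::complex_star_algebra mat"
  assumes T: "T \<in> carrier_mat m k" and v: "v \<in> carrier_mat k l" and ij: "i < m" "j < l"
  shows "(scalar_mat T * v) $$ (i, j) = (\<Sum>r<k. T $$ (i, r) *\<^sub>C v $$ (r, j))"
  unfolding index_mult_mat_sum[OF scalar_mat_carrier[OF T] v ij]
  using ij by (intro sum.cong refl) (simp add: index_scalar_mat[OF T] mult_scaleC_left)

lemma index_mult_scalar_mat:
  fixes v :: "'a::complex_star_algebra mat"
  assumes T: "T \<in> carrier_mat k l" and v: "v \<in> carrier_mat m k" and ij: "i < m" "j < l"
  shows "(v * scalar_mat T) $$ (i, j) = (\<Sum>r<k. T $$ (r, j) *\<^sub>C v $$ (i, r))"
  unfolding index_mult_mat_sum[OF v scalar_mat_carrier[OF T] ij]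
  using ij by (intro sum.cong refl) (simp add: index_scalar_mat[OF T] mult_scaleC_right)

lemma scalar_mat_mult:
  assumes A: "A \<in> carrier_mat m k" and B: "B \<in> carrier_mat k l"
  shows "(scalar_mat (A * B) :: 'a::complex_star_algebra mat) = scalar_mat A * scalar_mat B"
proof (rule eq_matI)
  fix i j assume "i < dim_row (scalar_mat A * scalar_mat B :: 'a mat)" "j < dim_col (scalar_mat A * scalar_mat B :: 'a mat)"
  then have ij: "i < m" "j < l" using A B by (auto simp: scalar_mat_def)
  show "(scalar_mat (A * B) :: 'a mat) $$ (i, j) = (scalar_mat A * scalar_mat B) $$ (i, j)"
    unfolding index_scalar_mat_mult[OF A scalar_mat_carrier[OF B] ij] index_scalar_mat[OF mult_carrier_mat[OF A B] ij]
      index_mult_mat_sum[OF A B ij] scaleC_sum_left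
    using ij by (intro sum.cong refl) (simp add: index_scalar_mat[OF B] scaleC_scaleC)
qed (use A B in \<open>simp_all add: scalar_mat_def\<close>)

lemma scalar_mat_one: "scalar_mat (1\<^sub>m m) = (1\<^sub>m m :: 'a::complex_star_algebra mat)"
  by (rule eq_matI) (auto simp: scalar_mat_def)

lemma intertwinersI:
  assumes "T \<in> carrier_mat k m" "v \<in> carrier_mat m m" "w \<in> carrier_mat k k"
    and "\<And>i j. i < k \<Longrightarrow> j < m \<Longrightarrow> (\<Sum>r<m. T $$ (i, r) *\<^sub>C v $$ (r, j)) = (\<Sum>r<k. T $$ (r, j) *\<^sub>C w $$ (i, r))"
  shows "T \<in> intertwiners v w"
proof -
  have "scalar_mat T * v = w * scalar_mat T"
  proof (rule eq_matI)
    fix i j assume "i < dim_row (w * scalar_mat T)" "j < dim_col (w * scalar_mat T)"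
    then have ij: "i < k" "j < m" using assms(1-3) by (auto simp: scalar_mat_def)
    then show "(scalar_mat T * v) $$ (i, j) = (w * scalar_mat T) $$ (i, j)"
      by (simp only: index_scalar_mat_mult[OF assms(1,2) ij] index_mult_scalar_mat[OF assms(1,3) ij] assms(4))
  qed (use assms(1-3) in \<open>simp_all add: scalar_mat_def\<close>)
  then show ?thesis using assms(1-3) by (simp add: intertwiners_def)
qed

lemma intertwinersD:
  assumes "T \<in> intertwiners v w" "v \<in> carrier_mat m m" "w \<in> carrier_mat k k"
  shows "T \<in> carrier_mat k m" "scalar_mat T * v = w * scalar_mat T"
    "\<And>i j. i < k \<Longrightarrow> j < m \<Longrightarrow> (\<Sum>r<m. T $$ (i, r) *\<^sub>C v $$ (r, j)) = (\<Sum>r<k. T $$ (r, j) *\<^sub>C w $$ (i, r))"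
proof -
  show T: "T \<in> carrier_mat k m" and eq: "scalar_mat T * v = w * scalar_mat T"
    using assms by (auto simp: intertwiners_def)
  show "(\<Sum>r<m. T $$ (i, r) *\<^sub>C v $$ (r, j)) = (\<Sum>r<k. T $$ (r, j) *\<^sub>C w $$ (i, r))" if "i < k" "j < m" for i j
    using arg_cong[OF eq, of "\<lambda>A. A $$ (i, j)"]
    by (simp only: index_scalar_mat_mult[OF T assms(2) that] index_mult_scalar_mat[OF T assms(3) that])
qed

lemma intertwiners_mult:
  assumes T: "T \<in> intertwiners v w" and R: "R \<in> intertwiners w z"
    and car: "v \<in> carrier_mat m m" "w \<in> carrier_mat k k" "z \<in> carrier_mat l l"
  shows "R * T \<in> intertwiners v z"
proof -
  note T = intertwinersD[OF T car(1,2)] and R = intertwinersD[OF R car(2,3)]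
  note T' = scalar_mat_carrier[OF T(1)] and R' = scalar_mat_carrier[OF R(1)]
  have "scalar_mat (R * T) * v = scalar_mat R * (scalar_mat T * v)"
    unfolding scalar_mat_mult[OF R(1) T(1)] by (rule assoc_mult_mat[OF R' T' car(1)])
  also have "\<dots> = scalar_mat R * w * scalar_mat T"
    unfolding T(2) by (rule assoc_mult_mat[OF R' car(2) T', symmetric])
  also have "\<dots> = z * scalar_mat (R * T)"
    unfolding scalar_mat_mult[OF R(1) T(1)] R(2) by (rule assoc_mult_mat[OF car(3) R' T'])
  finally show ?thesis using T(1) R(1) car by (simp add: intertwiners_def)
qed

context compact_quantum_group
begin

lemma unitary_repD:
  assumes "unitary_rep comul m v"
  shows "v \<in> carrier_mat m m"
    "\<And>i j. i < m \<Longrightarrow> j < m \<Longrightarrow> comul (v $$ (i, j)) = (\<Sum>k<m. v $$ (i, k) \<otimes>\<^sub>t v $$ (k, j))"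
    "\<And>i j. i < m \<Longrightarrow> j < m \<Longrightarrow> (\<Sum>k<m. v $$ (i, k) * star (v $$ (j, k))) = (if i = j then 1 else 0)"
    "\<And>i j. i < m \<Longrightarrow> j < m \<Longrightarrow> (\<Sum>k<m. star (v $$ (k, i)) * v $$ (k, j)) = (if i = j then 1 else 0)"
proof -
  show v: "v \<in> carrier_mat m m" using assms by (simp add: unitary_rep_def)
  note v' = star_mat_carrier[OF v]
  fix i j assume ij: "i < m" "j < m"
  show "comul (v $$ (i, j)) = (\<Sum>k<m. v $$ (i, k) \<otimes>\<^sub>t v $$ (k, j))"
    using assms ij by (simp add: unitary_rep_def)
  have "(\<Sum>k<m. v $$ (i, k) * star (v $$ (j, k))) = (v * star_mat v) $$ (i, j)"
    unfolding index_mult_mat_sum[OF v v' ij] using ij by (intro sum.cong refl) (simp add: index_star_mat[OF v])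
  then show "(\<Sum>k<m. v $$ (i, k) * star (v $$ (j, k))) = (if i = j then 1 else 0)"
    using assms ij by (simp add: unitary_rep_def)
  have "(\<Sum>k<m. star (v $$ (k, i)) * v $$ (k, j)) = (star_mat v * v) $$ (i, j)"
    unfolding index_mult_mat_sum[OF v' v ij] using ij by (intro sum.cong refl) (simp add: index_star_mat[OF v])
  then show "(\<Sum>k<m. star (v $$ (k, i)) * v $$ (k, j)) = (if i = j then 1 else 0)"
    using assms ij by (simp add: unitary_rep_def)
qed

lemma unitary_repI:
  assumes v: "v \<in> carrier_mat m m"
    and "\<And>i j. i < m \<Longrightarrow> j < m \<Longrightarrow> comul (v $$ (i, j)) = (\<Sum>k<m. v $$ (i, k) \<otimes>\<^sub>t v $$ (k, j))"
    and 1: "\<And>i j. i < m \<Longrightarrow> j < m \<Longrightarrow> (\<Sum>k<m. v $$ (i, k) * star (v $$ (j, k))) = (if i = j then 1 else 0)"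
    and 2: "\<And>i j. i < m \<Longrightarrow> j < m \<Longrightarrow> (\<Sum>k<m. star (v $$ (k, i)) * v $$ (k, j)) = (if i = j then 1 else 0)"
  shows "unitary_rep comul m v"
proof -
  note v' = star_mat_carrier[OF v]
  have "v * star_mat v = 1\<^sub>m m"
  proof (rule eq_matI)
    fix i j assume "i < dim_row (1\<^sub>m m :: 'a mat)" "j < dim_col (1\<^sub>m m :: 'a mat)"
    then have ij: "i < m" "j < m" by auto
    have "(v * star_mat v) $$ (i, j) = (\<Sum>k<m. v $$ (i, k) * star (v $$ (j, k)))"
      unfolding index_mult_mat_sum[OF v v' ij] using ij by (intro sum.cong refl) (simp add: index_star_mat[OF v])
    then show "(v * star_mat v) $$ (i, j) = 1\<^sub>m m $$ (i, j)" using ij by (simp add: 1)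
  qed (use v v' in auto)
  moreover have "star_mat v * v = 1\<^sub>m m"
  proof (rule eq_matI)
    fix i j assume "i < dim_row (1\<^sub>m m :: 'a mat)" "j < dim_col (1\<^sub>m m :: 'a mat)"
    then have ij: "i < m" "j < m" by auto
    have "(star_mat v * v) $$ (i, j) = (\<Sum>k<m. star (v $$ (k, i)) * v $$ (k, j))"
      unfolding index_mult_mat_sum[OF v' v ij] using ij by (intro sum.cong refl) (simp add: index_star_mat[OF v])
    then show "(star_mat v * v) $$ (i, j) = 1\<^sub>m m $$ (i, j)" using ij by (simp add: 2)
  qed (use v v' in auto)
  ultimately show ?thesis using assms by (simp add: unitary_rep_def)
qed

text \<open>Multiplying T v = w T by the adjoint of w on the left and that of v on the right cancels
  v and w by unitarity; the adjoint of what remains is the claim.\<close>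

lemma intertwiners_adjoint:
  assumes v: "unitary_rep comul m v" and w: "unitary_rep comul k w" and T: "T \<in> intertwiners v w"
  shows "mat_adjoint T \<in> intertwiners w v"
proof -
  note cv = unitary_repD(1)[OF v] and cw = unitary_repD(1)[OF w]
  note T = intertwinersD[OF T cv cw]
  note T' = scalar_mat_carrier[OF T(1)]
  note sv = star_mat_carrier[OF cv] and sw = star_mat_carrier[OF cw]
  have "star_mat w * (scalar_mat T * v) * star_mat v = star_mat w * (w * scalar_mat T) * star_mat v"
    by (simp add: T(2))
  moreover have "star_mat w * (scalar_mat T * v) * star_mat v = star_mat w * scalar_mat T * (v * star_mat v)"
    by (simp only: assoc_mult_mat[OF sw T' cv, symmetric] assoc_mult_mat[OF mult_carrier_mat[OF sw T'] cv sv])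
  moreover have "star_mat w * (w * scalar_mat T) * star_mat v = (star_mat w * w) * (scalar_mat T * star_mat v)"
    by (simp only: assoc_mult_mat[OF sw cw T', symmetric] assoc_mult_mat[OF mult_carrier_mat[OF sw cw] T' sv])
  ultimately have "star_mat w * scalar_mat T = scalar_mat T * star_mat v"
    using v w right_mult_one_mat[OF mult_carrier_mat[OF sw T']] left_mult_one_mat[OF mult_carrier_mat[OF T' sv]]
    by (simp add: unitary_rep_def)
  from arg_cong[OF this, of star_mat]
  have "scalar_mat (mat_adjoint T) * w = v * scalar_mat (mat_adjoint T)"
    by (simp add: star_mat_mult[OF sw T'] star_mat_mult[OF T' sv] star_mat_star_mat star_mat_scalar_mat)
  then show ?thesis using mat_adjoint_carrier[OF T(1)] cv cw by (simp add: intertwiners_def)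
qed

text \<open>Only the comultiplication law is kept, on plain index functions. Conjugates of unitary
  representations and matrices of inverse antipode values satisfy it without having to be
  unitary.\<close>

definition corep :: "nat \<Rightarrow> (nat \<Rightarrow> nat \<Rightarrow> 'a) \<Rightarrow> bool" where
  "corep m v \<longleftrightarrow> (\<forall>i<m. \<forall>j<m. comul (v i j) = (\<Sum>k<m. v i k \<otimes>\<^sub>t v k j))"

lemma tlift_corep:
  assumes "corep m v" "i < m" "j < m" "cbilinear f"
  shows "tlift f (comul (v i j)) = (\<Sum>k<m. f (v i k) (v k j))"
  using assms by (simp add: corep_def tlift_sum_tensor)

lemma unitary_rep_corep: "unitary_rep comul m v \<Longrightarrow> corep m (\<lambda>i j. v $$ (i, j))"
  by (simp add: corep_def unitary_repD(2))

lemma corep_star: "corep m v \<Longrightarrow> corep m (\<lambda>i j. star (v i j))"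
  by (simp add: corep_def comul_star star_sum elem_tensor_star)

lemma corep_counit:
  assumes "corep m v" "i < m" "j < m"
  shows "(\<Sum>k<m. counit (v i k) *\<^sub>C v k j) = v i j"
proof -
  have "cbilinear (\<lambda>a b :: 'a. counit a *\<^sub>C b)"
    by (rule cbilinearI) (simp_all add: clinear_add[OF counit_linear] clinear_scale[OF counit_linear]
      scaleC_add_left scaleC_add_right scaleC_scaleC scaleC_complex_def mult.commute)
  from tlift_corep[OF assms this] show ?thesis by (simp add: counit_left)
qed

lemma corep_antipode_left:
  assumes "corep m v" "i < m" "j < m"
  shows "(\<Sum>k<m. antipode (v i k) * v k j) = counit (v i j) *\<^sub>C 1"
proof -
  have "cbilinear (\<lambda>a b. antipode a * b)"
    by (rule cbilinearI) (simp_all add: clinear_add[OF antipode_linear] clinear_scale[OF antipode_linear]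
      distrib_left distrib_right mult_scaleC_left mult_scaleC_right)
  from tlift_corep[OF assms this] show ?thesis by (simp add: antipode_left)
qed

lemma corep_antipode_right:
  assumes "corep m v" "i < m" "j < m"
  shows "(\<Sum>k<m. v i k * antipode (v k j)) = counit (v i j) *\<^sub>C 1"
proof -
  have "cbilinear (\<lambda>a b. a * antipode b)"
    by (rule cbilinearI) (simp_all add: clinear_add[OF antipode_linear] clinear_scale[OF antipode_linear]
      distrib_left distrib_right mult_scaleC_left mult_scaleC_right)
  from tlift_corep[OF assms this] show ?thesis by (simp add: antipode_right)
qed

lemma sum_delta_left: "i < (m::nat) \<Longrightarrow> (\<Sum>k<m. (if i = k then 1 else 0) * f k) = (f i :: 'b::semiring_1)"
proof -
  have "(\<Sum>k<m. (if i = k then 1 else 0) * f k) = (\<Sum>k<m. if i = k then f k else 0)"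
    by (intro sum.cong) auto
  then show "i < m \<Longrightarrow> ?thesis" by (simp add: sum.delta')
qed

lemma sum_delta_right: "i < (m::nat) \<Longrightarrow> (\<Sum>k<m. f k * (if k = i then 1 else 0)) = (f i :: 'b::semiring_1)"
proof -
  have "(\<Sum>k<m. f k * (if k = i then 1 else 0)) = (\<Sum>k<m. if k = i then f k else 0)"
    by (intro sum.cong) auto
  then show "i < m \<Longrightarrow> ?thesis" by (simp add: sum.delta)
qed

text \<open>By \<open>corep_counit\<close> the scalar matrix of counit values fixes v from the left;
  multiplying by the adjoint of v on the right leaves the identity matrix.\<close>

lemma counit_unitary_rep:
  assumes v: "unitary_rep comul m v" and ij: "i < m" "j < m"
  shows "counit (v $$ (i, j)) = (if i = j then 1 else 0)"
proof -
  have "(\<Sum>l<m. (\<Sum>k<m. counit (v $$ (i, k)) *\<^sub>C v $$ (k, l)) * star (v $$ (j, l)))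
      = (\<Sum>l<m. v $$ (i, l) * star (v $$ (j, l)))"
    using ij corep_counit[OF unitary_rep_corep[OF v]] by simp
  also have "\<dots> = (if i = j then 1 else 0)" by (rule unitary_repD(3)[OF v ij])
  also have "(\<Sum>l<m. (\<Sum>k<m. counit (v $$ (i, k)) *\<^sub>C v $$ (k, l)) * star (v $$ (j, l)))
      = (\<Sum>k<m. \<Sum>l<m. counit (v $$ (i, k)) *\<^sub>C (v $$ (k, l) * star (v $$ (j, l))))"
    unfolding sum_distrib_right mult_scaleC_left by (rule sum.swap)
  also have "\<dots> = (\<Sum>k<m. counit (v $$ (i, k)) *\<^sub>C (if k = j then 1 else 0))"
    unfolding scaleC_sum_right[symmetric] using ij by (intro sum.cong refl) (simp add: unitary_repD(3)[OF v])
  also have "\<dots> = counit (v $$ (i, j)) *\<^sub>C 1"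
    using ij by (simp add: if_distrib[of "scaleC _"] sum.delta cong: if_cong)
  finally have "counit (v $$ (i, j)) *\<^sub>C 1 = (if i = j then 1 else 0) *\<^sub>C (1::'a)"
    by (simp split: if_splits)
  then show ?thesis by (simp only: scaleC_one_eq_iff)
qed

text \<open>Compatibility of the counit with the star is not an axiom, so the cancellation is
  repeated: the counit relation of the conjugate corepresentation, starred, again exhibits a scalar
  matrix that fixes v.\<close>

lemma counit_star_unitary_rep:
  assumes v: "unitary_rep comul m v" and ij: "i < m" "j < m"
  shows "counit (star (v $$ (i, j))) = (if i = j then 1 else 0)"
proof -
  let ?c = "\<lambda>k. cnj (counit (star (v $$ (i, k))))"
  have 0: "(\<Sum>k<m. ?c k *\<^sub>C v $$ (k, l)) = v $$ (i, l)" if "l < m" for l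
    using arg_cong[OF corep_counit[OF corep_star[OF unitary_rep_corep[OF v]] ij(1) that], of star]
    by (simp add: star_sum star_scaleC star_star)
  have "(\<Sum>l<m. (\<Sum>k<m. ?c k *\<^sub>C v $$ (k, l)) * star (v $$ (j, l)))
      = (\<Sum>l<m. v $$ (i, l) * star (v $$ (j, l)))"
    using 0 by simp
  also have "\<dots> = (if i = j then 1 else 0)" by (rule unitary_repD(3)[OF v ij])
  also have "(\<Sum>l<m. (\<Sum>k<m. ?c k *\<^sub>C v $$ (k, l)) * star (v $$ (j, l)))
      = (\<Sum>k<m. \<Sum>l<m. ?c k *\<^sub>C (v $$ (k, l) * star (v $$ (j, l))))"
    unfolding sum_distrib_right mult_scaleC_left by (rule sum.swap)
  also have "\<dots> = (\<Sum>k<m. ?c k *\<^sub>C (if k = j then 1 else 0))"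
    unfolding scaleC_sum_right[symmetric] using ij by (intro sum.cong refl) (simp add: unitary_repD(3)[OF v])
  also have "\<dots> = ?c j *\<^sub>C 1"
    using ij by (simp add: if_distrib[of "scaleC _"] sum.delta cong: if_cong)
  finally have "?c j *\<^sub>C 1 = (if i = j then 1 else 0) *\<^sub>C (1::'a)"
    by (simp split: if_splits)
  then have "?c j = (if i = j then 1 else 0)" by (simp only: scaleC_one_eq_iff)
  then show ?thesis by (metis complex_cnj_cnj complex_cnj_one complex_cnj_zero)
qed

text \<open>A left and a right inverse of v coincide: the antipode axiom provides the first,
  unitarity the second.\<close>

lemma antipode_unitary_rep:
  assumes v: "unitary_rep comul m v" and ij: "i < m" "j < m"
  shows "antipode (v $$ (i, j)) = star (v $$ (j, i))"
proof -
  have "(\<Sum>l<m. (\<Sum>k<m. antipode (v $$ (i, k)) * v $$ (k, l)) * star (v $$ (j, l)))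
     = (\<Sum>l<m. (if i = l then 1 else 0) * star (v $$ (j, l)))"
    using ij by (intro sum.cong refl)
      (simp add: corep_antipode_left[OF unitary_rep_corep[OF v]] counit_unitary_rep[OF v])
  also have "\<dots> = star (v $$ (j, i))" by (rule sum_delta_left[OF ij(1)])
  also have "(\<Sum>l<m. (\<Sum>k<m. antipode (v $$ (i, k)) * v $$ (k, l)) * star (v $$ (j, l)))
      = (\<Sum>k<m. \<Sum>l<m. antipode (v $$ (i, k)) * (v $$ (k, l) * star (v $$ (j, l))))"
    unfolding sum_distrib_right mult.assoc by (rule sum.swap)
  also have "\<dots> = (\<Sum>k<m. antipode (v $$ (i, k)) * (if k = j then 1 else 0))"
    unfolding sum_distrib_left[symmetric] using ij by (intro sum.cong refl) (simp add: unitary_repD(3)[OF v])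
  also have "\<dots> = antipode (v $$ (i, j))" by (rule sum_delta_right[OF ij(2)])
  finally show ?thesis .
qed

end

section \<open>Reduction of unitary representations along Hermitian intertwiners\<close>

lemma (in compact_quantum_group) intertwiners_add:
  assumes "T \<in> intertwiners v w" "R \<in> intertwiners v w" "v \<in> carrier_mat m m" "w \<in> carrier_mat k k"
  shows "T + R \<in> intertwiners v w"
proof -
  note T = intertwinersD[OF assms(1,3,4)] and R = intertwinersD[OF assms(2,3,4)]
  show ?thesis
  proof (rule intertwinersI[OF _ assms(3,4)])
    show "T + R \<in> carrier_mat k m" using T(1) R(1) by simp
    fix i j assume ij: "i < k" "j < m"
    have "(\<Sum>r<m. (T + R) $$ (i, r) *\<^sub>C v $$ (r, j)) = (\<Sum>r<m. T $$ (i, r) *\<^sub>C v $$ (r, j)) + (\<Sum>r<m. R $$ (i, r) *\<^sub>C v $$ (r, j))"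
      unfolding sum.distrib[symmetric] using T(1) R(1) ij by (intro sum.cong refl) (simp add: scaleC_add_left)
    also have "\<dots> = (\<Sum>r<k. (T + R) $$ (r, j) *\<^sub>C w $$ (i, r))"
      unfolding T(3)[OF ij] R(3)[OF ij] sum.distrib[symmetric]
      using T(1) R(1) ij by (intro sum.cong refl) (simp add: scaleC_add_left)
    finally show "(\<Sum>r<m. (T + R) $$ (i, r) *\<^sub>C v $$ (r, j)) = (\<Sum>r<k. (T + R) $$ (r, j) *\<^sub>C w $$ (i, r))" .
  qed
qed

lemma (in compact_quantum_group) intertwiners_smult:
  assumes "T \<in> intertwiners v w" "v \<in> carrier_mat m m" "w \<in> carrier_mat k k"
  shows "c \<cdot>\<^sub>m T \<in> intertwiners v w"
proof -
  note T = intertwinersD[OF assms]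
  show ?thesis
  proof (rule intertwinersI[OF _ assms(2,3)])
    show "c \<cdot>\<^sub>m T \<in> carrier_mat k m" using T(1) by simp
    fix i j assume ij: "i < k" "j < m"
    have "(\<Sum>r<m. (c \<cdot>\<^sub>m T) $$ (i, r) *\<^sub>C v $$ (r, j)) = c *\<^sub>C (\<Sum>r<m. T $$ (i, r) *\<^sub>C v $$ (r, j))"
      unfolding scaleC_sum_right using T(1) ij by (intro sum.cong refl) (simp add: scaleC_scaleC)
    also have "\<dots> = (\<Sum>r<k. (c \<cdot>\<^sub>m T) $$ (r, j) *\<^sub>C w $$ (i, r))"
      unfolding T(3)[OF ij] scaleC_sum_right using T(1) ij by (intro sum.cong refl) (simp add: scaleC_scaleC)
    finally show "(\<Sum>r<m. (c \<cdot>\<^sub>m T) $$ (i, r) *\<^sub>C v $$ (r, j)) = (\<Sum>r<k. (c \<cdot>\<^sub>m T) $$ (r, j) *\<^sub>C w $$ (i, r))" .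
  qed
qed

lemma smult_one_eqI:
  assumes "T \<in> carrier_mat m m" "\<And>i j. i < m \<Longrightarrow> j < m \<Longrightarrow> T $$ (i, j) = (if i = j then c else 0)"
  shows "T = (c :: complex) \<cdot>\<^sub>m 1\<^sub>m m"
  by (rule eq_matI) (use assms in auto)

lemma elem_tensor_scale_scale: "(c *\<^sub>C a) \<otimes>\<^sub>t (d *\<^sub>C b) = (c * d) *\<^sub>C (a \<otimes>\<^sub>t b)"
  by (simp add: elem_tensor_scale_left elem_tensor_scale_right scaleC_scaleC mult.commute)

lemma elem_tensor_sum_sum:
  "(\<Sum>i\<in>I. c i *\<^sub>C a i) \<otimes>\<^sub>t (\<Sum>j\<in>J. d j *\<^sub>C b j) = (\<Sum>i\<in>I. \<Sum>j\<in>J. (c i * d j) *\<^sub>C (a i \<otimes>\<^sub>t b j))"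
  unfolding elem_tensor_sum_left elem_tensor_sum_right elem_tensor_scale_scale by (rule sum.swap)

text \<open>Change of basis in the summed middle index of a comultiplication: mutually inverse
  scalar matrices on the two legs cancel.\<close>

lemma elem_tensor_sum_contract:
  assumes "\<And>r q. r < m \<Longrightarrow> q < m \<Longrightarrow> (\<Sum>s<m. V r s * W s q) = (if r = q then 1 else 0)"
  shows "(\<Sum>s<m. (\<Sum>r<m. V r s *\<^sub>C a r) \<otimes>\<^sub>t (\<Sum>q<m. W s q *\<^sub>C c q)) = (\<Sum>r<(m::nat). a r \<otimes>\<^sub>t c r)"
proof -
  have "(\<Sum>s<m. (\<Sum>r<m. V r s *\<^sub>C a r) \<otimes>\<^sub>t (\<Sum>q<m. W s q *\<^sub>C c q))
      = (\<Sum>s<m. \<Sum>r<m. \<Sum>q<m. (V r s * W s q) *\<^sub>C (a r \<otimes>\<^sub>t c q))"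
    by (simp only: elem_tensor_sum_sum)
  also have "\<dots> = (\<Sum>r<m. \<Sum>s<m. \<Sum>q<m. (V r s * W s q) *\<^sub>C (a r \<otimes>\<^sub>t c q))"
    by (rule sum.swap)
  also have "\<dots> = (\<Sum>r<m. \<Sum>q<m. \<Sum>s<m. (V r s * W s q) *\<^sub>C (a r \<otimes>\<^sub>t c q))"
    by (intro sum.cong refl sum.swap)
  also have "\<dots> = (\<Sum>r<m. \<Sum>q<m. if r = q then a r \<otimes>\<^sub>t c q else 0)"
    unfolding scaleC_sum_left[symmetric] by (intro sum.cong refl) (simp add: assms)
  also have "\<dots> = (\<Sum>r<m. a r \<otimes>\<^sub>t c r)" by (intro sum.cong refl) (simp add: sum.delta')
  finally show ?thesis .
qed

lemma (in compact_quantum_group) unitary_rep_conj: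
  assumes v: "unitary_rep comul m v" and V: "V \<in> carrier_mat m m" "V * mat_adjoint V = 1\<^sub>m m" "mat_adjoint V * V = 1\<^sub>m m"
  shows "unitary_rep comul m (scalar_mat (mat_adjoint V) * (v * scalar_mat V))"
proof -
  let ?S = "scalar_mat V :: 'a mat" and ?S' = "scalar_mat (mat_adjoint V) :: 'a mat"
  let ?w = "?S' * (v * ?S)"
  note v = unitary_repD[OF v] and uv = v
  note V' = mat_adjoint_carrier[OF V(1)]
  note S = scalar_mat_carrier[OF V(1), where 'a = 'a] and S' = scalar_mat_carrier[OF V', where 'a = 'a]
  note sv = star_mat_carrier[OF v(1)]
  have w: "?w \<in> carrier_mat m m" using S S' v(1) by simp
  have SS': "?S * ?S' = 1\<^sub>m m" and S'S: "?S' * ?S = 1\<^sub>m m"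
    using scalar_mat_mult[OF V(1) V', where 'a = 'a] scalar_mat_mult[OF V' V(1), where 'a = 'a] V by (simp_all add: scalar_mat_one)
  have stw: "star_mat ?w = ?S' * (star_mat v * ?S)"
  proof -
    have "star_mat ?w = star_mat (v * ?S) * star_mat ?S'" by (rule star_mat_mult[OF S' mult_carrier_mat[OF v(1) S]])
    also have "star_mat (v * ?S) = ?S' * star_mat v"
      by (subst star_mat_mult[OF v(1) S]) (simp add: star_mat_scalar_mat)
    also have "star_mat ?S' = ?S" by (simp add: star_mat_scalar_mat)
    also have "?S' * star_mat v * ?S = ?S' * (star_mat v * ?S)" by (rule assoc_mult_mat[OF S' sv S])
    finally show ?thesis .
  qed
  have conj: "?S' * (a * ?S) * (?S' * (b * ?S)) = ?S' * (a * b * ?S)"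
    if a: "a \<in> carrier_mat m m" and b: "b \<in> carrier_mat m m" for a b
  proof -
    have "?S' * (a * ?S) * (?S' * (b * ?S)) = ?S' * (a * (?S * ?S' * (b * ?S)))"
      using a b S S' by (simp add: assoc_mult_square[of _ m] mult_carrier_square)
    then show ?thesis using a b S S' by (simp add: SS' assoc_mult_square[of _ m] mult_carrier_square)
  qed
  have "?w * star_mat ?w = 1\<^sub>m m" "star_mat ?w * ?w = 1\<^sub>m m"
    unfolding stw conj[OF v(1) sv] conj[OF sv v(1)] using assms(1) S by (simp_all add: unitary_rep_def S'S)
  moreover have "comul (?w $$ (i, j)) = (\<Sum>k<m. ?w $$ (i, k) \<otimes>\<^sub>t ?w $$ (k, j))" if ij: "i < m" "j < m" for i j
  proof -
    define a where "a r = (\<Sum>k<m. cnj (V $$ (k, i)) *\<^sub>C v $$ (k, r))" for r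
    define c where "c r = (\<Sum>l<m. V $$ (l, j) *\<^sub>C v $$ (r, l))" for r
    have vS: "v * ?S \<in> carrier_mat m m" and S'v: "?S' * v \<in> carrier_mat m m" using v(1) S S' by simp_all
    have w2: "?w = (?S' * v) * ?S" by (rule assoc_mult_mat[OF S' v(1) S, symmetric])
    have adjV: "mat_adjoint V $$ (p, q) = cnj (V $$ (q, p))" if "p < m" "q < m" for p q
      using that V(1) by simp
    have wij: "?w $$ (i, j) = (\<Sum>k<m. cnj (V $$ (k, i)) *\<^sub>C (\<Sum>l<m. V $$ (l, j) *\<^sub>C v $$ (k, l)))"
      unfolding index_scalar_mat_mult[OF V' vS ij]
      by (intro sum.cong refl arg_cong2[of _ _ _ _ scaleC])
        (simp_all add: adjV ij(1) index_mult_scalar_mat[OF V(1) v(1) _ ij(2)])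
    have wis: "?w $$ (i, s) = (\<Sum>r<m. V $$ (r, s) *\<^sub>C a r)" if "s < m" for s
      unfolding w2 index_mult_scalar_mat[OF V(1) S'v ij(1) that] a_def
      by (intro sum.cong refl arg_cong2[of _ _ _ _ scaleC])
        (simp_all add: adjV ij(1) index_scalar_mat_mult[OF V' v(1) ij(1)])
    have wsj: "?w $$ (s, j) = (\<Sum>r<m. cnj (V $$ (r, s)) *\<^sub>C c r)" if "s < m" for s
      unfolding index_scalar_mat_mult[OF V' vS that ij(2)] c_def
      by (intro sum.cong refl arg_cong2[of _ _ _ _ scaleC])
        (simp_all add: adjV that index_mult_scalar_mat[OF V(1) v(1) _ ij(2)])
    have "comul (?w $$ (i, j)) = (\<Sum>k<m. \<Sum>l<m. \<Sum>r<m. (cnj (V $$ (k, i)) * V $$ (l, j)) *\<^sub>C (v $$ (k, r) \<otimes>\<^sub>t v $$ (r, l)))"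
      unfolding wij clinear_sum[OF comul_linear] clinear_scale[OF comul_linear] scaleC_sum_right
      by (intro sum.cong refl) (simp add: v(2) scaleC_sum_right scaleC_scaleC)
    also have "\<dots> = (\<Sum>k<m. \<Sum>r<m. \<Sum>l<m. (cnj (V $$ (k, i)) * V $$ (l, j)) *\<^sub>C (v $$ (k, r) \<otimes>\<^sub>t v $$ (r, l)))"
      by (intro sum.cong refl sum.swap)
    also have "\<dots> = (\<Sum>r<m. \<Sum>k<m. \<Sum>l<m. (cnj (V $$ (k, i)) * V $$ (l, j)) *\<^sub>C (v $$ (k, r) \<otimes>\<^sub>t v $$ (r, l)))"
      by (rule sum.swap)
    also have "\<dots> = (\<Sum>r<m. a r \<otimes>\<^sub>t c r)"
      by (simp only: a_def c_def elem_tensor_sum_sum)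
    also have "\<dots> = (\<Sum>s<m. (\<Sum>r<m. V $$ (r, s) *\<^sub>C a r) \<otimes>\<^sub>t (\<Sum>q<m. cnj (V $$ (q, s)) *\<^sub>C c q))"
    proof (rule elem_tensor_sum_contract[symmetric])
      fix r q assume rq: "r < m" "q < m"
      have "(\<Sum>s<m. V $$ (r, s) * cnj (V $$ (q, s))) = (V * mat_adjoint V) $$ (r, q)"
        unfolding index_mult_mat_sum[OF V(1) V' rq] using rq by (intro sum.cong refl) (simp add: adjV)
      then show "(\<Sum>s<m. V $$ (r, s) * cnj (V $$ (q, s))) = (if r = q then 1 else 0)"
        using rq by (simp add: V(2))
    qed
    also have "\<dots> = (\<Sum>k<m. ?w $$ (i, k) \<otimes>\<^sub>t ?w $$ (k, j))"
      by (intro sum.cong refl) (simp only: wis wsj lessThan_iff)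
    finally show ?thesis .
  qed
  ultimately show ?thesis using w by (simp add: unitary_rep_def)
qed

text \<open>Entries between K and its complement vanish in both directions, so sums over K agree
  with sums over all indices and the block inherits every law. The bijection f renumbers K as an
  initial segment, as matrix indices demand.\<close>

lemma (in compact_quantum_group) unitary_rep_restrict:
  assumes v: "unitary_rep comul m v" and K: "K \<subseteq> {..<m}" and f: "bij_betw f {..<k} K"
    and z: "\<And>i j. i < m \<Longrightarrow> j < m \<Longrightarrow> i \<in> K \<Longrightarrow> j \<notin> K \<Longrightarrow> v $$ (i, j) = 0 \<and> v $$ (j, i) = 0"
  shows "unitary_rep comul k (mat k k (\<lambda>(i, j). v $$ (f i, f j)))"
proof -
  note v = unitary_repD[OF v]
  have fK: "f i \<in> K" if "i < k" for i using f that by (auto simp: bij_betw_def)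
  have fm: "f i < m" if "i < k" for i using fK[OF that] K by auto
  have inj: "f i = f j \<longleftrightarrow> i = j" if "i < k" "j < k" for i j
    using f that by (auto simp: bij_betw_def inj_on_def)
  have red: "(\<Sum>s<k. g (f s)) = (\<Sum>s<m. g s)" if "\<And>s. s < m \<Longrightarrow> s \<notin> K \<Longrightarrow> g s = 0" for g :: "nat \<Rightarrow> 'z::comm_monoid_add"
    unfolding sum.reindex_bij_betw[OF f] using K that by (intro sum.mono_neutral_left) auto
  show ?thesis
  proof (rule unitary_repI)
    fix i j assume ij: "i < k" "j < k"
    let ?w = "mat k k (\<lambda>(i, j). v $$ (f i, f j))"
    have "(\<Sum>s<k. ?w $$ (i, s) \<otimes>\<^sub>t ?w $$ (s, j)) = (\<Sum>s<k. v $$ (f i, f s) \<otimes>\<^sub>t v $$ (f s, f j))"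
      using ij by (intro sum.cong refl) simp
    also have "\<dots> = (\<Sum>s<m. v $$ (f i, s) \<otimes>\<^sub>t v $$ (s, f j))"
      by (rule red) (use z[OF fm _ fK] ij in auto)
    finally show "comul (?w $$ (i, j)) = (\<Sum>s<k. ?w $$ (i, s) \<otimes>\<^sub>t ?w $$ (s, j))"
      using ij by (simp add: v(2) fm)
    have "(\<Sum>s<k. ?w $$ (i, s) * star (?w $$ (j, s))) = (\<Sum>s<k. v $$ (f i, f s) * star (v $$ (f j, f s)))"
      using ij by (intro sum.cong refl) simp
    also have "\<dots> = (\<Sum>s<m. v $$ (f i, s) * star (v $$ (f j, s)))"
      by (rule red) (use z[OF fm _ fK] ij in auto)
    finally show "(\<Sum>s<k. ?w $$ (i, s) * star (?w $$ (j, s))) = (if i = j then 1 else 0)"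
      using ij by (simp add: v(3) fm inj)
    have "(\<Sum>s<k. star (?w $$ (s, i)) * ?w $$ (s, j)) = (\<Sum>s<k. star (v $$ (f s, f i)) * v $$ (f s, f j))"
      using ij by (intro sum.cong refl) simp
    also have "\<dots> = (\<Sum>s<m. star (v $$ (s, f i)) * v $$ (s, f j))"
      by (rule red) (use z[OF fm _ fK] ij in auto)
    finally show "(\<Sum>s<k. star (?w $$ (s, i)) * ?w $$ (s, j)) = (if i = j then 1 else 0)"
      using ij by (simp add: v(4) fm inj)
  qed simp
qed

text \<open>T plus its adjoint, and i times the difference of T and its adjoint, are Hermitian
  intertwiners of which T is a combination; if both were scalar, so would be T.\<close>

lemma (in compact_quantum_group) hermitian_intertwiner:
  assumes v: "unitary_rep comul m v" and m: "0 < m" and nirr: "\<not> irreducible_rep v"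
  obtains H where "H \<in> intertwiners v v" "mat_adjoint H = H" "\<And>c. H \<noteq> c \<cdot>\<^sub>m 1\<^sub>m m"
proof -
  note cv = unitary_repD(1)[OF v]
  have dim: "dim_row v = m" using cv by simp
  have scal: "c \<cdot>\<^sub>m 1\<^sub>m m \<in> intertwiners v v" for c
  proof (rule intertwinersI[OF _ cv cv])
    fix i j assume ij: "i < m" "j < m"
    have "(\<Sum>r<m. (c \<cdot>\<^sub>m 1\<^sub>m m) $$ (i, r) *\<^sub>C v $$ (r, j)) = (\<Sum>r<m. if i = r then c *\<^sub>C v $$ (r, j) else 0)"
      using ij by (intro sum.cong refl) auto
    moreover have "(\<Sum>r<m. (c \<cdot>\<^sub>m 1\<^sub>m m) $$ (r, j) *\<^sub>C v $$ (i, r)) = (\<Sum>r<m. if r = j then c *\<^sub>C v $$ (i, r) else 0)"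
      using ij by (intro sum.cong refl) auto
    ultimately show "(\<Sum>r<m. (c \<cdot>\<^sub>m 1\<^sub>m m) $$ (i, r) *\<^sub>C v $$ (r, j)) = (\<Sum>r<m. (c \<cdot>\<^sub>m 1\<^sub>m m) $$ (r, j) *\<^sub>C v $$ (i, r))"
      using ij by (simp add: sum.delta sum.delta')
  qed simp
  obtain T where T: "T \<in> intertwiners v v" "\<And>c. T \<noteq> c \<cdot>\<^sub>m 1\<^sub>m m"
    using nirr m scal unfolding irreducible_rep_def dim by blast
  note Tc = intertwinersD(1)[OF T(1) cv cv] and T' = intertwiners_adjoint[OF v v T(1)]
  define H1 where "H1 = T + mat_adjoint T"
  define H2 where "H2 = \<i> \<cdot>\<^sub>m T + (- \<i>) \<cdot>\<^sub>m mat_adjoint T"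
  have H: "H1 \<in> intertwiners v v" "H2 \<in> intertwiners v v"
    unfolding H1_def H2_def
    by (rule intertwiners_add[OF _ _ cv cv] intertwiners_smult[OF _ cv cv] T T')+
  have adj: "mat_adjoint H1 = H1" "mat_adjoint H2 = H2"
    using Tc by (auto simp: H1_def H2_def intro!: eq_matI)
  have "(\<forall>c. H1 \<noteq> c \<cdot>\<^sub>m 1\<^sub>m m) \<or> (\<forall>c. H2 \<noteq> c \<cdot>\<^sub>m 1\<^sub>m m)"
  proof (rule ccontr)
    assume "\<not> ?thesis"
    then obtain c d where cd: "H1 = c \<cdot>\<^sub>m 1\<^sub>m m" "H2 = d \<cdot>\<^sub>m 1\<^sub>m m" by blast
    have "T = ((c - \<i> * d) / 2) \<cdot>\<^sub>m 1\<^sub>m m"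
    proof (rule smult_one_eqI[OF Tc])
      fix i j assume ij: "i < m" "j < m"
      have "T $$ (i, j) = (H1 $$ (i, j) - \<i> * H2 $$ (i, j)) / 2"
        using ij Tc by (simp add: H1_def H2_def algebra_simps)
      then show "T $$ (i, j) = (if i = j then (c - \<i> * d) / 2 else 0)"
        using ij by (cases "i = j") (simp_all add: cd)
    qed
    with T(2) show False by blast
  qed
  then show ?thesis using H adj that by blast
qed

context discrete_quantum_group
begin

subsection \<open>Matrix coefficients\<close>

lemma u_rep: "unitary_rep comul (n \<alpha>) (u \<alpha>)"
  and u_irreducible: "irreducible_rep (u \<alpha>)"
  and u_distinct: "equivalent_rep (u \<alpha>) (u \<beta>) \<Longrightarrow> \<alpha> = \<beta>"
  and u_complete: "unitary_rep comul m v \<Longrightarrow> irreducible_rep v \<Longrightarrow> \<exists>\<alpha>. equivalent_rep (u \<alpha>) v"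
  using irreps unfolding complete_irreps_def by blast+

lemmas u_carrier = unitary_repD(1)[OF u_rep]

lemma n_pos: "0 < n \<alpha>"
  using u_irreducible[of \<alpha>] u_carrier[of \<alpha>] by (simp add: irreducible_rep_def)

definition coeffs :: "'a set" where
  "coeffs = {u \<alpha> $$ (i, j) | \<alpha> i j. i < n \<alpha> \<and> j < n \<alpha>}"

lemma coeff_in_span: "i < n \<alpha> \<Longrightarrow> j < n \<alpha> \<Longrightarrow> u \<alpha> $$ (i, j) \<in> star_alg.span coeffs"
  by (rule star_alg.span_base) (auto simp: coeffs_def)

text \<open>Strong induction on the dimension. An irreducible v is equivalent to some
  \<open>u \<alpha>\<close>, and the scalar change of basis expresses its entries. Otherwise a
  nonscalar Hermitian intertwiner is diagonalized; in its eigenbasis v falls apart into two blocks,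
  each a smaller unitary representation.\<close>

lemma rep_in_span:
  "unitary_rep comul m v \<Longrightarrow> i < m \<Longrightarrow> j < m \<Longrightarrow> v $$ (i, j) \<in> star_alg.span coeffs"
proof (induction m arbitrary: v i j rule: less_induct)
  case (less m v i j)
  note v = less.prems(1) and ij = less.prems(2,3)
  note cv = unitary_repD(1)[OF v]
  show ?case
  proof (cases "irreducible_rep v")
    case True
    then obtain \<alpha> T where T: "T \<in> intertwiners (u \<alpha>) v" "invertible_mat T"
      using u_complete[OF v] by (auto simp: equivalent_rep_def)
    note T' = intertwinersD[OF T(1) u_carrier cv]
    obtain R where R: "T * R = 1\<^sub>m m" "R * T = 1\<^sub>m (dim_row R)"
      using T(2) T'(1) by (auto simp: invertible_mat_def inverts_mat_def)
    have nm: "n \<alpha> = m" using T(2) T'(1) by (auto simp: invertible_mat_def)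
    have "dim_col R = m" using arg_cong[OF R(1), of dim_col] by simp
    moreover have "dim_row R = m" using arg_cong[OF R(2), of dim_col] T'(1) nm by simp
    ultimately have Rc: "R \<in> carrier_mat m m" by (rule carrier_matI[rotated])
    have Tc: "T \<in> carrier_mat m m" and uc: "u \<alpha> \<in> carrier_mat m m" using T'(1) u_carrier[of \<alpha>] nm by simp_all
    note Ts = scalar_mat_carrier[OF Tc, where 'a = 'a] and Rs = scalar_mat_carrier[OF Rc, where 'a = 'a]
    have "v = v * scalar_mat (T * R)" using cv by (simp add: R(1) scalar_mat_one)
    also have "\<dots> = scalar_mat T * u \<alpha> * scalar_mat R"
      unfolding scalar_mat_mult[OF Tc Rc] assoc_mult_mat[OF cv Ts Rs, symmetric] T'(2) ..
    finally have eq: "v $$ (i, j) = (scalar_mat T * u \<alpha> * scalar_mat R) $$ (i, j)" by simp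
    have "(scalar_mat T * u \<alpha> * scalar_mat R) $$ (i, j)
        = (\<Sum>l<m. R $$ (l, j) *\<^sub>C (\<Sum>k<m. T $$ (i, k) *\<^sub>C u \<alpha> $$ (k, l)))"
      unfolding index_mult_scalar_mat[OF Rc mult_carrier_mat[OF Ts uc] ij]
      using ij by (intro sum.cong refl) (simp add: index_scalar_mat_mult[OF Tc uc])
    then show ?thesis unfolding eq
      by (simp only:) (intro star_alg.span_sum star_alg.span_scale coeff_in_span, auto simp: nm)
  next
    case False
    have m: "0 < m" using ij by simp
    obtain H where H: "H \<in> intertwiners v v" "mat_adjoint H = H" "\<And>c. H \<noteq> c \<cdot>\<^sub>m 1\<^sub>m m"
      using hermitian_intertwiner[OF v m False] by blast
    note H' = intertwinersD[OF H(1) cv cv]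
    obtain V d where V: "V \<in> carrier_mat m m" "V * mat_adjoint V = 1\<^sub>m m" "mat_adjoint V * V = 1\<^sub>m m"
      "H = V * mat_diag m (\<lambda>i. complex_of_real (d i)) * mat_adjoint V"
      using hermitian_diagonalization[OF H'(1) H(2)] by blast
    define D where "D = mat_diag m (\<lambda>i. complex_of_real (d i))"
    have D: "D \<in> carrier_mat m m" by (simp add: D_def)
    note V' = mat_adjoint_carrier[OF V(1)]
    let ?S = "scalar_mat V :: 'a mat" and ?S' = "scalar_mat (mat_adjoint V) :: 'a mat"
    note S = scalar_mat_carrier[OF V(1), where 'a = 'a] and S' = scalar_mat_carrier[OF V', where 'a = 'a]
    have SS': "?S * ?S' = 1\<^sub>m m" and S'S: "?S' * ?S = 1\<^sub>m m"
      using scalar_mat_mult[OF V(1) V', where 'a = 'a] scalar_mat_mult[OF V' V(1), where 'a = 'a] V by (simp_all add: scalar_mat_one)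
    define w where "w = ?S' * (v * ?S)"
    have w: "unitary_rep comul m w" unfolding w_def by (rule unitary_rep_conj[OF v V(1-3)])
    note cw = unitary_repD(1)[OF w]
    have vw: "v = ?S * w * ?S'"
    proof -
      have "?S * w * ?S' = (?S * ?S') * (v * (?S * ?S'))"
        unfolding w_def using cv S S' by (simp add: assoc_mult_square[of _ m] mult_carrier_square)
      then show ?thesis using cv by (simp add: SS')
    qed
    have comm: "scalar_mat D * w = w * scalar_mat D"
    proof -
      note Ds = scalar_mat_carrier[OF D, where 'a = 'a]
      have sH: "scalar_mat H = ?S * (scalar_mat D * ?S')"
        unfolding V(4) D_def[symmetric] using V(1) V' D S S' Ds
        by (simp add: scalar_mat_mult[of _ m m _ m] assoc_mult_square[of _ m] mult_carrier_square)
      have "?S' * (scalar_mat H * v) * ?S = ?S' * (v * scalar_mat H) * ?S" by (simp add: H'(2))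
      moreover have "?S' * (scalar_mat H * v) * ?S = (?S' * ?S) * (scalar_mat D * (?S' * (v * ?S)))"
        unfolding sH using cv S S' Ds by (simp add: assoc_mult_square[of _ m] mult_carrier_square)
      moreover have "?S' * (v * scalar_mat H) * ?S = ?S' * (v * ?S) * (scalar_mat D * (?S' * ?S))"
        unfolding sH using cv S S' Ds by (simp add: assoc_mult_square[of _ m] mult_carrier_square)
      ultimately show ?thesis using cw S S' Ds cv unfolding S'S w_def[symmetric]
        by (simp add: left_mult_one_mat[of _ m m])
    qed
    \<comment> \<open>D is diagonal, so the (p, q) entries of D w = w D give (d p - d q) w_pq =
      0.\<close>
    have wz: "w $$ (p, q) = 0" if pq: "p < m" "q < m" "d p \<noteq> d q" for p q
    proof -
      have "(scalar_mat D * w) $$ (p, q) = (\<Sum>r<m. if p = r then of_real (d p) *\<^sub>C w $$ (r, q) else 0)"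
        unfolding index_scalar_mat_mult[OF D cw pq(1,2)]
        using pq by (intro sum.cong refl) (auto simp: D_def mat_diag_def)
      moreover have "(w * scalar_mat D) $$ (p, q) = (\<Sum>r<m. if r = q then of_real (d q) *\<^sub>C w $$ (p, r) else 0)"
        unfolding index_mult_scalar_mat[OF D cw pq(1,2)]
        using pq by (intro sum.cong refl) (auto simp: D_def mat_diag_def)
      ultimately have "of_real (d p) *\<^sub>C w $$ (p, q) = of_real (d q) *\<^sub>C w $$ (p, q)"
        using pq comm by (simp add: sum.delta sum.delta')
      then show ?thesis using pq(3) by simp
    qed
    \<comment> \<open>The eigenvalue \<open>d 0\<close> against all others. Both parts are proper: I
      contains 0, and J is nonempty because H is not scalar.\<close>
    define I where "I = {p. p < m \<and> d p = d 0}"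
    define J where "J = {p. p < m \<and> d p \<noteq> d 0}"
    have "J \<noteq> {}"
    proof
      assume "J = {}"
      then have dd: "p < m \<Longrightarrow> d p = d 0" for p unfolding J_def by blast
      have "D = complex_of_real (d 0) \<cdot>\<^sub>m 1\<^sub>m m"
      proof (rule smult_one_eqI[OF D])
        fix p q assume "p < m" "q < m"
        then show "D $$ (p, q) = (if p = q then complex_of_real (d 0) else 0)"
          using dd[of q] by (simp add: D_def mat_diag_def)
      qed
      then have "H = complex_of_real (d 0) \<cdot>\<^sub>m 1\<^sub>m m"
        using V(1,2) V' by (simp add: V(4) D_def[symmetric] mult_smult_distrib[OF V(1) one_carrier_mat] mult_smult_assoc_mat[OF V(1) V'])
      with H(3) show False by blast
    qed
    moreover have "0 \<in> I" using m by (simp add: I_def)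
    ultimately have less_m: "card I < m" "card J < m"
      using psubset_card_mono[of "{..<m}" I] psubset_card_mono[of "{..<m}" J] m
      by (auto simp: I_def J_def)
    have block: "w $$ (p, q) \<in> star_alg.span coeffs" if K: "K \<subseteq> {..<m}" "card K < m"
      "\<And>p q. p < m \<Longrightarrow> q < m \<Longrightarrow> p \<in> K \<Longrightarrow> q \<notin> K \<Longrightarrow> d p \<noteq> d q" and pq: "p \<in> K" "q \<in> K" for K p q
    proof -
      have "finite K" using K(1) finite_subset by blast
      then obtain f where f: "bij_betw f {..<card K} K"
        using ex_bij_betw_nat_finite[of K] by (auto simp: lessThan_atLeast0)
      have w': "unitary_rep comul (card K) (mat (card K) (card K) (\<lambda>(i, j). w $$ (f i, f j)))"
        by (rule unitary_rep_restrict[OF w K(1) f]) (metis K(3) wz)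
      have "p \<in> f ` {..<card K}" "q \<in> f ` {..<card K}"
        unfolding bij_betw_imp_surj_on[OF f] by (fact pq)+
      then obtain p' q' where "p' < card K" "p = f p'" "q' < card K" "q = f q'"
        unfolding image_iff lessThan_iff by blast
      then show ?thesis using less.IH[OF K(2) w', of p' q'] by simp
    qed
    have wspan: "w $$ (p, q) \<in> star_alg.span coeffs" if pq: "p < m" "q < m" for p q
    proof (cases "d p = d q")
      case False
      then show ?thesis using wz[OF pq] by (simp add: star_alg.span_zero)
    next
      case True
      show ?thesis
      proof (cases "p \<in> I")
        case True
        then show ?thesis using \<open>d p = d q\<close> pq less_m by (intro block[of I]) (auto simp: I_def)
      next
        case False
        then show ?thesis using \<open>d p = d q\<close> pq less_m by (intro block[of J]) (auto simp: I_def J_def)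
      qed
    qed
    have "v $$ (i, j) = (\<Sum>l<m. mat_adjoint V $$ (l, j) *\<^sub>C (\<Sum>k<m. V $$ (i, k) *\<^sub>C w $$ (k, l)))"
      unfolding arg_cong[OF vw, of "\<lambda>A. A $$ (i, j)"] index_mult_scalar_mat[OF V' mult_carrier_mat[OF S cw] ij]
      using ij by (intro sum.cong refl) (simp add: index_scalar_mat_mult[OF V(1) cw])
    then show ?thesis
      by (simp only:) (intro star_alg.span_sum star_alg.span_scale wspan, auto)
  qed
qed

lemma span_coeffs: "star_alg.span coeffs = UNIV"
proof -
  have "star_alg.span {v $$ (i, j) | m v i j. unitary_rep comul m v \<and> i < m \<and> j < m} \<subseteq> star_alg.span coeffs"
    by (rule star_alg.span_minimal) (auto intro: rep_in_span)
  then show ?thesis using coefficients_span by auto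
qed

end

section \<open>Schur's lemma and the basis of matrix coefficients\<close>

interpretation star_alg_pairs: vector_space_pair
  "scaleC :: complex \<Rightarrow> 'a \<Rightarrow> 'a::complex_star_algebra"
  "scaleC :: complex \<Rightarrow> 'b \<Rightarrow> 'b::complex_star_algebra"
  by unfold_locales

lemma clinear_if_linear: "Vector_Spaces.linear (*\<^sub>C) (*\<^sub>C) f \<Longrightarrow> clinear f"
  unfolding clinear_def by (auto simp: star_alg_pairs.linear_add star_alg_pairs.linear_scale)

lemma cbilinear_scale: "clinear f \<Longrightarrow> cbilinear (\<lambda>a b. f a *\<^sub>C b)" for f :: "'a::complex_star_algebra \<Rightarrow> complex"
  by (rule cbilinearI) (simp_all add: clinear_add clinear_scale scaleC_add_left scaleC_add_right scaleC_scaleC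
    scaleC_complex_def mult.commute)

lemma mat_eq_zero_iff: "T \<in> carrier_mat m k \<Longrightarrow> T = 0\<^sub>m m k \<longleftrightarrow> (\<forall>i<m. \<forall>j<k. T $$ (i, j) = 0)"
  by (auto intro!: eq_matI)

lemma sum_cnj_mult_eq_0:
  assumes "finite A" "(\<Sum>k\<in>A. cnj (f k) * f k) = 0" "k \<in> A"
  shows "f k = 0"
proof -
  have "(\<Sum>k\<in>A. cnj (f k) * f k) = of_real (\<Sum>k\<in>A. (cmod (f k))\<^sup>2)"
    unfolding of_real_sum by (intro sum.cong refl) (metis complex_norm_square mult.commute of_real_power)
  with assms have "(\<Sum>k\<in>A. (cmod (f k))\<^sup>2) = 0" by (metis of_real_eq_0_iff)
  then show ?thesis using assms by (simp add: sum_nonneg_eq_0_iff)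
qed

context discrete_quantum_group
begin

lemma schur_same:
  assumes "T \<in> intertwiners (u \<alpha>) (u \<alpha>)"
  obtains c where "T = c \<cdot>\<^sub>m 1\<^sub>m (n \<alpha>)"
  using assms u_irreducible[of \<alpha>] u_carrier[of \<alpha>] by (auto simp: irreducible_rep_def)

text \<open>For nonzero T both products of T with its adjoint are intertwiners of an irreducible,
  hence scalars. These are nonzero and equal, and comparing traces makes T square, so T is
  invertible, against inequivalence.\<close>

lemma schur_distinct:
  assumes T: "T \<in> intertwiners (u \<alpha>) (u \<beta>)" and ne: "\<alpha> \<noteq> \<beta>"
  shows "T = 0\<^sub>m (n \<beta>) (n \<alpha>)"
proof (rule ccontr)
  assume T0: "T \<noteq> 0\<^sub>m (n \<beta>) (n \<alpha>)"
  note T' = intertwiners_adjoint[OF u_rep u_rep T]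
  note Tc = intertwinersD(1)[OF T u_carrier u_carrier] and Tc' = intertwinersD(1)[OF T' u_carrier u_carrier]
  obtain c where c: "mat_adjoint T * T = c \<cdot>\<^sub>m 1\<^sub>m (n \<alpha>)"
    using schur_same[OF intertwiners_mult[OF T T' u_carrier u_carrier u_carrier]] by blast
  obtain c' where c': "T * mat_adjoint T = c' \<cdot>\<^sub>m 1\<^sub>m (n \<beta>)"
    using schur_same[OF intertwiners_mult[OF T' T u_carrier u_carrier u_carrier]] by blast
  obtain i j where ij: "i < n \<beta>" "j < n \<alpha>" "T $$ (i, j) \<noteq> 0"
    using T0 Tc by (auto simp: mat_eq_zero_iff)
  have cc: "(\<Sum>k<n \<beta>. cnj (T $$ (k, l)) * T $$ (k, l)) = c" if l: "l < n \<alpha>" for l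
  proof -
    have "(mat_adjoint T * T) $$ (l, l) = (\<Sum>k<n \<beta>. cnj (T $$ (k, l)) * T $$ (k, l))"
      unfolding index_mult_mat_sum[OF Tc' Tc l l] using l Tc by (intro sum.cong refl) simp
    then show ?thesis using l by (simp add: c)
  qed
  have cc': "(\<Sum>l<n \<alpha>. T $$ (k, l) * cnj (T $$ (k, l))) = c'" if k: "k < n \<beta>" for k
  proof -
    have "(T * mat_adjoint T) $$ (k, k) = (\<Sum>l<n \<alpha>. T $$ (k, l) * cnj (T $$ (k, l)))"
      unfolding index_mult_mat_sum[OF Tc Tc' k k] using k Tc by (intro sum.cong refl) simp
    then show ?thesis using k by (simp add: c')
  qed
  have c0: "c \<noteq> 0"
    using sum_cnj_mult_eq_0[of "{..<n \<beta>}" "\<lambda>k. T $$ (k, j)" i] cc[OF ij(2)] ij by auto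
  have "c \<cdot>\<^sub>m mat_adjoint T = c' \<cdot>\<^sub>m mat_adjoint T"
  proof -
    have "mat_adjoint T * T * mat_adjoint T = mat_adjoint T * (T * mat_adjoint T)"
      by (rule assoc_mult_mat[OF Tc' Tc Tc'])
    then show ?thesis using Tc'
      by (simp add: c c' mult_smult_distrib[OF Tc' one_carrier_mat] mult_smult_assoc_mat[OF one_carrier_mat Tc']
        left_mult_one_mat[OF Tc'] right_mult_one_mat[OF Tc'])
  qed
  then have "(c \<cdot>\<^sub>m mat_adjoint T) $$ (j, i) = (c' \<cdot>\<^sub>m mat_adjoint T) $$ (j, i)" by simp
  then have cceq: "c = c'" using ij Tc by simp
  have "of_nat (n \<alpha>) * c = (\<Sum>l<n \<alpha>. \<Sum>k<n \<beta>. cnj (T $$ (k, l)) * T $$ (k, l))"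
    using cc by simp
  also have "\<dots> = (\<Sum>k<n \<beta>. \<Sum>l<n \<alpha>. T $$ (k, l) * cnj (T $$ (k, l)))"
    by (subst sum.swap) (simp add: mult.commute)
  also have "\<dots> = of_nat (n \<beta>) * c'" using cc' by simp
  finally have dim: "n \<alpha> = n \<beta>" using cceq c0 by simp
  have "invertible_mat T"
    unfolding invertible_mat_def inverts_mat_def
  proof (intro conjI exI)
    show "square_mat T" using Tc dim by simp
    have sm: "1 / c \<cdot>\<^sub>m (c \<cdot>\<^sub>m 1\<^sub>m k) = 1\<^sub>m k" for k using c0 by (intro eq_matI) auto
    have inv: "T * (1 / c \<cdot>\<^sub>m mat_adjoint T) = 1\<^sub>m (n \<beta>)" "(1 / c \<cdot>\<^sub>m mat_adjoint T) * T = 1\<^sub>m (n \<alpha>)"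
      using c0 by (simp_all add: mult_smult_distrib[OF Tc Tc'] mult_smult_assoc_mat[OF Tc' Tc] c c' cceq[symmetric] sm)
    show "T * (1 / c \<cdot>\<^sub>m mat_adjoint T) = 1\<^sub>m (dim_row T)" using inv(1) Tc by simp
    show "(1 / c \<cdot>\<^sub>m mat_adjoint T) * T = 1\<^sub>m (dim_row (1 / c \<cdot>\<^sub>m mat_adjoint T))" using inv(2) Tc by simp
  qed
  then have "equivalent_rep (u \<alpha>) (u \<beta>)" using T by (auto simp: equivalent_rep_def)
  with u_distinct ne show False by blast
qed

lemma antipode_u: "i < n \<alpha> \<Longrightarrow> j < n \<alpha> \<Longrightarrow> antipode (u \<alpha> $$ (i, j)) = star (u \<alpha> $$ (j, i))"
  by (rule antipode_unitary_rep[OF u_rep])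

text \<open>The space of relations among coefficients is invariant under the right regular action of the
  functionals, which is closed under adjoints, so the orthogonal projection onto it commutes with this
  action. By Schur's lemma the projection is then \<open>1 \<otimes> e\<close> on each block, and a relation
  \<open>u\<^sup>\<alpha> e = 0\<close> contradicts the invertibility of \<open>u\<^sup>\<alpha>\<close>.\<close>

lemma coeff_independent:
  assumes F: "finite F"
    and rel: "(\<Sum>\<alpha>\<in>F. \<Sum>i<n \<alpha>. \<Sum>j<n \<alpha>. c \<alpha> i j *\<^sub>C u \<alpha> $$ (i, j)) = 0"
    and \<alpha>: "\<alpha> \<in> F" "i < n \<alpha>" "j < n \<alpha>"
  shows "c \<alpha> i j = 0"
proof -
  define I where "I = (SIGMA \<alpha>:F. {..<n \<alpha>} \<times> {..<n \<alpha>})"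
  define b where "b = (\<lambda>(\<alpha>, i, j). u \<alpha> $$ (i, j))"
  have I_iff: "(\<alpha>, i, j) \<in> I \<longleftrightarrow> \<alpha> \<in> F \<and> i < n \<alpha> \<and> j < n \<alpha>" for \<alpha> i j by (auto simp: I_def)
  have finI: "finite I" using F by (simp add: I_def)
  have sumI: "(\<Sum>t\<in>I. g t) = (\<Sum>\<alpha>\<in>F. \<Sum>i<n \<alpha>. \<Sum>j<n \<alpha>. g (\<alpha>, i, j))" for g :: "_ \<Rightarrow> 'z::comm_monoid_add"
  proof -
    have "(\<Sum>t\<in>I. g t) = (\<Sum>\<alpha>\<in>F. \<Sum>s\<in>{..<n \<alpha>} \<times> {..<n \<alpha>}. g (\<alpha>, s))"
      unfolding I_def using F by (subst sum.Sigma) (auto simp: case_prod_unfold)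
    also have "\<dots> = (\<Sum>\<alpha>\<in>F. \<Sum>i<n \<alpha>. \<Sum>j<n \<alpha>. g (\<alpha>, i, j))"
      by (intro sum.cong refl, subst sum.cartesian_product) (simp add: case_prod_unfold)
    finally show ?thesis .
  qed
  define W where "W = {w :: 'i \<times> nat \<times> nat \<Rightarrow> complex. (\<forall>t. t \<notin> I \<longrightarrow> w t = 0) \<and> (\<Sum>t\<in>I. w t *\<^sub>C b t) = 0}"
  have Wlin: "(\<lambda>x. v x + k * w x) \<in> W" if "v \<in> W" "w \<in> W" for v w k
  proof -
    have "(\<Sum>t\<in>I. (v t + k * w t) *\<^sub>C b t) = (\<Sum>t\<in>I. v t *\<^sub>C b t) + k *\<^sub>C (\<Sum>t\<in>I. w t *\<^sub>C b t)"
      by (simp add: scaleC_add_left scaleC_sum_right scaleC_scaleC sum.distrib)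
    then show ?thesis using that by (simp add: W_def)
  qed
  have W0: "(\<lambda>_. 0) \<in> W" by (simp add: W_def)
  have Wout: "w t = 0" if "w \<in> W" "t \<notin> I" for w t using that unfolding W_def by blast
  have "\<exists>E. (\<forall>y\<in>I. (\<lambda>x. E x y) \<in> W) \<and> (\<forall>w\<in>W. \<forall>x. (\<Sum>y\<in>I. E x y * w y) = w x) \<and> (\<forall>x y. E x y = cnj (E y x))"
    by (rule orthogonal_projection_exists[OF finI]) (fact Wlin, fact W0, fact Wout)
  then obtain E where "\<forall>y\<in>I. (\<lambda>x. E x y) \<in> W" "\<forall>w\<in>W. \<forall>x. (\<Sum>y\<in>I. E x y * w y) = w x" "\<forall>x y. E x y = cnj (E y x)"
    by blast
  note E = this[rule_format]
  \<comment> \<open>The map sending a to the image of \<open>comul a\<close> under f \<otimes> id,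
    written on coefficient vectors. A relation stays a relation because it represents the element
    0.\<close>
  define L :: "('a \<Rightarrow> complex) \<Rightarrow> ('i \<times> nat \<times> nat \<Rightarrow> complex) \<Rightarrow> 'i \<times> nat \<times> nat \<Rightarrow> complex" where
    "L f w t = (if t \<in> I then (case t of (\<alpha>, k, j) \<Rightarrow> \<Sum>i<n \<alpha>. f (u \<alpha> $$ (i, k)) * w (\<alpha>, i, j)) else 0)" for f w t
  have Lin: "L f w (\<alpha>, k, j) = (\<Sum>i<n \<alpha>. f (u \<alpha> $$ (i, k)) * w (\<alpha>, i, j))" if "\<alpha> \<in> F" "k < n \<alpha>" "j < n \<alpha>" for f w \<alpha> k j
    using that by (simp add: L_def I_iff)
  have LW: "L f w \<in> W" if f: "clinear f" and w: "w \<in> W" for f w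
  proof -
    note bil = cbilinear_scale[OF f]
    have "(\<Sum>t\<in>I. L f w t *\<^sub>C b t)
        = (\<Sum>\<alpha>\<in>F. \<Sum>k<n \<alpha>. \<Sum>j<n \<alpha>. (\<Sum>i<n \<alpha>. f (u \<alpha> $$ (i, k)) * w (\<alpha>, i, j)) *\<^sub>C u \<alpha> $$ (k, j))"
      unfolding sumI by (intro sum.cong refl) (simp add: Lin b_def)
    also have "\<dots> = (\<Sum>\<alpha>\<in>F. \<Sum>k<n \<alpha>. \<Sum>j<n \<alpha>. \<Sum>i<n \<alpha>. (w (\<alpha>, i, j) * f (u \<alpha> $$ (i, k))) *\<^sub>C u \<alpha> $$ (k, j))"
      by (simp only: scaleC_sum_left mult.commute)
    also have "\<dots> = (\<Sum>\<alpha>\<in>F. \<Sum>k<n \<alpha>. \<Sum>i<n \<alpha>. \<Sum>j<n \<alpha>. (w (\<alpha>, i, j) * f (u \<alpha> $$ (i, k))) *\<^sub>C u \<alpha> $$ (k, j))"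
      by (intro sum.cong refl sum.swap)
    also have "\<dots> = (\<Sum>\<alpha>\<in>F. \<Sum>i<n \<alpha>. \<Sum>k<n \<alpha>. \<Sum>j<n \<alpha>. (w (\<alpha>, i, j) * f (u \<alpha> $$ (i, k))) *\<^sub>C u \<alpha> $$ (k, j))"
      by (intro sum.cong refl sum.swap)
    also have "\<dots> = (\<Sum>\<alpha>\<in>F. \<Sum>i<n \<alpha>. \<Sum>j<n \<alpha>. \<Sum>k<n \<alpha>. (w (\<alpha>, i, j) * f (u \<alpha> $$ (i, k))) *\<^sub>C u \<alpha> $$ (k, j))"
      by (intro sum.cong refl sum.swap)
    also have "\<dots> = (\<Sum>\<alpha>\<in>F. \<Sum>i<n \<alpha>. \<Sum>j<n \<alpha>. w (\<alpha>, i, j) *\<^sub>C tlift (\<lambda>a b. f a *\<^sub>C b) (comul (u \<alpha> $$ (i, j))))"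
      by (intro sum.cong refl)
        (simp add: tlift_corep[OF unitary_rep_corep[OF u_rep] _ _ bil] scaleC_sum_right scaleC_scaleC)
    also have "\<dots> = tlift (\<lambda>a b. f a *\<^sub>C b) (comul (\<Sum>t\<in>I. w t *\<^sub>C b t))"
      unfolding sumI b_def by (simp add: clinear_sum[OF comul_linear] clinear_scale[OF comul_linear]
        clinear_sum[OF clinear_tlift[OF bil]] clinear_scale[OF clinear_tlift[OF bil]])
    also have "\<dots> = 0" using w by (simp add: W_def clinear_zero[OF comul_linear] clinear_zero[OF clinear_tlift[OF bil]])
    finally show ?thesis by (simp add: W_def L_def)
  qed
  \<comment> \<open>By unitarity its value at u_ij is the conjugate of f at u_ji, which makes
    \<open>L (adj f)\<close> the adjoint of \<open>L f\<close> for the standard inner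
    product.\<close>
  define adj :: "('a \<Rightarrow> complex) \<Rightarrow> 'a \<Rightarrow> complex" where "adj f a = cnj (f (star (antipode a)))" for f a
  have adj_lin: "clinear (adj f)" if "clinear f" for f
    using that antipode_linear by (simp add: clinear_def adj_def star_add star_scaleC scaleC_complex_def)
  have adj_u: "adj f (u \<alpha> $$ (i, j)) = cnj (f (u \<alpha> $$ (j, i)))" if "i < n \<alpha>" "j < n \<alpha>" for f \<alpha> i j
    using that by (simp add: adj_def antipode_u star_star)
  have inner: "(\<Sum>t\<in>I. cnj (v t) * L f w t) = (\<Sum>t\<in>I. cnj (L (adj f) v t) * w t)" for f v w
  proof -
    have "(\<Sum>t\<in>I. cnj (v t) * L f w t)
        = (\<Sum>\<alpha>\<in>F. \<Sum>k<n \<alpha>. \<Sum>j<n \<alpha>. \<Sum>i<n \<alpha>. cnj (v (\<alpha>, k, j)) * f (u \<alpha> $$ (i, k)) * w (\<alpha>, i, j))"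
      unfolding sumI by (intro sum.cong refl) (simp add: Lin sum_distrib_left mult.assoc)
    also have "\<dots> = (\<Sum>\<alpha>\<in>F. \<Sum>k<n \<alpha>. \<Sum>i<n \<alpha>. \<Sum>j<n \<alpha>. cnj (v (\<alpha>, k, j)) * f (u \<alpha> $$ (i, k)) * w (\<alpha>, i, j))"
      by (intro sum.cong refl sum.swap)
    also have "\<dots> = (\<Sum>\<alpha>\<in>F. \<Sum>i<n \<alpha>. \<Sum>k<n \<alpha>. \<Sum>j<n \<alpha>. cnj (v (\<alpha>, k, j)) * f (u \<alpha> $$ (i, k)) * w (\<alpha>, i, j))"
      by (intro sum.cong refl sum.swap)
    also have "\<dots> = (\<Sum>\<alpha>\<in>F. \<Sum>i<n \<alpha>. \<Sum>j<n \<alpha>. \<Sum>k<n \<alpha>. cnj (v (\<alpha>, k, j)) * f (u \<alpha> $$ (i, k)) * w (\<alpha>, i, j))"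
      by (intro sum.cong refl sum.swap)
    also have "\<dots> = (\<Sum>t\<in>I. cnj (L (adj f) v t) * w t)"
      unfolding sumI by (intro sum.cong refl) (simp add: Lin adj_u sum_distrib_left mult_ac)
    finally show ?thesis .
  qed
  have commute: "L f (\<lambda>z. E z y) x = cnj (L (adj f) (\<lambda>z. E z x) y)" if f: "clinear f" and x: "x \<in> I" and y: "y \<in> I" for f x y
  proof -
    have "L f (\<lambda>z. E z y) x = (\<Sum>z\<in>I. E x z * L f (\<lambda>z. E z y) z)"
      by (rule E(2)[OF LW[OF f E(1)[OF y]], symmetric])
    also have "\<dots> = (\<Sum>z\<in>I. cnj (E z x) * L f (\<lambda>z. E z y) z)"
      by (intro sum.cong refl arg_cong2[of _ _ _ _ "(*)"]) (rule E(3))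
    also have "\<dots> = (\<Sum>z\<in>I. cnj (L (adj f) (\<lambda>z. E z x) z) * E z y)" by (rule inner)
    also have "\<dots> = cnj (\<Sum>z\<in>I. E y z * L (adj f) (\<lambda>z. E z x) z)"
      unfolding cnj_sum complex_cnj_mult
      by (intro sum.cong refl) (subst E(3), simp add: mult.commute)
    also have "(\<Sum>z\<in>I. E y z * L (adj f) (\<lambda>z. E z x) z) = L (adj f) (\<lambda>z. E z x) y"
      by (rule E(2)[OF LW[OF adj_lin[OF f] E(1)[OF x]]])
    finally show ?thesis .
  qed
  \<comment> \<open>Commutation with the actions of all functionals f at once is an identity in the
    algebra itself.\<close>
  have key: "(\<Sum>i<n \<alpha>. E (\<alpha>, i, j) (\<beta>, m, l) *\<^sub>C u \<alpha> $$ (i, k)) = (\<Sum>i<n \<beta>. E (\<alpha>, k, j) (\<beta>, i, l) *\<^sub>C u \<beta> $$ (m, i))"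
    if a: "\<alpha> \<in> F" "j < n \<alpha>" "k < n \<alpha>" and b: "\<beta> \<in> F" "m < n \<beta>" "l < n \<beta>" for \<alpha> \<beta> j k m l
  proof (rule clinear_eqI)
    fix f :: "'a \<Rightarrow> complex" assume f: "clinear f"
    have "f (\<Sum>i<n \<alpha>. E (\<alpha>, i, j) (\<beta>, m, l) *\<^sub>C u \<alpha> $$ (i, k)) = L f (\<lambda>z. E z (\<beta>, m, l)) (\<alpha>, k, j)"
      using a by (simp add: Lin clinear_sum[OF f] clinear_scale[OF f] scaleC_complex_def mult.commute)
    also have "\<dots> = cnj (L (adj f) (\<lambda>z. E z (\<alpha>, k, j)) (\<beta>, m, l))"
      by (rule commute[OF f]) (use a b in \<open>simp_all add: I_iff\<close>)
    also have "\<dots> = (\<Sum>i<n \<beta>. f (u \<beta> $$ (m, i)) * cnj (E (\<beta>, i, l) (\<alpha>, k, j)))"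
      using b by (simp add: Lin adj_u)
    also have "\<dots> = f (\<Sum>i<n \<beta>. E (\<alpha>, k, j) (\<beta>, i, l) *\<^sub>C u \<beta> $$ (m, i))"
      unfolding clinear_sum[OF f] clinear_scale[OF f] scaleC_complex_def E(3)[of "(\<alpha>, k, j)"]
      by (intro sum.cong refl) simp
    finally show "f (\<Sum>i<n \<alpha>. E (\<alpha>, i, j) (\<beta>, m, l) *\<^sub>C u \<alpha> $$ (i, k)) = f (\<Sum>i<n \<beta>. E (\<alpha>, k, j) (\<beta>, i, l) *\<^sub>C u \<beta> $$ (m, i))" .
  qed
  \<comment> \<open>For fixed column indices j and l the entries of E form a matrix in the row
    indices, and \<open>key\<close> is its intertwining relation.\<close>
  define X where "X \<alpha> j \<beta> l = mat (n \<beta>) (n \<alpha>) (\<lambda>(m, i). E (\<alpha>, i, j) (\<beta>, m, l))" for \<alpha> j \<beta> l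
  have X: "X \<alpha> j \<beta> l \<in> intertwiners (u \<alpha>) (u \<beta>)" if "\<alpha> \<in> F" "j < n \<alpha>" "\<beta> \<in> F" "l < n \<beta>" for \<alpha> j \<beta> l
  proof (rule intertwinersI[OF _ u_carrier u_carrier])
    fix m k assume mk: "m < n \<beta>" "k < n \<alpha>"
    then show "(\<Sum>r<n \<alpha>. X \<alpha> j \<beta> l $$ (m, r) *\<^sub>C u \<alpha> $$ (r, k)) = (\<Sum>r<n \<beta>. X \<alpha> j \<beta> l $$ (r, k) *\<^sub>C u \<beta> $$ (m, r))"
      using key[OF that(1,2) mk(2) that(3) mk(1) that(4)] by (simp add: X_def)
  qed (simp add: X_def)
  have E0: "E (\<alpha>, i, j) (\<beta>, m, l) = 0"
    if "\<alpha> \<in> F" "i < n \<alpha>" "j < n \<alpha>" "\<beta> \<in> F" "m < n \<beta>" "l < n \<beta>" "\<alpha> \<noteq> \<beta>" for \<alpha> i j \<beta> m l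
  proof -
    have "X \<alpha> j \<beta> l $$ (m, i) = 0\<^sub>m (n \<beta>) (n \<alpha>) $$ (m, i)"
      using schur_distinct[OF X that(7)] that by simp
    then show ?thesis using that by (simp add: X_def)
  qed
  have E1: "E (\<alpha>, i, j) (\<alpha>, m, l) = 0"
    if a: "\<alpha> \<in> F" "i < n \<alpha>" "j < n \<alpha>" "m < n \<alpha>" "l < n \<alpha>" for \<alpha> i j m l
  proof -
    have "\<forall>j\<in>{..<n \<alpha>}. \<exists>e. X \<alpha> j \<alpha> l = e \<cdot>\<^sub>m 1\<^sub>m (n \<alpha>)"
      using schur_same[OF X] a by (metis lessThan_iff)
    then obtain e where e: "\<And>j. j < n \<alpha> \<Longrightarrow> X \<alpha> j \<alpha> l = e j \<cdot>\<^sub>m 1\<^sub>m (n \<alpha>)"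
      by (metis lessThan_iff)
    have Ee: "E (\<alpha>, i, j) (\<alpha>, m, l) = (if m = i then e j else 0)" if "i < n \<alpha>" "j < n \<alpha>" "m < n \<alpha>" for i j m
      using arg_cong[OF e[OF that(2)], of "\<lambda>A. A $$ (m, i)"] that by (simp add: X_def split: if_splits)
    \<comment> \<open>Each column of E is itself a relation; once E has the form given by Schur's
      lemma, only one row of \<open>u \<alpha>\<close> survives in it.\<close>
    have row: "(\<Sum>j<n \<alpha>. e j *\<^sub>C u \<alpha> $$ (m, j)) = 0" if m: "m < n \<alpha>" for m
    proof -
      have "(\<lambda>x. E x (\<alpha>, m, l)) \<in> W" using E(1) a m by (simp add: I_iff)
      then have "0 = (\<Sum>\<beta>\<in>F. \<Sum>i<n \<beta>. \<Sum>j<n \<beta>. E (\<beta>, i, j) (\<alpha>, m, l) *\<^sub>C u \<beta> $$ (i, j))"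
        unfolding W_def sumI by (simp add: b_def)
      also have "\<dots> = (\<Sum>\<beta>\<in>F. if \<beta> = \<alpha> then (\<Sum>i<n \<alpha>. \<Sum>j<n \<alpha>. E (\<alpha>, i, j) (\<alpha>, m, l) *\<^sub>C u \<alpha> $$ (i, j)) else 0)"
        by (intro sum.cong refl) (use E0 a m in auto)
      also have "\<dots> = (\<Sum>i<n \<alpha>. \<Sum>j<n \<alpha>. E (\<alpha>, i, j) (\<alpha>, m, l) *\<^sub>C u \<alpha> $$ (i, j))"
        using F a by (simp add: sum.delta)
      also have "\<dots> = (\<Sum>i<n \<alpha>. if i = m then (\<Sum>j<n \<alpha>. e j *\<^sub>C u \<alpha> $$ (m, j)) else 0)"
        by (intro sum.cong refl) (use Ee m in auto)
      finally show ?thesis using m by (simp add: sum.delta)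
    qed
    have "e k = 0" if k: "k < n \<alpha>" for k
    proof -
      have "0 = (\<Sum>m<n \<alpha>. star (u \<alpha> $$ (m, k)) * (\<Sum>j<n \<alpha>. e j *\<^sub>C u \<alpha> $$ (m, j)))"
        using row by simp
      also have "\<dots> = (\<Sum>j<n \<alpha>. \<Sum>m<n \<alpha>. e j *\<^sub>C (star (u \<alpha> $$ (m, k)) * u \<alpha> $$ (m, j)))"
        unfolding sum_distrib_left mult_scaleC_right by (rule sum.swap)
      also have "\<dots> = (\<Sum>j<n \<alpha>. if k = j then e j *\<^sub>C 1 else 0)"
        unfolding scaleC_sum_right[symmetric] using k by (intro sum.cong refl) (simp add: unitary_repD(4)[OF u_rep])
      also have "\<dots> = e k *\<^sub>C 1" using k by (simp add: sum.delta')
      finally show ?thesis by (simp add: star_alg.scale_eq_0_iff)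
    qed
    then show ?thesis using Ee a by simp
  qed
  define w where "w t = (if t \<in> I then (case t of (\<alpha>, i, j) \<Rightarrow> c \<alpha> i j) else 0)" for t
  have "(\<Sum>t\<in>I. w t *\<^sub>C b t) = 0"
  proof -
    have "(\<Sum>t\<in>I. w t *\<^sub>C b t) = (\<Sum>\<alpha>\<in>F. \<Sum>i<n \<alpha>. \<Sum>j<n \<alpha>. c \<alpha> i j *\<^sub>C u \<alpha> $$ (i, j))"
      unfolding sumI by (intro sum.cong refl) (simp add: w_def b_def I_iff)
    then show ?thesis using rel by simp
  qed
  then have w: "w \<in> W" by (simp add: W_def w_def)
  have "w (\<alpha>, i, j) = (\<Sum>y\<in>I. E (\<alpha>, i, j) y * w y)" by (rule E(2)[OF w, symmetric])
  also have "\<dots> = 0"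
  proof (rule sum.neutral, rule ballI)
    fix y assume "y \<in> I"
    then obtain \<beta> m l where y: "y = (\<beta>, m, l)" "\<beta> \<in> F" "m < n \<beta>" "l < n \<beta>" by (cases y) (auto simp: I_iff)
    have "E (\<alpha>, i, j) y = 0"
      using E0[of \<alpha> i j \<beta> m l] E1[of \<alpha> i j m l] y \<alpha> by (cases "\<alpha> = \<beta>") simp_all
    then show "E (\<alpha>, i, j) y * w y = 0" by simp
  qed
  finally show ?thesis using \<alpha> by (simp add: w_def I_iff)
qed

lemma coeff_family_independent:
  assumes T: "finite T" "\<And>\<alpha> i j. (\<alpha>, i, j) \<in> T \<Longrightarrow> i < n \<alpha> \<and> j < n \<alpha>"
    and rel: "(\<Sum>(\<alpha>, i, j)\<in>T. c (\<alpha>, i, j) *\<^sub>C u \<alpha> $$ (i, j)) = 0" and t: "t \<in> T"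
  shows "c t = 0"
proof -
  obtain \<alpha> i j where t': "t = (\<alpha>, i, j)" by (cases t)
  define c' where "c' \<alpha> i j = (if (\<alpha>, i, j) \<in> T then c (\<alpha>, i, j) else 0)" for \<alpha> i j
  define J where "J = (SIGMA \<alpha>:fst ` T. {..<n \<alpha>} \<times> {..<n \<alpha>})"
  have TJ: "T \<subseteq> J" using T(2) by (force simp: J_def)
  have "(\<Sum>\<alpha>\<in>fst ` T. \<Sum>i<n \<alpha>. \<Sum>j<n \<alpha>. c' \<alpha> i j *\<^sub>C u \<alpha> $$ (i, j)) = (\<Sum>(\<alpha>, i, j)\<in>J. c' \<alpha> i j *\<^sub>C u \<alpha> $$ (i, j))"
    unfolding J_def using T(1) by (subst sum.Sigma[symmetric]) (auto simp: sum.cartesian_product)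
  also have "\<dots> = (\<Sum>(\<alpha>, i, j)\<in>T. c (\<alpha>, i, j) *\<^sub>C u \<alpha> $$ (i, j))"
    using TJ T(1) by (intro sum.mono_neutral_cong_right) (auto simp: J_def c'_def)
  finally have "c' \<alpha> i j = 0"
    using coeff_independent[of "fst ` T" c' \<alpha> i j] T t t' rel by force
  then show ?thesis using t t' by (simp add: c'_def)
qed

text \<open>Independence is used twice: a two-term relation with coefficients 1 and -1 shows that
  distinct index triples have distinct coefficients, and longer relations show that these vectors
  are independent. Values prescribed on triples then extend linearly.\<close>

lemma linear_extension_exists:
  fixes f :: "'i \<Rightarrow> nat \<Rightarrow> nat \<Rightarrow> 'b::complex_star_algebra"
  shows "\<exists>F. clinear F \<and> (\<forall>\<alpha>. \<forall>i<n \<alpha>. \<forall>j<n \<alpha>. F (u \<alpha> $$ (i, j)) = f \<alpha> i j)"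
proof -
  define J where "J = {(\<alpha>, i, j). i < n \<alpha> \<and> j < n \<alpha>}"
  define b where "b = (\<lambda>(\<alpha>, i, j). u \<alpha> $$ (i, j))"
  have JD: "(\<alpha>, i, j) \<in> T \<Longrightarrow> i < n \<alpha> \<and> j < n \<alpha>" if "T \<subseteq> J" for T \<alpha> i j using that by (auto simp: J_def)
  have inj: "inj_on b J"
  proof (rule inj_onI, rule ccontr)
    fix s t assume st: "s \<in> J" "t \<in> J" "b s = b t" "s \<noteq> t"
    have "(\<Sum>(\<alpha>, i, j)\<in>{s, t}. (if (\<alpha>, i, j) = s then 1 else - 1) *\<^sub>C u \<alpha> $$ (i, j)) = b s - b t"
      using st(4) by (cases s; cases t) (auto simp: b_def)
    then have "(if s = s then 1 else - 1 :: complex) = 0"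
      using st coeff_family_independent[of "{s, t}" "\<lambda>x. if x = s then 1 else - 1" s] JD[of "{s, t}"] by simp
    then show False by simp
  qed
  have ind: "star_alg.independent (b ` J)"
    unfolding star_alg.dependent_explicit
  proof (clarify)
    fix U r v assume U: "finite U" "U \<subseteq> b ` J" "(\<Sum>v\<in>U. r v *\<^sub>C v) = 0" "v \<in> U" "r v \<noteq> 0"
    obtain T where T: "T \<subseteq> J" "U = b ` T" "finite T"
      using U(1,2) by (metis finite_subset_image)
    have injT: "inj_on b T" using inj T(1) inj_on_subset by blast
    obtain t where t: "t \<in> T" "v = b t" using U(4) T(2) by blast
    have "(\<Sum>(\<alpha>, i, j)\<in>T. r (b (\<alpha>, i, j)) *\<^sub>C u \<alpha> $$ (i, j)) = (\<Sum>v\<in>U. r v *\<^sub>C v)"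
      unfolding T(2) sum.reindex[OF injT] by (intro sum.cong) (auto simp: b_def)
    then have "r (b t) = 0"
      using coeff_family_independent[of T "\<lambda>t. r (b t)" t] JD[OF T(1)] T(3) t(1) U(3) by simp
    with U(5) t(2) show False by simp
  qed
  define g where "g v = (case inv_into J b v of (\<alpha>, i, j) \<Rightarrow> f \<alpha> i j)" for v
  obtain F where F: "Vector_Spaces.linear (*\<^sub>C) (*\<^sub>C) F" "\<forall>x\<in>b ` J. F x = g x"
    using star_alg_pairs.linear_independent_extend[OF ind, of g] by blast
  have "F (u \<alpha> $$ (i, j)) = f \<alpha> i j" if "i < n \<alpha>" "j < n \<alpha>" for \<alpha> i j
  proof -
    have J: "(\<alpha>, i, j) \<in> J" using that by (simp add: J_def)
    then have "F (b (\<alpha>, i, j)) = f \<alpha> i j" using F(2) inj by (simp add: g_def)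
    then show ?thesis by (simp add: b_def)
  qed
  then show ?thesis using clinear_if_linear[OF F(1)] by blast
qed

definition lext :: "('i \<Rightarrow> nat \<Rightarrow> nat \<Rightarrow> 'b::complex_star_algebra) \<Rightarrow> 'a \<Rightarrow> 'b" where
  "lext f = (SOME F. clinear F \<and> (\<forall>\<alpha>. \<forall>i<n \<alpha>. \<forall>j<n \<alpha>. F (u \<alpha> $$ (i, j)) = f \<alpha> i j))"

lemma clinear_lext: "clinear (lext f)"
  and lext_coeff: "i < n \<alpha> \<Longrightarrow> j < n \<alpha> \<Longrightarrow> lext f (u \<alpha> $$ (i, j)) = f \<alpha> i j"
  using someI_ex[OF linear_extension_exists[of f]] unfolding lext_def by auto

lemma coeff_induct [case_names coeff add scale]:
  assumes "\<And>\<alpha> i j. i < n \<alpha> \<Longrightarrow> j < n \<alpha> \<Longrightarrow> P (u \<alpha> $$ (i, j))"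
    and "\<And>x y. P x \<Longrightarrow> P y \<Longrightarrow> P (x + y)" and "\<And>c x. P x \<Longrightarrow> P (c *\<^sub>C x)"
  shows "P x"
proof -
  have P0: "P 0" using assms(3)[OF assms(1)[OF n_pos n_pos], of 0] by simp
  have "x \<in> star_alg.span coeffs" by (simp add: span_coeffs)
  then show ?thesis
  proof (induction rule: star_alg.span_induct_alt)
    case base
    show ?case by (rule P0)
  next
    case (step c x y)
    then show ?case using assms by (auto simp: coeffs_def)
  qed
qed

lemma clinear_eq_on_coeffs:
  assumes "clinear f" "clinear g" "\<And>\<alpha> i j. i < n \<alpha> \<Longrightarrow> j < n \<alpha> \<Longrightarrow> f (u \<alpha> $$ (i, j)) = g (u \<alpha> $$ (i, j))"
  shows "f x = g x"
  by (induction x rule: coeff_induct)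
    (simp_all add: assms(3) clinear_add[OF assms(1)] clinear_add[OF assms(2)] clinear_scale[OF assms(1)] clinear_scale[OF assms(2)])

end

lemma cbilinear_scale_right: "clinear f \<Longrightarrow> cbilinear (\<lambda>a b. f b *\<^sub>C a)" for f :: "'a::complex_star_algebra \<Rightarrow> complex"
  by (rule cbilinearI) (simp_all add: clinear_add clinear_scale scaleC_add_left scaleC_add_right scaleC_scaleC
    scaleC_complex_def mult.commute)

lemma clinear_times_left: "clinear f \<Longrightarrow> clinear (\<lambda>x. f x * b)"
  and clinear_times_right: "clinear f \<Longrightarrow> clinear (\<lambda>x. b * f x)"
  by (simp_all add: clinear_def distrib_left distrib_right mult_scaleC_left mult_scaleC_right)

lemma clinear_ident: "clinear (\<lambda>x. x)"
  by (simp add: clinear_def)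

lemma clinear_scale_one: "clinear f \<Longrightarrow> clinear (\<lambda>x. f x *\<^sub>C b)" for f :: "'a::complex_star_algebra \<Rightarrow> complex"
  by (simp add: clinear_def scaleC_add_left scaleC_scaleC scaleC_complex_def)

context discrete_quantum_group
begin

section \<open>The trivial representation\<close>

lemma trivial_rep: "unitary_rep comul 1 (1\<^sub>m 1)" "irreducible_rep (1\<^sub>m 1 :: 'a mat)"
proof -
  have "1 = (1 :: 'a) \<otimes>\<^sub>t (1 :: 'a)" by transfer (simp add: tensor_eq_def)
  then show "unitary_rep comul 1 (1\<^sub>m 1)"
    by (intro unitary_repI) (auto simp: comul_one)
  have "T \<in> {c \<cdot>\<^sub>m 1\<^sub>m 1 |c. True}" if "T \<in> carrier_mat 1 1" for T :: "complex mat"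
  proof -
    have "T = T $$ (0, 0) \<cdot>\<^sub>m 1\<^sub>m 1" using that by (intro eq_matI) auto
    then show ?thesis by blast
  qed
  moreover have "c \<cdot>\<^sub>m 1\<^sub>m 1 \<in> intertwiners (1\<^sub>m 1 :: 'a mat) (1\<^sub>m 1)" for c
    by (rule intertwinersI[of _ 1 1]) auto
  ultimately show "irreducible_rep (1\<^sub>m 1 :: 'a mat)"
    unfolding irreducible_rep_def by (auto simp: intertwiners_def)
qed

definition triv :: 'i where "triv = (THE \<alpha>. u \<alpha> = 1\<^sub>m 1)"

text \<open>Completeness provides a representative equivalent to the trivial one. In dimension one
  the equivalence is a nonzero scalar, which cancels from the intertwining relation, so the two are
  equal; uniqueness is pairwise inequivalence. The description in \<open>dual_counit\<close>
  therefore denotes.\<close>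

lemma u_triv: "u triv = 1\<^sub>m 1"
proof -
  obtain \<alpha> T where T: "T \<in> intertwiners (u \<alpha>) (1\<^sub>m 1)" "invertible_mat T"
    using u_complete[OF trivial_rep] unfolding equivalent_rep_def by blast
  note T' = intertwinersD[OF T(1) u_carrier one_carrier_mat]
  have n1: "n \<alpha> = 1" using T(2) T'(1) by (auto simp: invertible_mat_def)
  obtain R where R: "T * R = 1\<^sub>m 1" "R * T = 1\<^sub>m (dim_row R)"
    using T(2) T'(1) by (auto simp: invertible_mat_def inverts_mat_def)
  have dimR: "dim_row R = 1" "dim_col R = 1"
    using arg_cong[OF R(2), of dim_col] arg_cong[OF R(1), of dim_col] T'(1) n1 by simp_all
  have T0: "T $$ (0, 0) \<noteq> 0"
  proof
    assume "T $$ (0, 0) = 0"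
    moreover have "(T * R) $$ (0, 0) = (\<Sum>r<1. T $$ (0, r) * R $$ (r, 0))"
      by (rule index_mult_mat_sum) (use T'(1) n1 dimR in auto)
    ultimately show False by (simp add: R(1))
  qed
  have "T $$ (0, 0) *\<^sub>C u \<alpha> $$ (0, 0) = T $$ (0, 0) *\<^sub>C 1"
    using T'(3)[of 0 0] n1 by simp
  then have "u \<alpha> $$ (0, 0) = 1" using T0 by simp
  then have ua: "u \<alpha> = 1\<^sub>m 1" using u_carrier[of \<alpha>] n1 by (intro eq_matI) auto
  show ?thesis unfolding triv_def
  proof (rule theI[of _ \<alpha>])
    show "u \<alpha> = 1\<^sub>m 1" by (rule ua)
    fix \<beta> assume ub: "u \<beta> = 1\<^sub>m 1"
    have "1\<^sub>m 1 \<in> intertwiners (1\<^sub>m 1 :: 'a mat) (1\<^sub>m 1)"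
      by (rule intertwinersI[of _ 1 1]) auto
    moreover have "invertible_mat (1\<^sub>m 1 :: complex mat)"
      unfolding invertible_mat_def inverts_mat_def by (auto intro!: exI[of _ "1\<^sub>m 1"])
    ultimately have "equivalent_rep (u \<beta>) (u \<alpha>)" unfolding ua ub equivalent_rep_def by blast
    then show "\<beta> = \<alpha>" by (rule u_distinct)
  qed
qed

lemma n_triv [simp]: "n triv = 1"
  using carrier_matD(1)[OF u_carrier[of triv]] by (simp add: u_triv)

lemma antipode_sum: "antipode (sum f A) = (\<Sum>x\<in>A. antipode (f x))"
  and antipode_scale: "antipode (c *\<^sub>C x) = c *\<^sub>C antipode x"
  by (rule clinear_sum[OF antipode_linear], rule clinear_scale[OF antipode_linear])

subsection \<open>The Haar functional\<close>

text \<open>The pairing of a family with the function algebra. It identifies arbitrary families of matrices with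
  arbitrary linear functionals, the coefficients being a basis.\<close>

definition ev :: "('i \<Rightarrow> complex mat) \<Rightarrow> 'a \<Rightarrow> complex" where
  "ev x = lext (\<lambda>\<alpha> i j. x \<alpha> $$ (i, j))"

lemma clinear_ev: "clinear (ev x)"
  unfolding ev_def by (rule clinear_lext)

lemma ev_coeff: "i < n \<alpha> \<Longrightarrow> j < n \<alpha> \<Longrightarrow> ev x (u \<alpha> $$ (i, j)) = x \<alpha> $$ (i, j)"
  unfolding ev_def by (rule lext_coeff)

lemma index_mat_unit: "r < n \<beta> \<Longrightarrow> s < n \<beta> \<Longrightarrow> mat_unit n \<alpha> i j \<beta> $$ (r, s) = (if \<beta> = \<alpha> \<and> r = i \<and> s = j then 1 else 0)"
  by (simp add: mat_unit_def)

text \<open>The Haar state: 1 on the coefficient of the trivial representation and 0 on all other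
  irreducible coefficients.\<close>

definition h :: "'a \<Rightarrow> complex" where "h = ev (mat_unit n triv 0 0)"

lemma clinear_h: "clinear h" unfolding h_def by (rule clinear_ev)

lemmas h_add = clinear_add[OF clinear_h] and h_scale = clinear_scale[OF clinear_h, unfolded scaleC_complex_def]
  and h_sum = clinear_sum[OF clinear_h] and h_zero = clinear_zero[OF clinear_h]

lemma h_coeff: "i < n \<alpha> \<Longrightarrow> j < n \<alpha> \<Longrightarrow> h (u \<alpha> $$ (i, j)) = (if \<alpha> = triv then 1 else 0)"
  unfolding h_def ev_coeff by (auto simp: index_mat_unit)

lemma h_one: "h 1 = 1"
  using h_coeff[of 0 triv 0] by (simp add: u_triv)

lemma h_left_invariant: "tlift (\<lambda>a b. h a *\<^sub>C b) (comul c) = h c *\<^sub>C 1"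
proof (rule clinear_eq_on_coeffs[where f = "\<lambda>c. tlift (\<lambda>a b. h a *\<^sub>C b) (comul c)" and g = "\<lambda>c. h c *\<^sub>C 1"])
  show "clinear (\<lambda>c. tlift (\<lambda>a b. h a *\<^sub>C b) (comul c))"
    by (rule clinear_comp[OF clinear_tlift[OF cbilinear_scale[OF clinear_h]] comul_linear])
  show "clinear (\<lambda>c. h c *\<^sub>C (1::'a))" by (rule clinear_scale_one[OF clinear_h])
  fix \<alpha> i j assume ij: "i < n \<alpha>" "j < n \<alpha>"
  then show "tlift (\<lambda>a b. h a *\<^sub>C b) (comul (u \<alpha> $$ (i, j))) = h (u \<alpha> $$ (i, j)) *\<^sub>C 1"
    unfolding tlift_corep[OF unitary_rep_corep[OF u_rep] ij cbilinear_scale[OF clinear_h]]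
    by (cases "\<alpha> = triv") (auto simp: h_coeff h_one u_triv)
qed

lemma h_right_invariant: "tlift (\<lambda>a b. h b *\<^sub>C a) (comul c) = h c *\<^sub>C 1"
proof (rule clinear_eq_on_coeffs[where f = "\<lambda>c. tlift (\<lambda>a b. h b *\<^sub>C a) (comul c)" and g = "\<lambda>c. h c *\<^sub>C 1"])
  show "clinear (\<lambda>c. tlift (\<lambda>a b. h b *\<^sub>C a) (comul c))"
    by (rule clinear_comp[OF clinear_tlift[OF cbilinear_scale_right[OF clinear_h]] comul_linear])
  show "clinear (\<lambda>c. h c *\<^sub>C (1::'a))" by (rule clinear_scale_one[OF clinear_h])
  fix \<alpha> i j assume ij: "i < n \<alpha>" "j < n \<alpha>"
  then show "tlift (\<lambda>a b. h b *\<^sub>C a) (comul (u \<alpha> $$ (i, j))) = h (u \<alpha> $$ (i, j)) *\<^sub>C 1"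
    unfolding tlift_corep[OF unitary_rep_corep[OF u_rep] ij cbilinear_scale_right[OF clinear_h]]
    by (cases "\<alpha> = triv") (auto simp: h_coeff h_one u_triv)
qed

text \<open>The point is that h kills the conjugate of a nontrivial coefficient. Left invariance for
  the conjugate corepresentation gives a relation between its entries; starring it and applying h
  makes one side vanish.\<close>

lemma h_antipode: "h (antipode c) = h c"
proof (rule clinear_eq_on_coeffs[OF clinear_comp[OF clinear_h antipode_linear] clinear_h])
  fix \<alpha> i j assume ij: "i < n \<alpha>" "j < n \<alpha>"
  show "h (antipode (u \<alpha> $$ (i, j))) = h (u \<alpha> $$ (i, j))"
  proof (cases "\<alpha> = triv")
    case True
    then show ?thesis using antipode_u[OF ij] ij by (simp add: u_triv)
  next
    case False
    have "(\<Sum>k<n \<alpha>. h (star (u \<alpha> $$ (j, k))) *\<^sub>C star (u \<alpha> $$ (k, i))) = h (star (u \<alpha> $$ (j, i))) *\<^sub>C 1"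
      using tlift_corep[OF corep_star[OF unitary_rep_corep[OF u_rep]] ij(2,1) cbilinear_scale[OF clinear_h]]
        h_left_invariant[of "star (u \<alpha> $$ (j, i))"] by simp
    from arg_cong[OF this, of "\<lambda>x. h (star x)"]
    have "h (star (u \<alpha> $$ (j, i))) = 0"
      using False ij by (simp add: star_sum star_scaleC star_star h_sum h_scale h_coeff h_one)
    then show ?thesis using ij False by (simp add: antipode_u h_coeff)
  qed
qed

subsection \<open>Orthogonality relations\<close>

abbreviation rinv :: "'i \<Rightarrow> complex mat" where "rinv \<alpha> \<equiv> minv (rho \<alpha>)"

lemma rinv_carrier: "rinv \<alpha> \<in> carrier_mat (n \<alpha>) (n \<alpha>)"
  and rho_rinv: "rho \<alpha> * rinv \<alpha> = 1\<^sub>m (n \<alpha>)" and rinv_rho: "rinv \<alpha> * rho \<alpha> = 1\<^sub>m (n \<alpha>)"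
  by (rule minv_pos_def[OF rho_carrier rho_pos_def])+

lemma rho_rinv_sum: "i < n \<alpha> \<Longrightarrow> j < n \<alpha> \<Longrightarrow> (\<Sum>k<n \<alpha>. rho \<alpha> $$ (i, k) * rinv \<alpha> $$ (k, j)) = (if i = j then 1 else 0)"
  using index_mult_mat_sum[OF rho_carrier rinv_carrier, of i \<alpha> j] by (simp add: rho_rinv)

lemma rinv_rho_sum: "i < n \<alpha> \<Longrightarrow> j < n \<alpha> \<Longrightarrow> (\<Sum>k<n \<alpha>. rinv \<alpha> $$ (i, k) * rho \<alpha> $$ (k, j)) = (if i = j then 1 else 0)"
  using index_mult_mat_sum[OF rinv_carrier rho_carrier, of i \<alpha> j] by (simp add: rinv_rho)

lemma antipode_antipode_coeff:
  assumes "i < n \<alpha>" "j < n \<alpha>"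
  shows "antipode (antipode (u \<alpha> $$ (i, j))) =
    (\<Sum>k<n \<alpha>. \<Sum>l<n \<alpha>. (rho \<alpha> $$ (i, k) * rinv \<alpha> $$ (l, j)) *\<^sub>C u \<alpha> $$ (k, l))"
proof -
  have c: "scalar_mat (rho \<alpha>) * u \<alpha> \<in> carrier_mat (n \<alpha>) (n \<alpha>)"
    using scalar_mat_carrier[OF rho_carrier, where 'a = 'a] u_carrier by (rule mult_carrier_mat)
  have "antipode (antipode (u \<alpha> $$ (i, j))) = map_mat (\<lambda>x. antipode (antipode x)) (u \<alpha>) $$ (i, j)"
    using assms u_carrier[of \<alpha>] by simp
  also have "\<dots> = (\<Sum>l<n \<alpha>. rinv \<alpha> $$ (l, j) *\<^sub>C (\<Sum>k<n \<alpha>. rho \<alpha> $$ (i, k) *\<^sub>C u \<alpha> $$ (k, l)))"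
    unfolding rho_intertwines index_mult_scalar_mat[OF rinv_carrier c assms]
    using assms by (intro sum.cong refl) (simp add: index_scalar_mat_mult[OF rho_carrier u_carrier])
  also have "\<dots> = (\<Sum>l<n \<alpha>. \<Sum>k<n \<alpha>. (rho \<alpha> $$ (i, k) * rinv \<alpha> $$ (l, j)) *\<^sub>C u \<alpha> $$ (k, l))"
    by (simp add: scaleC_sum_right scaleC_scaleC mult.commute)
  also have "\<dots> = (\<Sum>k<n \<alpha>. \<Sum>l<n \<alpha>. (rho \<alpha> $$ (i, k) * rinv \<alpha> $$ (l, j)) *\<^sub>C u \<alpha> $$ (k, l))"
    by (rule sum.swap)
  finally show ?thesis .
qed

text \<open>The antipode axioms for the conjugate corepresentation, whose entries are themselves
  antipode values. Through these sums \<rho>, which implements the square of the antipode, enters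
  the orthogonality relations.\<close>

lemma star_antipode2_sum:
  assumes ij: "i < n \<alpha>" "j < n \<alpha>"
  shows "(\<Sum>k<n \<alpha>. star (u \<alpha> $$ (i, k)) * antipode (antipode (u \<alpha> $$ (j, k)))) = (if i = j then 1 else 0)"
    "(\<Sum>k<n \<alpha>. antipode (antipode (u \<alpha> $$ (k, i))) * star (u \<alpha> $$ (k, j))) = (if i = j then 1 else 0)"
  using corep_antipode_right[OF corep_star[OF unitary_rep_corep[OF u_rep]] ij]
    corep_antipode_left[OF corep_star[OF unitary_rep_corep[OF u_rep]] ij] ij
  by (simp_all add: antipode_u counit_star_unitary_rep[OF u_rep])

lemma mult_coeff_comul:
  assumes v: "corep m v" and w: "corep l w" and "i < m" "j < m" "p < l" "q < l" and f: "cbilinear f"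
  shows "tlift f (comul (v i j * w p q)) = (\<Sum>k<m. \<Sum>r<l. f (v i k * w p r) (v k j * w r q))"
proof -
  have "comul (v i j * w p q) = (\<Sum>k<m. \<Sum>r<l. (v i k * w p r) \<otimes>\<^sub>t (v k j * w r q))"
    using assms by (simp add: comul_mult corep_def sum_product elem_tensor_mult)
  then show ?thesis by (simp add: clinear_sum[OF clinear_tlift[OF f]] tlift_elem_tensor[OF f])
qed

text \<open>Averaging over the group: left invariance expresses the Haar values X by sums of X
  against products of coefficients. Multiplying by u_mi and summing over i removes the starred
  factor by unitarity.\<close>

lemma h_star_mult_intertwiner:
  assumes k: "k < n \<alpha>" and l: "l < n \<beta>"
  shows "mat (n \<alpha>) (n \<beta>) (\<lambda>(a, b). h (star (u \<alpha> $$ (k, a)) * u \<beta> $$ (l, b))) \<in> intertwiners (u \<beta>) (u \<alpha>)"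
proof (rule intertwinersI[OF _ u_carrier u_carrier])
  let ?X = "\<lambda>a b. h (star (u \<alpha> $$ (k, a)) * u \<beta> $$ (l, b))"
  fix m j assume mj: "m < n \<alpha>" "j < n \<beta>"
  have inv: "(\<Sum>a<n \<alpha>. \<Sum>b<n \<beta>. ?X a b *\<^sub>C (star (u \<alpha> $$ (a, i)) * u \<beta> $$ (b, j))) = ?X i j *\<^sub>C 1" if "i < n \<alpha>" for i
    using mult_coeff_comul[OF corep_star[OF unitary_rep_corep[OF u_rep]] unitary_rep_corep[OF u_rep] k that l mj(2)
      cbilinear_scale[OF clinear_h]] h_left_invariant[of "star (u \<alpha> $$ (k, i)) * u \<beta> $$ (l, j)"] by simp
  have "(\<Sum>b<n \<beta>. ?X m b *\<^sub>C u \<beta> $$ (b, j)) = (\<Sum>a<n \<alpha>. \<Sum>b<n \<beta>. if m = a then ?X a b *\<^sub>C u \<beta> $$ (b, j) else 0)"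
    using mj by (subst sum.swap) (simp add: sum.delta')
  also have "\<dots> = (\<Sum>a<n \<alpha>. \<Sum>b<n \<beta>. \<Sum>i<n \<alpha>. ?X a b *\<^sub>C (u \<alpha> $$ (m, i) * star (u \<alpha> $$ (a, i)) * u \<beta> $$ (b, j)))"
    unfolding scaleC_sum_right[symmetric] sum_distrib_right[symmetric]
    using mj by (intro sum.cong refl) (simp add: unitary_repD(3)[OF u_rep])
  also have "\<dots> = (\<Sum>a<n \<alpha>. \<Sum>i<n \<alpha>. \<Sum>b<n \<beta>. ?X a b *\<^sub>C (u \<alpha> $$ (m, i) * star (u \<alpha> $$ (a, i)) * u \<beta> $$ (b, j)))"
    by (intro sum.cong refl sum.swap)
  also have "\<dots> = (\<Sum>i<n \<alpha>. \<Sum>a<n \<alpha>. \<Sum>b<n \<beta>. ?X a b *\<^sub>C (u \<alpha> $$ (m, i) * star (u \<alpha> $$ (a, i)) * u \<beta> $$ (b, j)))"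
    by (rule sum.swap)
  also have "\<dots> = (\<Sum>i<n \<alpha>. u \<alpha> $$ (m, i) * (\<Sum>a<n \<alpha>. \<Sum>b<n \<beta>. ?X a b *\<^sub>C (star (u \<alpha> $$ (a, i)) * u \<beta> $$ (b, j))))"
    by (simp add: sum_distrib_left mult_scaleC_right mult.assoc)
  also have "\<dots> = (\<Sum>i<n \<alpha>. ?X i j *\<^sub>C u \<alpha> $$ (m, i))"
    by (intro sum.cong refl) (simp add: inv mult_scaleC_right)
  finally show "(\<Sum>r<n \<beta>. mat (n \<alpha>) (n \<beta>) (\<lambda>(a, b). ?X a b) $$ (m, r) *\<^sub>C u \<beta> $$ (r, j))
      = (\<Sum>r<n \<alpha>. mat (n \<alpha>) (n \<beta>) (\<lambda>(a, b). ?X a b) $$ (r, j) *\<^sub>C u \<alpha> $$ (m, r))"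
    using mj by simp
qed simp

text \<open>The mirror image, with right invariance and a multiplication from the right. It has to
  be treated separately because h need not be a trace.\<close>

lemma h_mult_star_intertwiner:
  assumes j: "j < n \<beta>" and l: "l < n \<alpha>"
  shows "mat (n \<beta>) (n \<alpha>) (\<lambda>(a, b). h (u \<beta> $$ (a, j) * star (u \<alpha> $$ (b, l)))) \<in> intertwiners (u \<alpha>) (u \<beta>)"
proof (rule intertwinersI[OF _ u_carrier u_carrier])
  let ?X = "\<lambda>a b. h (u \<beta> $$ (a, j) * star (u \<alpha> $$ (b, l)))"
  fix i m assume im: "i < n \<beta>" "m < n \<alpha>"
  have inv: "(\<Sum>a<n \<beta>. \<Sum>b<n \<alpha>. ?X a b *\<^sub>C (u \<beta> $$ (i, a) * star (u \<alpha> $$ (k, b)))) = ?X i k *\<^sub>C 1" if "k < n \<alpha>" for k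
    using mult_coeff_comul[OF unitary_rep_corep[OF u_rep] corep_star[OF unitary_rep_corep[OF u_rep]] im(1) j that l
      cbilinear_scale_right[OF clinear_h]] h_right_invariant[of "u \<beta> $$ (i, j) * star (u \<alpha> $$ (k, l))"] by simp
  have "(\<Sum>a<n \<beta>. ?X a m *\<^sub>C u \<beta> $$ (i, a)) = (\<Sum>a<n \<beta>. \<Sum>b<n \<alpha>. if b = m then ?X a b *\<^sub>C u \<beta> $$ (i, a) else 0)"
    using im by (simp add: sum.delta)
  also have "\<dots> = (\<Sum>a<n \<beta>. \<Sum>b<n \<alpha>. \<Sum>k<n \<alpha>. ?X a b *\<^sub>C (u \<beta> $$ (i, a) * (star (u \<alpha> $$ (k, b)) * u \<alpha> $$ (k, m))))"
    unfolding scaleC_sum_right[symmetric] sum_distrib_left[symmetric]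
    using im by (intro sum.cong refl) (simp add: unitary_repD(4)[OF u_rep])
  also have "\<dots> = (\<Sum>a<n \<beta>. \<Sum>k<n \<alpha>. \<Sum>b<n \<alpha>. ?X a b *\<^sub>C (u \<beta> $$ (i, a) * (star (u \<alpha> $$ (k, b)) * u \<alpha> $$ (k, m))))"
    by (intro sum.cong refl sum.swap)
  also have "\<dots> = (\<Sum>k<n \<alpha>. \<Sum>a<n \<beta>. \<Sum>b<n \<alpha>. ?X a b *\<^sub>C (u \<beta> $$ (i, a) * (star (u \<alpha> $$ (k, b)) * u \<alpha> $$ (k, m))))"
    by (rule sum.swap)
  also have "\<dots> = (\<Sum>k<n \<alpha>. (\<Sum>a<n \<beta>. \<Sum>b<n \<alpha>. ?X a b *\<^sub>C (u \<beta> $$ (i, a) * star (u \<alpha> $$ (k, b)))) * u \<alpha> $$ (k, m))"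
    by (simp add: sum_distrib_right mult_scaleC_left mult.assoc)
  also have "\<dots> = (\<Sum>k<n \<alpha>. ?X i k *\<^sub>C u \<alpha> $$ (k, m))"
    by (intro sum.cong refl) (simp add: inv mult_scaleC_left)
  finally show "(\<Sum>r<n \<alpha>. mat (n \<beta>) (n \<alpha>) (\<lambda>(a, b). ?X a b) $$ (i, r) *\<^sub>C u \<alpha> $$ (r, m))
      = (\<Sum>r<n \<beta>. mat (n \<beta>) (n \<alpha>) (\<lambda>(a, b). ?X a b) $$ (r, m) *\<^sub>C u \<beta> $$ (i, r))"
    using im by simp
qed simp

lemma dimq_rinv: "(\<Sum>i<n \<alpha>. rinv \<alpha> $$ (i, i)) = dimq rho \<alpha>" "(\<Sum>i<n \<alpha>. rho \<alpha> $$ (i, i)) = dimq rho \<alpha>"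
proof -
  have "mat_trace (rinv \<alpha>) = (\<Sum>i<n \<alpha>. rinv \<alpha> $$ (i, i))" "mat_trace (rho \<alpha>) = (\<Sum>i<n \<alpha>. rho \<alpha> $$ (i, i))"
    using rinv_carrier[of \<alpha>] rho_carrier[of \<alpha>] by (simp_all add: mat_trace_def)
  then show "(\<Sum>i<n \<alpha>. rinv \<alpha> $$ (i, i)) = dimq rho \<alpha>" "(\<Sum>i<n \<alpha>. rho \<alpha> $$ (i, i)) = dimq rho \<alpha>"
    by (simp_all add: dimq_def rho_trace[of \<alpha>])
qed

text \<open>Schur's lemma leaves one constant for each pair of row indices. The sums in
  \<open>star_antipode2_sum\<close> normalize it: there the square of the antipode brings \<rho> on
  the rows and the trace of \<rho>^-1, which is dim_q, on the columns.\<close>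

lemma h_star_mult_same:
  obtains c where "\<And>i j k l. i < n \<alpha> \<Longrightarrow> j < n \<alpha> \<Longrightarrow> k < n \<alpha> \<Longrightarrow> l < n \<alpha> \<Longrightarrow>
     h (star (u \<alpha> $$ (k, i)) * u \<alpha> $$ (l, j)) = (if i = j then c k l else 0)"
    "\<And>j k. j < n \<alpha> \<Longrightarrow> k < n \<alpha> \<Longrightarrow> dimq rho \<alpha> * (\<Sum>a<n \<alpha>. rho \<alpha> $$ (j, a) * c k a) = (if j = k then 1 else 0)"
proof -
  have "\<forall>k l. \<exists>c. k < n \<alpha> \<longrightarrow> l < n \<alpha> \<longrightarrow> mat (n \<alpha>) (n \<alpha>) (\<lambda>(a, b). h (star (u \<alpha> $$ (k, a)) * u \<alpha> $$ (l, b))) = c \<cdot>\<^sub>m 1\<^sub>m (n \<alpha>)"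
    using schur_same[OF h_star_mult_intertwiner] by metis
  then obtain c where c: "\<And>k l. k < n \<alpha> \<Longrightarrow> l < n \<alpha> \<Longrightarrow>
      mat (n \<alpha>) (n \<alpha>) (\<lambda>(a, b). h (star (u \<alpha> $$ (k, a)) * u \<alpha> $$ (l, b))) = c k l \<cdot>\<^sub>m 1\<^sub>m (n \<alpha>)"
    by metis
  have 1: "h (star (u \<alpha> $$ (k, i)) * u \<alpha> $$ (l, j)) = (if i = j then c k l else 0)"
    if "i < n \<alpha>" "j < n \<alpha>" "k < n \<alpha>" "l < n \<alpha>" for i j k l
    using arg_cong[OF c[OF that(3,4)], of "\<lambda>A. A $$ (i, j)"] that(1,2) by (simp split: if_splits)
  have 2: "dimq rho \<alpha> * (\<Sum>a<n \<alpha>. rho \<alpha> $$ (j, a) * c k a) = (if j = k then 1 else 0)" if jk: "j < n \<alpha>" "k < n \<alpha>" for j k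
  proof -
    have "(if j = k then 1 else 0) = h (\<Sum>i<n \<alpha>. star (u \<alpha> $$ (k, i)) * antipode (antipode (u \<alpha> $$ (j, i))))"
      unfolding star_antipode2_sum(1)[OF jk(2,1)] by (auto simp: h_one h_zero)
    also have "\<dots> = (\<Sum>i<n \<alpha>. \<Sum>a<n \<alpha>. \<Sum>b<n \<alpha>. (rho \<alpha> $$ (j, a) * rinv \<alpha> $$ (b, i)) * h (star (u \<alpha> $$ (k, i)) * u \<alpha> $$ (a, b)))"
      unfolding h_sum using jk
      by (intro sum.cong refl) (simp add: antipode_antipode_coeff sum_distrib_left mult_scaleC_right h_sum h_scale)
    also have "\<dots> = (\<Sum>i<n \<alpha>. \<Sum>a<n \<alpha>. \<Sum>b<n \<alpha>. if i = b then rinv \<alpha> $$ (b, i) * (rho \<alpha> $$ (j, a) * c k a) else 0)"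
      using jk by (intro sum.cong refl) (simp add: 1)
    also have "\<dots> = (\<Sum>i<n \<alpha>. rinv \<alpha> $$ (i, i)) * (\<Sum>a<n \<alpha>. rho \<alpha> $$ (j, a) * c k a)"
      by (simp add: sum.delta' sum_product)
    finally show ?thesis by (simp add: dimq_rinv)
  qed
  show ?thesis using 1 2 that by blast
qed

text \<open>The normalization of the Schur constants equals 1 on the diagonal and contains dim_q as
  a factor.\<close>

lemma dimq_nonzero: "dimq rho \<alpha> \<noteq> 0"
proof (rule h_star_mult_same[of \<alpha>])
  fix c
  assume "\<And>j k. j < n \<alpha> \<Longrightarrow> k < n \<alpha> \<Longrightarrow> dimq rho \<alpha> * (\<Sum>a<n \<alpha>. rho \<alpha> $$ (j, a) * c k a) = (if j = k then 1 else 0)"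
  from this[OF n_pos n_pos] show ?thesis by auto
qed

text \<open>Inverting \<rho> in the normalization determines the Schur constants.\<close>

lemma h_star_mult:
  assumes "i < n \<alpha>" "k < n \<alpha>" "j < n \<beta>" "l < n \<beta>"
  shows "h (star (u \<alpha> $$ (k, i)) * u \<beta> $$ (l, j)) = (if \<alpha> = \<beta> \<and> i = j then rinv \<alpha> $$ (l, k) / dimq rho \<alpha> else 0)"
proof (cases "\<alpha> = \<beta>")
  case False
  have "mat (n \<alpha>) (n \<beta>) (\<lambda>(a, b). h (star (u \<alpha> $$ (k, a)) * u \<beta> $$ (l, b))) = 0\<^sub>m (n \<alpha>) (n \<beta>)"
    using schur_distinct[OF h_star_mult_intertwiner[OF assms(2,4)]] False by simp
  from arg_cong[OF this, of "\<lambda>A. A $$ (i, j)"] show ?thesis using assms False by simp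
next
  case True
  obtain c where c: "\<And>i j k l. i < n \<alpha> \<Longrightarrow> j < n \<alpha> \<Longrightarrow> k < n \<alpha> \<Longrightarrow> l < n \<alpha> \<Longrightarrow>
     h (star (u \<alpha> $$ (k, i)) * u \<alpha> $$ (l, j)) = (if i = j then c k l else 0)"
    "\<And>j k. j < n \<alpha> \<Longrightarrow> k < n \<alpha> \<Longrightarrow> dimq rho \<alpha> * (\<Sum>a<n \<alpha>. rho \<alpha> $$ (j, a) * c k a) = (if j = k then 1 else 0)"
    by (rule h_star_mult_same[of \<alpha>], rule that)
  have l: "l < n \<alpha>" using True assms by simp
  have "rinv \<alpha> $$ (l, k) = (\<Sum>j<n \<alpha>. rinv \<alpha> $$ (l, j) * (if j = k then 1 else 0))"
    using assms(2) by (rule sum_delta_right[symmetric])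
  also have "\<dots> = (\<Sum>j<n \<alpha>. rinv \<alpha> $$ (l, j) * (dimq rho \<alpha> * (\<Sum>a<n \<alpha>. rho \<alpha> $$ (j, a) * c k a)))"
    using assms(2) by (intro sum.cong refl) (simp add: c(2))
  also have "\<dots> = (\<Sum>j<n \<alpha>. \<Sum>a<n \<alpha>. dimq rho \<alpha> * c k a * (rinv \<alpha> $$ (l, j) * rho \<alpha> $$ (j, a)))"
    by (simp add: sum_distrib_left mult_ac)
  also have "\<dots> = (\<Sum>a<n \<alpha>. \<Sum>j<n \<alpha>. dimq rho \<alpha> * c k a * (rinv \<alpha> $$ (l, j) * rho \<alpha> $$ (j, a)))"
    by (rule sum.swap)
  also have "\<dots> = (\<Sum>a<n \<alpha>. if l = a then dimq rho \<alpha> * c k a else 0)"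
    unfolding sum_distrib_left[symmetric] using l by (intro sum.cong refl) (simp add: rinv_rho_sum)
  also have "\<dots> = dimq rho \<alpha> * c k l" using l by (simp add: sum.delta')
  finally have "c k l = rinv \<alpha> $$ (l, k) / dimq rho \<alpha>" using dimq_nonzero by (simp add: field_simps)
  then show ?thesis using c(1)[OF assms(1) _ assms(2) l] assms(3) unfolding True[symmetric] by simp
qed

text \<open>In the normalizing sum the square of the antipode now stands on the first factor, so the
  trace that appears is that of \<rho>. The result has \<rho> on the column indices, where the other
  order of factors has \<rho>^-1 on the rows.\<close>

lemma h_mult_star:
  assumes "i < n \<beta>" "j < n \<beta>" "k < n \<alpha>" "l < n \<alpha>"
  shows "h (u \<beta> $$ (i, j) * star (u \<alpha> $$ (k, l))) = (if \<alpha> = \<beta> \<and> i = k then rho \<alpha> $$ (l, j) / dimq rho \<alpha> else 0)"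
proof (cases "\<alpha> = \<beta>")
  case False
  have "mat (n \<beta>) (n \<alpha>) (\<lambda>(a, b). h (u \<beta> $$ (a, j) * star (u \<alpha> $$ (b, l)))) = 0\<^sub>m (n \<beta>) (n \<alpha>)"
    using schur_distinct[OF h_mult_star_intertwiner[OF assms(2,4)]] False by simp
  from arg_cong[OF this, of "\<lambda>A. A $$ (i, k)"] show ?thesis using assms False by simp
next
  case True
  have "\<forall>j l. \<exists>c. j < n \<alpha> \<longrightarrow> l < n \<alpha> \<longrightarrow> mat (n \<alpha>) (n \<alpha>) (\<lambda>(a, b). h (u \<alpha> $$ (a, j) * star (u \<alpha> $$ (b, l)))) = c \<cdot>\<^sub>m 1\<^sub>m (n \<alpha>)"
    using schur_same[OF h_mult_star_intertwiner] by metis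
  then obtain c where c0: "\<And>j l. j < n \<alpha> \<Longrightarrow> l < n \<alpha> \<Longrightarrow>
      mat (n \<alpha>) (n \<alpha>) (\<lambda>(a, b). h (u \<alpha> $$ (a, j) * star (u \<alpha> $$ (b, l)))) = c j l \<cdot>\<^sub>m 1\<^sub>m (n \<alpha>)"
    by metis
  have c: "h (u \<alpha> $$ (i, j) * star (u \<alpha> $$ (k, l))) = (if i = k then c j l else 0)"
    if "i < n \<alpha>" "j < n \<alpha>" "k < n \<alpha>" "l < n \<alpha>" for i j k l
    using arg_cong[OF c0[OF that(2,4)], of "\<lambda>A. A $$ (i, k)"] that(1,3) by (simp split: if_splits)
  have 2: "dimq rho \<alpha> * (\<Sum>b<n \<alpha>. rinv \<alpha> $$ (b, i) * c b j) = (if i = j then 1 else 0)" if ij: "i < n \<alpha>" "j < n \<alpha>" for i j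
  proof -
    have "(if i = j then 1 else 0) = h (\<Sum>k<n \<alpha>. antipode (antipode (u \<alpha> $$ (k, i))) * star (u \<alpha> $$ (k, j)))"
      unfolding star_antipode2_sum(2)[OF ij] by (auto simp: h_one h_zero)
    also have "\<dots> = (\<Sum>k<n \<alpha>. \<Sum>a<n \<alpha>. \<Sum>b<n \<alpha>. (rho \<alpha> $$ (k, a) * rinv \<alpha> $$ (b, i)) * h (u \<alpha> $$ (a, b) * star (u \<alpha> $$ (k, j))))"
      unfolding h_sum using ij
      by (intro sum.cong refl) (simp add: antipode_antipode_coeff sum_distrib_right mult_scaleC_left h_sum h_scale)
    also have "\<dots> = (\<Sum>k<n \<alpha>. \<Sum>a<n \<alpha>. if a = k then rho \<alpha> $$ (k, k) * (\<Sum>b<n \<alpha>. rinv \<alpha> $$ (b, i) * c b j) else 0)"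
      using ij by (intro sum.cong refl) (simp add: c sum_distrib_left mult.assoc)
    also have "\<dots> = (\<Sum>k<n \<alpha>. rho \<alpha> $$ (k, k)) * (\<Sum>b<n \<alpha>. rinv \<alpha> $$ (b, i) * c b j)"
      by (simp add: sum.delta sum_distrib_right)
    finally show ?thesis by (simp add: dimq_rinv)
  qed
  have j: "j < n \<alpha>" using True assms by simp
  have "rho \<alpha> $$ (l, j) = (\<Sum>i<n \<alpha>. rho \<alpha> $$ (i, j) * (if i = l then 1 else 0))"
    using assms(4) by (rule sum_delta_right[symmetric])
  also have "\<dots> = (\<Sum>i<n \<alpha>. rho \<alpha> $$ (i, j) * (dimq rho \<alpha> * (\<Sum>b<n \<alpha>. rinv \<alpha> $$ (b, i) * c b l)))"
    using assms(4) by (intro sum.cong refl) (simp add: 2)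
  also have "\<dots> = (\<Sum>i<n \<alpha>. \<Sum>b<n \<alpha>. dimq rho \<alpha> * c b l * (rinv \<alpha> $$ (b, i) * rho \<alpha> $$ (i, j)))"
    by (simp add: sum_distrib_left mult_ac)
  also have "\<dots> = (\<Sum>b<n \<alpha>. \<Sum>i<n \<alpha>. dimq rho \<alpha> * c b l * (rinv \<alpha> $$ (b, i) * rho \<alpha> $$ (i, j)))"
    by (rule sum.swap)
  also have "\<dots> = (\<Sum>b<n \<alpha>. if b = j then dimq rho \<alpha> * c b l else 0)"
    unfolding sum_distrib_left[symmetric] using j by (intro sum.cong refl) (simp add: rinv_rho_sum)
  also have "\<dots> = dimq rho \<alpha> * c j l" using j by (simp add: sum.delta)
  finally have "c j l = rho \<alpha> $$ (l, j) / dimq rho \<alpha>" using dimq_nonzero by (simp add: field_simps)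
  then show ?thesis using c[OF _ j assms(3,4)] assms(1) unfolding True[symmetric] by simp
qed

end

section \<open>Traces, the antipode of products, and families as functionals\<close>

lemma mat_trace_mult:
  "A \<in> carrier_mat m k \<Longrightarrow> B \<in> carrier_mat k m \<Longrightarrow>
   mat_trace (A * B) = (\<Sum>i<m. \<Sum>j<k. A $$ (i, j) * B $$ (j, i))"
  by (simp add: mat_trace_def index_mult_mat_sum[of _ m k _ m] del: index_mult_mat(1))

lemma mat_trace_cyclic:
  "A \<in> carrier_mat m k \<Longrightarrow> B \<in> carrier_mat k m \<Longrightarrow> mat_trace (A * B) = mat_trace (B * A :: 'b::comm_semiring_0 mat)"
  by (simp add: mat_trace_mult[of _ m k] mat_trace_mult[of _ k m] mult.commute) (rule sum.swap)

lemma index_mult3_mat_sum: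
  assumes "A \<in> carrier_mat m m" "B \<in> carrier_mat m m" "C \<in> carrier_mat m m" "i < m" "j < m"
  shows "(A * B * C) $$ (i, j) = (\<Sum>k<m. \<Sum>l<m. A $$ (i, k) * B $$ (k, l) * (C $$ (l, j) :: 'b::comm_semiring_0))"
proof -
  have "(A * B * C) $$ (i, j) = (\<Sum>l<m. \<Sum>k<m. A $$ (i, k) * B $$ (k, l) * C $$ (l, j))"
    unfolding index_mult_mat_sum[OF mult_carrier_mat[OF assms(1,2)] assms(3-5)]
    by (intro sum.cong refl) (simp add: index_mult_mat_sum[OF assms(1,2,4)] sum_distrib_right del: index_mult_mat(1))
  then show ?thesis by (subst sum.swap) simp
qed

lemma infsum_eq_sum:
  fixes f :: "'b \<Rightarrow> complex"
  assumes "finite F" "\<And>x. x \<notin> F \<Longrightarrow> f x = 0"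
  shows "infsum f UNIV = sum f F"
proof -
  have "infsum f UNIV = infsum f F" by (rule infsum_cong_neutral) (use assms(2) in auto)
  then show ?thesis using assms(1) by simp
qed

context discrete_quantum_group
begin

text \<open>Uniqueness of inverses for the tensor product of two representations: the antipode of
  its entries is a left inverse by the antipode axiom, and the product of the adjoints in reversed
  order is a right inverse.\<close>

lemma antipode_mult_coeff:
  assumes it: "i < n \<alpha>" "t < n \<alpha>" and ks: "k < n \<beta>" "s < n \<beta>"
  shows "antipode (u \<alpha> $$ (i, t) * u \<beta> $$ (k, s)) = antipode (u \<beta> $$ (k, s)) * antipode (u \<alpha> $$ (i, t))"
proof -
  define X where "X m r = antipode (u \<alpha> $$ (i, m) * u \<beta> $$ (k, r))" for m r
  have bil: "cbilinear (\<lambda>a b. antipode a * b)"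
    by (rule cbilinearI) (simp_all add: clinear_add[OF antipode_linear] clinear_scale[OF antipode_linear]
      distrib_left distrib_right mult_scaleC_left mult_scaleC_right)
  have eq: "(\<Sum>m<n \<alpha>. \<Sum>r<n \<beta>. X m r * (u \<alpha> $$ (m, j) * u \<beta> $$ (r, l))) = (if i = j then if k = l then 1 else 0 else 0)"
    if "j < n \<alpha>" "l < n \<beta>" for j l
  proof -
    have "(\<Sum>m<n \<alpha>. \<Sum>r<n \<beta>. X m r * (u \<alpha> $$ (m, j) * u \<beta> $$ (r, l))) = counit (u \<alpha> $$ (i, j) * u \<beta> $$ (k, l)) *\<^sub>C 1"
      unfolding X_def
      by (rule trans[OF mult_coeff_comul[OF unitary_rep_corep[OF u_rep] unitary_rep_corep[OF u_rep] it(1) that(1) ks(1) that(2) bil, symmetric] antipode_left])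
    then show ?thesis using that it ks by (simp add: counit_mult counit_unitary_rep[OF u_rep])
  qed
  \<comment> \<open>The right inverse: unitarity of \<open>u \<beta>\<close> removes the inner pair
    of factors, then that of \<open>u \<alpha>\<close> the outer pair.\<close>
  have contract: "(\<Sum>j<n \<alpha>. \<Sum>l<n \<beta>. u \<alpha> $$ (m, j) * u \<beta> $$ (r, l) * (star (u \<beta> $$ (s, l)) * star (u \<alpha> $$ (t, j))))
      = (if m = t then if r = s then 1 else 0 else 0)" if "m < n \<alpha>" "r < n \<beta>" for m r
  proof -
    have "(\<Sum>j<n \<alpha>. \<Sum>l<n \<beta>. u \<alpha> $$ (m, j) * u \<beta> $$ (r, l) * (star (u \<beta> $$ (s, l)) * star (u \<alpha> $$ (t, j))))
       = (\<Sum>j<n \<alpha>. u \<alpha> $$ (m, j) * (\<Sum>l<n \<beta>. u \<beta> $$ (r, l) * star (u \<beta> $$ (s, l))) * star (u \<alpha> $$ (t, j)))"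
      by (simp add: sum_distrib_left sum_distrib_right mult.assoc)
    also have "\<dots> = (if r = s then (\<Sum>j<n \<alpha>. u \<alpha> $$ (m, j) * star (u \<alpha> $$ (t, j))) else 0)"
      using that ks by (simp add: unitary_repD(3)[OF u_rep])
    also have "\<dots> = (if m = t then if r = s then 1 else 0 else 0)"
      using that it by (simp add: unitary_repD(3)[OF u_rep])
    finally show ?thesis .
  qed
  have "antipode (u \<beta> $$ (k, s)) * antipode (u \<alpha> $$ (i, t)) = star (u \<beta> $$ (s, k)) * star (u \<alpha> $$ (t, i))"
    using assms by (simp add: antipode_u)
  also have "\<dots> = (\<Sum>j<n \<alpha>. \<Sum>l<n \<beta>. if i = j then if k = l then star (u \<beta> $$ (s, l)) * star (u \<alpha> $$ (t, j)) else 0 else 0)"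
  proof -
    have "(\<Sum>j<n \<alpha>. \<Sum>l<n \<beta>. if i = j then if k = l then star (u \<beta> $$ (s, l)) * star (u \<alpha> $$ (t, j)) else 0 else 0)
        = (\<Sum>j<n \<alpha>. if i = j then star (u \<beta> $$ (s, k)) * star (u \<alpha> $$ (t, j)) else 0)"
      using ks by (intro sum.cong refl) (simp add: sum.delta')
    then show ?thesis using it by (simp add: sum.delta')
  qed
  also have "\<dots> = (\<Sum>j<n \<alpha>. \<Sum>l<n \<beta>. (\<Sum>m<n \<alpha>. \<Sum>r<n \<beta>. X m r * (u \<alpha> $$ (m, j) * u \<beta> $$ (r, l))) * (star (u \<beta> $$ (s, l)) * star (u \<alpha> $$ (t, j))))"
    by (intro sum.cong refl) (simp add: eq)
  also have "\<dots> = (\<Sum>j<n \<alpha>. \<Sum>l<n \<beta>. \<Sum>m<n \<alpha>. \<Sum>r<n \<beta>. X m r * (u \<alpha> $$ (m, j) * u \<beta> $$ (r, l) * (star (u \<beta> $$ (s, l)) * star (u \<alpha> $$ (t, j)))))"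
    by (simp add: sum_distrib_right mult.assoc)
  also have "\<dots> = (\<Sum>j<n \<alpha>. \<Sum>m<n \<alpha>. \<Sum>l<n \<beta>. \<Sum>r<n \<beta>. X m r * (u \<alpha> $$ (m, j) * u \<beta> $$ (r, l) * (star (u \<beta> $$ (s, l)) * star (u \<alpha> $$ (t, j)))))"
    by (intro sum.cong refl sum.swap)
  also have "\<dots> = (\<Sum>m<n \<alpha>. \<Sum>j<n \<alpha>. \<Sum>l<n \<beta>. \<Sum>r<n \<beta>. X m r * (u \<alpha> $$ (m, j) * u \<beta> $$ (r, l) * (star (u \<beta> $$ (s, l)) * star (u \<alpha> $$ (t, j)))))"
    by (rule sum.swap)
  also have "\<dots> = (\<Sum>m<n \<alpha>. \<Sum>j<n \<alpha>. \<Sum>r<n \<beta>. \<Sum>l<n \<beta>. X m r * (u \<alpha> $$ (m, j) * u \<beta> $$ (r, l) * (star (u \<beta> $$ (s, l)) * star (u \<alpha> $$ (t, j)))))"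
    by (intro sum.cong refl sum.swap)
  also have "\<dots> = (\<Sum>m<n \<alpha>. \<Sum>r<n \<beta>. \<Sum>j<n \<alpha>. \<Sum>l<n \<beta>. X m r * (u \<alpha> $$ (m, j) * u \<beta> $$ (r, l) * (star (u \<beta> $$ (s, l)) * star (u \<alpha> $$ (t, j)))))"
    by (intro sum.cong refl sum.swap)
  also have "\<dots> = (\<Sum>m<n \<alpha>. \<Sum>r<n \<beta>. if m = t then if r = s then X m r else 0 else 0)"
    unfolding sum_distrib_left[symmetric] by (intro sum.cong refl) (simp add: contract)
  also have "\<dots> = (\<Sum>m<n \<alpha>. if m = t then X m s else 0)"
    using ks by (intro sum.cong refl) (auto simp: sum.delta)
  also have "\<dots> = X t s" using it by (simp add: sum.delta)
  finally show ?thesis by (simp add: X_def)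
qed

lemma antipode_mult: "antipode (a * b) = antipode b * antipode a"
proof (induction a rule: coeff_induct)
  case (coeff \<alpha> i j)
  then show ?case
    by (induction b rule: coeff_induct)
      (simp_all add: antipode_mult_coeff distrib_left distrib_right mult_scaleC_left mult_scaleC_right
        clinear_add[OF antipode_linear] antipode_scale)
qed (simp_all add: distrib_left distrib_right mult_scaleC_left mult_scaleC_right
    clinear_add[OF antipode_linear] antipode_scale)

text \<open>Families of the right shape without any bound; under \<open>ev\<close> these are all
  linear functionals on the function algebra.\<close>

definition fam_carrier :: "('i \<Rightarrow> complex mat) \<Rightarrow> bool" where
  "fam_carrier x \<longleftrightarrow> (\<forall>\<alpha>. x \<alpha> \<in> carrier_mat (n \<alpha>) (n \<alpha>))"

lemma fam_carrierD: "fam_carrier x \<Longrightarrow> x \<alpha> \<in> carrier_mat (n \<alpha>) (n \<alpha>)"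
  by (simp add: fam_carrier_def)

lemma fam_carrier_rho: "fam_carrier rho" "fam_carrier (\<lambda>\<alpha>. rinv \<alpha>)"
  by (simp_all add: fam_carrier_def rho_carrier rinv_carrier)

lemma fam_carrier_mult: "fam_carrier x \<Longrightarrow> fam_carrier y \<Longrightarrow> fam_carrier (\<lambda>\<alpha>. x \<alpha> * y \<alpha>)"
  by (simp add: fam_carrier_def mult_carrier_square)

lemma fam_carrier_one: "fam_carrier (\<lambda>\<alpha>. 1\<^sub>m (n \<alpha>))"
  by (simp add: fam_carrier_def)

lemma c00_fam_carrier: "x \<in> c00 n \<Longrightarrow> fam_carrier x"
  and linf_fam_carrier: "x \<in> linf n \<Longrightarrow> fam_carrier x"
  by (auto simp: c00_def linf_def fam_carrier_def)

lemma fam_eqI: "fam_carrier x \<Longrightarrow> fam_carrier y \<Longrightarrow>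
   (\<And>\<alpha> i j. i < n \<alpha> \<Longrightarrow> j < n \<alpha> \<Longrightarrow> x \<alpha> $$ (i, j) = y \<alpha> $$ (i, j)) \<Longrightarrow> x = y"
  by (intro ext eq_matI) (simp_all add: carrier_matD[OF fam_carrierD])

lemma c00_iff: "x \<in> c00 n \<longleftrightarrow> fam_carrier x \<and> (\<exists>F. finite F \<and> (\<forall>\<alpha>. \<alpha> \<notin> F \<longrightarrow> x \<alpha> = 0\<^sub>m (n \<alpha>) (n \<alpha>)))"
proof
  assume "x \<in> c00 n"
  then show "fam_carrier x \<and> (\<exists>F. finite F \<and> (\<forall>\<alpha>. \<alpha> \<notin> F \<longrightarrow> x \<alpha> = 0\<^sub>m (n \<alpha>) (n \<alpha>)))"
    unfolding c00_def fam_carrier_def by (intro conjI exI[of _ "{\<alpha>. x \<alpha> \<noteq> 0\<^sub>m (n \<alpha>) (n \<alpha>)}"]) auto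
next
  assume "fam_carrier x \<and> (\<exists>F. finite F \<and> (\<forall>\<alpha>. \<alpha> \<notin> F \<longrightarrow> x \<alpha> = 0\<^sub>m (n \<alpha>) (n \<alpha>)))"
  then obtain F where F: "fam_carrier x" "finite F" "\<And>\<alpha>. \<alpha> \<notin> F \<Longrightarrow> x \<alpha> = 0\<^sub>m (n \<alpha>) (n \<alpha>)" by blast
  have "{\<alpha>. x \<alpha> \<noteq> 0\<^sub>m (n \<alpha>) (n \<alpha>)} \<subseteq> F" using F(3) by blast
  then show "x \<in> c00 n" using F(1,2) finite_subset by (auto simp: c00_def fam_carrier_def)
qed

text \<open>An element of the function algebra is a finite combination of coefficients, so it sees
  only finitely many blocks. This is what makes infinite sums over blocks finite later on.\<close>

lemma ev_support: "\<exists>F. finite F \<and> (\<forall>x y. (\<forall>\<alpha>\<in>F. x \<alpha> = y \<alpha>) \<longrightarrow> ev x c = ev y c)"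
proof (induction c rule: coeff_induct)
  case (coeff \<alpha> i j)
  then show ?case by (intro exI[of _ "{\<alpha>}"]) (simp add: ev_coeff)
next
  case (add a b)
  then obtain F G where "finite F" "\<forall>x y. (\<forall>\<alpha>\<in>F. x \<alpha> = y \<alpha>) \<longrightarrow> ev x a = ev y a"
    and G: "finite G" "\<forall>x y. (\<forall>\<alpha>\<in>G. x \<alpha> = y \<alpha>) \<longrightarrow> ev x b = ev y b" by blast
  then have "(\<forall>\<alpha>\<in>F \<union> G. x \<alpha> = y \<alpha>) \<longrightarrow> ev x (a + b) = ev y (a + b)" for x y
    unfolding clinear_add[OF clinear_ev] by (metis UnCI)
  with \<open>finite F\<close> G(1) show ?case by (intro exI[of _ "F \<union> G"]) simp
next
  case (scale k a)
  then obtain F where "finite F" "\<forall>x y. (\<forall>\<alpha>\<in>F. x \<alpha> = y \<alpha>) \<longrightarrow> ev x a = ev y a" by blast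
  then show ?case by (intro exI[of _ F]) (auto simp: clinear_scale[OF clinear_ev])
qed

definition truncate :: "'i set \<Rightarrow> ('i \<Rightarrow> complex mat) \<Rightarrow> 'i \<Rightarrow> complex mat" where
  "truncate F x \<alpha> = (if \<alpha> \<in> F then x \<alpha> else 0\<^sub>m (n \<alpha>) (n \<alpha>))"

lemma truncate_c00: "finite F \<Longrightarrow> fam_carrier x \<Longrightarrow> truncate F x \<in> c00 n"
  unfolding c00_iff by (intro conjI exI[of _ F]) (auto simp: truncate_def fam_carrier_def)

lemma clinear_eq_ev: "clinear f \<Longrightarrow> f c = ev (\<lambda>\<alpha>. mat (n \<alpha>) (n \<alpha>) (\<lambda>(i, j). f (u \<alpha> $$ (i, j)))) c"
  by (erule clinear_eq_on_coeffs[where f = f and x = c, OF _ clinear_ev]) (simp add: ev_coeff)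

text \<open>Every functional is \<open>ev\<close> of some family, and truncating that family to the
  blocks seen by a and b does not change its values there.\<close>

lemma ev_eqI:
  assumes "\<And>x. x \<in> c00 n \<Longrightarrow> ev x a = ev x b"
  shows "a = b"
proof (rule clinear_eqI)
  fix f :: "'a \<Rightarrow> complex" assume f: "clinear f"
  define x where "x \<alpha> = mat (n \<alpha>) (n \<alpha>) (\<lambda>(i, j). f (u \<alpha> $$ (i, j)))" for \<alpha>
  have fx: "f c = ev x c" for c unfolding x_def[abs_def] by (rule clinear_eq_ev[OF f])
  obtain F where F: "finite F" "\<forall>x y. (\<forall>\<alpha>\<in>F. x \<alpha> = y \<alpha>) \<longrightarrow> ev x a = ev y a" using ev_support[of a] by blast
  obtain G where G: "finite G" "\<forall>x y. (\<forall>\<alpha>\<in>G. x \<alpha> = y \<alpha>) \<longrightarrow> ev x b = ev y b" using ev_support[of b] by blast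
  let ?y = "truncate (F \<union> G) x"
  have "?y \<in> c00 n" by (rule truncate_c00) (simp_all add: F(1) G(1) fam_carrier_def x_def)
  moreover have "ev x a = ev ?y a" by (rule F(2)[rule_format]) (simp add: truncate_def)
  moreover have "ev x b = ev ?y b" by (rule G(2)[rule_format]) (simp add: truncate_def)
  ultimately show "f a = f b" using assms by (simp add: fx)
qed

subsection \<open>Conjugation maps and the inverse of the antipode\<close>

text \<open>Blockwise this is u -> A u B. Under \<open>ev\<close> it is the transpose of the map x
  -> A x B on families.\<close>

definition cmap :: "('i \<Rightarrow> complex mat) \<Rightarrow> ('i \<Rightarrow> complex mat) \<Rightarrow> 'a \<Rightarrow> 'a" where
  "cmap A B = lext (\<lambda>\<alpha> i j. \<Sum>k<n \<alpha>. \<Sum>l<n \<alpha>. (A \<alpha> $$ (i, k) * B \<alpha> $$ (l, j)) *\<^sub>C u \<alpha> $$ (k, l))"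

lemma clinear_cmap: "clinear (cmap A B)"
  unfolding cmap_def by (rule clinear_lext)

lemma cmap_coeff: "i < n \<alpha> \<Longrightarrow> j < n \<alpha> \<Longrightarrow>
  cmap A B (u \<alpha> $$ (i, j)) = (\<Sum>k<n \<alpha>. \<Sum>l<n \<alpha>. (A \<alpha> $$ (i, k) * B \<alpha> $$ (l, j)) *\<^sub>C u \<alpha> $$ (k, l))"
  unfolding cmap_def by (rule lext_coeff)

lemma ev_cmap:
  assumes "fam_carrier A" "fam_carrier B" "fam_carrier x"
  shows "ev x (cmap A B c) = ev (\<lambda>\<alpha>. A \<alpha> * x \<alpha> * B \<alpha>) c"
proof (rule clinear_eq_on_coeffs[where f = "\<lambda>c. ev x (cmap A B c)" and g = "ev (\<lambda>\<alpha>. A \<alpha> * x \<alpha> * B \<alpha>)"])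
  show "clinear (\<lambda>c. ev x (cmap A B c))" by (rule clinear_comp[OF clinear_ev clinear_cmap])
  show "clinear (ev (\<lambda>\<alpha>. A \<alpha> * x \<alpha> * B \<alpha>))" by (rule clinear_ev)
  fix \<alpha> i j assume ij: "i < n \<alpha>" "j < n \<alpha>"
  show "ev x (cmap A B (u \<alpha> $$ (i, j))) = ev (\<lambda>\<alpha>. A \<alpha> * x \<alpha> * B \<alpha>) (u \<alpha> $$ (i, j))"
    unfolding ev_coeff[OF ij] index_mult3_mat_sum[OF fam_carrierD[OF assms(1)] fam_carrierD[OF assms(3)] fam_carrierD[OF assms(2)] ij]
      cmap_coeff[OF ij] clinear_sum[OF clinear_ev] clinear_scale[OF clinear_ev] scaleC_complex_def
    by (intro sum.cong refl) (simp add: ev_coeff)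
qed

lemma cmap_cmap:
  assumes "fam_carrier A" "fam_carrier B" "fam_carrier C" "fam_carrier D"
  shows "cmap C D (cmap A B c) = cmap (\<lambda>\<alpha>. A \<alpha> * C \<alpha>) (\<lambda>\<alpha>. D \<alpha> * B \<alpha>) c"
proof (rule ev_eqI)
  fix x assume "x \<in> c00 n"
  then have x: "fam_carrier x" by (rule c00_fam_carrier)
  have "A \<alpha> * (C \<alpha> * x \<alpha> * D \<alpha>) * B \<alpha> = A \<alpha> * C \<alpha> * x \<alpha> * (D \<alpha> * B \<alpha>)" for \<alpha>
    using assms[THEN fam_carrierD, of \<alpha>] fam_carrierD[OF x, of \<alpha>]
    by (simp add: assoc_mult_square[of _ "n \<alpha>"] mult_carrier_square)
  then show "ev x (cmap C D (cmap A B c)) = ev x (cmap (\<lambda>\<alpha>. A \<alpha> * C \<alpha>) (\<lambda>\<alpha>. D \<alpha> * B \<alpha>) c)"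
    using assms x by (simp add: ev_cmap fam_carrier_mult)
qed

lemma cmap_one: "cmap (\<lambda>\<alpha>. 1\<^sub>m (n \<alpha>)) (\<lambda>\<alpha>. 1\<^sub>m (n \<alpha>)) c = c"
proof (rule ev_eqI)
  fix x assume "x \<in> c00 n"
  then have x: "fam_carrier x" by (rule c00_fam_carrier)
  show "ev x (cmap (\<lambda>\<alpha>. 1\<^sub>m (n \<alpha>)) (\<lambda>\<alpha>. 1\<^sub>m (n \<alpha>)) c) = ev x c"
    unfolding ev_cmap[OF fam_carrier_one fam_carrier_one x] left_mult_one_mat[OF fam_carrierD[OF x]]
      right_mult_one_mat[OF fam_carrierD[OF x]] ..
qed

lemma antipode_antipode: "antipode (antipode c) = cmap rho (\<lambda>\<alpha>. rinv \<alpha>) c"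
  by (rule clinear_eq_on_coeffs[OF clinear_comp[OF antipode_linear antipode_linear] clinear_cmap])
    (simp add: antipode_antipode_coeff cmap_coeff)

text \<open>The square of the antipode is conjugation by \<rho>, so composing the antipode with
  conjugation by \<rho>^-1 inverts it.\<close>

definition antipode_inv :: "'a \<Rightarrow> 'a" where
  "antipode_inv c = antipode (cmap (\<lambda>\<alpha>. rinv \<alpha>) rho c)"

lemma clinear_antipode_inv: "clinear antipode_inv"
  unfolding antipode_inv_def[abs_def] by (rule clinear_comp[OF antipode_linear clinear_cmap])

lemma cmap_inverse: "cmap rho (\<lambda>\<alpha>. rinv \<alpha>) (cmap (\<lambda>\<alpha>. rinv \<alpha>) rho c) = c"
  "cmap (\<lambda>\<alpha>. rinv \<alpha>) rho (cmap rho (\<lambda>\<alpha>. rinv \<alpha>) c) = c"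
  by (simp_all add: cmap_cmap fam_carrier_rho rho_rinv rinv_rho cmap_one)

lemma antipode_antipode_inv [simp]: "antipode (antipode_inv c) = c"
  by (simp add: antipode_inv_def antipode_antipode cmap_inverse)

text \<open>That the antipode commutes with conjugation by \<rho> is not yet available. Instead c is
  written as the square of the antipode at its preimage, and the resulting third power is read as
  the square applied to a single antipode.\<close>

lemma antipode_inv_antipode [simp]: "antipode_inv (antipode c) = c"
proof -
  let ?G = "cmap (\<lambda>\<alpha>. rinv \<alpha>) rho"
  have "antipode (antipode (?G c)) = c" by (simp only: antipode_antipode cmap_inverse)
  then have "antipode (?G (antipode c)) = antipode (?G (antipode (antipode (antipode (?G c)))))"
    by (simp only:)
  also have "\<dots> = antipode (?G (cmap rho (\<lambda>\<alpha>. rinv \<alpha>) (antipode (?G c))))"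
    unfolding antipode_antipode[of "antipode (?G c)"] ..
  also have "\<dots> = antipode (antipode (?G c))"
    by (simp only: cmap_inverse)
  also have "\<dots> = c" by (simp add: antipode_antipode cmap_inverse)
  finally show ?thesis by (simp add: antipode_inv_def)
qed

lemma antipode_inv_mult: "antipode_inv (a * b) = antipode_inv b * antipode_inv a"
  using antipode_inv_antipode[of "antipode_inv b * antipode_inv a"] by (simp add: antipode_mult)

lemma h_antipode_inv: "h (antipode_inv c) = h c"
  using h_antipode[of "antipode_inv c"] by simp

text \<open>The modular property of the Haar state, checked on coefficients by comparing the two
  orthogonality relations: one carries \<rho>^-1 on the rows, the other \<rho> on the columns, and
  \<rho>^-1 on both sides converts between them. One factor is first taken as an antipode value, so
  that stars appear.\<close>

lemma h_mult_commute: "h (c * b) = h (cmap (\<lambda>\<alpha>. rinv \<alpha>) (\<lambda>\<alpha>. rinv \<alpha>) b * c)"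
proof -
  let ?M = "cmap (\<lambda>\<alpha>. rinv \<alpha>) (\<lambda>\<alpha>. rinv \<alpha>)"
  have "h (antipode c * b) = h (?M b * antipode c)" for c
  proof (induction b rule: coeff_induct)
    case (coeff \<beta> r s)
    then show ?case
    proof (induction c rule: coeff_induct)
      case (coeff \<alpha> i j)
      have "h (?M (u \<beta> $$ (r, s)) * antipode (u \<alpha> $$ (i, j)))
         = (\<Sum>k<n \<beta>. \<Sum>l<n \<beta>. rinv \<beta> $$ (r, k) * rinv \<beta> $$ (l, s) * h (u \<beta> $$ (k, l) * star (u \<alpha> $$ (j, i))))"
        using coeff by (simp add: cmap_coeff antipode_u sum_distrib_right mult_scaleC_left h_sum h_scale)
      also have "\<dots> = (if \<alpha> = \<beta> then (\<Sum>k<n \<beta>. \<Sum>l<n \<beta>. if k = j then rinv \<beta> $$ (r, j) * (rho \<beta> $$ (i, l) * rinv \<beta> $$ (l, s)) / dimq rho \<beta> else 0) else 0)"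
        using coeff by (auto simp: h_mult_star intro!: sum.cong)
      also have "\<dots> = (if \<alpha> = \<beta> then rinv \<beta> $$ (r, j) * (\<Sum>l<n \<beta>. rho \<beta> $$ (i, l) * rinv \<beta> $$ (l, s)) / dimq rho \<beta> else 0)"
      proof (cases "\<alpha> = \<beta>")
        case True
        with coeff have "j < n \<beta>" by simp
        then show ?thesis by (subst sum.swap) (simp add: sum.delta sum_distrib_left sum_divide_distrib True)
      qed simp
      also have "\<dots> = h (antipode (u \<alpha> $$ (i, j)) * u \<beta> $$ (r, s))"
        using coeff by (auto simp: antipode_u h_star_mult rho_rinv_sum)
      finally show ?case by simp
    qed (simp_all add: distrib_left distrib_right mult_scaleC_left mult_scaleC_right
      clinear_add[OF antipode_linear] antipode_scale h_add h_scale)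
  qed (simp_all add: distrib_left distrib_right mult_scaleC_left mult_scaleC_right
      clinear_add[OF clinear_cmap] clinear_scale[OF clinear_cmap] h_add h_scale)
  from this[of "antipode_inv c"] show ?thesis by simp
qed

subsection \<open>The Fourier transform\<close>

text \<open>The trace of Y u^\<alpha>; its pairing with a family x is the trace of Y times the block
  of x.\<close>

definition block :: "complex mat \<Rightarrow> 'i \<Rightarrow> 'a" where
  "block Y \<alpha> = (\<Sum>i<n \<alpha>. \<Sum>j<n \<alpha>. Y $$ (j, i) *\<^sub>C u \<alpha> $$ (i, j))"

lemma ev_block:
  assumes "Y \<in> carrier_mat (n \<alpha>) (n \<alpha>)" "x \<alpha> \<in> carrier_mat (n \<alpha>) (n \<alpha>)"
  shows "ev x (block Y \<alpha>) = mat_trace (Y * x \<alpha>)"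
proof -
  have "ev x (block Y \<alpha>) = (\<Sum>i<n \<alpha>. \<Sum>j<n \<alpha>. Y $$ (j, i) * x \<alpha> $$ (i, j))"
    by (simp add: block_def clinear_sum[OF clinear_ev] clinear_scale[OF clinear_ev] scaleC_complex_def ev_coeff)
  also have "\<dots> = (\<Sum>j<n \<alpha>. \<Sum>i<n \<alpha>. Y $$ (j, i) * x \<alpha> $$ (i, j))"
    by (rule sum.swap)
  finally show ?thesis by (simp add: mat_trace_mult[OF assms])
qed

text \<open>The Fourier transform. The block x \<rho> and the factor dim_q are read off from the
  weight of y x, because the trace of \<rho> y x equals that of x \<rho> y.\<close>

definition hat :: "('i \<Rightarrow> complex mat) \<Rightarrow> 'a" where
  "hat x = (\<Sum>\<alpha> | x \<alpha> \<noteq> 0\<^sub>m (n \<alpha>) (n \<alpha>). dimq rho \<alpha> *\<^sub>C block (x \<alpha> * rho \<alpha>) \<alpha>)"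

lemma ev_hat:
  assumes x: "x \<in> c00 n" and y: "fam_carrier y"
  shows "ev y (hat x) = haar rho (fam_mult y x)" 
proof -
  let ?F = "{\<alpha>. x \<alpha> \<noteq> 0\<^sub>m (n \<alpha>) (n \<alpha>)}"
  note xc = fam_carrierD[OF c00_fam_carrier[OF x]] and yc = fam_carrierD[OF y]
  have "haar rho (fam_mult y x) = (\<Sum>\<alpha>\<in>?F. mat_trace (rho \<alpha>) * mat_trace (rho \<alpha> * (y \<alpha> * x \<alpha>)))"
    unfolding haar_def fam_mult_def
  proof (rule infsum_eq_sum)
    show "finite ?F" using x by (simp add: c00_def)
    fix \<alpha> assume "\<alpha> \<notin> ?F"
    then show "mat_trace (rho \<alpha>) * mat_trace (rho \<alpha> * (y \<alpha> * x \<alpha>)) = 0"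
      using rho_carrier[of \<alpha>] yc[of \<alpha>] by (simp add: right_mult_zero_mat[of _ "n \<alpha>" "n \<alpha>"]) (simp add: mat_trace_def)
  qed
  also have "\<dots> = (\<Sum>\<alpha>\<in>?F. dimq rho \<alpha> * mat_trace (x \<alpha> * rho \<alpha> * y \<alpha>))"
  proof (intro sum.cong refl arg_cong2[of _ _ _ _ "(*)"])
    fix \<alpha>
    have "mat_trace (rho \<alpha> * (y \<alpha> * x \<alpha>)) = mat_trace (rho \<alpha> * y \<alpha> * x \<alpha>)"
      by (simp only: assoc_mult_square[OF rho_carrier yc xc])
    also have "\<dots> = mat_trace (x \<alpha> * (rho \<alpha> * y \<alpha>))"
      by (rule mat_trace_cyclic[OF mult_carrier_mat[OF rho_carrier yc] xc])
    finally show "mat_trace (rho \<alpha> * (y \<alpha> * x \<alpha>)) = mat_trace (x \<alpha> * rho \<alpha> * y \<alpha>)"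
      by (simp only: assoc_mult_square[OF xc rho_carrier yc])
  qed (simp add: dimq_def)
  also have "\<dots> = ev y (hat x)"
    unfolding hat_def clinear_sum[OF clinear_ev] clinear_scale[OF clinear_ev] scaleC_complex_def
    by (intro sum.cong refl arg_cong2[of _ _ _ _ "(*)"] ev_block[symmetric, OF mult_carrier_mat[OF xc rho_carrier] yc])
  finally show ?thesis ..
qed

lemma h_block:
  assumes "a < n \<alpha>" "b < n \<alpha>" and Y: "Y \<in> carrier_mat (n \<beta>) (n \<beta>)"
  shows "h (antipode (u \<alpha> $$ (a, b)) * block Y \<beta>) = (if \<alpha> = \<beta> then (Y * rinv \<beta>) $$ (a, b) / dimq rho \<beta> else 0)"
proof -
  have "h (antipode (u \<alpha> $$ (a, b)) * block Y \<beta>) = (\<Sum>i<n \<beta>. \<Sum>j<n \<beta>. Y $$ (j, i) * h (star (u \<alpha> $$ (b, a)) * u \<beta> $$ (i, j)))"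
    using assms by (simp add: block_def antipode_u sum_distrib_left mult_scaleC_right h_sum h_scale)
  also have "\<dots> = (\<Sum>i<n \<beta>. \<Sum>j<n \<beta>. if a = j then if \<alpha> = \<beta> then Y $$ (a, i) * rinv \<beta> $$ (i, b) / dimq rho \<beta> else 0 else 0)"
    using assms by (intro sum.cong refl) (simp add: h_star_mult)
  also have "\<dots> = (if \<alpha> = \<beta> then (\<Sum>i<n \<beta>. Y $$ (a, i) * rinv \<beta> $$ (i, b)) / dimq rho \<beta> else 0)"
  proof (cases "\<alpha> = \<beta>")
    case True
    with assms have "a < n \<beta>" by simp
    then show ?thesis by (simp add: sum.delta' sum_divide_distrib True)
  qed simp
  also have "\<dots> = (if \<alpha> = \<beta> then (Y * rinv \<beta>) $$ (a, b) / dimq rho \<beta> else 0)"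
    using assms index_mult_mat_sum[OF Y rinv_carrier, of a b] by auto
  finally show ?thesis .
qed

text \<open>An inversion formula: the orthogonality relation contributes \<rho>^-1 and 1 / dim_q,
  which cancel the factors built into \<open>hat\<close>. It turns pairings into Haar values, to
  which invariance and the modular property apply.\<close>

lemma ev_eq_h:
  assumes y: "y \<in> c00 n"
  shows "ev y c = h (antipode c * hat y)"
proof (rule clinear_eq_on_coeffs[where g = "\<lambda>c. h (antipode c * hat y)", OF clinear_ev])
  show "clinear (\<lambda>c. h (antipode c * hat y))"
    by (rule clinear_comp[OF clinear_h clinear_times_left[OF antipode_linear]])
  fix \<alpha> a b assume ab: "a < n \<alpha>" "b < n \<alpha>"
  note yc = fam_carrierD[OF c00_fam_carrier[OF y]]
  have fin: "finite {\<alpha>. y \<alpha> \<noteq> 0\<^sub>m (n \<alpha>) (n \<alpha>)}" using y by (simp add: c00_def)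
  have "h (antipode (u \<alpha> $$ (a, b)) * hat y)
      = (\<Sum>\<beta> | y \<beta> \<noteq> 0\<^sub>m (n \<beta>) (n \<beta>). dimq rho \<beta> * h (antipode (u \<alpha> $$ (a, b)) * block (y \<beta> * rho \<beta>) \<beta>))"
    by (simp add: hat_def sum_distrib_left mult_scaleC_right h_sum h_scale)
  also have "\<dots> = (\<Sum>\<beta> | y \<beta> \<noteq> 0\<^sub>m (n \<beta>) (n \<beta>). if \<alpha> = \<beta> then y \<alpha> $$ (a, b) else 0)"
  proof (intro sum.cong refl)
    fix \<beta>
    have "y \<beta> * rho \<beta> * rinv \<beta> = y \<beta>"
      using assoc_mult_square[OF yc rho_carrier rinv_carrier, of \<beta>] right_mult_one_mat[OF yc, of \<beta>] by (simp add: rho_rinv)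
    then show "dimq rho \<beta> * h (antipode (u \<alpha> $$ (a, b)) * block (y \<beta> * rho \<beta>) \<beta>) = (if \<alpha> = \<beta> then y \<alpha> $$ (a, b) else 0)"
      using h_block[OF ab mult_carrier_mat[OF yc rho_carrier]] dimq_nonzero[of \<beta>] by auto
  qed
  also have "\<dots> = y \<alpha> $$ (a, b)"
    using fin ab by (auto simp: sum.delta')
  finally show "ev y (u \<alpha> $$ (a, b)) = h (antipode (u \<alpha> $$ (a, b)) * hat y)" by (simp add: ev_coeff ab)
qed

text \<open>By orthogonality a coefficient meets only its own block. Families defined by such Haar
  values thus have finite support, so translates of families in c00 stay in c00.\<close>

lemma finite_h_left: "finite {\<beta>. \<exists>i<n \<beta>. \<exists>j<n \<beta>. h (antipode (u \<beta> $$ (i, j)) * b) \<noteq> 0}"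
proof (induction b rule: coeff_induct)
  case (coeff \<alpha> r s)
  have "{\<beta>. \<exists>i<n \<beta>. \<exists>j<n \<beta>. h (antipode (u \<beta> $$ (i, j)) * u \<alpha> $$ (r, s)) \<noteq> 0} \<subseteq> {\<alpha>}"
    using coeff by (auto simp: antipode_u h_star_mult split: if_splits)
  then show ?case by (rule finite_subset) simp
next
  case (add x y)
  show ?case by (rule finite_subset[OF _ finite_UnI[OF add]], clarsimp simp: distrib_left h_add) (metis add.right_neutral)
next
  case (scale c x)
  show ?case by (rule finite_subset[OF _ scale]) (auto simp: mult_scaleC_right h_scale)
qed

lemma finite_h_right: "finite {\<beta>. \<exists>i<n \<beta>. \<exists>j<n \<beta>. h (b * antipode (u \<beta> $$ (i, j))) \<noteq> 0}"
proof (induction b rule: coeff_induct)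
  case (coeff \<alpha> r s)
  have "{\<beta>. \<exists>i<n \<beta>. \<exists>j<n \<beta>. h (u \<alpha> $$ (r, s) * antipode (u \<beta> $$ (i, j))) \<noteq> 0} \<subseteq> {\<alpha>}"
    using coeff by (auto simp: antipode_u h_mult_star split: if_splits)
  then show ?case by (rule finite_subset) simp
next
  case (add x y)
  show ?case by (rule finite_subset[OF _ finite_UnI[OF add]], clarsimp simp: distrib_right h_add) (metis add.right_neutral)
next
  case (scale c x)
  show ?case by (rule finite_subset[OF _ scale]) (auto simp: mult_scaleC_left h_scale)
qed

end

subsection \<open>Bounded families and the comultiplication\<close>

lemma sum_lessThan_mult:
  fixes f :: "nat \<Rightarrow> nat \<Rightarrow> 'b::comm_monoid_add"
  assumes "0 < l"
  shows "(\<Sum>k<m * l. f (k div l) (k mod l)) = (\<Sum>i<m. \<Sum>j<l. f i j)"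
proof -
  have "(\<Sum>i<m. \<Sum>j<l. f i j) = (\<Sum>(i, j)\<in>{..<m} \<times> {..<l}. f i j)"
    by (simp add: sum.cartesian_product)
  also have "\<dots> = (\<Sum>k<m * l. f (k div l) (k mod l))"
  proof (rule sum.reindex_bij_witness[where i = "\<lambda>k. (k div l, k mod l)" and j = "\<lambda>(i, j). i * l + j"])
    fix k assume "k \<in> {..<m * l}"
    then show "(k div l, k mod l) \<in> {..<m} \<times> {..<l}"
      using assms by (simp add: less_mult_imp_div_less)
  next
    fix p assume "p \<in> {..<m} \<times> {..<l}"
    then obtain i j where p: "p = (i, j)" "i < m" "j < l" by auto
    have "i * l + j < (i + 1) * l" using p by simp
    also have "\<dots> \<le> m * l" using p by (intro mult_le_mono1) simp
    finally show "(case p of (i, j) \<Rightarrow> i * l + j) \<in> {..<m * l}" using p by simp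
  qed (use assms in auto)
  finally show ?thesis ..
qed

lemma pair_index_less: "i < m \<Longrightarrow> j < l \<Longrightarrow> i * l + j < m * (l::nat)"
proof -
  assume ij: "i < m" "j < l"
  have "i * l + j < (i + 1) * l" using ij by simp
  also have "\<dots> \<le> m * l" using ij by (intro mult_le_mono1) simp
  finally show ?thesis .
qed

lemma dim_kron: "dim_row (kron A B) = dim_row A * dim_row B" "dim_col (kron A B) = dim_col A * dim_col B"
  by (simp_all add: kron_def)

lemma kron_carrier: "A \<in> carrier_mat m m \<Longrightarrow> B \<in> carrier_mat k k \<Longrightarrow> kron A B \<in> carrier_mat (m * k) (m * k)"
  by (rule carrier_matI) (simp_all add: dim_kron)

lemma index_kron_div_mod:
  assumes "A \<in> carrier_mat m m" "B \<in> carrier_mat k k" "r < m * k" "s < m * k"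
  shows "kron A B $$ (r, s) = A $$ (r div k, s div k) * B $$ (r mod k, s mod k)"
  using assms by (simp add: kron_def)

lemma cscalar_prod_self:
  assumes "x \<in> carrier_mat m m" "v \<in> carrier_vec m"
  shows "Re ((x *\<^sub>v v) \<bullet>c (x *\<^sub>v v)) = (\<Sum>i<m. (cmod (\<Sum>j<m. x $$ (i, j) * v $ j))\<^sup>2)"
    "Re (v \<bullet>c v) = (\<Sum>i<m. (cmod (v $ i))\<^sup>2)"
proof -
  have "(x *\<^sub>v v) $ i = (\<Sum>j<m. x $$ (i, j) * v $ j)" if "i < m" for i
    using assms that by (auto simp: scalar_prod_def lessThan_atLeast0 intro!: sum.cong)
  moreover have "Re (w \<bullet>c w) = (\<Sum>i<m. (cmod (w $ i))\<^sup>2)" if "w \<in> carrier_vec m" for w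
    using that by (simp add: scalar_prod_def lessThan_atLeast0 complex_mult_cnj cmod_power2)
  ultimately show "Re ((x *\<^sub>v v) \<bullet>c (x *\<^sub>v v)) = (\<Sum>i<m. (cmod (\<Sum>j<m. x $$ (i, j) * v $ j))\<^sup>2)"
    "Re (v \<bullet>c v) = (\<Sum>i<m. (cmod (v $ i))\<^sup>2)"
    using assms by (simp_all del: index_mult_mat_vec)
qed

lemma linf_iff:
  "x \<in> linf n \<longleftrightarrow> (\<forall>k. x k \<in> carrier_mat (n k) (n k)) \<and>
     (\<exists>C. \<forall>k v. (\<Sum>i<n k. (cmod (\<Sum>j<n k. x k $$ (i, j) * v j))\<^sup>2) \<le> C * (\<Sum>i<n k. (cmod (v i))\<^sup>2))"
proof (cases "\<forall>k. x k \<in> carrier_mat (n k) (n k)")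
  case False
  then show ?thesis by (auto simp: linf_def)
next
  case True
  then have c: "x k \<in> carrier_mat (n k) (n k)" for k by blast
  have "(\<forall>k. \<forall>v \<in> carrier_vec (n k). Re ((x k *\<^sub>v v) \<bullet>c (x k *\<^sub>v v)) \<le> C * Re (v \<bullet>c v))
    \<longleftrightarrow> (\<forall>k v. (\<Sum>i<n k. (cmod (\<Sum>j<n k. x k $$ (i, j) * v j))\<^sup>2) \<le> C * (\<Sum>i<n k. (cmod (v i))\<^sup>2))" for C
  proof (intro iffI allI ballI)
    fix k and v :: "nat \<Rightarrow> complex"
    assume "\<forall>k. \<forall>v \<in> carrier_vec (n k). Re ((x k *\<^sub>v v) \<bullet>c (x k *\<^sub>v v)) \<le> C * Re (v \<bullet>c v)"
    then have "Re ((x k *\<^sub>v vec (n k) v) \<bullet>c (x k *\<^sub>v vec (n k) v)) \<le> C * Re (vec (n k) v \<bullet>c vec (n k) v)" by simp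
    then show "(\<Sum>i<n k. (cmod (\<Sum>j<n k. x k $$ (i, j) * v j))\<^sup>2) \<le> C * (\<Sum>i<n k. (cmod (v i))\<^sup>2)"
      by (simp add: cscalar_prod_self(1)[OF c vec_carrier] cscalar_prod_self(2)[OF c vec_carrier])
  next
    fix k and v :: "complex vec"
    assume "\<forall>k v. (\<Sum>i<n k. (cmod (\<Sum>j<n k. x k $$ (i, j) * v j))\<^sup>2) \<le> C * (\<Sum>i<n k. (cmod (v i))\<^sup>2)"
      and v: "v \<in> carrier_vec (n k)"
    then show "Re ((x k *\<^sub>v v) \<bullet>c (x k *\<^sub>v v)) \<le> C * Re (v \<bullet>c v)"
      by (simp add: cscalar_prod_self(1)[OF c v] cscalar_prod_self(2)[OF c v])
  qed
  with True show ?thesis by (simp add: linf_def)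
qed

lemma linfI:
  assumes "\<And>k. x k \<in> carrier_mat (n k) (n k)"
    "\<And>k v. (\<Sum>i<n k. (cmod (\<Sum>j<n k. x k $$ (i, j) * v j))\<^sup>2) \<le> C * (\<Sum>i<n k. (cmod (v i))\<^sup>2)"
  shows "x \<in> linf n"
  using assms by (auto simp: linf_iff)

lemma linf_bound:
  assumes "x \<in> linf n"
  obtains C where "0 \<le> C"
    "\<And>k v. (\<Sum>i<n k. (cmod (\<Sum>j<n k. x k $$ (i, j) * v j))\<^sup>2) \<le> C * (\<Sum>i<n k. (cmod (v i))\<^sup>2)"
proof -
  obtain C where C: "\<And>k v. (\<Sum>i<n k. (cmod (\<Sum>j<n k. x k $$ (i, j) * v j))\<^sup>2) \<le> C * (\<Sum>i<n k. (cmod (v i))\<^sup>2)"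
    using assms by (auto simp: linf_iff)
  have "(\<Sum>i<n k. (cmod (\<Sum>j<n k. x k $$ (i, j) * v j))\<^sup>2) \<le> max C 0 * (\<Sum>i<n k. (cmod (v i))\<^sup>2)" for k v
    by (rule order.trans[OF C mult_right_mono]) (auto intro: sum_nonneg)
  then show ?thesis by (intro that[of "max C 0"]) auto
qed

lemma linf_carrier: "x \<in> linf n \<Longrightarrow> x k \<in> carrier_mat (n k) (n k)"
  by (simp add: linf_iff)

lemma cmod_add_squared_le: "(cmod (a + b))\<^sup>2 \<le> 2 * (cmod a)\<^sup>2 + 2 * (cmod b)\<^sup>2"
proof -
  have "(cmod (a + b))\<^sup>2 \<le> (cmod a + cmod b)\<^sup>2"
    by (intro power_mono norm_triangle_ineq) simp
  also have "\<dots> \<le> 2 * (cmod a)\<^sup>2 + 2 * (cmod b)\<^sup>2"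
    using sum_squares_bound[of "cmod a" "cmod b"] by (simp add: power2_sum)
  finally show ?thesis .
qed

lemma linf_add:
  assumes "x \<in> linf n" "y \<in> linf n"
  shows "fam_add x y \<in> linf n"
proof -
  obtain C where "0 \<le> C" and C: "\<And>k v. (\<Sum>i<n k. (cmod (\<Sum>j<n k. x k $$ (i, j) * v j))\<^sup>2) \<le> C * (\<Sum>i<n k. (cmod (v i))\<^sup>2)"
    by (rule linf_bound[OF assms(1)], rule that)
  obtain D where "0 \<le> D" and D: "\<And>k v. (\<Sum>i<n k. (cmod (\<Sum>j<n k. y k $$ (i, j) * v j))\<^sup>2) \<le> D * (\<Sum>i<n k. (cmod (v i))\<^sup>2)"
    by (rule linf_bound[OF assms(2)], rule that)
  note c = linf_carrier[OF assms(1)] linf_carrier[OF assms(2)]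
  show ?thesis
  proof (rule linfI[where C = "2 * C + 2 * D"])
    show "fam_add x y k \<in> carrier_mat (n k) (n k)" for k
      using c by (simp add: fam_add_def)
    fix k and v :: "nat \<Rightarrow> complex"
    have "(\<Sum>i<n k. (cmod (\<Sum>j<n k. fam_add x y k $$ (i, j) * v j))\<^sup>2)
        = (\<Sum>i<n k. (cmod ((\<Sum>j<n k. x k $$ (i, j) * v j) + (\<Sum>j<n k. y k $$ (i, j) * v j)))\<^sup>2)"
      unfolding sum.distrib[symmetric]
      by (intro sum.cong refl arg_cong[of _ _ "\<lambda>z. (cmod z)\<^sup>2"]) (use c(1)[of k] c(2)[of k] in \<open>simp add: fam_add_def distrib_right\<close>)
    also have "\<dots> \<le> (\<Sum>i<n k. 2 * (cmod (\<Sum>j<n k. x k $$ (i, j) * v j))\<^sup>2 + 2 * (cmod (\<Sum>j<n k. y k $$ (i, j) * v j))\<^sup>2)"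
      by (intro sum_mono cmod_add_squared_le)
    also have "\<dots> = 2 * (\<Sum>i<n k. (cmod (\<Sum>j<n k. x k $$ (i, j) * v j))\<^sup>2) + 2 * (\<Sum>i<n k. (cmod (\<Sum>j<n k. y k $$ (i, j) * v j))\<^sup>2)"
      by (simp add: sum.distrib sum_distrib_left)
    also have "\<dots> \<le> (2 * C + 2 * D) * (\<Sum>i<n k. (cmod (v i))\<^sup>2)"
      using C[of k v] D[of k v] by (simp add: distrib_right)
    finally show "(\<Sum>i<n k. (cmod (\<Sum>j<n k. fam_add x y k $$ (i, j) * v j))\<^sup>2) \<le> (2 * C + 2 * D) * (\<Sum>i<n k. (cmod (v i))\<^sup>2)" .
  qed
qed

lemma linf_scale:
  assumes "x \<in> linf n"
  shows "fam_scale a x \<in> linf n"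
proof -
  obtain C where "0 \<le> C" and C: "\<And>k v. (\<Sum>i<n k. (cmod (\<Sum>j<n k. x k $$ (i, j) * v j))\<^sup>2) \<le> C * (\<Sum>i<n k. (cmod (v i))\<^sup>2)"
    by (rule linf_bound[OF assms], rule that)
  note c = linf_carrier[OF assms]
  show ?thesis
  proof (rule linfI[where C = "(cmod a)\<^sup>2 * C"])
    show "fam_scale a x k \<in> carrier_mat (n k) (n k)" for k
      using c by (simp add: fam_scale_def)
    fix k and v :: "nat \<Rightarrow> complex"
    have "(\<Sum>j<n k. fam_scale a x k $$ (i, j) * v j) = a * (\<Sum>j<n k. x k $$ (i, j) * v j)" if "i < n k" for i
      unfolding sum_distrib_left using c[of k] that by (intro sum.cong refl) (simp add: fam_scale_def mult.assoc)
    then have "(\<Sum>i<n k. (cmod (\<Sum>j<n k. fam_scale a x k $$ (i, j) * v j))\<^sup>2)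
        = (cmod a)\<^sup>2 * (\<Sum>i<n k. (cmod (\<Sum>j<n k. x k $$ (i, j) * v j))\<^sup>2)"
      by (simp add: norm_mult power_mult_distrib sum_distrib_left[symmetric])
    also have "\<dots> \<le> (cmod a)\<^sup>2 * C * (\<Sum>i<n k. (cmod (v i))\<^sup>2)"
      using C[of k v] by (simp add: mult.assoc mult_left_mono)
    finally show "(\<Sum>i<n k. (cmod (\<Sum>j<n k. fam_scale a x k $$ (i, j) * v j))\<^sup>2) \<le> (cmod a)\<^sup>2 * C * (\<Sum>i<n k. (cmod (v i))\<^sup>2)" .
  qed
qed

lemma c00_subset_linf: "c00 n \<subseteq> linf n"
proof
  fix x :: "'a \<Rightarrow> complex mat" assume x: "x \<in> c00 n"
  let ?F = "{k. x k \<noteq> 0\<^sub>m (n k) (n k)}"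
  \<comment> \<open>The squared Hilbert-Schmidt norm of the block, which bounds the operator norm by
    Cauchy-Schwarz; its sum over the finite support bounds all blocks at once.\<close>
  define B where "B k = (\<Sum>i<n k. \<Sum>j<n k. (cmod (x k $$ (i, j)))\<^sup>2)" for k
  have B0: "0 \<le> B k" for k by (simp add: B_def sum_nonneg)
  have fin: "finite ?F" and c: "x k \<in> carrier_mat (n k) (n k)" for k using x by (auto simp: c00_def)
  show "x \<in> linf n"
  proof (rule linfI[where C = "\<Sum>k\<in>?F. B k"])
    show "x k \<in> carrier_mat (n k) (n k)" for k by (rule c)
    fix k and v :: "nat \<Rightarrow> complex"
    let ?N = "\<Sum>i<n k. (cmod (v i))\<^sup>2"
    show "(\<Sum>i<n k. (cmod (\<Sum>j<n k. x k $$ (i, j) * v j))\<^sup>2) \<le> (\<Sum>k\<in>?F. B k) * ?N"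
    proof (cases "k \<in> ?F")
      case False
      then show ?thesis using B0 by (simp add: sum_nonneg)
    next
      case True
      have "(cmod (\<Sum>j<n k. x k $$ (i, j) * v j))\<^sup>2 \<le> (\<Sum>j<n k. (cmod (x k $$ (i, j)))\<^sup>2) * ?N" for i
      proof -
        have "cmod (\<Sum>j<n k. x k $$ (i, j) * v j) \<le> (\<Sum>j<n k. cmod (x k $$ (i, j)) * cmod (v j))"
          using norm_sum[of "\<lambda>j. x k $$ (i, j) * v j" "{..<n k}"] by (simp add: norm_mult)
        then have "(cmod (\<Sum>j<n k. x k $$ (i, j) * v j))\<^sup>2 \<le> (\<Sum>j<n k. cmod (x k $$ (i, j)) * cmod (v j))\<^sup>2"
          by (intro power_mono) auto
        also have "\<dots> \<le> (\<Sum>j<n k. (cmod (x k $$ (i, j)))\<^sup>2) * ?N"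
        proof -
          have "(\<Sum>j<n k. cmod (x k $$ (i, j)) * cmod (v j))
              \<le> L2_set (\<lambda>j. cmod (x k $$ (i, j))) {..<n k} * L2_set (\<lambda>j. cmod (v j)) {..<n k}"
            using L2_set_mult_ineq[of "\<lambda>j. cmod (x k $$ (i, j))" "\<lambda>j. cmod (v j)" "{..<n k}"] by simp
          then have "(\<Sum>j<n k. cmod (x k $$ (i, j)) * cmod (v j))\<^sup>2
              \<le> (L2_set (\<lambda>j. cmod (x k $$ (i, j))) {..<n k} * L2_set (\<lambda>j. cmod (v j)) {..<n k})\<^sup>2"
            by (intro power_mono sum_nonneg) auto
          then show ?thesis by (simp add: power_mult_distrib L2_set_def sum_nonneg)
        qed
        finally show ?thesis .
      qed
      then have "(\<Sum>i<n k. (cmod (\<Sum>j<n k. x k $$ (i, j) * v j))\<^sup>2) \<le> B k * ?N"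
        unfolding B_def sum_distrib_right[of _ _ ?N] by (intro sum_mono) (simp add: sum_distrib_right)
      also have "\<dots> \<le> (\<Sum>k\<in>?F. B k) * ?N"
        using True fin B0 by (intro mult_right_mono member_le_sum) (auto intro: sum_nonneg)
      finally show ?thesis .
    qed
  qed
qed

text \<open>The j-th diagonal entry of Q is the squared norm of its j-th column, and positivity of
  -Q makes it nonpositive. This is how a part of the image of the unit under \<open>Delta\<close> is
  shown to vanish.\<close>

lemma projection_eq_0:
  assumes Q: "Q \<in> carrier_mat m m" "mat_adjoint Q = Q" "Q * Q = Q" and neg: "psd (0\<^sub>m m m - Q)"
  shows "Q = 0\<^sub>m m m"
proof -
  have "Q $$ (i, j) = 0" if ij: "i < m" "j < m" for i j
  proof -
    have sq: "Q $$ (j, j) = of_real (\<Sum>k<m. (cmod (Q $$ (k, j)))\<^sup>2)"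
    proof -
      have "Q $$ (j, j) = (\<Sum>k<m. Q $$ (j, k) * Q $$ (k, j))"
        using index_mult_mat_sum[OF Q(1) Q(1) ij(2,2)] by (simp add: Q(3))
      also have "\<dots> = (\<Sum>k<m. cnj (Q $$ (k, j)) * Q $$ (k, j))"
      proof (intro sum.cong refl)
        fix k assume "k \<in> {..<m}"
        then have "mat_adjoint Q $$ (j, k) = cnj (Q $$ (k, j))" using Q(1) ij by simp
        then show "Q $$ (j, k) * Q $$ (k, j) = cnj (Q $$ (k, j)) * Q $$ (k, j)" by (simp add: Q(2))
      qed
      finally show ?thesis unfolding of_real_sum by (simp add: complex_norm_square[symmetric] mult.commute)
    qed
    have "0 \<le> Re (\<Sum>r<m. \<Sum>s<m. cnj (if r = j then 1 else 0) * (0\<^sub>m m m - Q) $$ (r, s) * (if s = j then 1 else 0))"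
    proof -
      have "0\<^sub>m m m - Q \<in> carrier_mat m m" by (rule minus_carrier_mat[OF Q(1)])
      from neg[unfolded psd_iff[OF this], THEN conjunct2, THEN spec, of "\<lambda>r. if r = j then 1 else 0"]
      show ?thesis .
    qed
    also have "(\<Sum>r<m. \<Sum>s<m. cnj (if r = j then 1 else 0) * (0\<^sub>m m m - Q) $$ (r, s) * (if s = j then 1 else 0))
        = (\<Sum>r<m. if r = j then (\<Sum>s<m. if s = j then - Q $$ (j, j) else 0) else 0)"
      using Q(1) ij by (intro sum.cong refl) (auto simp del: sum.delta sum.delta' intro!: sum.cong sum.neutral)
    also have "\<dots> = - Q $$ (j, j)" using ij by (simp add: sum.delta)
    finally have "(\<Sum>k<m. (cmod (Q $$ (k, j)))\<^sup>2) \<le> 0" unfolding sq by simp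
    moreover have "(cmod (Q $$ (i, j)))\<^sup>2 \<le> (\<Sum>k<m. (cmod (Q $$ (k, j)))\<^sup>2)"
      using ij by (intro member_le_sum) auto
    ultimately have "(cmod (Q $$ (i, j)))\<^sup>2 \<le> 0" by linarith
    then show ?thesis by simp
  qed
  then show ?thesis using Q(1) by (intro eq_matI) auto
qed

lemma psd_mult_adjoint_self:
  assumes Q: "Q \<in> carrier_mat m m" "mat_adjoint Q = Q" "Q * Q = Q"
  shows "psd Q"
  unfolding psd_iff[OF Q(1)]
proof (intro conjI allI impI)
  have adj: "Q $$ (j, i) = cnj (Q $$ (i, j))" if "i < m" "j < m" for i j
  proof -
    have "mat_adjoint Q $$ (j, i) = cnj (Q $$ (i, j))" using Q(1) that by simp
    then show ?thesis by (simp add: Q(2))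
  qed
  show "i < m \<Longrightarrow> j < m \<Longrightarrow> Q $$ (j, i) = cnj (Q $$ (i, j))" for i j by (rule adj)
  fix v :: "nat \<Rightarrow> complex"
  have "(\<Sum>i<m. \<Sum>j<m. cnj (v i) * Q $$ (i, j) * v j) = (\<Sum>i<m. \<Sum>j<m. \<Sum>k<m. cnj (v i) * cnj (Q $$ (k, i)) * (Q $$ (k, j) * v j))"
  proof (intro sum.cong refl)
    fix i j assume ij: "i \<in> {..<m}" "j \<in> {..<m}"
    have "Q $$ (i, j) = (\<Sum>k<m. Q $$ (i, k) * Q $$ (k, j))"
      using index_mult_mat_sum[OF Q(1) Q(1), of i j] ij unfolding Q(3) lessThan_iff by blast
    also have "\<dots> = (\<Sum>k<m. cnj (Q $$ (k, i)) * Q $$ (k, j))"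
      using ij by (intro sum.cong refl) (simp add: adj[symmetric])
    finally have q: "Q $$ (i, j) = (\<Sum>k<m. cnj (Q $$ (k, i)) * Q $$ (k, j))" .
    show "cnj (v i) * Q $$ (i, j) * v j = (\<Sum>k<m. cnj (v i) * cnj (Q $$ (k, i)) * (Q $$ (k, j) * v j))"
      unfolding q by (simp add: sum_distrib_left sum_distrib_right mult_ac)
  qed
  also have "\<dots> = (\<Sum>i<m. \<Sum>k<m. \<Sum>j<m. cnj (v i) * cnj (Q $$ (k, i)) * (Q $$ (k, j) * v j))"
    by (intro sum.cong refl sum.swap)
  also have "\<dots> = (\<Sum>k<m. \<Sum>i<m. \<Sum>j<m. cnj (v i) * cnj (Q $$ (k, i)) * (Q $$ (k, j) * v j))"
    by (rule sum.swap)
  also have "\<dots> = (\<Sum>k<m. cnj (\<Sum>j<m. Q $$ (k, j) * v j) * (\<Sum>j<m. Q $$ (k, j) * v j))"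
    by (simp only: cnj_sum sum_product) (intro sum.cong refl, simp)
  also have "Re \<dots> = (\<Sum>k<m. (cmod (\<Sum>j<m. Q $$ (k, j) * v j))\<^sup>2)"
    by (simp only: Re_sum mult.commute[of "cnj _"] complex_norm_square[symmetric] Re_complex_of_real)
  finally show "0 \<le> Re (\<Sum>i<m. \<Sum>j<m. cnj (v i) * Q $$ (i, j) * v j)" by (simp add: sum_nonneg)
qed

context discrete_quantum_group
begin

section \<open>Coordinates of the dual comultiplication\<close>

lemma mat_unit_c00: "mat_unit n \<alpha> i j \<in> c00 n"
  unfolding c00_iff fam_carrier_def by (intro conjI exI[of _ "{\<alpha>}"]) (auto simp: mat_unit_def intro!: eq_matI)

text \<open>Additivity and homogeneity are asked on c00 only, because \<open>S\<close> is known to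
  be linear only there.\<close>

lemma c00_linear_expansion:
  fixes f :: "('i \<Rightarrow> complex mat) \<Rightarrow> complex"
  assumes add: "\<And>x y. x \<in> c00 n \<Longrightarrow> y \<in> c00 n \<Longrightarrow> f (fam_add x y) = f x + f y"
    and scale: "\<And>a x. x \<in> c00 n \<Longrightarrow> f (fam_scale a x) = a * f x"
    and x: "x \<in> c00 n" and F: "finite F" "\<And>\<alpha>. \<alpha> \<notin> F \<Longrightarrow> x \<alpha> = 0\<^sub>m (n \<alpha>) (n \<alpha>)"
  shows "f x = (\<Sum>\<alpha>\<in>F. \<Sum>i<n \<alpha>. \<Sum>j<n \<alpha>. x \<alpha> $$ (i, j) * f (mat_unit n \<alpha> i j))"
proof -
  note xc = fam_carrierD[OF c00_fam_carrier[OF x]]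
  define r where "r T \<alpha> = mat (n \<alpha>) (n \<alpha>) (\<lambda>(i, j). if (\<alpha>, i, j) \<in> T then x \<alpha> $$ (i, j) else 0)" for T \<alpha>
  have rc: "r T \<in> c00 n" for T
  proof -
    have "r T \<alpha> = 0\<^sub>m (n \<alpha>) (n \<alpha>)" if "\<alpha> \<notin> F" for \<alpha>
      unfolding r_def using F(2)[OF that] by (intro eq_matI) auto
    then show ?thesis unfolding c00_iff fam_carrier_def using F(1) by (auto simp: r_def intro!: exI[of _ F])
  qed
  have step: "f (r T) = (\<Sum>(\<alpha>, i, j)\<in>T. x \<alpha> $$ (i, j) * f (mat_unit n \<alpha> i j))"
    if "finite T" "\<forall>(\<alpha>, i, j)\<in>T. i < n \<alpha> \<and> j < n \<alpha>" for T
    using that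
  proof (induction T rule: finite_induct)
    case empty
    have "r {} = fam_scale 0 (r {})" unfolding fam_scale_def r_def by (intro ext eq_matI) auto
    then have "f (r {}) = 0" using scale[OF rc, of 0 "{}"] by simp
    then show ?case by simp
  next
    case (insert t T)
    obtain \<alpha> i j where t: "t = (\<alpha>, i, j)" by (cases t)
    have ij: "i < n \<alpha>" "j < n \<alpha>" using insert.prems t by auto
    have "r (insert t T) = fam_add (fam_scale (x \<alpha> $$ (i, j)) (mat_unit n \<alpha> i j)) (r T)"
      using insert(2) unfolding fam_add_def fam_scale_def r_def mat_unit_def t by (intro ext eq_matI) auto
    moreover have "fam_scale (x \<alpha> $$ (i, j)) (mat_unit n \<alpha> i j) \<in> c00 n"
      unfolding c00_iff fam_carrier_def by (intro conjI exI[of _ "{\<alpha>}"]) (auto simp: mat_unit_def fam_scale_def intro!: eq_matI)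
    ultimately show ?case using insert t by (simp add: add rc scale mat_unit_c00)
  qed
  define J where "J = (SIGMA \<alpha>:F. {..<n \<alpha>} \<times> {..<n \<alpha>})"
  have "x = r J"
  proof (rule fam_eqI)
    fix \<alpha> i j assume "i < n \<alpha>" "j < n \<alpha>"
    then show "x \<alpha> $$ (i, j) = r J \<alpha> $$ (i, j)"
      using F(2)[of \<alpha>] by (auto simp: r_def J_def)
  qed (use x rc c00_fam_carrier in auto)
  then have "f x = (\<Sum>(\<alpha>, i, j)\<in>J. x \<alpha> $$ (i, j) * f (mat_unit n \<alpha> i j))"
    using step[of J] F(1) by (simp add: J_def)
  also have "\<dots> = (\<Sum>\<alpha>\<in>F. \<Sum>i<n \<alpha>. \<Sum>j<n \<alpha>. x \<alpha> $$ (i, j) * f (mat_unit n \<alpha> i j))"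
    unfolding J_def using F(1) by (subst sum.Sigma[symmetric]) (auto simp: sum.cartesian_product)
  finally show ?thesis .
qed

lemma truncate_linf:
  assumes "x \<in> linf n"
  shows "truncate F x \<in> linf n"
proof -
  obtain C where C: "0 \<le> C" "\<And>k v. (\<Sum>i<n k. (cmod (\<Sum>j<n k. x k $$ (i, j) * v j))\<^sup>2) \<le> C * (\<Sum>i<n k. (cmod (v i))\<^sup>2)"
    by (rule linf_bound[OF assms], rule that)
  show ?thesis
  proof (rule linfI[where C = C])
    show "truncate F x k \<in> carrier_mat (n k) (n k)" for k
      using linf_carrier[OF assms] by (simp add: truncate_def)
    show "(\<Sum>i<n k. (cmod (\<Sum>j<n k. truncate F x k $$ (i, j) * v j))\<^sup>2) \<le> C * (\<Sum>i<n k. (cmod (v i))\<^sup>2)" for k v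
      using C by (cases "k \<in> F") (simp_all add: truncate_def sum_nonneg)
  qed
qed

lemma fam_one_linf: "fam_one n \<in> linf n"
proof (rule linfI[where C = 1])
  fix k and v :: "nat \<Rightarrow> complex"
  have "(\<Sum>j<n k. fam_one n k $$ (i, j) * v j) = v i" if "i < n k" for i
  proof -
    have "(\<Sum>j<n k. fam_one n k $$ (i, j) * v j) = (\<Sum>j<n k. if i = j then v j else 0)"
      using that by (intro sum.cong) (auto simp: fam_one_def)
    then show ?thesis using that by (simp add: sum.delta')
  qed
  then show "(\<Sum>i<n k. (cmod (\<Sum>j<n k. fam_one n k $$ (i, j) * v j))\<^sup>2) \<le> 1 * (\<Sum>i<n k. (cmod (v i))\<^sup>2)" by simp
qed (simp add: fam_one_def)

lemma Delta_linf: "x \<in> linf n \<Longrightarrow> Delta x \<in> linf (dim2 n)"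
  and Delta_add: "x \<in> linf n \<Longrightarrow> y \<in> linf n \<Longrightarrow> Delta (fam_add x y) = fam_add (Delta x) (Delta y)"
  and Delta_scale: "x \<in> linf n \<Longrightarrow> Delta (fam_scale c x) = fam_scale c (Delta x)"
  and Delta_mult: "x \<in> linf n \<Longrightarrow> y \<in> linf n \<Longrightarrow> Delta (fam_mult x y) = fam_mult (Delta x) (Delta y)"
  and Delta_star: "x \<in> linf n \<Longrightarrow> Delta (fam_star x) = fam_star (Delta x)"
  and Delta_normal: "normal_map n (dim2 n) Delta"
  using Delta unfolding dual_comultiplication_def star_hom_on_def linear_map_on_def by blast+

lemma Delta_carrier: "x \<in> linf n \<Longrightarrow> Delta x (\<gamma>, \<beta>) \<in> carrier_mat (n \<gamma> * n \<beta>) (n \<gamma> * n \<beta>)"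
  using linf_carrier[OF Delta_linf, of x "(\<gamma>, \<beta>)"] by (simp add: dim2_def)

definition Delta_support :: "'i \<Rightarrow> 'i \<Rightarrow> 'i set" where
  "Delta_support \<gamma> \<beta> = {\<alpha>. \<exists>i<n \<alpha>. \<exists>j<n \<alpha>. Delta (mat_unit n \<alpha> i j) (\<gamma>, \<beta>) \<noteq> 0\<^sub>m (n \<gamma> * n \<beta>) (n \<gamma> * n \<beta>)}"

text \<open>The factor from the second leg stands first. This reversed order is the source of the
  opposite multiplication dual to \<open>Delta\<close>.\<close>

lemma index_kron_mult_kron:
  assumes "a < n \<gamma>" "b < n \<gamma>" "p < n \<beta>" "q < n \<beta>"
  shows "(kron (1\<^sub>m (n \<gamma>)) (u \<beta>) * kron (u \<gamma>) (1\<^sub>m (n \<beta>))) $$ (a * n \<beta> + p, b * n \<beta> + q) = u \<beta> $$ (p, q) * u \<gamma> $$ (a, b)"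
proof -
  note less = pair_index_less[OF assms(1,3)] pair_index_less[OF assms(2,4)]
  have "(kron (1\<^sub>m (n \<gamma>)) (u \<beta>) * kron (u \<gamma>) (1\<^sub>m (n \<beta>))) $$ (a * n \<beta> + p, b * n \<beta> + q)
     = (\<Sum>k<n \<gamma> * n \<beta>. kron (1\<^sub>m (n \<gamma>)) (u \<beta>) $$ (a * n \<beta> + p, k) * kron (u \<gamma>) (1\<^sub>m (n \<beta>)) $$ (k, b * n \<beta> + q))"
    by (rule index_mult_mat_sum[OF kron_carrier[OF one_carrier_mat u_carrier] kron_carrier[OF u_carrier one_carrier_mat] less])
  also have "\<dots> = (\<Sum>k<n \<gamma> * n \<beta>. (if a = k div n \<beta> then 1 else 0) * u \<beta> $$ (p, k mod n \<beta>) * (u \<gamma> $$ (k div n \<beta>, b) * (if k mod n \<beta> = q then 1 else 0)))"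
  proof (intro sum.cong refl)
    fix k assume k: "k \<in> {..<n \<gamma> * n \<beta>}"
    then have "k div n \<beta> < n \<gamma>" by (simp add: less_mult_imp_div_less)
    then show "kron (1\<^sub>m (n \<gamma>)) (u \<beta>) $$ (a * n \<beta> + p, k) * kron (u \<gamma>) (1\<^sub>m (n \<beta>)) $$ (k, b * n \<beta> + q)
       = (if a = k div n \<beta> then 1 else 0) * u \<beta> $$ (p, k mod n \<beta>) * (u \<gamma> $$ (k div n \<beta>, b) * (if k mod n \<beta> = q then 1 else 0))"
      using k less assms n_pos[of \<beta>]
      by (simp add: index_kron_div_mod[OF one_carrier_mat u_carrier] index_kron_div_mod[OF u_carrier one_carrier_mat])
  qed
  also have "\<dots> = (\<Sum>i<n \<gamma>. \<Sum>j<n \<beta>. (if a = i then 1 else 0) * u \<beta> $$ (p, j) * (u \<gamma> $$ (i, b) * (if j = q then 1 else 0)))"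
    by (rule sum_lessThan_mult[OF n_pos, where f = "\<lambda>i j. (if a = i then 1 else 0) * u \<beta> $$ (p, j) * (u \<gamma> $$ (i, b) * (if j = q then 1 else 0))"])
  also have "\<dots> = (\<Sum>i<n \<gamma>. if a = i then (\<Sum>j<n \<beta>. if j = q then u \<beta> $$ (p, j) * u \<gamma> $$ (i, b) else 0) else 0)"
  proof (intro sum.cong refl)
    fix i
    show "(\<Sum>j<n \<beta>. (if a = i then 1 else 0) * u \<beta> $$ (p, j) * (u \<gamma> $$ (i, b) * (if j = q then 1 else 0)))
       = (if a = i then (\<Sum>j<n \<beta>. if j = q then u \<beta> $$ (p, j) * u \<gamma> $$ (i, b) else 0) else 0)"
      by (cases "a = i") (auto simp del: sum.delta sum.delta' intro!: sum.cong)
  qed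
  also have "\<dots> = u \<beta> $$ (p, q) * u \<gamma> $$ (a, b)"
    using assms by (simp add: sum.delta sum.delta')
  finally show ?thesis .
qed

text \<open>If all these products vanished then so would 1, written as the product of a column
  relation of \<open>u \<beta>\<close> and a row relation of \<open>u \<gamma>\<close>.\<close>

lemma coeff_mult_nonzero: "\<exists>p<n \<beta>. \<exists>q<n \<beta>. \<exists>a<n \<gamma>. \<exists>b<n \<gamma>. u \<beta> $$ (p, q) * u \<gamma> $$ (a, b) \<noteq> 0"
proof (rule ccontr)
  assume "\<not> ?thesis"
  then have z: "u \<beta> $$ (p, 0) * u \<gamma> $$ (0, b) = 0" if "p < n \<beta>" "b < n \<gamma>" for p b
    using that n_pos[of \<beta>] n_pos[of \<gamma>] by blast
  have "1 = (\<Sum>p<n \<beta>. star (u \<beta> $$ (p, 0)) * u \<beta> $$ (p, 0)) * (\<Sum>b<n \<gamma>. u \<gamma> $$ (0, b) * star (u \<gamma> $$ (0, b)))"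
    by (simp add: unitary_repD(3,4)[OF u_rep] n_pos)
  also have "\<dots> = (\<Sum>p<n \<beta>. \<Sum>b<n \<gamma>. star (u \<beta> $$ (p, 0)) * (u \<beta> $$ (p, 0) * u \<gamma> $$ (0, b)) * star (u \<gamma> $$ (0, b)))"
    unfolding sum_product by (simp add: mult.assoc)
  also have "\<dots> = 0" by (simp add: z)
  finally show False by simp
qed

lemma Delta_coeff_expansion:
  assumes "a < n \<gamma>" "b < n \<gamma>" "p < n \<beta>" "q < n \<beta>"
  shows "(\<Sum>\<alpha>\<in>Delta_support \<gamma> \<beta>. \<Sum>i<n \<alpha>. \<Sum>j<n \<alpha>.
      Delta (mat_unit n \<alpha> i j) (\<gamma>, \<beta>) $$ (a * n \<beta> + p, b * n \<beta> + q) *\<^sub>C u \<alpha> $$ (i, j)) = u \<beta> $$ (p, q) * u \<gamma> $$ (a, b)"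
proof -
  note less = pair_index_less[OF assms(1,3)] pair_index_less[OF assms(2,4)]
  have "mat (n \<gamma> * n \<beta>) (n \<gamma> * n \<beta>) (\<lambda>(r, s). \<Sum>\<alpha>\<in>Delta_support \<gamma> \<beta>. \<Sum>i<n \<alpha>. \<Sum>j<n \<alpha>.
        Delta (mat_unit n \<alpha> i j) (\<gamma>, \<beta>) $$ (r, s) *\<^sub>C u \<alpha> $$ (i, j)) = kron (1\<^sub>m (n \<gamma>)) (u \<beta>) * kron (u \<gamma>) (1\<^sub>m (n \<beta>))"
    using Delta unfolding dual_comultiplication_def Let_def Delta_support_def by blast
  from arg_cong[OF this, of "\<lambda>A. A $$ (a * n \<beta> + p, b * n \<beta> + q)"]
  show ?thesis using less by (simp add: index_kron_mult_kron[OF assms])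
qed

text \<open>A sum over an infinite set has the value 0 by convention. With infinite support the
  formula for W would then make all products of coefficients of \<open>u \<beta>\<close> and
  \<open>u \<gamma>\<close> vanish.\<close>

lemma finite_Delta_support: "finite (Delta_support \<gamma> \<beta>)"
proof (rule ccontr)
  assume "infinite (Delta_support \<gamma> \<beta>)"
  then have "u \<beta> $$ (p, q) * u \<gamma> $$ (a, b) = 0" if "a < n \<gamma>" "b < n \<gamma>" "p < n \<beta>" "q < n \<beta>" for a b p q
    using Delta_coeff_expansion[OF that] by simp
  with coeff_mult_nonzero[of \<beta> \<gamma>] show False by blast
qed

lemma Delta_mat_unit_outside:
  "\<alpha> \<notin> Delta_support \<gamma> \<beta> \<Longrightarrow> i < n \<alpha> \<Longrightarrow> j < n \<alpha> \<Longrightarrow> Delta (mat_unit n \<alpha> i j) (\<gamma>, \<beta>) = 0\<^sub>m (n \<gamma> * n \<beta>) (n \<gamma> * n \<beta>)"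
  unfolding Delta_support_def by blast

lemma Delta_c00_index:
  assumes x: "x \<in> c00 n" and F: "finite F" "\<And>\<alpha>. \<alpha> \<notin> F \<Longrightarrow> x \<alpha> = 0\<^sub>m (n \<alpha>) (n \<alpha>)"
    and rs: "r < n \<gamma> * n \<beta>" "s < n \<gamma> * n \<beta>"
  shows "Delta x (\<gamma>, \<beta>) $$ (r, s) = (\<Sum>\<alpha>\<in>F. \<Sum>i<n \<alpha>. \<Sum>j<n \<alpha>. x \<alpha> $$ (i, j) * Delta (mat_unit n \<alpha> i j) (\<gamma>, \<beta>) $$ (r, s))"
proof (rule c00_linear_expansion[where f = "\<lambda>x. Delta x (\<gamma>, \<beta>) $$ (r, s)", OF _ _ x F])
  fix x y assume "x \<in> c00 n" "y \<in> c00 n"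
  then have xy: "x \<in> linf n" "y \<in> linf n" using c00_subset_linf by blast+
  then show "Delta (fam_add x y) (\<gamma>, \<beta>) $$ (r, s) = Delta x (\<gamma>, \<beta>) $$ (r, s) + Delta y (\<gamma>, \<beta>) $$ (r, s)"
    unfolding Delta_add[OF xy] unfolding fam_add_def using rs Delta_carrier[of x \<gamma> \<beta>] Delta_carrier[of y \<gamma> \<beta>] by simp
next
  fix a x assume "x \<in> c00 n"
  then have x: "x \<in> linf n" using c00_subset_linf by blast
  then show "Delta (fam_scale a x) (\<gamma>, \<beta>) $$ (r, s) = a * Delta x (\<gamma>, \<beta>) $$ (r, s)"
    unfolding Delta_scale[OF x] unfolding fam_scale_def using rs Delta_carrier[of x \<gamma> \<beta>] by simp
qed

lemma truncate_one_c00: "finite F \<Longrightarrow> truncate F (fam_one n) \<in> c00 n"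
  by (rule truncate_c00) (simp_all add: fam_carrier_def fam_one_def)

lemma truncate_projection:
  "fam_star (truncate F (fam_one n)) = truncate F (fam_one n)"
  "fam_mult (truncate F (fam_one n)) (truncate F (fam_one n)) = truncate F (fam_one n)"
  by (auto simp: fam_star_def fam_mult_def truncate_def fam_one_def intro!: ext eq_matI)

lemma Delta_truncate_psd: "psd (Delta (truncate F (fam_one n)) \<kappa>)"
  and Delta_truncate_projection:
    "mat_adjoint (Delta (truncate F (fam_one n)) \<kappa>) = Delta (truncate F (fam_one n)) \<kappa>"
    "Delta (truncate F (fam_one n)) \<kappa> * Delta (truncate F (fam_one n)) \<kappa> = Delta (truncate F (fam_one n)) \<kappa>"
proof -
  obtain \<gamma> \<beta> where k: "\<kappa> = (\<gamma>, \<beta>)" by (cases \<kappa>)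
  have lin: "truncate F (fam_one n) \<in> linf n" by (rule truncate_linf[OF fam_one_linf])
  show adj: "mat_adjoint (Delta (truncate F (fam_one n)) \<kappa>) = Delta (truncate F (fam_one n)) \<kappa>"
    using fun_cong[OF Delta_star[OF lin], of \<kappa>] unfolding truncate_projection by (simp only: fam_star_def)
  show idem: "Delta (truncate F (fam_one n)) \<kappa> * Delta (truncate F (fam_one n)) \<kappa> = Delta (truncate F (fam_one n)) \<kappa>"
    using fun_cong[OF Delta_mult[OF lin lin], of \<kappa>] unfolding truncate_projection by (simp only: fam_mult_def)
  show "psd (Delta (truncate F (fam_one n)) \<kappa>)"
    by (rule psd_mult_adjoint_self[OF _ adj idem]) (use Delta_carrier[OF lin] k in simp)
qed

lemma truncate_split:
  assumes "fam_carrier x" "F \<inter> G = {}"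
  shows "truncate (F \<union> G) x = fam_add (truncate F x) (truncate G x)"
  using assms by (intro ext) (auto simp: fam_add_def truncate_def fam_carrier_def)

lemma Delta_truncate_diff:
  assumes "F \<inter> G = {}"
  shows "Delta (truncate (F \<union> G) (fam_one n)) \<kappa> - Delta (truncate F (fam_one n)) \<kappa> = Delta (truncate G (fam_one n)) \<kappa>"
proof -
  obtain \<gamma> \<beta> where k: "\<kappa> = (\<gamma>, \<beta>)" by (cases \<kappa>)
  note lin = truncate_linf[OF fam_one_linf]
  have "Delta (truncate (F \<union> G) (fam_one n)) \<kappa> = Delta (truncate F (fam_one n)) \<kappa> + Delta (truncate G (fam_one n)) \<kappa>"
    unfolding truncate_split[OF linf_fam_carrier[OF fam_one_linf] assms] Delta_add[OF lin lin] unfolding fam_add_def ..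
  then show ?thesis
    using Delta_carrier[OF lin[of F], of \<gamma> \<beta>] Delta_carrier[OF lin[of G], of \<gamma> \<beta>] k by (intro eq_matI) auto
qed

text \<open>The net to which normality of \<open>Delta\<close> is applied. An upper bound is
  compared with the unit block by block, using the unit of a single block.\<close>

lemma is_sup_fam_one: "is_sup n {truncate G (fam_one n) | G. finite G} (fam_one n)"
  unfolding is_sup_def fam_le_def
proof (intro conjI ballI allI impI)
  show "fam_one n \<in> linf n" by (rule fam_one_linf)
  fix x \<alpha> assume "x \<in> {truncate G (fam_one n) | G. finite G}"
  then obtain G where G: "x = truncate G (fam_one n)" by blast
  show "psd (fam_one n \<alpha> - x \<alpha>)"
  proof (rule psd_mult_adjoint_self[where m = "n \<alpha>"])
    show "fam_one n \<alpha> - x \<alpha> \<in> carrier_mat (n \<alpha>) (n \<alpha>)" by (simp add: G truncate_def fam_one_def minus_carrier_mat)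
    show "mat_adjoint (fam_one n \<alpha> - x \<alpha>) = fam_one n \<alpha> - x \<alpha>"
      by (rule eq_matI) (auto simp: G truncate_def fam_one_def)
    have "fam_one n \<alpha> - x \<alpha> = 1\<^sub>m (n \<alpha>) \<or> fam_one n \<alpha> - x \<alpha> = 0\<^sub>m (n \<alpha>) (n \<alpha>)"
      by (auto simp: G truncate_def fam_one_def intro!: eq_matI)
    then show "(fam_one n \<alpha> - x \<alpha>) * (fam_one n \<alpha> - x \<alpha>) = fam_one n \<alpha> - x \<alpha>" by auto
  qed
next
  fix t \<alpha> assume t: "t \<in> linf n" "\<forall>x\<in>{truncate G (fam_one n) | G. finite G}. \<forall>\<alpha>. psd (t \<alpha> - x \<alpha>)"
  have "psd (t \<alpha> - truncate {\<alpha>} (fam_one n) \<alpha>)" using t(2) by blast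
  then show "psd (t \<alpha> - fam_one n \<alpha>)" by (simp add: truncate_def)
qed

text \<open>The formula for W controls matrix units only, and normality excludes a contribution of
  all remaining blocks together. At the given component a finite partial unit has the same image as
  its part inside the support. So the images have the image of the unit of the support as an upper
  bound there, and the complementary projection is also negative.\<close>

lemma Delta_one_support: "Delta (truncate (- Delta_support \<gamma> \<beta>) (fam_one n)) (\<gamma>, \<beta>) = 0\<^sub>m (n \<gamma> * n \<beta>) (n \<gamma> * n \<beta>)"
proof -
  let ?F = "Delta_support \<gamma> \<beta>" and ?m = "n \<gamma> * n \<beta>"
  let ?D = "{truncate G (fam_one n) | G. finite G}"
  note lin = truncate_linf[OF fam_one_linf]
  \<comment> \<open>The image of the unit, altered in the one component in question to use only the
    blocks of the support. It remains an upper bound for the images of the finite partial units, so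
    it dominates their supremum.\<close>
  define t where "t \<kappa> = (if \<kappa> = (\<gamma>, \<beta>) then Delta (truncate ?F (fam_one n)) \<kappa> else Delta (fam_one n) \<kappa>)" for \<kappa>
  have "is_sup (dim2 n) (Delta ` ?D) (Delta (fam_one n))"
  proof -
    have "?D \<noteq> {}" by blast
    moreover have "?D \<subseteq> {x \<in> linf n. fam_star x = x}"
      using lin truncate_projection(1) by blast
    moreover have "\<exists>z\<in>?D. fam_le x z \<and> fam_le y z" if xy: "x \<in> ?D" "y \<in> ?D" for x y
    proof -
      obtain G H where GH: "x = truncate G (fam_one n)" "y = truncate H (fam_one n)" "finite G" "finite H" using xy by blast
      have le: "fam_le (truncate K (fam_one n)) (truncate (G \<union> H) (fam_one n))" if "K \<subseteq> G \<union> H" for K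
        unfolding fam_le_def
      proof
        fix \<alpha>
        show "psd (truncate (G \<union> H) (fam_one n) \<alpha> - truncate K (fam_one n) \<alpha>)"
        proof (rule psd_mult_adjoint_self[where m = "n \<alpha>"])
          let ?x = "truncate (G \<union> H) (fam_one n) \<alpha> - truncate K (fam_one n) \<alpha>"
          show "?x \<in> carrier_mat (n \<alpha>) (n \<alpha>)" by (simp add: truncate_def fam_one_def minus_carrier_mat)
          have "?x = 1\<^sub>m (n \<alpha>) \<or> ?x = 0\<^sub>m (n \<alpha>) (n \<alpha>)"
            using that by (auto simp: truncate_def fam_one_def intro!: eq_matI)
          then show "?x * ?x = ?x" "mat_adjoint ?x = ?x" by (auto intro!: eq_matI)
        qed
      qed
      show ?thesis using le[of G] le[of H] GH by blast
    qed
    ultimately show ?thesis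
      by (intro Delta_normal[unfolded normal_map_def, THEN spec, THEN spec, THEN mp] conjI ballI is_sup_fam_one)
  qed
  then have sup: "\<And>G \<kappa>. finite G \<Longrightarrow> psd (Delta (fam_one n) \<kappa> - Delta (truncate G (fam_one n)) \<kappa>)"
    and least: "\<And>s. s \<in> linf (dim2 n) \<Longrightarrow> (\<And>G \<kappa>. finite G \<Longrightarrow> psd (s \<kappa> - Delta (truncate G (fam_one n)) \<kappa>)) \<Longrightarrow> psd (s (\<gamma>, \<beta>) - Delta (fam_one n) (\<gamma>, \<beta>))"
    unfolding is_sup_def fam_le_def by blast+
  have "t \<in> linf (dim2 n)"
  proof -
    obtain C where C: "0 \<le> C" "\<And>k v. (\<Sum>i<dim2 n k. (cmod (\<Sum>j<dim2 n k. Delta (truncate ?F (fam_one n)) k $$ (i, j) * v j))\<^sup>2) \<le> C * (\<Sum>i<dim2 n k. (cmod (v i))\<^sup>2)"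
      by (rule linf_bound[OF Delta_linf[OF lin]], rule that)
    obtain D where D: "0 \<le> D" "\<And>k v. (\<Sum>i<dim2 n k. (cmod (\<Sum>j<dim2 n k. Delta (fam_one n) k $$ (i, j) * v j))\<^sup>2) \<le> D * (\<Sum>i<dim2 n k. (cmod (v i))\<^sup>2)"
      by (rule linf_bound[OF Delta_linf[OF fam_one_linf]], rule that)
    show ?thesis
    proof (rule linfI[where C = "max C D"])
      show "t k \<in> carrier_mat (dim2 n k) (dim2 n k)" for k
        using linf_carrier[OF Delta_linf[OF lin]] linf_carrier[OF Delta_linf[OF fam_one_linf]] by (simp add: t_def)
      fix k and v :: "nat \<Rightarrow> complex"
      have N: "0 \<le> (\<Sum>i<dim2 n k. (cmod (v i))\<^sup>2)" by (simp add: sum_nonneg)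
      show "(\<Sum>i<dim2 n k. (cmod (\<Sum>j<dim2 n k. t k $$ (i, j) * v j))\<^sup>2) \<le> max C D * (\<Sum>i<dim2 n k. (cmod (v i))\<^sup>2)"
        using order.trans[OF C(2)[of k v] mult_right_mono[OF max.cobounded1[of C D] N]]
          order.trans[OF D(2)[of k v] mult_right_mono[OF max.cobounded2[of D C] N]]
        by (cases "k = (\<gamma>, \<beta>)") (simp_all only: t_def if_True if_False simp_thms)
    qed
  qed
  moreover have "psd (t \<kappa> - Delta (truncate G (fam_one n)) \<kappa>)" if G: "finite G" for G \<kappa>
  proof (cases "\<kappa> = (\<gamma>, \<beta>)")
    case False
    then show ?thesis using sup[OF G] by (simp add: t_def)
  next
    case True
    have 0: "Delta (truncate (G - ?F) (fam_one n)) (\<gamma>, \<beta>) = 0\<^sub>m ?m ?m"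
    proof (rule eq_matI)
      fix r s assume "r < dim_row (0\<^sub>m ?m ?m :: complex mat)" "s < dim_col (0\<^sub>m ?m ?m :: complex mat)"
      then have rs: "r < ?m" "s < ?m" by auto
      show "Delta (truncate (G - ?F) (fam_one n)) (\<gamma>, \<beta>) $$ (r, s) = 0\<^sub>m ?m ?m $$ (r, s)"
        using rs G by (subst Delta_c00_index[where F = "G - ?F", OF truncate_one_c00])
          (auto simp: truncate_def Delta_mat_unit_outside intro!: sum.neutral)
    qed (use Delta_carrier[OF lin[of "G - ?F"], of \<gamma> \<beta>] in auto)
    note c = Delta_carrier[OF lin, of _ \<gamma> \<beta>]
    have "Delta (truncate G (fam_one n)) (\<gamma>, \<beta>) - Delta (truncate (G \<inter> ?F) (fam_one n)) (\<gamma>, \<beta>) = 0\<^sub>m ?m ?m"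
      using Delta_truncate_diff[of "G \<inter> ?F" "G - ?F" "(\<gamma>, \<beta>)"] 0 by (simp add: Int_Diff_Un Int_Diff_disjoint)
    then have "Delta (truncate G (fam_one n)) (\<gamma>, \<beta>) = Delta (truncate (G \<inter> ?F) (fam_one n)) (\<gamma>, \<beta>)"
    proof -
      assume d: "Delta (truncate G (fam_one n)) (\<gamma>, \<beta>) - Delta (truncate (G \<inter> ?F) (fam_one n)) (\<gamma>, \<beta>) = 0\<^sub>m ?m ?m"
      show ?thesis
      proof (rule eq_matI)
        fix i j assume "i < dim_row (Delta (truncate (G \<inter> ?F) (fam_one n)) (\<gamma>, \<beta>))" "j < dim_col (Delta (truncate (G \<inter> ?F) (fam_one n)) (\<gamma>, \<beta>))"
        then show "Delta (truncate G (fam_one n)) (\<gamma>, \<beta>) $$ (i, j) = Delta (truncate (G \<inter> ?F) (fam_one n)) (\<gamma>, \<beta>) $$ (i, j)"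
          using arg_cong[OF d, of "\<lambda>A. A $$ (i, j)"] c[of G] c[of "G \<inter> ?F"] by simp
      qed (use c[of G] c[of "G \<inter> ?F"] in auto)
    qed
    then have "t \<kappa> - Delta (truncate G (fam_one n)) \<kappa> = Delta (truncate ((?F \<inter> G) \<union> (?F - G)) (fam_one n)) (\<gamma>, \<beta>) - Delta (truncate (?F \<inter> G) (fam_one n)) (\<gamma>, \<beta>)"
    proof -
      assume eq: "Delta (truncate G (fam_one n)) (\<gamma>, \<beta>) = Delta (truncate (G \<inter> ?F) (fam_one n)) (\<gamma>, \<beta>)"
      have "(?F \<inter> G) \<union> (?F - G) = ?F" by blast
      then show ?thesis using True by (simp only: t_def eq Int_commute if_True simp_thms)
    qed
    also have "\<dots> = Delta (truncate (?F - G) (fam_one n)) (\<gamma>, \<beta>)"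
      by (rule Delta_truncate_diff) blast
    finally show ?thesis using Delta_truncate_psd by simp
  qed
  ultimately have neg: "psd (Delta (truncate ?F (fam_one n)) (\<gamma>, \<beta>) - Delta (fam_one n) (\<gamma>, \<beta>))"
    using least[of t] by (simp add: t_def)
  have one: "truncate (?F \<union> - ?F) (fam_one n) = fam_one n" by (simp add: truncate_def[abs_def])
  have diff: "Delta (fam_one n) (\<gamma>, \<beta>) - Delta (truncate ?F (fam_one n)) (\<gamma>, \<beta>) = Delta (truncate (- ?F) (fam_one n)) (\<gamma>, \<beta>)"
    using Delta_truncate_diff[of ?F "- ?F" "(\<gamma>, \<beta>)"] unfolding one by simp
  have "Delta (truncate ?F (fam_one n)) (\<gamma>, \<beta>) - Delta (fam_one n) (\<gamma>, \<beta>) = 0\<^sub>m ?m ?m - Delta (truncate (- ?F) (fam_one n)) (\<gamma>, \<beta>)"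
    unfolding diff[symmetric] using Delta_carrier[OF lin[of ?F], of \<gamma> \<beta>] Delta_carrier[OF fam_one_linf, of \<gamma> \<beta>]
    by (intro eq_matI) auto
  with neg show ?thesis
    by (intro projection_eq_0 Delta_truncate_projection Delta_carrier[OF lin]) simp
qed

text \<open>The part of x outside the support is x times a central projection with vanishing image
  at this component; the finitely many other blocks are expanded in matrix units.\<close>

lemma Delta_index_support:
  assumes x: "x \<in> linf n" and rs: "r < n \<gamma> * n \<beta>" "s < n \<gamma> * n \<beta>"
  shows "Delta x (\<gamma>, \<beta>) $$ (r, s) = (\<Sum>\<alpha>\<in>Delta_support \<gamma> \<beta>. \<Sum>i<n \<alpha>. \<Sum>j<n \<alpha>. x \<alpha> $$ (i, j) * Delta (mat_unit n \<alpha> i j) (\<gamma>, \<beta>) $$ (r, s))"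
proof -
  let ?F = "Delta_support \<gamma> \<beta>" and ?m = "n \<gamma> * n \<beta>"
  note lin = truncate_linf[OF x]
  have "truncate (- ?F) x = fam_mult x (truncate (- ?F) (fam_one n))"
  proof
    fix \<alpha>
    show "truncate (- ?F) x \<alpha> = fam_mult x (truncate (- ?F) (fam_one n)) \<alpha>"
      using linf_carrier[OF x, of \<alpha>] by (simp add: truncate_def fam_mult_def fam_one_def right_mult_zero_mat)
  qed
  then have "Delta (truncate (- ?F) x) (\<gamma>, \<beta>) = Delta x (\<gamma>, \<beta>) * 0\<^sub>m ?m ?m"
    by (simp only: Delta_mult[OF x truncate_linf[OF fam_one_linf]]) (simp only: fam_mult_def Delta_one_support)
  then have 0: "Delta (truncate (- ?F) x) (\<gamma>, \<beta>) = 0\<^sub>m ?m ?m"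
    using Delta_carrier[OF x, of \<gamma> \<beta>] by (simp add: right_mult_zero_mat)
  have "x = truncate (?F \<union> - ?F) x" by (simp add: truncate_def[abs_def])
  then have "Delta x (\<gamma>, \<beta>) = Delta (truncate ?F x) (\<gamma>, \<beta>) + 0\<^sub>m ?m ?m"
    using truncate_split[OF linf_fam_carrier[OF x], of ?F "- ?F"] fun_cong[OF Delta_add[OF lin[of ?F] lin[of "- ?F"]], of "(\<gamma>, \<beta>)"] 0
    unfolding fam_add_def[of "Delta _"] by simp
  then have "Delta x (\<gamma>, \<beta>) $$ (r, s) = Delta (truncate ?F x) (\<gamma>, \<beta>) $$ (r, s)"
    using Delta_carrier[OF lin[of ?F], of \<gamma> \<beta>] rs by simp
  also have "\<dots> = (\<Sum>\<alpha>\<in>?F. \<Sum>i<n \<alpha>. \<Sum>j<n \<alpha>. truncate ?F x \<alpha> $$ (i, j) * Delta (mat_unit n \<alpha> i j) (\<gamma>, \<beta>) $$ (r, s))"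
    by (rule Delta_c00_index[OF truncate_c00[OF finite_Delta_support linf_fam_carrier[OF x]] finite_Delta_support _ rs])
      (simp add: truncate_def)
  finally show ?thesis by (simp add: truncate_def)
qed

text \<open>Both sides are the same finite combination of entries of x, with coefficients from the
  expansion of the product of two coefficients. No finite support of x is involved.\<close>

lemma Delta_index:
  assumes x: "x \<in> linf n" and "a < n \<gamma>" "b < n \<gamma>" "p < n \<beta>" "q < n \<beta>"
  shows "Delta x (\<gamma>, \<beta>) $$ (a * n \<beta> + p, b * n \<beta> + q) = ev x (u \<beta> $$ (p, q) * u \<gamma> $$ (a, b))"
proof -
  note less = pair_index_less[OF assms(2,4)] pair_index_less[OF assms(3,5)]
  show ?thesis
    unfolding Delta_coeff_expansion[OF assms(2-5), symmetric] Delta_index_support[OF x less] clinear_sum[OF clinear_ev]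
      clinear_scale[OF clinear_ev] scaleC_complex_def
    by (intro sum.cong refl) (simp add: ev_coeff)
qed

end

section \<open>Kronecker products and block decompositions of the Fourier transform\<close>

lemma kron_mult:
  fixes A B C D :: "complex mat"
  assumes A: "A \<in> carrier_mat m m" and C: "C \<in> carrier_mat m m" and B: "B \<in> carrier_mat k k" and D: "D \<in> carrier_mat k k"
  shows "kron A B * kron C D = kron (A * C) (B * D)"
proof (cases "k = 0")
  case True
  then show ?thesis using assms by (intro eq_matI) (auto simp: dim_kron)
next
  case False
  then have k: "0 < k" by simp
  note AB = kron_carrier[OF A B] and CD = kron_carrier[OF C D]
    and AC = mult_carrier_square[OF A C] and BD = mult_carrier_square[OF B D]
  show ?thesis
  proof (rule eq_matI)
    fix r s assume "r < dim_row (kron (A * C) (B * D))" "s < dim_col (kron (A * C) (B * D))"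
    then have rs: "r < m * k" "s < m * k" using assms by (auto simp: dim_kron)
    have d: "r div k < m" "s div k < m" using rs by (simp_all add: less_mult_imp_div_less)
    have "(kron A B * kron C D) $$ (r, s) = (\<Sum>t<m * k. A $$ (r div k, t div k) * B $$ (r mod k, t mod k) * (C $$ (t div k, s div k) * D $$ (t mod k, s mod k)))"
      unfolding index_mult_mat_sum[OF AB CD rs] using rs
      by (intro sum.cong refl) (simp add: index_kron_div_mod[OF A B] index_kron_div_mod[OF C D])
    also have "\<dots> = (\<Sum>i<m. \<Sum>j<k. A $$ (r div k, i) * B $$ (r mod k, j) * (C $$ (i, s div k) * D $$ (j, s mod k)))"
      by (rule sum_lessThan_mult[OF k, where f = "\<lambda>i j. A $$ (r div k, i) * B $$ (r mod k, j) * (C $$ (i, s div k) * D $$ (j, s mod k))"])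
    also have "\<dots> = (\<Sum>i<m. A $$ (r div k, i) * C $$ (i, s div k)) * (\<Sum>j<k. B $$ (r mod k, j) * D $$ (j, s mod k))"
      unfolding sum_product by (intro sum.cong refl) simp
    also have "\<dots> = (A * C) $$ (r div k, s div k) * (B * D) $$ (r mod k, s mod k)"
      using k by (simp only: index_mult_mat_sum[OF A C d] index_mult_mat_sum[OF B D] mod_less_divisor)
    finally show "(kron A B * kron C D) $$ (r, s) = kron (A * C) (B * D) $$ (r, s)"
      using rs by (simp only: index_kron_div_mod[OF AC BD])
  qed (use assms in \<open>auto simp: dim_kron\<close>)
qed

lemma kron_one: "kron (1\<^sub>m m) (1\<^sub>m k) = (1\<^sub>m (m * k) :: complex mat)"
proof (cases "k = 0")
  case False
  show ?thesis
  proof (rule eq_matI)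
    fix r s assume "r < dim_row (1\<^sub>m (m * k) :: complex mat)" "s < dim_col (1\<^sub>m (m * k) :: complex mat)"
    then have rs: "r < m * k" "s < m * k" by auto
    then have "r div k < m" "s div k < m" by (simp_all add: less_mult_imp_div_less)
    moreover have "r = s \<longleftrightarrow> r div k = s div k \<and> r mod k = s mod k" by (metis div_mult_mod_eq)
    ultimately show "kron (1\<^sub>m m) (1\<^sub>m k) $$ (r, s) = (1\<^sub>m (m * k) :: complex mat) $$ (r, s)"
      using rs False by (simp add: index_kron_div_mod[OF one_carrier_mat one_carrier_mat])
  qed (simp_all add: dim_kron)
qed (auto simp: dim_kron intro!: eq_matI)

context discrete_quantum_group
begin

lemma block_zero: "block (0\<^sub>m (n \<alpha>) (n \<alpha>)) \<alpha> = 0"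
  by (simp add: block_def)

lemma hat_eq_sum:
  assumes x: "x \<in> c00 n" and F: "finite F" "\<And>\<alpha>. \<alpha> \<notin> F \<Longrightarrow> x \<alpha> = 0\<^sub>m (n \<alpha>) (n \<alpha>)"
  shows "hat x = (\<Sum>\<alpha>\<in>F. dimq rho \<alpha> *\<^sub>C block (x \<alpha> * rho \<alpha>) \<alpha>)"
  unfolding hat_def
proof (rule sum.mono_neutral_left[OF F(1)])
  show "{\<alpha>. x \<alpha> \<noteq> 0\<^sub>m (n \<alpha>) (n \<alpha>)} \<subseteq> F" using F(2) by blast
  show "\<forall>\<alpha>\<in>F - {\<alpha>. x \<alpha> \<noteq> 0\<^sub>m (n \<alpha>) (n \<alpha>)}. dimq rho \<alpha> *\<^sub>C block (x \<alpha> * rho \<alpha>) \<alpha> = 0"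
    using left_mult_zero_mat[OF rho_carrier] by (auto simp: block_zero)
qed

lemma hat_truncate_single: "fam_carrier x \<Longrightarrow> hat (truncate {\<alpha>} x) = dimq rho \<alpha> *\<^sub>C block (x \<alpha> * rho \<alpha>) \<alpha>"
  using hat_eq_sum[OF truncate_c00[of "{\<alpha>}" x], of "{\<alpha>}"] by (simp add: truncate_def)

lemma hat_sum_truncate:
  assumes "x \<in> c00 n" "finite F" "\<And>\<alpha>. \<alpha> \<notin> F \<Longrightarrow> x \<alpha> = 0\<^sub>m (n \<alpha>) (n \<alpha>)"
  shows "hat x = (\<Sum>\<alpha>\<in>F. hat (truncate {\<alpha>} x))"
  using hat_truncate_single[OF c00_fam_carrier[OF assms(1)]] hat_eq_sum[OF assms] by simp

lemma ev_truncate_sum: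
  assumes "finite F"
  shows "ev (truncate F x) c = (\<Sum>\<alpha>\<in>F. ev (truncate {\<alpha>} x) c)"
proof (rule clinear_eq_on_coeffs[where f = "ev (truncate F x)" and g = "\<lambda>c. \<Sum>\<alpha>\<in>F. ev (truncate {\<alpha>} x) c", OF clinear_ev])
  show "clinear (\<lambda>c. \<Sum>\<alpha>\<in>F. ev (truncate {\<alpha>} x) c)"
    unfolding clinear_def by (simp add: clinear_add[OF clinear_ev] clinear_scale[OF clinear_ev] sum.distrib scaleC_complex_def sum_distrib_left)
  fix \<alpha> i j assume ij: "i < n \<alpha>" "j < n \<alpha>"
  have "(\<Sum>\<beta>\<in>F. ev (truncate {\<beta>} x) (u \<alpha> $$ (i, j))) = (\<Sum>\<beta>\<in>F. if \<alpha> = \<beta> then x \<alpha> $$ (i, j) else 0)"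
    using ij by (intro sum.cong refl) (simp add: ev_coeff truncate_def)
  then show "ev (truncate F x) (u \<alpha> $$ (i, j)) = (\<Sum>\<beta>\<in>F. ev (truncate {\<beta>} x) (u \<alpha> $$ (i, j)))"
    using assms ij by (simp add: sum.delta' ev_coeff truncate_def)
qed

abbreviation "rho_conj \<equiv> cmap (\<lambda>\<alpha>. rinv \<alpha>) rho"

text \<open>Under the trace with \<rho>, exchanging x and y conjugates y by \<rho>; the transpose of
  this conjugation acts on the Fourier transform of x.\<close>

lemma haar_left:
  assumes x: "x \<in> c00 n" and y: "fam_carrier y"
  shows "haar rho (fam_mult x y) = ev y (rho_conj (hat x))"
proof -
  note xc = fam_carrierD[OF c00_fam_carrier[OF x]] and yc = fam_carrierD[OF y]
  note c = xc yc rho_carrier rinv_carrier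
  have tr: "mat_trace (rho \<alpha> * (x \<alpha> * y \<alpha>)) = mat_trace (rho \<alpha> * (rinv \<alpha> * y \<alpha> * rho \<alpha> * x \<alpha>))" for \<alpha>
  proof -
    have "rho \<alpha> * (rinv \<alpha> * y \<alpha> * rho \<alpha> * x \<alpha>) = (rho \<alpha> * rinv \<alpha>) * (y \<alpha> * (rho \<alpha> * x \<alpha>))"
      using c[of \<alpha>] by (simp only: assoc_mult_square[of _ "n \<alpha>"] mult_carrier_square)
    also have "\<dots> = y \<alpha> * (rho \<alpha> * x \<alpha>)"
      unfolding rho_rinv by (rule left_mult_one_mat[OF mult_carrier_square[OF yc mult_carrier_square[OF rho_carrier xc]]])
    also have "mat_trace \<dots> = mat_trace (rho \<alpha> * x \<alpha> * y \<alpha>)"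
      by (rule mat_trace_cyclic[OF yc mult_carrier_square[OF rho_carrier xc]])
    finally show ?thesis by (simp only: assoc_mult_square[OF rho_carrier xc yc])
  qed
  have "haar rho (fam_mult x y) = haar rho (fam_mult (\<lambda>\<alpha>. rinv \<alpha> * y \<alpha> * rho \<alpha>) x)"
    unfolding haar_def fam_mult_def tr ..
  also have "\<dots> = ev (\<lambda>\<alpha>. rinv \<alpha> * y \<alpha> * rho \<alpha>) (hat x)"
    by (rule ev_hat[OF x, symmetric]) (intro fam_carrier_mult fam_carrier_rho y)
  also have "\<dots> = ev y (rho_conj (hat x))"
    by (rule ev_cmap[OF fam_carrier_rho(2,1) y, symmetric])
  finally show ?thesis .
qed

lemma ev_hat_swap: "x \<in> c00 n \<Longrightarrow> y \<in> c00 n \<Longrightarrow> ev y (rho_conj (hat x)) = ev x (hat y)"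
  using haar_left[of x y] ev_hat[of y x] c00_fam_carrier by simp

subsection \<open>Convolution operators\<close>

text \<open>The convolution operator with symbol \<open>P\<close> is right translation by this element.\<close>

definition kernel :: "('i \<Rightarrow> complex mat) \<Rightarrow> 'a" where
  "kernel P = antipode_inv (cmap (\<lambda>\<alpha>. rinv \<alpha>) (\<lambda>\<alpha>. rinv \<alpha>) (hat P))"

text \<open>This explains the formula for \<open>kernel\<close>: its antipode is
  \<open>hat P\<close> multiplied by \<rho>^-1 on both sides, which is the form that the modular
  property of h moves from the left end of a product to the right end as
  \<open>hat P\<close>.\<close>

lemma ev_mult_kernel: "x \<in> c00 n \<Longrightarrow> ev x (c * kernel P) = h (antipode c * hat x * hat P)"
  using h_mult_commute[of "antipode c * hat x" "hat P"]
  by (simp add: ev_eq_h kernel_def antipode_mult mult.assoc)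

text \<open>Both sides are one Haar value, reached from the left by applying the inverse antipode
  under h and from the right by \<open>ev_mult_kernel\<close>.\<close>

lemma ev_hat_mult_hat:
  assumes x: "x \<in> c00 n" and y: "y \<in> c00 n"
  shows "ev y (hat x * hat P) = ev x (rho_conj (hat y) * kernel P)"
proof -
  have "ev y (hat x * hat P) = h (antipode (hat x * hat P) * hat y)" by (rule ev_eq_h[OF y])
  also have "\<dots> = h (antipode_inv (antipode (hat x * hat P) * hat y))" by (simp only: h_antipode_inv)
  also have "\<dots> = h (antipode (rho_conj (hat y)) * hat x * hat P)"
    by (simp add: antipode_inv_mult antipode_inv_def[symmetric] mult.assoc)
  finally show ?thesis by (simp only: ev_mult_kernel[OF x])
qed

text \<open>Composition with the antipode of the function algebra. By \<open>co_antipode_S\<close>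
  it undoes the antipode \<open>S\<close> of the dual on c00.\<close>

definition co_antipode :: "('i \<Rightarrow> complex mat) \<Rightarrow> 'i \<Rightarrow> complex mat" where
  "co_antipode x \<alpha> = mat (n \<alpha>) (n \<alpha>) (\<lambda>(i, j). ev x (antipode (u \<alpha> $$ (i, j))))"

lemma ev_co_antipode: "ev (co_antipode x) c = ev x (antipode c)"
  by (rule clinear_eq_on_coeffs[where f = "ev (co_antipode x)" and g = "\<lambda>c. ev x (antipode c)",
    OF clinear_ev clinear_comp[OF clinear_ev antipode_linear]]) (simp add: ev_coeff co_antipode_def)

lemma c00_if_finite:
  assumes "finite {\<beta>. \<exists>i<n \<beta>. \<exists>j<n \<beta>. f \<beta> i j \<noteq> 0}"
  shows "(\<lambda>\<alpha>. mat (n \<alpha>) (n \<alpha>) (\<lambda>(i, j). f \<alpha> i j)) \<in> c00 n"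
  unfolding c00_iff fam_carrier_def
  by (intro conjI exI[of _ "{\<beta>. \<exists>i<n \<beta>. \<exists>j<n \<beta>. f \<beta> i j \<noteq> 0}"] assms) (auto intro!: eq_matI)

text \<open>Invariance of h under the inverse antipode rewrites the values as Haar values of a fixed
  element times antipodes of coefficients, which vanish outside finitely many blocks.\<close>

lemma co_antipode_c00:
  assumes x: "x \<in> c00 n"
  shows "co_antipode x \<in> c00 n"
proof -
  have "ev x (antipode c) = h (antipode_inv (hat x) * antipode c)" for c
    using h_antipode_inv[of "antipode (antipode c) * hat x"] by (simp add: ev_eq_h[OF x] antipode_inv_mult)
  then show ?thesis
    unfolding co_antipode_def[abs_def] using finite_h_right[of "antipode_inv (hat x)"] by (intro c00_if_finite) simp
qed

text \<open>At c = 1 the formula of \<open>ev_mult_kernel\<close> is the Haar value of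
  \<open>hat x * hat P\<close>, which the inversion formula for P turns into a pairing of P with an
  antipode.\<close>

lemma kernel_eq_hat:
  assumes P: "P \<in> c00 n"
  shows "kernel P = hat (co_antipode P)"
proof (rule ev_eqI)
  fix x assume x: "x \<in> c00 n"
  have "ev x (kernel P) = h (hat x * hat P)"
    using ev_mult_kernel[OF x, of 1 P] antipode_u[of 0 triv 0] by (simp add: u_triv)
  also have "\<dots> = ev P (antipode (rho_conj (hat x)))"
    unfolding antipode_inv_def[symmetric] by (simp add: ev_eq_h[OF P])
  also have "\<dots> = ev x (hat (co_antipode P))"
    unfolding ev_co_antipode[symmetric] by (rule ev_hat_swap[OF x co_antipode_c00[OF P]])
  finally show "ev x (kernel P) = ev x (hat (co_antipode P))" .
qed

definition rtrans :: "'a \<Rightarrow> ('i \<Rightarrow> complex mat) \<Rightarrow> 'i \<Rightarrow> complex mat" where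
  "rtrans c x \<beta> = mat (n \<beta>) (n \<beta>) (\<lambda>(p, q). ev x (u \<beta> $$ (p, q) * c))"

lemma ev_rtrans: "ev (rtrans c x) b = ev x (b * c)"
  by (rule clinear_eq_on_coeffs[where f = "ev (rtrans c x)" and g = "\<lambda>b. ev x (b * c)",
    OF clinear_ev clinear_comp[OF clinear_ev clinear_times_left[OF clinear_ident]]]) (simp add: ev_coeff rtrans_def)

text \<open>For a coefficient (a, b) of \<open>u \<gamma>\<close> the translate in block \<beta> is
  the (a, b) corner of \<open>Delta x\<close> at (\<gamma>, \<beta>), so the bound for
  \<open>Delta x\<close> serves all \<beta> at once; general c follow by linearity.\<close>

lemma rtrans_linf:
  assumes x: "x \<in> linf n"
  shows "rtrans c x \<in> linf n"
proof (induction c rule: coeff_induct)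
  case (coeff \<gamma> a b)
  obtain C where C: "0 \<le> C" "\<And>k v. (\<Sum>i<dim2 n k. (cmod (\<Sum>j<dim2 n k. Delta x k $$ (i, j) * v j))\<^sup>2) \<le> C * (\<Sum>i<dim2 n k. (cmod (v i))\<^sup>2)"
    by (rule linf_bound[OF Delta_linf[OF x]], rule that)
  show ?case
  proof (rule linfI[where C = C])
    show "rtrans (u \<gamma> $$ (a, b)) x k \<in> carrier_mat (n k) (n k)" for k by (simp add: rtrans_def)
    fix \<beta> and v :: "nat \<Rightarrow> complex"
    let ?D = "Delta x (\<gamma>, \<beta>)"
    \<comment> \<open>The vector v placed in slot b of the product index, an isometric
      embedding.\<close>
    define w where "w s = (if s div n \<beta> = b then v (s mod n \<beta>) else 0)" for s
    have sum_w: "(\<Sum>s<n \<gamma> * n \<beta>. g s * w s) = (\<Sum>q<n \<beta>. g (b * n \<beta> + q) * v q)" for g :: "nat \<Rightarrow> complex"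
    proof -
      have "(\<Sum>s<n \<gamma> * n \<beta>. g s * w s) = (\<Sum>s<n \<gamma> * n \<beta>. g (s div n \<beta> * n \<beta> + s mod n \<beta>) * (if s div n \<beta> = b then v (s mod n \<beta>) else 0))"
        by (simp add: w_def)
      also have "\<dots> = (\<Sum>i<n \<gamma>. \<Sum>q<n \<beta>. g (i * n \<beta> + q) * (if i = b then v q else 0))"
        by (rule sum_lessThan_mult[OF n_pos, where f = "\<lambda>i q. g (i * n \<beta> + q) * (if i = b then v q else 0)"])
      also have "\<dots> = (\<Sum>i<n \<gamma>. if i = b then (\<Sum>q<n \<beta>. g (b * n \<beta> + q) * v q) else 0)"
        by (intro sum.cong refl) simp
      finally show ?thesis using coeff by (simp add: sum.delta)
    qed
    have norm_w: "(\<Sum>s<n \<gamma> * n \<beta>. (cmod (w s))\<^sup>2) = (\<Sum>q<n \<beta>. (cmod (v q))\<^sup>2)"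
    proof -
      have "(\<Sum>s<n \<gamma> * n \<beta>. (cmod (w s))\<^sup>2) = (\<Sum>i<n \<gamma>. \<Sum>q<n \<beta>. (cmod (if i = b then v q else 0))\<^sup>2)"
        unfolding w_def by (rule sum_lessThan_mult[OF n_pos, where f = "\<lambda>i q. (cmod (if i = b then v q else 0))\<^sup>2"])
      also have "\<dots> = (\<Sum>i<n \<gamma>. if i = b then (\<Sum>q<n \<beta>. (cmod (v q))\<^sup>2) else 0)"
        by (intro sum.cong refl) simp
      finally show ?thesis using coeff by (simp add: sum.delta)
    qed
    have "(\<Sum>p<n \<beta>. (cmod (\<Sum>q<n \<beta>. rtrans (u \<gamma> $$ (a, b)) x \<beta> $$ (p, q) * v q))\<^sup>2)
       = (\<Sum>p<n \<beta>. (cmod (\<Sum>s<n \<gamma> * n \<beta>. ?D $$ (a * n \<beta> + p, s) * w s))\<^sup>2)"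
    proof (rule sum.cong[OF refl], rule arg_cong[of _ _ "\<lambda>z. (cmod z)\<^sup>2"])
      fix p assume "p \<in> {..<n \<beta>}"
      then show "(\<Sum>q<n \<beta>. rtrans (u \<gamma> $$ (a, b)) x \<beta> $$ (p, q) * v q) = (\<Sum>s<n \<gamma> * n \<beta>. ?D $$ (a * n \<beta> + p, s) * w s)"
        using coeff unfolding sum_w by (intro sum.cong refl) (simp add: rtrans_def Delta_index[OF x])
    qed
    also have "\<dots> = (\<Sum>i<n \<gamma>. if i = a then (\<Sum>p<n \<beta>. (cmod (\<Sum>s<n \<gamma> * n \<beta>. ?D $$ (i * n \<beta> + p, s) * w s))\<^sup>2) else 0)"
      using coeff by (simp add: sum.delta)
    also have "\<dots> \<le> (\<Sum>i<n \<gamma>. (\<Sum>p<n \<beta>. (cmod (\<Sum>s<n \<gamma> * n \<beta>. ?D $$ (i * n \<beta> + p, s) * w s))\<^sup>2))"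
      by (intro sum_mono) (auto intro: sum_nonneg)
    also have "\<dots> = (\<Sum>r<n \<gamma> * n \<beta>. (cmod (\<Sum>s<n \<gamma> * n \<beta>. ?D $$ (r div n \<beta> * n \<beta> + r mod n \<beta>, s) * w s))\<^sup>2)"
      by (rule sum_lessThan_mult[OF n_pos, symmetric])
    also have "\<dots> = (\<Sum>r<n \<gamma> * n \<beta>. (cmod (\<Sum>s<n \<gamma> * n \<beta>. ?D $$ (r, s) * w s))\<^sup>2)" by simp
    also have "\<dots> \<le> C * (\<Sum>s<n \<gamma> * n \<beta>. (cmod (w s))\<^sup>2)"
      using C(2)[of "(\<gamma>, \<beta>)" w] by (simp add: dim2_def)
    finally show "(\<Sum>p<n \<beta>. (cmod (\<Sum>q<n \<beta>. rtrans (u \<gamma> $$ (a, b)) x \<beta> $$ (p, q) * v q))\<^sup>2) \<le> C * (\<Sum>i<n \<beta>. (cmod (v i))\<^sup>2)"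
      unfolding norm_w .
  qed
next
  case (add c d)
  have "rtrans (c + d) x = fam_add (rtrans c x) (rtrans d x)"
    unfolding rtrans_def fam_add_def by (intro ext eq_matI) (auto simp: distrib_left clinear_add[OF clinear_ev])
  then show ?case using add linf_add by metis
next
  case (scale k c)
  have "rtrans (k *\<^sub>C c) x = fam_scale k (rtrans c x)"
    unfolding rtrans_def fam_scale_def
    by (intro ext eq_matI) (auto simp: mult_scaleC_right clinear_scale[OF clinear_ev] scaleC_complex_def)
  then show ?case using scale linf_scale by metis
qed

text \<open>Cyclicity of the trace brings P \<otimes> x in front of the weights. The trace against
  \<open>Delta y\<close> is then the pairing of y with a product of blocks, that of x before that of
  P because \<open>Delta\<close> reverses the order.\<close>

lemma haar2_term:
  assumes y: "y \<in> c00 n" and P: "fam_carrier P" and x: "fam_carrier x"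
  shows "mat_trace (rho \<gamma>) * mat_trace (rho \<beta>) *
      mat_trace (kron (rho \<gamma>) (rho \<beta>) * fam_mult (Delta y) (fam_kron P x) (\<gamma>, \<beta>))
    = ev y (hat (truncate {\<beta>} x) * hat (truncate {\<gamma>} P))"
proof -
  let ?m = "n \<gamma> * n \<beta>"
  let ?D = "Delta y (\<gamma>, \<beta>)"
  have yl: "y \<in> linf n" using y c00_subset_linf by blast
  note Pc = fam_carrierD[OF P] and xc = fam_carrierD[OF x]
  have D: "?D \<in> carrier_mat ?m ?m" by (rule Delta_carrier[OF yl])
  note R = kron_carrier[OF rho_carrier rho_carrier, of \<gamma> \<beta>] and K = kron_carrier[OF Pc xc, of \<gamma> \<beta>]
  have PR: "P \<gamma> * rho \<gamma> \<in> carrier_mat (n \<gamma>) (n \<gamma>)" and XR: "x \<beta> * rho \<beta> \<in> carrier_mat (n \<beta>) (n \<beta>)"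
    by (rule mult_carrier_square[OF Pc rho_carrier], rule mult_carrier_square[OF xc rho_carrier])
  have "mat_trace (kron (rho \<gamma>) (rho \<beta>) * (?D * kron (P \<gamma>) (x \<beta>)))
      = mat_trace (kron (rho \<gamma>) (rho \<beta>) * ?D * kron (P \<gamma>) (x \<beta>))"
    by (simp only: assoc_mult_square[OF R D K])
  also have "\<dots> = mat_trace (kron (P \<gamma>) (x \<beta>) * (kron (rho \<gamma>) (rho \<beta>) * ?D))"
    by (rule mat_trace_cyclic[OF mult_carrier_square[OF R D] K])
  also have "kron (P \<gamma>) (x \<beta>) * (kron (rho \<gamma>) (rho \<beta>) * ?D) = kron (P \<gamma> * rho \<gamma>) (x \<beta> * rho \<beta>) * ?D"
    by (simp only: assoc_mult_square[OF K R D, symmetric] kron_mult[OF Pc rho_carrier xc rho_carrier])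
  also have "mat_trace \<dots> = (\<Sum>s<?m. \<Sum>r<?m. kron (P \<gamma> * rho \<gamma>) (x \<beta> * rho \<beta>) $$ (s, r) * ?D $$ (r, s))"
    by (rule mat_trace_mult[OF kron_carrier[OF PR XR] D])
  also have "\<dots> = (\<Sum>s<?m. \<Sum>r<?m. (P \<gamma> * rho \<gamma>) $$ (s div n \<beta>, r div n \<beta>) * (x \<beta> * rho \<beta>) $$ (s mod n \<beta>, r mod n \<beta>)
        * ?D $$ (r div n \<beta> * n \<beta> + r mod n \<beta>, s div n \<beta> * n \<beta> + s mod n \<beta>))"
    by (intro sum.cong refl) (simp add: index_kron_div_mod[OF PR XR])
  also have "\<dots> = (\<Sum>s<?m. \<Sum>a<n \<gamma>. \<Sum>p<n \<beta>. (P \<gamma> * rho \<gamma>) $$ (s div n \<beta>, a) * (x \<beta> * rho \<beta>) $$ (s mod n \<beta>, p)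
        * ?D $$ (a * n \<beta> + p, s div n \<beta> * n \<beta> + s mod n \<beta>))"
    by (intro sum.cong refl sum_lessThan_mult[OF n_pos])
  also have "\<dots> = (\<Sum>b<n \<gamma>. \<Sum>q<n \<beta>. \<Sum>a<n \<gamma>. \<Sum>p<n \<beta>. (P \<gamma> * rho \<gamma>) $$ (b, a) * (x \<beta> * rho \<beta>) $$ (q, p)
        * ?D $$ (a * n \<beta> + p, b * n \<beta> + q))"
    by (rule sum_lessThan_mult[OF n_pos])
  also have "\<dots> = (\<Sum>b<n \<gamma>. \<Sum>q<n \<beta>. \<Sum>a<n \<gamma>. \<Sum>p<n \<beta>. (P \<gamma> * rho \<gamma>) $$ (b, a) * (x \<beta> * rho \<beta>) $$ (q, p)
        * ev y (u \<beta> $$ (p, q) * u \<gamma> $$ (a, b)))"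
    by (intro sum.cong refl) (simp add: Delta_index[OF yl])
  also have "\<dots> = (\<Sum>b<n \<gamma>. \<Sum>a<n \<gamma>. \<Sum>q<n \<beta>. \<Sum>p<n \<beta>. (P \<gamma> * rho \<gamma>) $$ (b, a) * (x \<beta> * rho \<beta>) $$ (q, p)
        * ev y (u \<beta> $$ (p, q) * u \<gamma> $$ (a, b)))"
    by (intro sum.cong refl sum.swap)
  also have "\<dots> = (\<Sum>a<n \<gamma>. \<Sum>b<n \<gamma>. \<Sum>q<n \<beta>. \<Sum>p<n \<beta>. (P \<gamma> * rho \<gamma>) $$ (b, a) * (x \<beta> * rho \<beta>) $$ (q, p)
        * ev y (u \<beta> $$ (p, q) * u \<gamma> $$ (a, b)))"
    by (rule sum.swap)
  also have "\<dots> = (\<Sum>a<n \<gamma>. \<Sum>b<n \<gamma>. \<Sum>p<n \<beta>. \<Sum>q<n \<beta>. (P \<gamma> * rho \<gamma>) $$ (b, a) * (x \<beta> * rho \<beta>) $$ (q, p)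
        * ev y (u \<beta> $$ (p, q) * u \<gamma> $$ (a, b)))"
    by (intro sum.cong refl sum.swap)
  also have "\<dots> = ev y (block (x \<beta> * rho \<beta>) \<beta> * block (P \<gamma> * rho \<gamma>) \<gamma>)"
    by (simp add: block_def sum_distrib_left sum_distrib_right mult_scaleC_left mult_scaleC_right scaleC_scaleC
      clinear_sum[OF clinear_ev] clinear_scale[OF clinear_ev] scaleC_complex_def mult_ac)
  finally show ?thesis
    by (simp add: fam_mult_def fam_kron_def hat_truncate_single[OF x] hat_truncate_single[OF P]
      mult_scaleC_left mult_scaleC_right clinear_scale[OF clinear_ev] scaleC_complex_def dimq_def)
qed

text \<open>P restricts \<gamma> to finitely many blocks, and for each of these a fixed element of
  the function algebra sees only finitely many \<beta>. The double sum is thus finite although x may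
  have infinite support.\<close>

lemma haar2_convolution:
  assumes y: "y \<in> c00 n" and P: "P \<in> c00 n" and x: "x \<in> linf n"
  shows "haar2 rho (fam_mult (Delta y) (fam_kron P x)) = ev x (rho_conj (hat y) * kernel P)"
proof -
  note Pf = c00_fam_carrier[OF P] and xf = linf_fam_carrier[OF x]
  obtain G where G: "finite G" "\<And>\<alpha>. \<alpha> \<notin> G \<Longrightarrow> P \<alpha> = 0\<^sub>m (n \<alpha>) (n \<alpha>)"
    using P unfolding c00_iff by blast
  define c where "c \<gamma> = rho_conj (hat y) * kernel (truncate {\<gamma>} P)" for \<gamma>
  have summand: "mat_trace (rho \<gamma>) * mat_trace (rho \<beta>) * mat_trace (kron (rho \<gamma>) (rho \<beta>) * fam_mult (Delta y) (fam_kron P x) (\<gamma>, \<beta>))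
      = ev (truncate {\<beta>} x) (c \<gamma>)" for \<gamma> \<beta>
    unfolding haar2_term[OF y Pf xf] c_def
    by (rule ev_hat_mult_hat[OF truncate_c00[OF _ xf] y]) simp
  have csum: "rho_conj (hat y) * kernel P = (\<Sum>\<gamma>\<in>G. c \<gamma>)"
  proof -
    have "kernel P = (\<Sum>\<gamma>\<in>G. kernel (truncate {\<gamma>} P))"
      unfolding kernel_def
      by (subst hat_sum_truncate[OF P G]) (simp_all add: clinear_sum[OF clinear_cmap] clinear_sum[OF clinear_antipode_inv])
    then show ?thesis by (simp add: c_def sum_distrib_left)
  qed
  have "\<forall>\<gamma>. \<exists>F. finite F \<and> (\<forall>x y. (\<forall>\<alpha>\<in>F. x \<alpha> = y \<alpha>) \<longrightarrow> ev x (c \<gamma>) = ev y (c \<gamma>))"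
    using ev_support by blast
  then obtain F where F: "\<And>\<gamma>. finite (F \<gamma>)" "\<And>\<gamma> x y. (\<And>\<alpha>. \<alpha> \<in> F \<gamma> \<Longrightarrow> x \<alpha> = y \<alpha>) \<Longrightarrow> ev x (c \<gamma>) = ev y (c \<gamma>)"
    by metis
  \<comment> \<open>All blocks seen by any of the finitely many elements
    \<open>c \<gamma>\<close>.\<close>
  define B where "B = (\<Union>\<gamma>\<in>G. F \<gamma>)"
  have B: "finite B" using G(1) F(1) by (simp add: B_def)
  have ev0: "ev (\<lambda>\<alpha>. 0\<^sub>m (n \<alpha>) (n \<alpha>)) b = 0" for b
    using ev_truncate_sum[of "{}" x b] by (simp add: truncate_def[abs_def])
  have kernel0: "kernel (truncate {\<gamma>} P) = 0" if "\<gamma> \<notin> G" for \<gamma>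
    unfolding kernel_def hat_truncate_single[OF Pf] G(2)[OF that] left_mult_zero_mat[OF rho_carrier] block_zero
    by (simp add: clinear_zero[OF clinear_cmap] clinear_zero[OF clinear_antipode_inv])
  have "haar2 rho (fam_mult (Delta y) (fam_kron P x)) = (\<Sum>\<^sub>\<infinity>(\<gamma>, \<beta>). ev (truncate {\<beta>} x) (c \<gamma>))"
    unfolding haar2_def summand ..
  also have "\<dots> = (\<Sum>(\<gamma>, \<beta>)\<in>G \<times> B. ev (truncate {\<beta>} x) (c \<gamma>))"
  proof (rule infsum_eq_sum)
    show "finite (G \<times> B)" using G(1) B by simp
    fix \<kappa> assume k: "\<kappa> \<notin> G \<times> B"
    obtain \<gamma> \<beta> where \<kappa>: "\<kappa> = (\<gamma>, \<beta>)" by (cases \<kappa>)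
    show "(case \<kappa> of (\<gamma>, \<beta>) \<Rightarrow> ev (truncate {\<beta>} x) (c \<gamma>)) = 0"
    proof (cases "\<gamma> \<in> G")
      case True
      then have "\<beta> \<notin> F \<gamma>" using k \<kappa> by (auto simp: B_def)
      then have "ev (truncate {\<beta>} x) (c \<gamma>) = ev (\<lambda>\<alpha>. 0\<^sub>m (n \<alpha>) (n \<alpha>)) (c \<gamma>)"
        by (intro F(2)) (auto simp: truncate_def)
      then show ?thesis by (simp add: \<kappa> ev0)
    next
      case False
      then show ?thesis by (simp add: \<kappa> c_def kernel0 clinear_zero[OF clinear_ev])
    qed
  qed
  also have "\<dots> = (\<Sum>\<gamma>\<in>G. \<Sum>\<beta>\<in>B. ev (truncate {\<beta>} x) (c \<gamma>))"
    by (simp add: sum.cartesian_product)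
  also have "\<dots> = (\<Sum>\<gamma>\<in>G. ev x (c \<gamma>))"
  proof (intro sum.cong refl)
    fix \<gamma> assume "\<gamma> \<in> G"
    then have "ev (truncate B x) (c \<gamma>) = ev x (c \<gamma>)"
      by (intro F(2)) (auto simp: truncate_def B_def)
    then show "(\<Sum>\<beta>\<in>B. ev (truncate {\<beta>} x) (c \<gamma>)) = ev x (c \<gamma>)"
      by (simp add: ev_truncate_sum[OF B])
  qed
  finally show ?thesis by (simp add: csum clinear_sum[OF clinear_ev])
qed

text \<open>Nondegeneracy of the weight against c00, which gives uniqueness in the description of
  the convolution.\<close>

lemma haar_separates:
  assumes z: "fam_carrier z" and z': "fam_carrier z'" and eq: "\<And>y. y \<in> c00 n \<Longrightarrow> haar rho (fam_mult y z) = haar rho (fam_mult y z')"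
  shows "z = z'"
proof (rule fam_eqI[OF z z'])
  fix \<alpha> i j assume ij: "i < n \<alpha>" "j < n \<alpha>"
  define E where "E = mat (n \<alpha>) (n \<alpha>) (\<lambda>(r, s). if r = j \<and> s = i then 1 else 0 :: complex)"
  \<comment> \<open>The factor \<rho>^-1 cancels the density of the weight and E is a transposed
    matrix unit, so the weight of y w is dim_q times the (i, j) entry of w.\<close>
  define y where "y = truncate {\<alpha>} (\<lambda>\<beta>. if \<beta> = \<alpha> then rinv \<alpha> * E else 0\<^sub>m (n \<beta>) (n \<beta>))"
  have E: "E \<in> carrier_mat (n \<alpha>) (n \<alpha>)" by (simp add: E_def)
  have RE: "rinv \<alpha> * E \<in> carrier_mat (n \<alpha>) (n \<alpha>)" by (rule mult_carrier_square[OF rinv_carrier E])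
  have y: "y \<in> c00 n" unfolding y_def by (rule truncate_c00) (auto simp: fam_carrier_def RE)
  have "haar rho (fam_mult y w) = dimq rho \<alpha> * w \<alpha> $$ (i, j)" if w: "fam_carrier w" for w
  proof -
    note wc = fam_carrierD[OF w]
    have "haar rho (fam_mult y w) = (\<Sum>\<beta>\<in>{\<alpha>}. mat_trace (rho \<beta>) * mat_trace (rho \<beta> * (y \<beta> * w \<beta>)))"
      unfolding haar_def fam_mult_def
    proof (rule infsum_eq_sum)
      fix \<beta> assume "\<beta> \<notin> {\<alpha>}"
      then have "y \<beta> * w \<beta> = 0\<^sub>m (n \<beta>) (n \<beta>)" using wc[of \<beta>] by (simp add: y_def truncate_def)
      then show "mat_trace (rho \<beta>) * mat_trace (rho \<beta> * (y \<beta> * w \<beta>)) = 0"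
        using rho_carrier[of \<beta>] by (simp add: right_mult_zero_mat) (simp add: mat_trace_def)
    qed simp
    moreover have "rho \<alpha> * (y \<alpha> * w \<alpha>) = (rho \<alpha> * rinv \<alpha>) * (E * w \<alpha>)"
      using rho_carrier[of \<alpha>] rinv_carrier[of \<alpha>] E wc[of \<alpha>]
      by (simp add: y_def truncate_def assoc_mult_square[of _ "n \<alpha>"] mult_carrier_square)
    moreover have "(rho \<alpha> * rinv \<alpha>) * (E * w \<alpha>) = E * w \<alpha>"
      unfolding rho_rinv by (rule left_mult_one_mat[OF mult_carrier_square[OF E wc]])
    ultimately have "haar rho (fam_mult y w) = dimq rho \<alpha> * mat_trace (E * w \<alpha>)"
      by (simp add: dimq_def)
    also have "mat_trace (E * w \<alpha>) = (\<Sum>r<n \<alpha>. if r = j then (\<Sum>s<n \<alpha>. if s = i then w \<alpha> $$ (s, j) else 0) else 0)"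
      unfolding mat_trace_mult[OF E wc]
      by (intro sum.cong refl) (auto simp: E_def simp del: sum.delta sum.delta' intro!: sum.cong sum.neutral)
    also have "\<dots> = w \<alpha> $$ (i, j)" using ij by (simp add: sum.delta)
    finally show ?thesis .
  qed
  then have "dimq rho \<alpha> * z \<alpha> $$ (i, j) = dimq rho \<alpha> * z' \<alpha> $$ (i, j)"
    using eq[OF y] z z' by simp
  then show "z \<alpha> $$ (i, j) = z' \<alpha> $$ (i, j)" using dimq_nonzero by simp
qed

lemma haar_rtrans:
  assumes "y \<in> c00 n"
  shows "haar rho (fam_mult y (rtrans c x)) = ev x (rho_conj (hat y) * c)"
  using haar_left[OF assms, of "rtrans c x"] by (simp add: ev_rtrans fam_carrier_def rtrans_def)

theorem convolution_eq:
  assumes P: "P \<in> c00 n" and x: "x \<in> linf n"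
  shows "convolution n rho Delta P x = rtrans (kernel P) x"
  unfolding convolution_def
proof (rule the_equality)
  show "rtrans (kernel P) x \<in> linf n \<and> (\<forall>y\<in>c00 n. haar rho (fam_mult y (rtrans (kernel P) x)) = haar2 rho (fam_mult (Delta y) (fam_kron P x)))"
    by (simp add: rtrans_linf[OF x] haar_rtrans haar2_convolution[OF _ P x])
next
  fix z assume z: "z \<in> linf n \<and> (\<forall>y\<in>c00 n. haar rho (fam_mult y z) = haar2 rho (fam_mult (Delta y) (fam_kron P x)))"
  show "z = rtrans (kernel P) x"
    by (rule haar_separates) (use z in \<open>simp_all add: linf_fam_carrier rtrans_linf[OF x] haar_rtrans haar2_convolution[OF _ P x]\<close>)
qed

subsection \<open>The antipode of the dual\<close>

definition ltrans :: "'a \<Rightarrow> ('i \<Rightarrow> complex mat) \<Rightarrow> 'i \<Rightarrow> complex mat" where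
  "ltrans c x \<beta> = mat (n \<beta>) (n \<beta>) (\<lambda>(p, q). ev x (c * u \<beta> $$ (p, q)))"

lemma ev_ltrans: "ev (ltrans c x) b = ev x (c * b)"
  by (rule clinear_eq_on_coeffs[where f = "ev (ltrans c x)" and g = "\<lambda>b. ev x (c * b)",
    OF clinear_ev clinear_comp[OF clinear_ev clinear_times_right[OF clinear_ident]]]) (simp add: ev_coeff ltrans_def)

lemma ltrans_ltrans: "ltrans c (ltrans d x) = ltrans (d * c) x"
  by (simp add: ltrans_def[of _ "ltrans d x", abs_def] ltrans_def[of "d * c", abs_def] ev_ltrans mult.assoc)

lemma ltrans_c00:
  assumes x: "x \<in> c00 n"
  shows "ltrans c x \<in> c00 n"
proof -
  have "ev x (c * b) = h (antipode b * (antipode c * hat x))" for b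
    by (simp add: ev_eq_h[OF x] antipode_mult mult.assoc)
  then show ?thesis
    unfolding ltrans_def[abs_def] using finite_h_left[of "antipode c * hat x"] by (intro c00_if_finite) simp
qed

lemma dual_counit_eq: "dual_counit u a = ev a 1"
  unfolding dual_counit_def triv_def[symmetric] using ev_coeff[of 0 triv 0 a] by (simp add: u_triv)

lemma S_c00: "x \<in> c00 n \<Longrightarrow> S x \<in> c00 n"
  and S_add: "x \<in> c00 n \<Longrightarrow> y \<in> c00 n \<Longrightarrow> S (fam_add x y) = fam_add (S x) (S y)"
  and S_scale: "x \<in> c00 n \<Longrightarrow> S (fam_scale c x) = fam_scale c (S x)"
  and S_left: "a \<in> c00 n \<Longrightarrow> b \<in> c00 n \<Longrightarrow>
    c00_lift n (\<lambda>x y. fam_mult (S x) y) (fam_mult (Delta a) (fam_kron (fam_one n) b)) = fam_scale (dual_counit u a) b"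
  using S unfolding dual_antipode_def linear_map_on_def by blast+

lemma S_carrier: "x \<in> c00 n \<Longrightarrow> S x \<delta> \<in> carrier_mat (n \<delta>) (n \<delta>)"
  using fam_carrierD[OF c00_fam_carrier[OF S_c00]] .

lemma S_index_add: "x \<in> c00 n \<Longrightarrow> y \<in> c00 n \<Longrightarrow> r < n \<delta> \<Longrightarrow> s < n \<delta> \<Longrightarrow>
    S (fam_add x y) \<delta> $$ (r, s) = S x \<delta> $$ (r, s) + S y \<delta> $$ (r, s)"
  using S_carrier[of x \<delta>] S_carrier[of y \<delta>] by (simp only: S_add) (simp add: fam_add_def)

lemma S_index_scale: "x \<in> c00 n \<Longrightarrow> r < n \<delta> \<Longrightarrow> s < n \<delta> \<Longrightarrow>
    S (fam_scale c x) \<delta> $$ (r, s) = c * S x \<delta> $$ (r, s)"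
  using S_carrier[of x \<delta>] by (simp only: S_scale) (simp add: fam_scale_def)

text \<open>The antipode identity with b the unit of block \<delta>, read at entry (r, s). By
  \<open>Delta_index\<close>, fixing entry (p, s) of block \<delta> in the right leg of
  \<open>Delta a\<close> leaves in the left leg the translate of a by u_ps.\<close>

lemma S_ltrans_sum:
  assumes a: "a \<in> c00 n" and rs: "r < n \<delta>" "s < n \<delta>"
  shows "(\<Sum>p<n \<delta>. S (ltrans (u \<delta> $$ (p, s)) a) \<delta> $$ (r, p)) = (if r = s then ev a 1 else 0)"
proof -
  define b where "b = truncate {\<delta>} (fam_one n)"
  define t where "t = fam_mult (Delta a) (fam_kron (fam_one n) b)"
  have b: "b \<in> c00 n" unfolding b_def by (rule truncate_one_c00) simp
  have al: "a \<in> linf n" using a c00_subset_linf by blast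
  note D = Delta_carrier[OF al]
  have t1: "t (\<gamma>, \<delta>) = Delta a (\<gamma>, \<delta>)" for \<gamma>
    using right_mult_one_mat[OF D[of \<gamma> \<delta>]]
    by (simp add: t_def fam_mult_def fam_kron_def b_def truncate_def fam_one_def kron_one)
  have t0: "t (\<gamma>, \<beta>) = 0\<^sub>m (n \<gamma> * n \<beta>) (n \<gamma> * n \<beta>)" if "\<beta> \<noteq> \<delta>" for \<gamma> \<beta>
  proof -
    have "kron (1\<^sub>m (n \<gamma>)) (0\<^sub>m (n \<beta>) (n \<beta>)) = (0\<^sub>m (n \<gamma> * n \<beta>) (n \<gamma> * n \<beta>) :: complex mat)"
      using n_pos[of \<beta>] by (intro eq_matI) (auto simp: kron_def)
    then show ?thesis using that right_mult_zero_mat[OF D[of \<gamma> \<beta>]]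
      by (simp add: t_def fam_mult_def fam_kron_def b_def truncate_def fam_one_def)
  qed
  define G where "G = {\<gamma>. t (\<gamma>, \<delta>) \<noteq> 0\<^sub>m (n \<gamma> * n \<delta>) (n \<gamma> * n \<delta>)}"
  \<comment> \<open>Finiteness of the support makes the sum in \<open>c00_lift\<close> meaningful;
    it holds because, against fixed elements, h vanishes on all but finitely many blocks.\<close>
  have "G \<subseteq> (\<Union>p\<in>{..<n \<delta>}. \<Union>s\<in>{..<n \<delta>}. {\<gamma>. \<exists>i<n \<gamma>. \<exists>j<n \<gamma>. h (antipode (u \<gamma> $$ (i, j)) * (antipode (u \<delta> $$ (p, s)) * hat a)) \<noteq> 0})"
  proof (rule subsetI, rule ccontr)
    fix \<gamma> assume g: "\<gamma> \<in> G" and no: "\<gamma> \<notin> (\<Union>p\<in>{..<n \<delta>}. \<Union>s\<in>{..<n \<delta>}. {\<gamma>. \<exists>i<n \<gamma>. \<exists>j<n \<gamma>. h (antipode (u \<gamma> $$ (i, j)) * (antipode (u \<delta> $$ (p, s)) * hat a)) \<noteq> 0})"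
    have z: "ev a (u \<delta> $$ (p, s) * u \<gamma> $$ (i, j)) = 0" if "p < n \<delta>" "s < n \<delta>" "i < n \<gamma>" "j < n \<gamma>" for p s i j
      using no that by (auto simp: ev_eq_h[OF a] antipode_mult mult.assoc)
    have "Delta a (\<gamma>, \<delta>) = 0\<^sub>m (n \<gamma> * n \<delta>) (n \<gamma> * n \<delta>)"
    proof (rule eq_matI)
      fix k l assume "k < dim_row (0\<^sub>m (n \<gamma> * n \<delta>) (n \<gamma> * n \<delta>) :: complex mat)" "l < dim_col (0\<^sub>m (n \<gamma> * n \<delta>) (n \<gamma> * n \<delta>) :: complex mat)"
      then have kl: "k < n \<gamma> * n \<delta>" "l < n \<gamma> * n \<delta>" by auto
      then have d: "k div n \<delta> < n \<gamma>" "l div n \<delta> < n \<gamma>" by (simp_all add: less_mult_imp_div_less)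
      show "Delta a (\<gamma>, \<delta>) $$ (k, l) = 0\<^sub>m (n \<gamma> * n \<delta>) (n \<gamma> * n \<delta>) $$ (k, l)"
        using Delta_index[OF al d, of "k mod n \<delta>" \<delta> "l mod n \<delta>"] n_pos[of \<delta>] kl d by (simp add: z)
    qed (use D[of \<gamma> \<delta>] in auto)
    with g show False by (simp add: G_def t1)
  qed
  then have G: "finite G" by (rule finite_subset) (intro finite_UN_I finite_lessThan finite_h_left)
  have supp: "{(\<gamma>, \<beta>). t (\<gamma>, \<beta>) \<noteq> 0\<^sub>m (n \<gamma> * n \<beta>) (n \<gamma> * n \<beta>)} = (\<lambda>\<gamma>. (\<gamma>, \<delta>)) ` G"
  proof (rule Set.set_eqI)
    fix \<kappa> :: "'i \<times> 'i"
    show "\<kappa> \<in> {(\<gamma>, \<beta>). t (\<gamma>, \<beta>) \<noteq> 0\<^sub>m (n \<gamma> * n \<beta>) (n \<gamma> * n \<beta>)} \<longleftrightarrow> \<kappa> \<in> (\<lambda>\<gamma>. (\<gamma>, \<delta>)) ` G"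
      using t0[of "snd \<kappa>" "fst \<kappa>"] by (cases \<kappa>) (auto simp: G_def)
  qed
  have lift: "c00_lift n (\<lambda>x y. fam_mult (S x) y) t \<delta> $$ (r, s)
     = (\<Sum>\<gamma>\<in>G. \<Sum>i<n \<gamma>. \<Sum>j<n \<gamma>. \<Sum>p<n \<delta>. ev a (u \<delta> $$ (p, s) * u \<gamma> $$ (i, j)) * S (mat_unit n \<gamma> i j) \<delta> $$ (r, p))"
  proof -
    have "c00_lift n (\<lambda>x y. fam_mult (S x) y) t \<delta> $$ (r, s)
      = (\<Sum>\<gamma>\<in>G. \<Sum>i<n \<gamma>. \<Sum>j<n \<gamma>. \<Sum>p<n \<delta>. \<Sum>q<n \<delta>. t (\<gamma>, \<delta>) $$ (i * n \<delta> + p, j * n \<delta> + q) *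
           fam_mult (S (mat_unit n \<gamma> i j)) (mat_unit n \<delta> p q) \<delta> $$ (r, s))"
      unfolding c00_lift_def supp using rs by (simp add: sum.reindex inj_on_def)
    also have "\<dots> = (\<Sum>\<gamma>\<in>G. \<Sum>i<n \<gamma>. \<Sum>j<n \<gamma>. \<Sum>p<n \<delta>. \<Sum>q<n \<delta>.
        if q = s then ev a (u \<delta> $$ (p, s) * u \<gamma> $$ (i, j)) * S (mat_unit n \<gamma> i j) \<delta> $$ (r, p) else 0)"
    proof (intro sum.cong refl)
      fix \<gamma> i j p q assume ijpq: "i \<in> {..<n \<gamma>}" "j \<in> {..<n \<gamma>}" "p \<in> {..<n \<delta>}" "q \<in> {..<n \<delta>}"
      have E: "mat_unit n \<delta> p q \<delta> \<in> carrier_mat (n \<delta>) (n \<delta>)" by (simp add: mat_unit_def)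
      have "fam_mult (S (mat_unit n \<gamma> i j)) (mat_unit n \<delta> p q) \<delta> $$ (r, s)
         = (\<Sum>k<n \<delta>. S (mat_unit n \<gamma> i j) \<delta> $$ (r, k) * mat_unit n \<delta> p q \<delta> $$ (k, s))"
        unfolding fam_mult_def by (rule index_mult_mat_sum[OF S_carrier[OF mat_unit_c00] E rs])
      also have "\<dots> = (\<Sum>k<n \<delta>. if k = p then (if q = s then S (mat_unit n \<gamma> i j) \<delta> $$ (r, p) else 0) else 0)"
        using rs by (intro sum.cong refl) (auto simp: index_mat_unit)
      finally have "fam_mult (S (mat_unit n \<gamma> i j)) (mat_unit n \<delta> p q) \<delta> $$ (r, s) = (if q = s then S (mat_unit n \<gamma> i j) \<delta> $$ (r, p) else 0)"
        using ijpq by (simp add: sum.delta)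
      then show "t (\<gamma>, \<delta>) $$ (i * n \<delta> + p, j * n \<delta> + q) * fam_mult (S (mat_unit n \<gamma> i j)) (mat_unit n \<delta> p q) \<delta> $$ (r, s)
         = (if q = s then ev a (u \<delta> $$ (p, s) * u \<gamma> $$ (i, j)) * S (mat_unit n \<gamma> i j) \<delta> $$ (r, p) else 0)"
        using ijpq by (simp add: t1 Delta_index[OF al])
    qed
    finally show ?thesis using rs by (simp add: sum.delta)
  qed
  have expand: "S (ltrans (u \<delta> $$ (p, s)) a) \<delta> $$ (r, p)
     = (\<Sum>\<gamma>\<in>G. \<Sum>i<n \<gamma>. \<Sum>j<n \<gamma>. ev a (u \<delta> $$ (p, s) * u \<gamma> $$ (i, j)) * S (mat_unit n \<gamma> i j) \<delta> $$ (r, p))" if p: "p < n \<delta>" for p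
  proof -
    have out: "ltrans (u \<delta> $$ (p, s)) a \<gamma> = 0\<^sub>m (n \<gamma>) (n \<gamma>)" if "\<gamma> \<notin> G" for \<gamma>
    proof (rule eq_matI)
      fix i j assume "i < dim_row (0\<^sub>m (n \<gamma>) (n \<gamma>) :: complex mat)" "j < dim_col (0\<^sub>m (n \<gamma>) (n \<gamma>) :: complex mat)"
      then have ij: "i < n \<gamma>" "j < n \<gamma>" by auto
      have "ev a (u \<delta> $$ (p, s) * u \<gamma> $$ (i, j)) = t (\<gamma>, \<delta>) $$ (i * n \<delta> + p, j * n \<delta> + s)"
        using Delta_index[OF al ij p rs(2)] by (simp add: t1)
      also have "\<dots> = 0" using that pair_index_less[OF ij(1) p] pair_index_less[OF ij(2) rs(2)] by (simp add: G_def)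
      finally show "ltrans (u \<delta> $$ (p, s)) a \<gamma> $$ (i, j) = 0\<^sub>m (n \<gamma>) (n \<gamma>) $$ (i, j)" using ij by (simp add: ltrans_def)
    qed (simp_all add: ltrans_def)
    have "S (ltrans (u \<delta> $$ (p, s)) a) \<delta> $$ (r, p)
      = (\<Sum>\<gamma>\<in>G. \<Sum>i<n \<gamma>. \<Sum>j<n \<gamma>. ltrans (u \<delta> $$ (p, s)) a \<gamma> $$ (i, j) * S (mat_unit n \<gamma> i j) \<delta> $$ (r, p))"
      by (rule c00_linear_expansion[where f = "\<lambda>x. S x \<delta> $$ (r, p)", OF _ _ ltrans_c00[OF a] G out])
        (simp_all add: S_index_add S_index_scale rs p)
    also have "\<dots> = (\<Sum>\<gamma>\<in>G. \<Sum>i<n \<gamma>. \<Sum>j<n \<gamma>. ev a (u \<delta> $$ (p, s) * u \<gamma> $$ (i, j)) * S (mat_unit n \<gamma> i j) \<delta> $$ (r, p))"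
      by (intro sum.cong refl) (simp add: ltrans_def)
    finally show ?thesis .
  qed
  have "(\<Sum>p<n \<delta>. S (ltrans (u \<delta> $$ (p, s)) a) \<delta> $$ (r, p))
     = (\<Sum>p<n \<delta>. \<Sum>\<gamma>\<in>G. \<Sum>i<n \<gamma>. \<Sum>j<n \<gamma>. ev a (u \<delta> $$ (p, s) * u \<gamma> $$ (i, j)) * S (mat_unit n \<gamma> i j) \<delta> $$ (r, p))"
    by (intro sum.cong refl) (simp add: expand)
  also have "\<dots> = (\<Sum>\<gamma>\<in>G. \<Sum>p<n \<delta>. \<Sum>i<n \<gamma>. \<Sum>j<n \<gamma>. ev a (u \<delta> $$ (p, s) * u \<gamma> $$ (i, j)) * S (mat_unit n \<gamma> i j) \<delta> $$ (r, p))"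
    by (rule sum.swap)
  also have "\<dots> = (\<Sum>\<gamma>\<in>G. \<Sum>i<n \<gamma>. \<Sum>p<n \<delta>. \<Sum>j<n \<gamma>. ev a (u \<delta> $$ (p, s) * u \<gamma> $$ (i, j)) * S (mat_unit n \<gamma> i j) \<delta> $$ (r, p))"
    by (intro sum.cong refl sum.swap)
  also have "\<dots> = (\<Sum>\<gamma>\<in>G. \<Sum>i<n \<gamma>. \<Sum>j<n \<gamma>. \<Sum>p<n \<delta>. ev a (u \<delta> $$ (p, s) * u \<gamma> $$ (i, j)) * S (mat_unit n \<gamma> i j) \<delta> $$ (r, p))"
    by (intro sum.cong refl sum.swap)
  also have "\<dots> = fam_scale (dual_counit u a) b \<delta> $$ (r, s)"
    unfolding lift[symmetric] t_def S_left[OF a b] ..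
  also have "\<dots> = (if r = s then ev a 1 else 0)"
    using rs by (simp add: fam_scale_def b_def truncate_def fam_one_def dual_counit_eq)
  finally show ?thesis .
qed

text \<open>The antipode axiom for \<open>u \<delta>\<close> with the antipode removed. The factors
  appear in the order in which translations compose.\<close>

lemma antipode_inv_sum:
  assumes "p < n \<delta>" "t < n \<delta>"
  shows "(\<Sum>s<n \<delta>. antipode_inv (u \<delta> $$ (s, t)) * u \<delta> $$ (p, s)) = (if p = t then 1 else 0)"
proof -
  have "antipode (\<Sum>s<n \<delta>. antipode_inv (u \<delta> $$ (s, t)) * u \<delta> $$ (p, s)) = (\<Sum>s<n \<delta>. antipode (u \<delta> $$ (p, s)) * u \<delta> $$ (s, t))"
    by (simp add: antipode_sum antipode_mult)
  also have "\<dots> = (if p = t then 1 else 0)"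
    using corep_antipode_left[OF unitary_rep_corep[OF u_rep] assms] by (simp add: counit_unitary_rep[OF u_rep assms])
  finally have "antipode_inv (antipode (\<Sum>s<n \<delta>. antipode_inv (u \<delta> $$ (s, t)) * u \<delta> $$ (p, s))) = antipode_inv (if p = t then 1 else 0)"
    by simp
  moreover have "antipode 1 = 1" using antipode_u[of 0 triv 0] by (simp add: u_triv)
  then have "antipode_inv 1 = 1" by (metis antipode_inv_antipode)
  ultimately show ?thesis by (simp add: clinear_zero[OF clinear_antipode_inv] split: if_splits)
qed

text \<open>The relations of \<open>S_ltrans_sum\<close> are solved for S: applied to the translates
  of x by the inverse antipode of u_st and summed over s, they leave only the term in which x is not
  translated.\<close>

theorem S_index:
  assumes x: "x \<in> c00 n" and rt: "r < n \<delta>" "t < n \<delta>"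
  shows "S x \<delta> $$ (r, t) = ev x (antipode_inv (u \<delta> $$ (r, t)))"
proof -
  let ?\<psi> = "\<lambda>p c. S (ltrans c x) \<delta> $$ (r, p)"
  have lin: "clinear (?\<psi> p)" if "p < n \<delta>" for p
    unfolding clinear_def
  proof (intro conjI allI)
    fix c d k
    have "ltrans (c + d) x = fam_add (ltrans c x) (ltrans d x)"
      unfolding ltrans_def fam_add_def by (intro ext eq_matI) (auto simp: distrib_right clinear_add[OF clinear_ev])
    then show "?\<psi> p (c + d) = ?\<psi> p c + ?\<psi> p d" by (simp add: S_index_add ltrans_c00[OF x] rt that)
    have "ltrans (k *\<^sub>C c) x = fam_scale k (ltrans c x)"
      unfolding ltrans_def fam_scale_def by (intro ext eq_matI) (auto simp: mult_scaleC_left clinear_scale[OF clinear_ev] scaleC_complex_def)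
    then show "?\<psi> p (k *\<^sub>C c) = k *\<^sub>C ?\<psi> p c" by (simp add: S_index_scale ltrans_c00[OF x] rt that scaleC_complex_def)
  qed
  have one: "ltrans 1 x = x"
    by (rule fam_eqI) (use x c00_fam_carrier in \<open>auto simp: fam_carrier_def ltrans_def ev_coeff\<close>)
  have "ev x (antipode_inv (u \<delta> $$ (r, t))) = (\<Sum>s<n \<delta>. if r = s then ev x (antipode_inv (u \<delta> $$ (s, t))) else 0)"
    using rt by (simp add: sum.delta')
  also have "\<dots> = (\<Sum>s<n \<delta>. \<Sum>p<n \<delta>. ?\<psi> p (antipode_inv (u \<delta> $$ (s, t)) * u \<delta> $$ (p, s)))"
  proof (intro sum.cong refl)
    fix s assume s: "s \<in> {..<n \<delta>}"
    show "(if r = s then ev x (antipode_inv (u \<delta> $$ (s, t))) else 0) = (\<Sum>p<n \<delta>. ?\<psi> p (antipode_inv (u \<delta> $$ (s, t)) * u \<delta> $$ (p, s)))"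
      using S_ltrans_sum[OF ltrans_c00[OF x] rt(1), of s "antipode_inv (u \<delta> $$ (s, t))"] s
      by (simp add: ltrans_ltrans ev_ltrans)
  qed
  also have "\<dots> = (\<Sum>p<n \<delta>. \<Sum>s<n \<delta>. ?\<psi> p (antipode_inv (u \<delta> $$ (s, t)) * u \<delta> $$ (p, s)))"
    by (rule sum.swap)
  also have "\<dots> = (\<Sum>p<n \<delta>. if p = t then ?\<psi> p 1 else 0)"
    using rt by (intro sum.cong refl) (simp add: clinear_sum[OF lin, symmetric] antipode_inv_sum clinear_zero[OF lin])
  also have "\<dots> = S x \<delta> $$ (r, t)" using rt by (simp add: sum.delta one)
  finally show ?thesis ..
qed

text \<open>S is composition with the inverse antipode of the function algebra. Invariance of P
  under S or R thereby becomes a statement on \<open>co_antipode P\<close>, hence on the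
  kernel.\<close>

lemma co_antipode_S:
  assumes x: "x \<in> c00 n"
  shows "co_antipode (S x) = x"
proof (rule fam_eqI)
  have ev_S: "ev (S x) c = ev x (antipode_inv c)" for c
    by (rule clinear_eq_on_coeffs[where f = "ev (S x)" and g = "\<lambda>c. ev x (antipode_inv c)",
      OF clinear_ev clinear_comp[OF clinear_ev clinear_antipode_inv]]) (simp add: ev_coeff S_index[OF x])
  fix \<alpha> i j assume "i < n \<alpha>" "j < n \<alpha>"
  then show "co_antipode (S x) \<alpha> $$ (i, j) = x \<alpha> $$ (i, j)" by (simp add: co_antipode_def ev_S ev_coeff)
qed (use x c00_fam_carrier in \<open>auto simp: fam_carrier_def co_antipode_def\<close>)

subsection \<open>Powers of the modular matrices\<close>

text \<open>Real exponents suffice, since i z = 1/2 at z = -i/2, and they give self-adjoint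
  matrices.\<close>

definition rpow :: "real \<Rightarrow> 'i \<Rightarrow> complex mat" where
  "rpow s \<alpha> = mat_cpow (rho \<alpha>) (complex_of_real s)"

text \<open>One unitary serves all exponents, which reduces the laws of powers to those of positive
  numbers.\<close>

lemma rho_diagonalization:
  obtains V d where "V \<in> carrier_mat (n \<alpha>) (n \<alpha>)" "V * mat_adjoint V = 1\<^sub>m (n \<alpha>)" "mat_adjoint V * V = 1\<^sub>m (n \<alpha>)"
    "\<And>i. i < n \<alpha> \<Longrightarrow> 0 < d i" "\<And>s. rpow s \<alpha> = V * mat_diag (n \<alpha>) (\<lambda>i. complex_of_real (d i powr s)) * mat_adjoint V"
    "rpow 1 \<alpha> = rho \<alpha>"
proof (rule pos_def_diagonalization[OF rho_carrier[of \<alpha>] rho_pos_def])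
  fix V d
  assume V: "V \<in> carrier_mat (n \<alpha>) (n \<alpha>)" "V * mat_adjoint V = 1\<^sub>m (n \<alpha>)" "mat_adjoint V * V = 1\<^sub>m (n \<alpha>)"
    and d: "\<And>i. i < n \<alpha> \<Longrightarrow> 0 < d i" and eq: "rho \<alpha> = V * mat_diag (n \<alpha>) (\<lambda>i. complex_of_real (d i)) * mat_adjoint V"
  have pow: "rpow s \<alpha> = V * mat_diag (n \<alpha>) (\<lambda>i. complex_of_real (d i powr s)) * mat_adjoint V" for s
  proof -
    have "mat_diag (n \<alpha>) (\<lambda>i. exp (complex_of_real s * complex_of_real (ln (d i)))) = mat_diag (n \<alpha>) (\<lambda>i. complex_of_real (d i powr s))"
      by (intro eq_matI) (auto simp: mat_diag_def powr_def exp_of_real d[THEN less_imp_neq, symmetric] simp flip: of_real_mult)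
    moreover have "mat_cpow (rho \<alpha>) (complex_of_real s) =
        V * mat_diag (n \<alpha>) (\<lambda>i. exp (complex_of_real s * complex_of_real (ln (d i)))) * mat_adjoint V"
      by (rule mat_cpow_eq[OF V _ eq]) (rule d)
    ultimately show ?thesis by (simp only: rpow_def)
  qed
  have "mat_diag (n \<alpha>) (\<lambda>i. complex_of_real (d i powr 1)) = mat_diag (n \<alpha>) (\<lambda>i. complex_of_real (d i))"
    using d by (intro eq_matI) (auto simp: mat_diag_def less_imp_le)
  then have "rpow 1 \<alpha> = rho \<alpha>" unfolding pow using eq by simp
  with V d pow show ?thesis by (intro that)
qed

lemma rpow_carrier: "rpow s \<alpha> \<in> carrier_mat (n \<alpha>) (n \<alpha>)"
proof (rule rho_diagonalization[of \<alpha>])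
  fix V d assume "V \<in> carrier_mat (n \<alpha>) (n \<alpha>)"
    "\<And>s. rpow s \<alpha> = V * mat_diag (n \<alpha>) (\<lambda>i. complex_of_real (d i powr s)) * mat_adjoint V"
  then show ?thesis by (simp only:) (intro mult_carrier_square mat_diag_carrier mat_adjoint_carrier)
qed

lemma rpow_mult: "rpow s \<alpha> * rpow t \<alpha> = rpow (s + t) \<alpha>"
proof (rule rho_diagonalization[of \<alpha>])
  fix V d
  assume V: "V \<in> carrier_mat (n \<alpha>) (n \<alpha>)" "mat_adjoint V * V = 1\<^sub>m (n \<alpha>)"
    and d: "\<And>i. i < n \<alpha> \<Longrightarrow> 0 < d i"
    and eq: "\<And>s. rpow s \<alpha> = V * mat_diag (n \<alpha>) (\<lambda>i. complex_of_real (d i powr s)) * mat_adjoint V"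
  have "mat_diag (n \<alpha>) (\<lambda>i. complex_of_real (d i powr s) * complex_of_real (d i powr t)) = mat_diag (n \<alpha>) (\<lambda>i. complex_of_real (d i powr (s + t)))"
    by (intro eq_matI) (auto simp: mat_diag_def powr_add)
  then show ?thesis unfolding eq unitary_diag_mult[OF V] by simp
qed

lemma rpow_1: "rpow 1 \<alpha> = rho \<alpha>"
  by (rule rho_diagonalization[of \<alpha>])

lemma rpow_0: "rpow 0 \<alpha> = 1\<^sub>m (n \<alpha>)"
proof (rule rho_diagonalization[of \<alpha>])
  fix V d
  assume V: "V \<in> carrier_mat (n \<alpha>) (n \<alpha>)" "V * mat_adjoint V = 1\<^sub>m (n \<alpha>)" and d: "\<And>i. i < n \<alpha> \<Longrightarrow> 0 < d i"
    and eq: "\<And>s. rpow s \<alpha> = V * mat_diag (n \<alpha>) (\<lambda>i. complex_of_real (d i powr s)) * mat_adjoint V"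
  have "mat_diag (n \<alpha>) (\<lambda>i. complex_of_real (d i powr 0)) = 1\<^sub>m (n \<alpha>)"
    by (rule mat_diag_eq_one) (use d in force)
  then show ?thesis unfolding eq using V by simp
qed

lemma rpow_minus_1: "rpow (-1) \<alpha> = rinv \<alpha>"
proof -
  have "rpow (-1) \<alpha> = rpow (-1) \<alpha> * (rpow 1 \<alpha> * rinv \<alpha>)"
    by (simp add: rpow_1 rho_rinv right_mult_one_mat[OF rpow_carrier])
  also have "\<dots> = rinv \<alpha>"
    by (simp add: assoc_mult_square[OF rpow_carrier rpow_carrier rinv_carrier, symmetric] rpow_mult rpow_0 left_mult_one_mat[OF rinv_carrier])
  finally show ?thesis .
qed

lemma rpow_adjoint: "mat_adjoint (rpow s \<alpha>) = rpow s \<alpha>"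
proof (rule rho_diagonalization[of \<alpha>])
  fix V d
  assume V: "V \<in> carrier_mat (n \<alpha>) (n \<alpha>)"
    and eq: "\<And>s. rpow s \<alpha> = V * mat_diag (n \<alpha>) (\<lambda>i. complex_of_real (d i powr s)) * mat_adjoint V"
  let ?D = "mat_diag (n \<alpha>) (\<lambda>i. complex_of_real (d i powr s))"
  have D: "?D \<in> carrier_mat (n \<alpha>) (n \<alpha>)" by simp
  note V' = mat_adjoint_carrier[OF V]
  have "mat_adjoint ?D = ?D" by (intro eq_matI) (auto simp: mat_diag_def)
  then have "mat_adjoint (V * ?D * mat_adjoint V) = V * (?D * mat_adjoint V)"
    by (simp add: mat_adjoint_mult[OF mult_carrier_square[OF V D] V'] mat_adjoint_mult[OF V D])
  then show ?thesis unfolding eq by (simp add: assoc_mult_square[OF V D V'])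
qed

lemma fam_carrier_rpow: "fam_carrier (rpow s)"
  by (simp add: fam_carrier_def rpow_carrier)

lemma cmap_rpow: "cmap (rpow s) (rpow t) (cmap (rpow s') (rpow t') c) = cmap (rpow (s' + s)) (rpow (t + t')) c"
  by (simp add: cmap_cmap fam_carrier_rpow rpow_mult)

lemma rho_conj_rpow: "rho_conj = cmap (rpow (-1)) (rpow 1)"
  and antipode_antipode_rpow: "antipode (antipode c) = cmap (rpow 1) (rpow (-1)) c"
proof -
  have 1: "rpow 1 = rho" and 2: "rpow (-1) = (\<lambda>\<alpha>. rinv \<alpha>)" by (auto simp: rpow_1 rpow_minus_1)
  show "rho_conj = cmap (rpow (-1)) (rpow 1)" unfolding 1 2 ..
  show "antipode (antipode c) = cmap (rpow 1) (rpow (-1)) c" unfolding 1 2 by (rule antipode_antipode)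
qed

lemma ev_add:
  assumes "fam_carrier x" "fam_carrier y"
  shows "ev (fam_add x y) c = ev x c + ev y c"
proof (induction c rule: coeff_induct)
  case (coeff \<alpha> i j)
  then show ?case
    using fam_carrierD[OF assms(1), of \<alpha>] fam_carrierD[OF assms(2), of \<alpha>] by (simp add: ev_coeff fam_add_def)
qed (simp_all add: clinear_add[OF clinear_ev] clinear_scale[OF clinear_ev] scaleC_complex_def distrib_left)

lemma ev_scale:
  assumes "fam_carrier x"
  shows "ev (fam_scale a x) c = a * ev x c"
proof (induction c rule: coeff_induct)
  case (coeff \<alpha> i j)
  then show ?case
    using fam_carrierD[OF assms, of \<alpha>] by (simp add: ev_coeff fam_scale_def)
qed (simp_all add: clinear_add[OF clinear_ev] clinear_scale[OF clinear_ev] scaleC_complex_def distrib_left)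

lemma ev_eqI_mat_unit:
  assumes "\<And>\<alpha> k l. k < n \<alpha> \<Longrightarrow> l < n \<alpha> \<Longrightarrow> ev (mat_unit n \<alpha> k l) a = ev (mat_unit n \<alpha> k l) b"
  shows "a = b"
proof (rule ev_eqI)
  fix x assume x: "x \<in> c00 n"
  then obtain F where F: "finite F" "\<And>\<alpha>. \<alpha> \<notin> F \<Longrightarrow> x \<alpha> = 0\<^sub>m (n \<alpha>) (n \<alpha>)" unfolding c00_iff by blast
  have "ev x c = (\<Sum>\<alpha>\<in>F. \<Sum>i<n \<alpha>. \<Sum>j<n \<alpha>. x \<alpha> $$ (i, j) * ev (mat_unit n \<alpha> i j) c)" for c
    by (rule c00_linear_expansion[where f = "\<lambda>x. ev x c", OF _ _ x F]) (simp_all add: ev_add ev_scale c00_fam_carrier)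
  then show "ev x a = ev x b" using assms by simp
qed

text \<open>Conjugation by powers of \<open>\<rho>\<close> is a power of the automorphism \<open>S\<^sup>2\<close>: in coordinates which
  diagonalize \<open>\<rho>\<close>, products of coefficients are eigenvectors of \<open>S\<^sup>2\<close> with positive eigenvalue, and
  the power acts on each eigenspace as a scalar depending only on the eigenvalue.\<close>

lemma cmap_rpow_mult: "cmap (rpow s) (rpow (- s)) (a * b) = cmap (rpow s) (rpow (- s)) a * cmap (rpow s) (rpow (- s)) b"
proof -
  let ?diag = "\<lambda>\<alpha> V d. V \<in> carrier_mat (n \<alpha>) (n \<alpha>) \<and> V * mat_adjoint V = 1\<^sub>m (n \<alpha>) \<and> mat_adjoint V * V = 1\<^sub>m (n \<alpha>) \<and>
    (\<forall>i<n \<alpha>. 0 < d i) \<and> (\<forall>s. rpow s \<alpha> = V * mat_diag (n \<alpha>) (\<lambda>i. complex_of_real (d i powr s)) * mat_adjoint V)"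
  have "\<exists>V d. ?diag \<alpha> V d" for \<alpha>
    by (rule rho_diagonalization[of \<alpha>]) blast
  then have "\<forall>\<alpha>. \<exists>Vd. ?diag \<alpha> (fst Vd) (snd Vd)" by simp
  from choice[OF this] obtain Vd where Vd: "\<forall>\<alpha>. ?diag \<alpha> (fst (Vd \<alpha>)) (snd (Vd \<alpha>))" ..
  obtain V d where "\<And>\<alpha>. ?diag \<alpha> (V \<alpha>) (d \<alpha>)"
    by (rule that) (rule Vd[rule_format])
  then have V: "\<And>\<alpha>. V \<alpha> \<in> carrier_mat (n \<alpha>) (n \<alpha>)" "\<And>\<alpha>. V \<alpha> * mat_adjoint (V \<alpha>) = 1\<^sub>m (n \<alpha>)" "\<And>\<alpha>. mat_adjoint (V \<alpha>) * V \<alpha> = 1\<^sub>m (n \<alpha>)"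
    and d: "\<And>\<alpha> i. i < n \<alpha> \<Longrightarrow> 0 < d \<alpha> i"
    and eq: "\<And>\<alpha> s. rpow s \<alpha> = V \<alpha> * mat_diag (n \<alpha>) (\<lambda>i. complex_of_real (d \<alpha> i powr s)) * mat_adjoint (V \<alpha>)"
    by blast+
  define W where "W \<alpha> = mat_adjoint (V \<alpha>)" for \<alpha>
  define D where "D s \<alpha> = mat_diag (n \<alpha>) (\<lambda>i. complex_of_real (d \<alpha> i powr s))" for s \<alpha>
  have Wc: "W \<alpha> \<in> carrier_mat (n \<alpha>) (n \<alpha>)" for \<alpha> using mat_adjoint_carrier[OF V(1)] by (simp add: W_def)
  have Dc: "D s \<alpha> \<in> carrier_mat (n \<alpha>) (n \<alpha>)" for s \<alpha> by (simp add: D_def)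
  have fV: "fam_carrier V" and fW: "fam_carrier W" and fD: "fam_carrier (D s)" for s
    by (simp_all add: fam_carrier_def V(1) Wc Dc)
  have VW: "V \<alpha> * W \<alpha> = 1\<^sub>m (n \<alpha>)" and WV: "W \<alpha> * V \<alpha> = 1\<^sub>m (n \<alpha>)" for \<alpha> by (simp_all add: W_def V(2,3))
  have rV: "rpow s \<alpha> * V \<alpha> = V \<alpha> * D s \<alpha>" for s \<alpha>
  proof -
    have "rpow s \<alpha> * V \<alpha> = V \<alpha> * (D s \<alpha> * (W \<alpha> * V \<alpha>))"
      unfolding eq W_def[symmetric] D_def[symmetric] using V(1)[of \<alpha>] Wc[of \<alpha>] Dc[of s \<alpha>]
      by (simp only: assoc_mult_square[of _ "n \<alpha>"] mult_carrier_square)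
    then show ?thesis by (simp add: WV right_mult_one_mat[OF Dc])
  qed
  have Wr: "W \<alpha> * rpow s \<alpha> = D s \<alpha> * W \<alpha>" for s \<alpha>
  proof -
    have "W \<alpha> * rpow s \<alpha> = (W \<alpha> * V \<alpha>) * (D s \<alpha> * W \<alpha>)"
      unfolding eq W_def[symmetric] D_def[symmetric] using V(1)[of \<alpha>] Wc[of \<alpha>] Dc[of s \<alpha>]
      by (simp only: assoc_mult_square[of _ "n \<alpha>"] mult_carrier_square)
    then show ?thesis by (simp add: WV left_mult_one_mat[OF mult_carrier_square[OF Dc Wc]])
  qed
  \<comment> \<open>k and k' are mutually inverse changes of coordinates; they carry the conjugation
    \<open>P s\<close> to the conjugation \<open>Q s\<close> by diagonal matrices, for which every
    coefficient is an eigenvector.\<close>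
  define k where "k = cmap V W"
  define k' where "k' = cmap W V"
  define P where "P s = cmap (rpow s) (rpow (- s))" for s
  define Q where "Q s = cmap (D s) (D (- s))" for s
  have kk': "k (k' c) = c" "k' (k c) = c" for c
    unfolding k_def k'_def by (simp_all add: cmap_cmap fV fW VW WV cmap_one)
  have kP: "k (P s c) = Q s (k c)" for s c
    unfolding k_def P_def Q_def by (simp add: cmap_cmap fV fW fD fam_carrier_rpow rV Wr)
  have lin: "clinear k" "clinear k'" "clinear (P s)" "clinear (Q s)" for s
    unfolding k_def k'_def P_def Q_def by (rule clinear_cmap)+
  have Pk': "P s (k' c) = k' (Q s c)" for s c
    using kP[of s "k' c"] kk' by metis
  define lam where "lam \<alpha> i j = d \<alpha> i / d \<alpha> j" for \<alpha> i j
  have lam_pow: "complex_of_real (d \<alpha> i powr s) * complex_of_real (d \<alpha> j powr (- s)) = complex_of_real (lam \<alpha> i j powr s)"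
    if "i < n \<alpha>" "j < n \<alpha>" for \<alpha> i j s
  proof -
    have "d \<alpha> i powr s * d \<alpha> j powr (- s) = lam \<alpha> i j powr s"
      using d[OF that(1)] d[OF that(2)] by (simp add: lam_def powr_divide powr_minus_divide)
    then show ?thesis by (simp only: of_real_mult[symmetric])
  qed
  have lam0: "0 < lam \<alpha> i j" if "i < n \<alpha>" "j < n \<alpha>" for \<alpha> i j
    using d[OF that(1)] d[OF that(2)] by (simp add: lam_def)
  have Du: "D s \<alpha> * X * D t \<alpha> = mat (n \<alpha>) (n \<alpha>) (\<lambda>(i, j). complex_of_real (d \<alpha> i powr s) * X $$ (i, j) * complex_of_real (d \<alpha> j powr t))"
    if X: "X \<in> carrier_mat (n \<alpha>) (n \<alpha>)" for X s t \<alpha>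
    unfolding D_def mat_diag_mult_left[OF X] by (subst mat_diag_mult_right[of _ "n \<alpha>" "n \<alpha>"]) (auto intro!: eq_matI)
  have evQ: "ev x (Q s c) = ev (\<lambda>\<alpha>. D s \<alpha> * x \<alpha> * D (- s) \<alpha>) c" if "fam_carrier x" for x s c
    unfolding Q_def by (rule ev_cmap[OF fD fD that])
  have Q_coeff: "Q s (u \<alpha> $$ (i, j)) = complex_of_real (lam \<alpha> i j powr s) *\<^sub>C u \<alpha> $$ (i, j)" if ij: "i < n \<alpha>" "j < n \<alpha>" for \<alpha> i j s
  proof (rule ev_eqI)
    fix x assume "x \<in> c00 n"
    then have x: "fam_carrier x" by (rule c00_fam_carrier)
    show "ev x (Q s (u \<alpha> $$ (i, j))) = ev x (complex_of_real (lam \<alpha> i j powr s) *\<^sub>C u \<alpha> $$ (i, j))"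
      using ij lam_pow[OF ij, of s]
      by (simp add: evQ[OF x] ev_coeff Du[OF fam_carrierD[OF x]] clinear_scale[OF clinear_ev] scaleC_complex_def mult_ac)
  qed
  have ev_unit: "ev (mat_unit n \<alpha> i j) (Q s c) = complex_of_real (lam \<alpha> i j powr s) * ev (mat_unit n \<alpha> i j) c"
    if ij: "i < n \<alpha>" "j < n \<alpha>" for \<alpha> i j s c
  proof -
    note mu = c00_fam_carrier[OF mat_unit_c00, of \<alpha> i j]
    have "(\<lambda>\<beta>. D s \<beta> * mat_unit n \<alpha> i j \<beta> * D (- s) \<beta>) = fam_scale (complex_of_real (lam \<alpha> i j powr s)) (mat_unit n \<alpha> i j)"
    proof
      fix \<beta>
      show "D s \<beta> * mat_unit n \<alpha> i j \<beta> * D (- s) \<beta> = fam_scale (complex_of_real (lam \<alpha> i j powr s)) (mat_unit n \<alpha> i j) \<beta>"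
        unfolding Du[OF fam_carrierD[OF mu]] using lam_pow[OF ij, of s]
        by (intro eq_matI) (auto simp: fam_scale_def mat_unit_def)
    qed
    then show ?thesis by (simp add: evQ[OF mu] ev_scale[OF mu])
  qed
  \<comment> \<open>At every matrix unit on which c does not vanish the eigenvalue must equal t, so
    its power is t^s there.\<close>
  have eigen: "Q s c = complex_of_real (t powr s) *\<^sub>C c" if t: "0 < t" "Q 1 c = complex_of_real t *\<^sub>C c" for t s c
  proof (rule ev_eqI_mat_unit)
    fix \<alpha> i j assume ij: "i < n \<alpha>" "j < n \<alpha>"
    have "complex_of_real (lam \<alpha> i j) * ev (mat_unit n \<alpha> i j) c = complex_of_real t * ev (mat_unit n \<alpha> i j) c"
      using ev_unit[OF ij, of 1 c] t lam0[OF ij] by (simp add: clinear_scale[OF clinear_ev] scaleC_complex_def eq_commute[of t])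
    then have "ev (mat_unit n \<alpha> i j) c = 0 \<or> lam \<alpha> i j = t" by simp
    then show "ev (mat_unit n \<alpha> i j) (Q s c) = ev (mat_unit n \<alpha> i j) (complex_of_real (t powr s) *\<^sub>C c)"
    proof
      assume "lam \<alpha> i j = t"
      then show ?thesis by (simp only: ev_unit[OF ij] clinear_scale[OF clinear_ev] scaleC_complex_def)
    qed (simp add: ev_unit[OF ij] clinear_scale[OF clinear_ev] scaleC_complex_def)
  qed
  \<comment> \<open>The exponent 1 is the square of the antipode, multiplicative because the
    antipode reverses products.\<close>
  have P1_mult: "P 1 (a * b) = P 1 a * P 1 b" for a b
    unfolding P_def antipode_antipode_rpow[symmetric] by (simp add: antipode_mult)
  have coeffs: "P s (k' (u \<alpha> $$ (i, j)) * k' (u \<beta> $$ (p, q))) = P s (k' (u \<alpha> $$ (i, j))) * P s (k' (u \<beta> $$ (p, q)))"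
    if ij: "i < n \<alpha>" "j < n \<alpha>" and pq: "p < n \<beta>" "q < n \<beta>" for \<alpha> i j \<beta> p q
  proof -
    let ?a = "k' (u \<alpha> $$ (i, j))" and ?b = "k' (u \<beta> $$ (p, q))"
    have Pa: "P s ?a = complex_of_real (lam \<alpha> i j powr s) *\<^sub>C ?a" for s
      by (simp add: Pk' Q_coeff[OF ij] clinear_scale[OF lin(2)])
    have Pb: "P s ?b = complex_of_real (lam \<beta> p q powr s) *\<^sub>C ?b" for s
      by (simp add: Pk' Q_coeff[OF pq] clinear_scale[OF lin(2)])
    have "Q 1 (k (?a * ?b)) = complex_of_real (lam \<alpha> i j * lam \<beta> p q) *\<^sub>C k (?a * ?b)"
      using lam0[OF ij] lam0[OF pq] unfolding kP[symmetric] P1_mult Pa Pb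
      by (simp add: mult_scaleC_left mult_scaleC_right scaleC_scaleC clinear_scale[OF lin(1)] mult.commute)
    then have "Q s (k (?a * ?b)) = complex_of_real ((lam \<alpha> i j * lam \<beta> p q) powr s) *\<^sub>C k (?a * ?b)"
      using lam0[OF ij] lam0[OF pq] by (intro eigen) simp_all
    then have "k (P s (?a * ?b)) = k (complex_of_real ((lam \<alpha> i j * lam \<beta> p q) powr s) *\<^sub>C (?a * ?b))"
      by (simp only: kP clinear_scale[OF lin(1)])
    then have "P s (?a * ?b) = complex_of_real ((lam \<alpha> i j * lam \<beta> p q) powr s) *\<^sub>C (?a * ?b)"
      using kk'(2) by metis
    also have "\<dots> = P s ?a * P s ?b"
      using lam0[OF ij] lam0[OF pq] by (simp add: Pa Pb mult_scaleC_left mult_scaleC_right scaleC_scaleC powr_mult mult.commute)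
    finally show ?thesis .
  qed
  have "P s (k' a * k' b) = P s (k' a) * P s (k' b)" for a b
  proof (induction a rule: coeff_induct)
    case (coeff \<alpha> i j)
    then show ?case
      by (induction b rule: coeff_induct)
        (simp_all add: coeffs clinear_add[OF lin(2)] clinear_add[OF lin(3)] clinear_scale[OF lin(2)] clinear_scale[OF lin(3)]
          distrib_left mult_scaleC_right)
  qed (simp_all add: clinear_add[OF lin(2)] clinear_add[OF lin(3)] clinear_scale[OF lin(2)] clinear_scale[OF lin(3)]
      distrib_right mult_scaleC_left)
  from this[of "k a" "k b"] show ?thesis by (simp add: kk' P_def)
qed

section \<open>Modular shifts of families and their Fourier transforms\<close>

text \<open>The modular group at the imaginary parameter z = -i s.\<close>

definition modular :: "real \<Rightarrow> ('i \<Rightarrow> complex mat) \<Rightarrow> 'i \<Rightarrow> complex mat" where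
  "modular s x \<alpha> = rpow s \<alpha> * x \<alpha> * rpow (- s) \<alpha>"

lemma modular_group_eq: "modular_group rho (- \<i> / 2) x = modular (1 / 2) x"
  by (simp add: modular_group_def modular_def[abs_def] rpow_def)

lemma modular_fam_carrier: "fam_carrier x \<Longrightarrow> fam_carrier (modular s x)"
  unfolding modular_def[abs_def] by (intro fam_carrier_mult fam_carrier_rpow)

lemma modular_c00:
  assumes "x \<in> c00 n"
  shows "modular s x \<in> c00 n"
proof -
  obtain F where F: "finite F" "\<And>\<alpha>. \<alpha> \<notin> F \<Longrightarrow> x \<alpha> = 0\<^sub>m (n \<alpha>) (n \<alpha>)" using assms unfolding c00_iff by blast
  have "modular s x \<alpha> = 0\<^sub>m (n \<alpha>) (n \<alpha>)" if "\<alpha> \<notin> F" for \<alpha>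
    by (simp add: modular_def F(2)[OF that] right_mult_zero_mat[OF rpow_carrier] left_mult_zero_mat[OF rpow_carrier])
  then show ?thesis unfolding c00_iff using F(1) modular_fam_carrier[OF c00_fam_carrier[OF assms]] by blast
qed

lemma ev_modular: "fam_carrier x \<Longrightarrow> ev (modular s x) c = ev x (cmap (rpow s) (rpow (- s)) c)"
  unfolding modular_def[abs_def] by (rule ev_cmap[OF fam_carrier_rpow fam_carrier_rpow, symmetric])

text \<open>Under the trace \<rho>^-s moves from the right of x to the left of y, past \<rho>, with
  which it commutes. The shift of x is thus the opposite shift of y, which \<open>ev_modular\<close>
  carries to the function algebra.\<close>

lemma hat_modular:
  assumes x: "x \<in> c00 n"
  shows "hat (modular s x) = cmap (rpow (- s)) (rpow s) (hat x)"
proof (rule ev_eqI)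
  fix y assume y: "y \<in> c00 n"
  note xf = c00_fam_carrier[OF x] and yf = c00_fam_carrier[OF y]
  have tr: "mat_trace (rho \<alpha> * (y \<alpha> * modular s x \<alpha>)) = mat_trace (rho \<alpha> * (modular (- s) y \<alpha> * x \<alpha>))" for \<alpha>
  proof -
    note c = fam_carrierD[OF xf, of \<alpha>] fam_carrierD[OF yf, of \<alpha>] rho_carrier[of \<alpha>] rpow_carrier[of _ \<alpha>]
    have "rho \<alpha> * (y \<alpha> * modular s x \<alpha>) = (rpow 1 \<alpha> * (y \<alpha> * (rpow s \<alpha> * x \<alpha>))) * rpow (- s) \<alpha>"
      unfolding modular_def rpow_1 using c by (simp only: assoc_mult_square[of _ "n \<alpha>"] mult_carrier_square)
    also have "mat_trace \<dots> = mat_trace (rpow (- s) \<alpha> * (rpow 1 \<alpha> * (y \<alpha> * (rpow s \<alpha> * x \<alpha>))))"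
      by (rule mat_trace_cyclic[of _ "n \<alpha>" "n \<alpha>"]) (intro mult_carrier_square c)+
    also have "rpow (- s) \<alpha> * (rpow 1 \<alpha> * (y \<alpha> * (rpow s \<alpha> * x \<alpha>))) = (rpow (- s) \<alpha> * rpow 1 \<alpha>) * (y \<alpha> * (rpow s \<alpha> * x \<alpha>))"
      using c by (simp only: assoc_mult_square[of _ "n \<alpha>"] mult_carrier_square)
    also have "rpow (- s) \<alpha> * rpow 1 \<alpha> = rpow 1 \<alpha> * rpow (- s) \<alpha>"
      by (simp add: rpow_mult add.commute)
    also have "rpow 1 \<alpha> * rpow (- s) \<alpha> * (y \<alpha> * (rpow s \<alpha> * x \<alpha>)) = rho \<alpha> * (modular (- s) y \<alpha> * x \<alpha>)"
      unfolding modular_def rpow_1 minus_minus using c by (simp only: assoc_mult_square[of _ "n \<alpha>"] mult_carrier_square)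
    finally show ?thesis .
  qed
  have "ev y (hat (modular s x)) = haar rho (fam_mult y (modular s x))"
    by (rule ev_hat[OF modular_c00[OF x] yf])
  also have "\<dots> = haar rho (fam_mult (modular (- s) y) x)"
    unfolding haar_def fam_mult_def tr ..
  also have "\<dots> = ev (modular (- s) y) (hat x)"
    by (rule ev_hat[OF x modular_fam_carrier[OF yf], symmetric])
  also have "\<dots> = ev y (cmap (rpow (- s)) (rpow s) (hat x))"
    using ev_modular[OF yf, of "- s"] by simp
  finally show "ev y (hat (modular s x)) = ev y (cmap (rpow (- s)) (rpow s) (hat x))" .
qed

subsection \<open>Symmetry\<close>

lemma rtrans_fam_carrier: "fam_carrier (rtrans c x)"
  by (simp add: fam_carrier_def rtrans_def)

text \<open>S(P) = P makes \<open>co_antipode P\<close> equal to P, and then the kernel is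
  \<open>hat P\<close> itself.\<close>

lemma GNS_symmetric_if:
  assumes P: "P \<in> c00 n" and A: "\<And>x. x \<in> linf n \<Longrightarrow> A x = rtrans (kernel P) x" and SP: "S P = P"
  shows "GNS_symmetric n rho A"
  unfolding GNS_symmetric_def
proof (intro ballI)
  fix x y assume x: "x \<in> c00 n" and y: "y \<in> c00 n"
  have xl: "x \<in> linf n" and yl: "y \<in> linf n" using x y c00_subset_linf by blast+
  have kernel: "kernel P = hat P"
    using kernel_eq_hat[OF P] co_antipode_S[OF P] by (simp add: SP)
  have "haar rho (fam_mult (A x) y) = ev x (hat y * kernel P)"
    unfolding A[OF xl] ev_hat[OF y rtrans_fam_carrier, symmetric] ev_rtrans ..
  also have "\<dots> = ev x (hat y * hat P)"
    by (simp only: kernel)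
  also have "\<dots> = haar rho (fam_mult x (A y))"
    unfolding A[OF yl] haar_rtrans[OF x] by (rule ev_hat_mult_hat[OF y x])
  finally show "haar rho (fam_mult (A x) y) = haar rho (fam_mult x (A y))" .
qed

text \<open>R(P) = P says that \<open>co_antipode P\<close> is P shifted by the exponent 1/2, so the
  kernel is \<theta> applied to \<open>hat P\<close>. The shift of y contributes the same \<theta>
  to \<open>hat y\<close>; multiplicativity merges the two, and \<theta> is then handed to x as a
  shift.\<close>

lemma KMS_symmetric_if:
  assumes P: "P \<in> c00 n" and A: "\<And>x. x \<in> linf n \<Longrightarrow> A x = rtrans (kernel P) x" and RP: "unitary_antipode rho S P = P"
  shows "KMS_symmetric n rho A"
  unfolding KMS_symmetric_def modular_group_eq
proof (intro ballI)
  fix x y assume x: "x \<in> c00 n" and y: "y \<in> c00 n"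
  have xl: "x \<in> linf n" and yl: "y \<in> linf n" using x y c00_subset_linf by blast+
  note xf = c00_fam_carrier[OF x]
  let ?\<theta> = "cmap (rpow (- (1 / 2))) (rpow (1 / 2))"
  have "co_antipode P = modular (1 / 2) P"
    using co_antipode_S[OF modular_c00[OF P, of "1 / 2"]] RP unfolding unitary_antipode_def modular_group_eq by simp
  then have kernel: "kernel P = ?\<theta> (hat P)"
    using kernel_eq_hat[OF P] hat_modular[OF P, of "1 / 2"] by simp
  have \<theta>_mult: "?\<theta> (a * b) = ?\<theta> a * ?\<theta> b" for a b
    using cmap_rpow_mult[of "- (1 / 2)"] by simp
  have "haar rho (fam_mult (A x) (modular (1 / 2) y)) = ev x (?\<theta> (hat y) * kernel P)"
    unfolding A[OF xl] ev_hat[OF modular_c00[OF y] rtrans_fam_carrier, symmetric] ev_rtrans hat_modular[OF y] ..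
  also have "\<dots> = ev x (?\<theta> (hat y * hat P))"
    by (simp only: kernel \<theta>_mult)
  also have "\<dots> = ev (modular (- (1 / 2)) x) (hat y * hat P)"
    using ev_modular[OF xf, of "- (1 / 2)"] by simp
  also have "\<dots> = ev y (rho_conj (hat (modular (- (1 / 2)) x)) * kernel P)"
    by (rule ev_hat_mult_hat[OF y modular_c00[OF x]])
  \<comment> \<open>Exponents add, so the shift of x commutes with conjugation by \<rho> and can be
    passed on to A y.\<close>
  also have "rho_conj (hat (modular (- (1 / 2)) x)) = cmap (rpow (1 / 2)) (rpow (- (1 / 2))) (rho_conj (hat x))"
    using hat_modular[OF x, of "- (1 / 2)"] by (simp add: rho_conj_rpow cmap_rpow add.commute)
  also have "ev y (cmap (rpow (1 / 2)) (rpow (- (1 / 2))) (rho_conj (hat x)) * kernel P)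
      = ev (modular (1 / 2) (A y)) (rho_conj (hat x))"
    unfolding A[OF yl] ev_modular[OF rtrans_fam_carrier] ev_rtrans ..
  also have "\<dots> = haar rho (fam_mult x (modular (1 / 2) (A y)))"
    by (rule haar_left[OF x, symmetric]) (unfold A[OF yl], intro modular_fam_carrier rtrans_fam_carrier)
  finally show "haar rho (fam_mult (A x) (modular (1 / 2) y)) = haar rho (fam_mult x (modular (1 / 2) (A y)))" .
qed

subsection \<open>Idempotents\<close>

lemma cbilinear_ev_mult: "cbilinear (\<lambda>a b. ev x a * ev y b)"
  by (rule cbilinearI) (simp_all add: clinear_add[OF clinear_ev] clinear_scale[OF clinear_ev] scaleC_complex_def algebra_simps)

text \<open>Multiplication of families is the transpose of \<open>comul\<close>, so P P = P becomes
  an identity for the values of P on any corepresentation.\<close>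

lemma ev_fam_mult:
  assumes x: "fam_carrier x" and y: "fam_carrier y"
  shows "ev (fam_mult x y) c = tlift (\<lambda>a b. ev x a * ev y b) (comul c)"
proof (rule clinear_eq_on_coeffs[where f = "ev (fam_mult x y)" and g = "\<lambda>c. tlift (\<lambda>a b. ev x a * ev y b) (comul c)",
    OF clinear_ev clinear_comp[OF clinear_tlift[OF cbilinear_ev_mult] comul_linear]])
  fix \<alpha> i j assume ij: "i < n \<alpha>" "j < n \<alpha>"
  then have "tlift (\<lambda>a b. ev x a * ev y b) (comul (u \<alpha> $$ (i, j))) = (\<Sum>k<n \<alpha>. x \<alpha> $$ (i, k) * y \<alpha> $$ (k, j))"
    using tlift_corep[OF unitary_rep_corep[OF u_rep] ij cbilinear_ev_mult] by (simp add: ev_coeff)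
  then show "ev (fam_mult x y) (u \<alpha> $$ (i, j)) = tlift (\<lambda>a b. ev x a * ev y b) (comul (u \<alpha> $$ (i, j)))"
    using ij by (simp add: ev_coeff fam_mult_def index_mult_mat_sum[OF fam_carrierD[OF x] fam_carrierD[OF y]])
qed

lemma c00_fam_mult:
  assumes x: "x \<in> c00 n" and y: "fam_carrier y"
  shows "fam_mult x y \<in> c00 n"
proof -
  obtain F where F: "finite F" "\<And>\<alpha>. \<alpha> \<notin> F \<Longrightarrow> x \<alpha> = 0\<^sub>m (n \<alpha>) (n \<alpha>)" using x unfolding c00_iff by blast
  have "fam_mult x y \<alpha> = 0\<^sub>m (n \<alpha>) (n \<alpha>)" if "\<alpha> \<notin> F" for \<alpha>
    by (simp add: fam_mult_def F(2)[OF that] left_mult_zero_mat[OF fam_carrierD[OF y]])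
  then show ?thesis unfolding c00_iff using F(1) fam_carrier_mult[OF c00_fam_carrier[OF x] y]
    by (auto simp: fam_mult_def)
qed

lemma hat_mat_unit:
  assumes ij: "i < n \<alpha>" "j < n \<alpha>" and y: "fam_carrier y"
  shows "hat (fam_mult (mat_unit n \<alpha> i j) y) = dimq rho \<alpha> *\<^sub>C (\<Sum>k<n \<alpha>. (y \<alpha> * rho \<alpha>) $$ (j, k) *\<^sub>C u \<alpha> $$ (k, i))"
proof -
  note c = fam_carrierD[OF c00_fam_carrier[OF mat_unit_c00], of \<alpha> i j \<alpha>] fam_carrierD[OF y, of \<alpha>] rho_carrier[of \<alpha>]
  have z: "fam_mult (mat_unit n \<alpha> i j) y \<beta> = 0\<^sub>m (n \<beta>) (n \<beta>)" if "\<beta> \<noteq> \<alpha>" for \<beta>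
  proof -
    have "mat_unit n \<alpha> i j \<beta> = 0\<^sub>m (n \<beta>) (n \<beta>)" using that by (intro eq_matI) (auto simp: mat_unit_def)
    then show ?thesis by (simp add: fam_mult_def left_mult_zero_mat[OF fam_carrierD[OF y]])
  qed
  have "hat (fam_mult (mat_unit n \<alpha> i j) y) = (\<Sum>\<beta>\<in>{\<alpha>}. dimq rho \<beta> *\<^sub>C block (fam_mult (mat_unit n \<alpha> i j) y \<beta> * rho \<beta>) \<beta>)"
    by (rule hat_eq_sum[OF c00_fam_mult[OF mat_unit_c00 y]]) (use z in auto)
  also have "\<dots> = dimq rho \<alpha> *\<^sub>C block (mat_unit n \<alpha> i j \<alpha> * (y \<alpha> * rho \<alpha>)) \<alpha>"
    by (simp add: fam_mult_def assoc_mult_square[OF c])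
  also have "block (mat_unit n \<alpha> i j \<alpha> * (y \<alpha> * rho \<alpha>)) \<alpha> = (\<Sum>k<n \<alpha>. (y \<alpha> * rho \<alpha>) $$ (j, k) *\<^sub>C u \<alpha> $$ (k, i))"
    unfolding block_def
  proof (intro sum.cong refl)
    fix k assume k: "k \<in> {..<n \<alpha>}"
    have "(mat_unit n \<alpha> i j \<alpha> * (y \<alpha> * rho \<alpha>)) $$ (l, k) = (if l = i then (y \<alpha> * rho \<alpha>) $$ (j, k) else 0)" if "l < n \<alpha>" for l
    proof -
      have "(mat_unit n \<alpha> i j \<alpha> * (y \<alpha> * rho \<alpha>)) $$ (l, k) = (\<Sum>m<n \<alpha>. (if j = m then 1 else 0) * (if l = i then (y \<alpha> * rho \<alpha>) $$ (m, k) else 0))"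
        unfolding index_mult_mat_sum[OF c(1) mult_carrier_square[OF c(2,3)] that lessThan_iff[THEN iffD1, OF k]]
        using that by (intro sum.cong refl) (simp add: index_mat_unit)
      then show ?thesis by (simp only: sum_delta_left[OF ij(2)])
    qed
    then have "(\<Sum>l<n \<alpha>. (mat_unit n \<alpha> i j \<alpha> * (y \<alpha> * rho \<alpha>)) $$ (l, k) *\<^sub>C u \<alpha> $$ (k, l))
        = (\<Sum>l<n \<alpha>. if l = i then (y \<alpha> * rho \<alpha>) $$ (j, k) *\<^sub>C u \<alpha> $$ (k, l) else 0)"
      by (intro sum.cong refl) simp
    then show "(\<Sum>l<n \<alpha>. (mat_unit n \<alpha> i j \<alpha> * (y \<alpha> * rho \<alpha>)) $$ (l, k) *\<^sub>C u \<alpha> $$ (k, l))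
        = (y \<alpha> * rho \<alpha>) $$ (j, k) *\<^sub>C u \<alpha> $$ (k, i)"
      using ij(1) by simp
  qed
  finally show ?thesis .
qed

lemma hat_mat_unit_rho:
  assumes ij: "i < n \<alpha>" "j < n \<alpha>"
  shows "hat (mat_unit n \<alpha> i j) = dimq rho \<alpha> *\<^sub>C (\<Sum>k<n \<alpha>. rho \<alpha> $$ (j, k) *\<^sub>C u \<alpha> $$ (k, i))"
proof -
  have "fam_mult (mat_unit n \<alpha> i j) (\<lambda>\<beta>. 1\<^sub>m (n \<beta>)) = mat_unit n \<alpha> i j"
    unfolding fam_mult_def using fam_carrierD[OF c00_fam_carrier[OF mat_unit_c00]] right_mult_one_mat by blast
  then show ?thesis using hat_mat_unit[OF ij fam_carrier_one] by (simp add: left_mult_one_mat[OF rho_carrier])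
qed

text \<open>The factor \<rho>^-1 in the adjacency relation cancels the \<rho> of the Fourier
  transform and leaves a single coefficient.\<close>

lemma hat_mat_unit_rinv:
  assumes ij: "i < n \<alpha>" "j < n \<alpha>"
  shows "hat (fam_mult (mat_unit n \<alpha> i j) (\<lambda>\<beta>. rinv \<beta>)) = dimq rho \<alpha> *\<^sub>C u \<alpha> $$ (j, i)"
proof -
  have "(\<Sum>k<n \<alpha>. 1\<^sub>m (n \<alpha>) $$ (j, k) *\<^sub>C u \<alpha> $$ (k, i)) = (\<Sum>k<n \<alpha>. if j = k then u \<alpha> $$ (k, i) else 0)"
    using ij by (intro sum.cong refl) (auto simp: scaleC_one)
  then show ?thesis using hat_mat_unit[OF ij fam_carrier_rho(2)] ij by (simp add: rinv_rho)
qed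

text \<open>The Haar value in \<open>ev_mult_kernel\<close> ends with \<open>hat P\<close>, so it
  can be read through the inversion formula for P instead of x.\<close>

lemma rtrans_kernel_index:
  assumes x: "x \<in> c00 n" and P: "P \<in> c00 n" and rs: "r < n \<gamma>" "s < n \<gamma>"
  shows "rtrans (kernel P) x \<gamma> $$ (r, s) = ev P (antipode_inv (hat x) * u \<gamma> $$ (r, s))"
  using rs ev_mult_kernel[OF x, of "u \<gamma> $$ (r, s)" P]
  by (simp add: rtrans_def ev_eq_h[OF P] antipode_mult)

text \<open>This matrix is the conjugate corepresentation between the transposes of \<rho> and
  \<rho>^-1. X and Y absorb one of the two scalar matrices each, so that these cancel in the middle
  index.\<close>

lemma corep_antipode_inv: "corep (n \<alpha>) (\<lambda>i k. antipode_inv (u \<alpha> $$ (k, i)))"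
  unfolding corep_def
proof (intro allI impI)
  fix i k assume ik: "i < n \<alpha>" "k < n \<alpha>"
  define X where "X i a = (\<Sum>b<n \<alpha>. rho \<alpha> $$ (b, i) *\<^sub>C star (u \<alpha> $$ (b, a)))" for i a
  define Y where "Y k b = (\<Sum>a<n \<alpha>. rinv \<alpha> $$ (k, a) *\<^sub>C star (u \<alpha> $$ (b, a)))" for k b
  have inv: "antipode_inv (u \<alpha> $$ (k, i)) = (\<Sum>a<n \<alpha>. \<Sum>b<n \<alpha>. (rinv \<alpha> $$ (k, a) * rho \<alpha> $$ (b, i)) *\<^sub>C star (u \<alpha> $$ (b, a)))"
    if "i < n \<alpha>" "k < n \<alpha>" for i k
    using that by (simp add: antipode_inv_def cmap_coeff antipode_sum antipode_scale antipode_u)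
  have inv_X: "antipode_inv (u \<alpha> $$ (k, i)) = (\<Sum>a<n \<alpha>. rinv \<alpha> $$ (k, a) *\<^sub>C X i a)" if "i < n \<alpha>" "k < n \<alpha>" for i k
    unfolding inv[OF that] X_def by (simp add: scaleC_sum_right scaleC_scaleC)
  have inv_Y: "antipode_inv (u \<alpha> $$ (k, i)) = (\<Sum>b<n \<alpha>. rho \<alpha> $$ (b, i) *\<^sub>C Y k b)" if "i < n \<alpha>" "k < n \<alpha>" for i k
    unfolding inv[OF that] Y_def scaleC_sum_right scaleC_scaleC by (subst sum.swap) (simp add: mult.commute)
  have "(\<Sum>s<n \<alpha>. antipode_inv (u \<alpha> $$ (s, i)) \<otimes>\<^sub>t antipode_inv (u \<alpha> $$ (k, s)))
      = (\<Sum>s<n \<alpha>. (\<Sum>r<n \<alpha>. rinv \<alpha> $$ (s, r) *\<^sub>C X i r) \<otimes>\<^sub>t (\<Sum>q<n \<alpha>. rho \<alpha> $$ (q, s) *\<^sub>C Y k q))"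
    using ik by (intro sum.cong refl) (simp add: inv_X[of i] inv_Y[of _ k])
  also have "\<dots> = (\<Sum>r<n \<alpha>. X i r \<otimes>\<^sub>t Y k r)"
  proof (rule elem_tensor_sum_contract)
    fix r q assume "r < n \<alpha>" "q < n \<alpha>"
    then show "(\<Sum>s<n \<alpha>. rinv \<alpha> $$ (s, r) * rho \<alpha> $$ (q, s)) = (if r = q then 1 else 0)"
      using rho_rinv_sum[of q \<alpha> r] by (simp add: mult.commute eq_commute[of r])
  qed
  also have "\<dots> = (\<Sum>r<n \<alpha>. \<Sum>b<n \<alpha>. \<Sum>a<n \<alpha>. (rho \<alpha> $$ (b, i) * rinv \<alpha> $$ (k, a)) *\<^sub>C (star (u \<alpha> $$ (b, r)) \<otimes>\<^sub>t star (u \<alpha> $$ (r, a))))"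
    unfolding X_def Y_def elem_tensor_sum_sum ..
  also have "\<dots> = (\<Sum>b<n \<alpha>. \<Sum>a<n \<alpha>. \<Sum>r<n \<alpha>. (rho \<alpha> $$ (b, i) * rinv \<alpha> $$ (k, a)) *\<^sub>C (star (u \<alpha> $$ (b, r)) \<otimes>\<^sub>t star (u \<alpha> $$ (r, a))))"
    by (subst sum.swap) (intro sum.cong refl sum.swap)
  also have "\<dots> = (\<Sum>b<n \<alpha>. \<Sum>a<n \<alpha>. (rho \<alpha> $$ (b, i) * rinv \<alpha> $$ (k, a)) *\<^sub>C comul (star (u \<alpha> $$ (b, a))))"
    using corep_star[OF unitary_rep_corep[OF u_rep[of \<alpha>]]] by (intro sum.cong refl) (simp add: corep_def scaleC_sum_right)
  also have "\<dots> = comul (antipode_inv (u \<alpha> $$ (k, i)))"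
    unfolding inv[OF ik] clinear_sum[OF comul_linear] clinear_scale[OF comul_linear]
    by (subst sum.swap) (simp add: mult.commute)
  finally show "comul (antipode_inv (u \<alpha> $$ (k, i))) = (\<Sum>s<n \<alpha>. antipode_inv (u \<alpha> $$ (s, i)) \<otimes>\<^sub>t antipode_inv (u \<alpha> $$ (k, s)))" ..
qed

text \<open>Every entry of the two factors is a value of P on a coefficient of v times one of
  \<open>u \<gamma>\<close>. The matrix \<rho> enters only through its row j, outside the sums over
  l and t, and one of the two factors dim_q is cancelled by the prefactor.\<close>

lemma rtrans_kernel_schur_idempotent:
  assumes P: "P \<in> c00 n" and PP: "fam_mult P P = P" and ij: "i < n \<alpha>" "j < n \<alpha>"
  shows "(1 / dimq rho \<alpha>) \<cdot>\<^sub>m mat (n \<gamma>) (n \<gamma>) (\<lambda>(r, s). \<Sum>l<n \<alpha>.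
            (rtrans (kernel P) (fam_mult (mat_unit n \<alpha> i l) (\<lambda>\<beta>. rinv \<beta>)) \<gamma> * rtrans (kernel P) (mat_unit n \<alpha> l j) \<gamma>) $$ (r, s))
        = rtrans (kernel P) (mat_unit n \<alpha> i j) \<gamma>"
    (is "?c \<cdot>\<^sub>m ?M = ?R")
proof (rule eq_matI)
  let ?d = "dimq rho \<alpha>"
  define v where "v i k = antipode_inv (u \<alpha> $$ (k, i))" for i k
  have 1: "rtrans (kernel P) (fam_mult (mat_unit n \<alpha> i l) (\<lambda>\<beta>. rinv \<beta>)) \<gamma> $$ (r, t) = ?d * ev P (v i l * u \<gamma> $$ (r, t))"
    if "i < n \<alpha>" "l < n \<alpha>" "r < n \<gamma>" "t < n \<gamma>" for i l r t
    unfolding rtrans_kernel_index[OF c00_fam_mult[OF mat_unit_c00 fam_carrier_rho(2)] P that(3,4)] hat_mat_unit_rinv[OF that(1,2)] v_def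
    by (simp add: clinear_scale[OF clinear_antipode_inv] clinear_scale[OF clinear_ev] mult_scaleC_left scaleC_complex_def)
  have 2: "rtrans (kernel P) (mat_unit n \<alpha> l j) \<gamma> $$ (t, s) = ?d * (\<Sum>k<n \<alpha>. rho \<alpha> $$ (j, k) * ev P (v l k * u \<gamma> $$ (t, s)))"
    if "l < n \<alpha>" "t < n \<gamma>" "s < n \<gamma>" for l t s
    unfolding rtrans_kernel_index[OF mat_unit_c00 P that(2,3)] hat_mat_unit_rho[OF that(1) ij(2)] v_def
    by (simp add: clinear_scale[OF clinear_antipode_inv] clinear_sum[OF clinear_antipode_inv] clinear_scale[OF clinear_ev]
        clinear_sum[OF clinear_ev] mult_scaleC_left sum_distrib_right scaleC_complex_def)
  fix r s assume "r < dim_row ?R" "s < dim_col ?R"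
  then have rs: "r < n \<gamma>" "s < n \<gamma>" by (auto simp: rtrans_def)
  \<comment> \<open>P P = P evaluated on the tensor product of the corepresentations v and
    \<open>u \<gamma>\<close>.\<close>
  have idem: "ev P (v i k * u \<gamma> $$ (r, s)) = (\<Sum>l<n \<alpha>. \<Sum>t<n \<gamma>. ev P (v i l * u \<gamma> $$ (r, t)) * ev P (v l k * u \<gamma> $$ (t, s)))"
    if k: "k < n \<alpha>" for k
  proof -
    have "corep (n \<alpha>) v" using corep_antipode_inv[of \<alpha>] by (simp only: v_def[abs_def])
    from mult_coeff_comul[OF this unitary_rep_corep[OF u_rep] ij(1) k rs cbilinear_ev_mult]
    show ?thesis using ev_fam_mult[OF c00_fam_carrier[OF P] c00_fam_carrier[OF P], of "v i k * u \<gamma> $$ (r, s)"] by (simp add: PP)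
  qed
  have "(?c \<cdot>\<^sub>m ?M) $$ (r, s) = (1 / ?d) * (\<Sum>l<n \<alpha>. \<Sum>t<n \<gamma>. (?d * ev P (v i l * u \<gamma> $$ (r, t))) * (?d * (\<Sum>k<n \<alpha>. rho \<alpha> $$ (j, k) * ev P (v l k * u \<gamma> $$ (t, s)))))"
    using rs ij by (simp add: index_mult_mat_sum[OF fam_carrierD[OF rtrans_fam_carrier] fam_carrierD[OF rtrans_fam_carrier]] 1 2
      del: index_mult_mat(1))
  also have "\<dots> = ?d * (\<Sum>l<n \<alpha>. \<Sum>t<n \<gamma>. \<Sum>k<n \<alpha>. rho \<alpha> $$ (j, k) * (ev P (v i l * u \<gamma> $$ (r, t)) * ev P (v l k * u \<gamma> $$ (t, s))))"
    using dimq_nonzero[of \<alpha>] by (simp add: sum_distrib_left mult_ac)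
  also have "\<dots> = ?d * (\<Sum>k<n \<alpha>. \<Sum>l<n \<alpha>. \<Sum>t<n \<gamma>. rho \<alpha> $$ (j, k) * (ev P (v i l * u \<gamma> $$ (r, t)) * ev P (v l k * u \<gamma> $$ (t, s))))"
  proof -
    have "(\<Sum>l<n \<alpha>. \<Sum>t<n \<gamma>. \<Sum>k<n \<alpha>. g k l t) = (\<Sum>k<n \<alpha>. \<Sum>l<n \<alpha>. \<Sum>t<n \<gamma>. g k l t)"
      for g :: "nat \<Rightarrow> nat \<Rightarrow> nat \<Rightarrow> complex"
    proof -
      have "(\<Sum>l<n \<alpha>. \<Sum>t<n \<gamma>. \<Sum>k<n \<alpha>. g k l t) = (\<Sum>l<n \<alpha>. \<Sum>k<n \<alpha>. \<Sum>t<n \<gamma>. g k l t)"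
        by (intro sum.cong refl sum.swap)
      also have "\<dots> = (\<Sum>k<n \<alpha>. \<Sum>l<n \<alpha>. \<Sum>t<n \<gamma>. g k l t)" by (rule sum.swap)
      finally show ?thesis .
    qed
    then show ?thesis by (rule arg_cong)
  qed
  also have "\<dots> = ?R $$ (r, s)"
    using rs ij by (simp add: 2 idem sum_distrib_left)
  finally show "(?c \<cdot>\<^sub>m ?M) $$ (r, s) = ?R $$ (r, s)" .
qed (auto simp: rtrans_def)

subsection \<open>Complete positivity\<close>

lemma amplification_psd_iff:
  assumes l: "0 < n k"
  shows "psd (amplification n N X k) \<longleftrightarrow>
    (\<forall>i<N. \<forall>j<N. \<forall>a<n k. \<forall>b<n k. X j i k $$ (b, a) = cnj (X i j k $$ (a, b))) \<and>
    (\<forall>w. 0 \<le> Re (\<Sum>i<N. \<Sum>a<n k. \<Sum>j<N. \<Sum>b<n k. cnj (w i a) * X i j k $$ (a, b) * w j b))" (is "_ \<longleftrightarrow> ?H \<and> ?Q")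
proof -
  let ?l = "n k"
  let ?A = "amplification n N X k"
  have c: "?A \<in> carrier_mat (N * ?l) (N * ?l)" by (simp add: amplification_def)
  have ix: "?A $$ (r, s) = X (r div ?l) (s div ?l) k $$ (r mod ?l, s mod ?l)" if "r < N * ?l" "s < N * ?l" for r s
    using that by (simp add: amplification_def)
  have dm: "r div ?l < N" "r mod ?l < ?l" if "r < N * ?l" for r
    using that l by (auto simp: less_mult_imp_div_less)
  have H: "(\<forall>r<N * ?l. \<forall>s<N * ?l. ?A $$ (s, r) = cnj (?A $$ (r, s))) \<longleftrightarrow> ?H"
  proof
    assume *: "\<forall>r<N * ?l. \<forall>s<N * ?l. ?A $$ (s, r) = cnj (?A $$ (r, s))"
    show ?H
    proof (intro allI impI)
      fix i j a b assume "i < N" "j < N" and ab: "a < ?l" "b < ?l"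
      then have less: "i * ?l + a < N * ?l" "j * ?l + b < N * ?l" by (simp_all add: pair_index_less)
      have dm': "(i * ?l + a) div ?l = i" "(i * ?l + a) mod ?l = a" "(j * ?l + b) div ?l = j" "(j * ?l + b) mod ?l = b"
        using ab by simp_all
      show "X j i k $$ (b, a) = cnj (X i j k $$ (a, b))"
        using *[rule_format, OF less] unfolding ix[OF less] ix[OF less(2,1)] dm' .
    qed
  next
    assume ?H
    show "\<forall>r<N * ?l. \<forall>s<N * ?l. ?A $$ (s, r) = cnj (?A $$ (r, s))"
    proof (intro allI impI)
      fix r s assume rs: "r < N * ?l" "s < N * ?l"
      then show "?A $$ (s, r) = cnj (?A $$ (r, s))"
        unfolding ix[OF rs] ix[OF rs(2,1)] using \<open>?H\<close> dm[OF rs(1)] dm[OF rs(2)] by blast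
    qed
  qed
  have sums: "(\<Sum>r<N * ?l. \<Sum>s<N * ?l. cnj (w (r div ?l) (r mod ?l)) * ?A $$ (r, s) * w (s div ?l) (s mod ?l))
      = (\<Sum>i<N. \<Sum>a<?l. \<Sum>j<N. \<Sum>b<?l. cnj (w i a) * X i j k $$ (a, b) * w j b)" for w
  proof -
    define G where "G i a j b = cnj (w i a) * X i j k $$ (a, b) * w j b" for i a j b
    have inner: "(\<Sum>s<N * ?l. G i a (s div ?l) (s mod ?l)) = (\<Sum>j<N. \<Sum>b<?l. G i a j b)" for i a
      by (rule sum_lessThan_mult[OF l])
    have "(\<Sum>r<N * ?l. \<Sum>s<N * ?l. cnj (w (r div ?l) (r mod ?l)) * ?A $$ (r, s) * w (s div ?l) (s mod ?l))
      = (\<Sum>r<N * ?l. \<Sum>s<N * ?l. G (r div ?l) (r mod ?l) (s div ?l) (s mod ?l))"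
      by (intro sum.cong refl) (simp add: ix G_def)
    also have "\<dots> = (\<Sum>i<N. \<Sum>a<?l. \<Sum>j<N. \<Sum>b<?l. G i a j b)"
      unfolding inner by (rule sum_lessThan_mult[OF l, where f = "\<lambda>i a. \<Sum>j<N. \<Sum>b<?l. G i a j b"])
    finally show ?thesis unfolding G_def .
  qed
  have Q: "(\<forall>v. 0 \<le> Re (\<Sum>r<N * ?l. \<Sum>s<N * ?l. cnj (v r) * ?A $$ (r, s) * v s)) \<longleftrightarrow> ?Q"
  proof
    assume *: "\<forall>v. 0 \<le> Re (\<Sum>r<N * ?l. \<Sum>s<N * ?l. cnj (v r) * ?A $$ (r, s) * v s)"
    show ?Q
    proof
      fix w show "0 \<le> Re (\<Sum>i<N. \<Sum>a<?l. \<Sum>j<N. \<Sum>b<?l. cnj (w i a) * X i j k $$ (a, b) * w j b)"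
        using *[rule_format, of "\<lambda>r. w (r div ?l) (r mod ?l)"] unfolding sums[of w] .
    qed
  next
    assume *: ?Q
    show "\<forall>v. 0 \<le> Re (\<Sum>r<N * ?l. \<Sum>s<N * ?l. cnj (v r) * ?A $$ (r, s) * v s)"
    proof
      fix v :: "nat \<Rightarrow> complex"
      show "0 \<le> Re (\<Sum>r<N * ?l. \<Sum>s<N * ?l. cnj (v r) * ?A $$ (r, s) * v s)"
        using *[rule_format, of "\<lambda>i a. v (i * ?l + a)"] unfolding sums[of "\<lambda>i a. v (i * ?l + a)", symmetric] by simp
    qed
  qed
  show ?thesis unfolding psd_iff[OF c] H Q ..
qed

text \<open>The matrix unit at (a, b) is the adjoint of that at (0, a) times that at (0, b), and
  \<open>Delta\<close> is a star-homomorphism. This yields a Kraus form of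
  \<open>Delta\<close>.\<close>

lemma Delta_mat_unit_factor:
  assumes ab: "a < n \<alpha>" "b < n \<alpha>" and RS: "R < n \<gamma> * n \<beta>" "S' < n \<gamma> * n \<beta>"
  shows "Delta (mat_unit n \<alpha> a b) (\<gamma>, \<beta>) $$ (R, S') = (\<Sum>T<n \<gamma> * n \<beta>.
    cnj (Delta (mat_unit n \<alpha> 0 a) (\<gamma>, \<beta>) $$ (T, R)) * Delta (mat_unit n \<alpha> 0 b) (\<gamma>, \<beta>) $$ (T, S'))"
proof -
  have lin: "mat_unit n \<alpha> i j \<in> linf n" for i j using mat_unit_c00 c00_subset_linf by blast
  have star: "fam_star (mat_unit n \<alpha> a 0) = mat_unit n \<alpha> 0 a"
    unfolding fam_star_def mat_unit_def by (intro ext eq_matI) auto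
  have star': "fam_star (mat_unit n \<alpha> 0 a) = mat_unit n \<alpha> a 0"
    unfolding fam_star_def mat_unit_def by (intro ext eq_matI) auto
  have mult: "fam_mult (mat_unit n \<alpha> a 0) (mat_unit n \<alpha> 0 b) = mat_unit n \<alpha> a b"
  proof
    fix \<beta>
    note c = fam_carrierD[OF c00_fam_carrier[OF mat_unit_c00]]
    show "fam_mult (mat_unit n \<alpha> a 0) (mat_unit n \<alpha> 0 b) \<beta> = mat_unit n \<alpha> a b \<beta>"
    proof (rule eq_matI)
      fix r s assume "r < dim_row (mat_unit n \<alpha> a b \<beta>)" "s < dim_col (mat_unit n \<alpha> a b \<beta>)"
      then have rs: "r < n \<beta>" "s < n \<beta>" by (auto simp: mat_unit_def)
      have "fam_mult (mat_unit n \<alpha> a 0) (mat_unit n \<alpha> 0 b) \<beta> $$ (r, s)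
          = (\<Sum>k<n \<beta>. (if 0 = k then 1 else 0) * (if \<beta> = \<alpha> \<and> r = a \<and> s = b then 1 else 0))"
        unfolding fam_mult_def index_mult_mat_sum[OF c c rs]
        using rs by (intro sum.cong refl) (auto simp: index_mat_unit)
      then show "fam_mult (mat_unit n \<alpha> a 0) (mat_unit n \<alpha> 0 b) \<beta> $$ (r, s) = mat_unit n \<alpha> a b \<beta> $$ (r, s)"
        by (simp only: sum_delta_left[OF n_pos] index_mat_unit[OF rs])
    qed (simp_all add: fam_mult_def mat_unit_def)
  qed
  note c = Delta_carrier[OF lin, of _ _ \<gamma> \<beta>]
  have "Delta (mat_unit n \<alpha> a b) (\<gamma>, \<beta>) = mat_adjoint (Delta (mat_unit n \<alpha> 0 a) (\<gamma>, \<beta>)) * Delta (mat_unit n \<alpha> 0 b) (\<gamma>, \<beta>)"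
    unfolding mult[symmetric] star'[symmetric] Delta_mult[OF lin[of a 0, unfolded star'[symmetric]] lin] Delta_star[OF lin]
    by (simp add: fam_mult_def fam_star_def)
  then show ?thesis
    unfolding index_mult_mat_sum[OF mat_adjoint_carrier[OF c[of 0 a]] c[of 0 b] RS, symmetric]
    using RS c[of 0 a] c[of 0 b] by (simp add: index_mult_mat_sum[OF mat_adjoint_carrier[OF c[of 0 a]] c[of 0 b] RS] del: index_mult_mat(1))
qed

text \<open>By the factorization of the images of matrix units, the form at \<eta> is a finite sum
  over blocks and rows T of forms of the amplified X at other vectors, each nonnegative by
  hypothesis.\<close>

lemma Delta_completely_positive:
  assumes X: "\<And>i j. i < N \<Longrightarrow> j < N \<Longrightarrow> X i j \<in> linf n" and pos: "\<And>\<alpha>. psd (amplification n N X \<alpha>)"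
  shows "0 \<le> Re (\<Sum>i<N. \<Sum>R<n \<gamma> * n \<beta>. \<Sum>j<N. \<Sum>S<n \<gamma> * n \<beta>. cnj (\<eta> i R) * Delta (X i j) (\<gamma>, \<beta>) $$ (R, S) * \<eta> j S)"
proof -
  let ?m = "n \<gamma> * n \<beta>"
  let ?D = "\<lambda>\<alpha> a T R. Delta (mat_unit n \<alpha> 0 a) (\<gamma>, \<beta>) $$ (T, R)"
  \<comment> \<open>Row T of the image of the unit at (0, a), applied to \<eta>: the vector at which
    X is tested.\<close>
  define w where "w \<alpha> T i a = (\<Sum>R<?m. ?D \<alpha> a T R * \<eta> i R)" for \<alpha> T i a
  have inner: "cnj (\<eta> i R) * Delta (X i j) (\<gamma>, \<beta>) $$ (R, S) * \<eta> j S
      = (\<Sum>\<alpha>\<in>Delta_support \<gamma> \<beta>. \<Sum>T<?m. \<Sum>a<n \<alpha>. \<Sum>b<n \<alpha>. cnj (?D \<alpha> a T R * \<eta> i R) * X i j \<alpha> $$ (a, b) * (?D \<alpha> b T S * \<eta> j S))"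
    if ij: "i < N" "j < N" and RS: "R < ?m" "S < ?m" for i j R S
  proof -
    have "Delta (X i j) (\<gamma>, \<beta>) $$ (R, S) = (\<Sum>\<alpha>\<in>Delta_support \<gamma> \<beta>. \<Sum>a<n \<alpha>. \<Sum>b<n \<alpha>. X i j \<alpha> $$ (a, b) * (\<Sum>T<?m. cnj (?D \<alpha> a T R) * ?D \<alpha> b T S))"
      unfolding Delta_index_support[OF X[OF ij] RS]
      by (intro sum.cong refl) (simp add: Delta_mat_unit_factor[OF _ _ RS])
    also have "\<dots> = (\<Sum>\<alpha>\<in>Delta_support \<gamma> \<beta>. \<Sum>T<?m. \<Sum>a<n \<alpha>. \<Sum>b<n \<alpha>. X i j \<alpha> $$ (a, b) * (cnj (?D \<alpha> a T R) * ?D \<alpha> b T S))"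
    proof (rule sum.cong[OF refl])
      fix \<alpha>
      have "(\<Sum>a<n \<alpha>. \<Sum>b<n \<alpha>. X i j \<alpha> $$ (a, b) * (\<Sum>T<?m. cnj (?D \<alpha> a T R) * ?D \<alpha> b T S))
         = (\<Sum>a<n \<alpha>. \<Sum>T<?m. \<Sum>b<n \<alpha>. X i j \<alpha> $$ (a, b) * (cnj (?D \<alpha> a T R) * ?D \<alpha> b T S))"
        unfolding sum_distrib_left by (intro sum.cong refl sum.swap)
      also have "\<dots> = (\<Sum>T<?m. \<Sum>a<n \<alpha>. \<Sum>b<n \<alpha>. X i j \<alpha> $$ (a, b) * (cnj (?D \<alpha> a T R) * ?D \<alpha> b T S))"
        by (rule sum.swap)
      finally show "(\<Sum>a<n \<alpha>. \<Sum>b<n \<alpha>. X i j \<alpha> $$ (a, b) * (\<Sum>T<?m. cnj (?D \<alpha> a T R) * ?D \<alpha> b T S)) = \<dots>" .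
    qed
    finally show ?thesis by (simp add: sum_distrib_left sum_distrib_right mult_ac)
  qed
  have swap: "(\<Sum>i<N. \<Sum>R<?m. \<Sum>j<N. \<Sum>S<?m. \<Sum>\<alpha>\<in>Delta_support \<gamma> \<beta>. \<Sum>T<?m. \<Sum>a<n \<alpha>. \<Sum>b<n \<alpha>. F \<alpha> T i a R j b S)
      = (\<Sum>\<alpha>\<in>Delta_support \<gamma> \<beta>. \<Sum>T<?m. \<Sum>i<N. \<Sum>a<n \<alpha>. \<Sum>j<N. \<Sum>b<n \<alpha>. \<Sum>R<?m. \<Sum>S<?m. F \<alpha> T i a R j b S)"
    for F :: "'i \<Rightarrow> nat \<Rightarrow> nat \<Rightarrow> nat \<Rightarrow> nat \<Rightarrow> nat \<Rightarrow> nat \<Rightarrow> nat \<Rightarrow> complex"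
  proof -
    have "(\<Sum>i<N. \<Sum>R<?m. \<Sum>j<N. \<Sum>S<?m. \<Sum>\<alpha>\<in>Delta_support \<gamma> \<beta>. \<Sum>T<?m. \<Sum>a<n \<alpha>. \<Sum>b<n \<alpha>. F \<alpha> T i a R j b S)
      = (\<Sum>(i, R, j, S)\<in>{..<N} \<times> {..<?m} \<times> {..<N} \<times> {..<?m}. \<Sum>(\<alpha>, T, a, b)\<in>(SIGMA \<alpha>:Delta_support \<gamma> \<beta>. {..<?m} \<times> {..<n \<alpha>} \<times> {..<n \<alpha>}). F \<alpha> T i a R j b S)"
      by (simp add: sum.cartesian_product[symmetric] sum.Sigma[symmetric] finite_Delta_support)
    also have "\<dots> = (\<Sum>(\<alpha>, T, i, a, j, b, R, S)\<in>(SIGMA \<alpha>:Delta_support \<gamma> \<beta>. {..<?m} \<times> {..<N} \<times> {..<n \<alpha>} \<times> {..<N} \<times> {..<n \<alpha>} \<times> {..<?m} \<times> {..<?m}). F \<alpha> T i a R j b S)"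
      unfolding split_def sum.cartesian_product
      by (rule sum.reindex_bij_witness[where
          i = "\<lambda>(\<alpha>, T, i, a, j, b, R, S). ((i, R, j, S), (\<alpha>, T, a, b))" and j = "\<lambda>((i, R, j, S), (\<alpha>, T, a, b)). (\<alpha>, T, i, a, j, b, R, S)"]) auto
    also have "\<dots> = (\<Sum>\<alpha>\<in>Delta_support \<gamma> \<beta>. \<Sum>T<?m. \<Sum>i<N. \<Sum>a<n \<alpha>. \<Sum>j<N. \<Sum>b<n \<alpha>. \<Sum>R<?m. \<Sum>S<?m. F \<alpha> T i a R j b S)"
      by (simp add: sum.cartesian_product[symmetric] sum.Sigma[symmetric] finite_Delta_support)
    finally show ?thesis .
  qed
  have "(\<Sum>i<N. \<Sum>R<?m. \<Sum>j<N. \<Sum>S<?m. cnj (\<eta> i R) * Delta (X i j) (\<gamma>, \<beta>) $$ (R, S) * \<eta> j S)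
    = (\<Sum>i<N. \<Sum>R<?m. \<Sum>j<N. \<Sum>S<?m. \<Sum>\<alpha>\<in>Delta_support \<gamma> \<beta>. \<Sum>T<?m. \<Sum>a<n \<alpha>. \<Sum>b<n \<alpha>.
        cnj (?D \<alpha> a T R * \<eta> i R) * X i j \<alpha> $$ (a, b) * (?D \<alpha> b T S * \<eta> j S))"
    by (intro sum.cong refl) (simp only: inner lessThan_iff)
  also have "\<dots> = (\<Sum>\<alpha>\<in>Delta_support \<gamma> \<beta>. \<Sum>T<?m. \<Sum>i<N. \<Sum>a<n \<alpha>. \<Sum>j<N. \<Sum>b<n \<alpha>. \<Sum>R<?m. \<Sum>S<?m.
        cnj (?D \<alpha> a T R * \<eta> i R) * X i j \<alpha> $$ (a, b) * (?D \<alpha> b T S * \<eta> j S))"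
    by (rule swap[of "\<lambda>\<alpha> T i a R j b S. cnj (?D \<alpha> a T R * \<eta> i R) * X i j \<alpha> $$ (a, b) * (?D \<alpha> b T S * \<eta> j S)"])
  also have "\<dots> = (\<Sum>\<alpha>\<in>Delta_support \<gamma> \<beta>. \<Sum>T<?m. \<Sum>i<N. \<Sum>a<n \<alpha>. \<Sum>j<N. \<Sum>b<n \<alpha>. cnj (w \<alpha> T i a) * X i j \<alpha> $$ (a, b) * w \<alpha> T j b)"
  proof -
    have "(\<Sum>R<?m. x R) * c * (\<Sum>S<?m. y S) = (\<Sum>R<?m. \<Sum>S<?m. x R * c * y S)" for x y :: "nat \<Rightarrow> complex" and c
      by (simp only: sum_distrib_right[of x _ c] sum_product)
    then show ?thesis by (simp only: w_def cnj_sum)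
  qed
  finally have eq: "(\<Sum>i<N. \<Sum>R<?m. \<Sum>j<N. \<Sum>S<?m. cnj (\<eta> i R) * Delta (X i j) (\<gamma>, \<beta>) $$ (R, S) * \<eta> j S) = \<dots>" .
  show ?thesis
    unfolding eq Re_sum[of _ "Delta_support \<gamma> \<beta>"] Re_sum[of _ "{..<?m}"]
  proof (intro sum_nonneg)
    fix \<alpha> T
    show "0 \<le> Re (\<Sum>i<N. \<Sum>a<n \<alpha>. \<Sum>j<N. \<Sum>b<n \<alpha>. cnj (w \<alpha> T i a) * X i j \<alpha> $$ (a, b) * w \<alpha> T j b)"
      using pos[of \<alpha>] unfolding amplification_psd_iff[OF n_pos] by blast
  qed
qed

section \<open>Positivity of the kernel of a projection\<close>

text \<open>\<rho> is its square root times the adjoint of that root, so its diagonal entries are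
  sums of squares.\<close>

lemma dimq_positive: obtains r where "0 \<le> r" "dimq rho \<alpha> = complex_of_real r"
proof
  define r where "r = (\<Sum>i<n \<alpha>. \<Sum>k<n \<alpha>. (cmod (rpow (1 / 2) \<alpha> $$ (i, k)))\<^sup>2)"
  show "0 \<le> r" by (simp add: r_def sum_nonneg)
  note c = rpow_carrier[of "1 / 2" \<alpha>]
  have "rho \<alpha> $$ (i, i) = (\<Sum>k<n \<alpha>. complex_of_real ((cmod (rpow (1 / 2) \<alpha> $$ (i, k)))\<^sup>2))" if i: "i < n \<alpha>" for i
  proof -
    have "rho \<alpha> = rpow (1 / 2) \<alpha> * mat_adjoint (rpow (1 / 2) \<alpha>)"
      by (simp add: rpow_adjoint rpow_mult rpow_1)
    then have "rho \<alpha> $$ (i, i) = (\<Sum>k<n \<alpha>. rpow (1 / 2) \<alpha> $$ (i, k) * mat_adjoint (rpow (1 / 2) \<alpha>) $$ (k, i))"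
      by (simp only: index_mult_mat_sum[OF c mat_adjoint_carrier[OF c] i i])
    also have "\<dots> = (\<Sum>k<n \<alpha>. complex_of_real ((cmod (rpow (1 / 2) \<alpha> $$ (i, k)))\<^sup>2))"
      using i c by (intro sum.cong refl) (simp add: complex_norm_square del: of_real_power)
    finally show ?thesis .
  qed
  then show "dimq rho \<alpha> = complex_of_real r"
    by (simp add: dimq_rinv(2)[symmetric] r_def)
qed

lemma co_antipode_fam_carrier: "fam_carrier (co_antipode x)"
  by (simp add: fam_carrier_def co_antipode_def)

text \<open>The entries are values of P on the conjugate corepresentation with the two indices
  exchanged; the exchange is harmless because the values are scalars and commute.\<close>

lemma co_antipode_idempotent:
  assumes P: "fam_carrier P" and PP: "fam_mult P P = P"
  shows "co_antipode P \<alpha> * co_antipode P \<alpha> = co_antipode P \<alpha>"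
proof (rule eq_matI)
  note c = fam_carrierD[OF co_antipode_fam_carrier, of P \<alpha>]
  fix i j assume "i < dim_row (co_antipode P \<alpha>)" "j < dim_col (co_antipode P \<alpha>)"
  then have ij: "i < n \<alpha>" "j < n \<alpha>" by (auto simp: co_antipode_def)
  have T: "co_antipode P \<alpha> $$ (i, j) = ev P (star (u \<alpha> $$ (j, i)))" if "i < n \<alpha>" "j < n \<alpha>" for i j
    using that by (simp add: co_antipode_def antipode_u)
  have "(\<Sum>k<n \<alpha>. co_antipode P \<alpha> $$ (i, k) * co_antipode P \<alpha> $$ (k, j))
      = (\<Sum>k<n \<alpha>. ev P (star (u \<alpha> $$ (j, k))) * ev P (star (u \<alpha> $$ (k, i))))"
    using ij by (intro sum.cong refl) (simp add: T mult.commute)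
  also have "\<dots> = ev (fam_mult P P) (star (u \<alpha> $$ (j, i)))"
    unfolding ev_fam_mult[OF P P] tlift_corep[OF corep_star[OF unitary_rep_corep[OF u_rep]] ij(2,1) cbilinear_ev_mult] ..
  finally show "(co_antipode P \<alpha> * co_antipode P \<alpha>) $$ (i, j) = co_antipode P \<alpha> $$ (i, j)"
    unfolding index_mult_mat_sum[OF c c ij] PP T[OF ij] .
qed (simp_all add: co_antipode_def)

text \<open>Self-adjointness of P says that P at c is the conjugate of P at the star of the antipode
  of c. Taking c itself to be an antipode value brings in the square of the antipode, hence
  \<rho>.\<close>

lemma co_antipode_self_adjoint:
  assumes P: "fam_carrier P" and PP: "fam_star P = P"
  shows "co_antipode P \<alpha> = rho \<alpha> * mat_adjoint (co_antipode P \<alpha>) * rinv \<alpha>"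
proof (rule eq_matI)
  note c = fam_carrierD[OF co_antipode_fam_carrier, of P \<alpha>]
  let ?R = "rho \<alpha> * mat_adjoint (co_antipode P \<alpha>) * rinv \<alpha>"
  have ev_star: "ev P c = cnj (ev P (star (antipode c)))" for c
  proof (rule clinear_eq_on_coeffs[where f = "ev P" and g = "\<lambda>c. cnj (ev P (star (antipode c)))", OF clinear_ev])
    show "clinear (\<lambda>c. cnj (ev P (star (antipode c))))"
      unfolding clinear_def
      by (simp add: clinear_add[OF antipode_linear] clinear_scale[OF antipode_linear] star_add star_scaleC
          clinear_add[OF clinear_ev] clinear_scale[OF clinear_ev] scaleC_complex_def)
    fix \<alpha> i j assume ij: "i < n \<alpha>" "j < n \<alpha>"
    have "P \<alpha> $$ (i, j) = fam_star P \<alpha> $$ (i, j)" by (simp only: PP)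
    also have "\<dots> = cnj (P \<alpha> $$ (j, i))" using ij fam_carrierD[OF P, of \<alpha>] by (simp add: fam_star_def)
    finally show "ev P (u \<alpha> $$ (i, j)) = cnj (ev P (star (antipode (u \<alpha> $$ (i, j)))))"
      using ij by (simp only: ev_coeff antipode_u star_star)
  qed
  fix i j assume "i < dim_row ?R" "j < dim_col ?R"
  then have ij: "i < n \<alpha>" "j < n \<alpha>" using rho_carrier[of \<alpha>] rinv_carrier[of \<alpha>] by auto
  have "co_antipode P \<alpha> $$ (i, j) = cnj (ev P (star (antipode (antipode (u \<alpha> $$ (i, j))))))"
    using ij ev_star[of "antipode (u \<alpha> $$ (i, j))"] by (simp only: co_antipode_def index_mat(1) split_conv)
  also have "\<dots> = (\<Sum>k<n \<alpha>. \<Sum>l<n \<alpha>. rho \<alpha> $$ (i, k) * rinv \<alpha> $$ (l, j) * cnj (co_antipode P \<alpha> $$ (l, k)))"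
    unfolding antipode_antipode_coeff[OF ij] star_sum star_scaleC clinear_sum[OF clinear_ev] clinear_scale[OF clinear_ev] cnj_sum
      scaleC_complex_def complex_cnj_mult complex_cnj_cnj
    by (intro sum.cong refl) (simp add: co_antipode_def antipode_u)
  also have "\<dots> = ?R $$ (i, j)"
    unfolding index_mult3_mat_sum[OF rho_carrier mat_adjoint_carrier[OF c] rinv_carrier ij]
    using c by (intro sum.cong refl) (simp add: mult_ac)
  finally show "co_antipode P \<alpha> $$ (i, j) = ?R $$ (i, j)" .
next
  show "dim_row (co_antipode P \<alpha>) = dim_row (rho \<alpha> * mat_adjoint (co_antipode P \<alpha>) * rinv \<alpha>)"
    using rho_carrier[of \<alpha>] by (simp add: co_antipode_def)
  show "dim_col (co_antipode P \<alpha>) = dim_col (rho \<alpha> * mat_adjoint (co_antipode P \<alpha>) * rinv \<alpha>)"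
    using rinv_carrier[of \<alpha>] by (simp add: co_antipode_def)
qed

text \<open>If \<open>P\<close> is a projection then \<open>T = co_antipode P\<close> is idempotent with \<open>T \<rho> = \<rho> T\<^sup>*\<close>, so
  \<open>T \<rho> = T T \<rho> = T \<rho> T\<^sup>*\<close> is positive.\<close>

lemma co_antipode_rho_factor:
  assumes P: "fam_carrier P" and proj: "is_projection P"
  defines "Z \<equiv> \<lambda>\<alpha>. co_antipode P \<alpha> * rpow (1 / 2) \<alpha>"
  shows "co_antipode P \<alpha> * rho \<alpha> = Z \<alpha> * mat_adjoint (Z \<alpha>)"
proof -
  define T where "T = co_antipode P \<alpha>"
  note c = fam_carrierD[OF co_antipode_fam_carrier, of P \<alpha>, folded T_def]
  note c' = mat_adjoint_carrier[OF c] and r = rho_carrier[of \<alpha>] and h = rpow_carrier[of "1 / 2" \<alpha>]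
  have idem: "T * T = T" and adj: "T = rho \<alpha> * mat_adjoint T * rinv \<alpha>"
    using co_antipode_idempotent[OF P, of \<alpha>] co_antipode_self_adjoint[OF P, of \<alpha>] proj unfolding is_projection_def T_def by blast+
  have "T * rho \<alpha> = rho \<alpha> * mat_adjoint T * (rinv \<alpha> * rho \<alpha>)"
    using arg_cong[OF adj, of "\<lambda>X. X * rho \<alpha>"]
    by (simp only: assoc_mult_square[OF mult_carrier_square[OF r c'] rinv_carrier r])
  then have swap: "T * rho \<alpha> = rho \<alpha> * mat_adjoint T"
    by (simp add: rinv_rho right_mult_one_mat[OF mult_carrier_square[OF r c']])
  have "T * rho \<alpha> = T * (T * rho \<alpha>)"
    using assoc_mult_square[OF c c r] by (simp only: idem)
  also have "\<dots> = T * (rpow (1 / 2) \<alpha> * rpow (1 / 2) \<alpha> * mat_adjoint T)"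
    by (simp add: swap rpow_mult rpow_1)
  also have "\<dots> = T * rpow (1 / 2) \<alpha> * (rpow (1 / 2) \<alpha> * mat_adjoint T)"
    using c c' h by (simp only: assoc_mult_square[of _ "n \<alpha>"] mult_carrier_square)
  also have "\<dots> = Z \<alpha> * mat_adjoint (Z \<alpha>)"
    unfolding Z_def T_def[symmetric] mat_adjoint_mult[OF c h] rpow_adjoint ..
  finally show ?thesis unfolding T_def .
qed

text \<open>In block \<gamma> the kernel is the trace of u^\<gamma> against d_\<gamma> times Z and
  its adjoint; each column m of Z contributes a rank-one positive form and thus one compression of
  \<open>Delta\<close>.\<close>

lemma kernel_positive:
  assumes P: "P \<in> c00 n" and proj: "is_projection P"
  obtains F d Z where "finite F" "\<And>\<gamma>. 0 \<le> d \<gamma>"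
    "kernel P = (\<Sum>\<gamma>\<in>F. \<Sum>m<n \<gamma>. \<Sum>a<n \<gamma>. \<Sum>b<n \<gamma>. (complex_of_real (d \<gamma>) * cnj (Z \<gamma> a m) * Z \<gamma> b m) *\<^sub>C u \<gamma> $$ (a, b))"
proof -
  note Pf = c00_fam_carrier[OF P] and Tf = co_antipode_fam_carrier[of P]
  obtain F where F: "finite F" "\<And>\<alpha>. \<alpha> \<notin> F \<Longrightarrow> co_antipode P \<alpha> = 0\<^sub>m (n \<alpha>) (n \<alpha>)"
    using co_antipode_c00[OF P] unfolding c00_iff by blast
  define Z where "Z \<alpha> = co_antipode P \<alpha> * rpow (1 / 2) \<alpha>" for \<alpha>
  have Zc: "Z \<alpha> \<in> carrier_mat (n \<alpha>) (n \<alpha>)" for \<alpha>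
    unfolding Z_def by (rule mult_carrier_square[OF fam_carrierD[OF Tf] rpow_carrier])
  have fac: "co_antipode P \<alpha> * rho \<alpha> = Z \<alpha> * mat_adjoint (Z \<alpha>)" for \<alpha>
    using co_antipode_rho_factor[OF Pf proj] by (simp only: Z_def)
  have "\<exists>r. 0 \<le> r \<and> dimq rho \<alpha> = complex_of_real r" for \<alpha>
    by (rule dimq_positive[of \<alpha>]) blast
  then obtain d where d: "\<And>\<alpha>. 0 \<le> d \<alpha>" "\<And>\<alpha>. dimq rho \<alpha> = complex_of_real (d \<alpha>)" by metis
  have blk: "block (co_antipode P \<gamma> * rho \<gamma>) \<gamma> = (\<Sum>m<n \<gamma>. \<Sum>a<n \<gamma>. \<Sum>b<n \<gamma>. (cnj (Z \<gamma> $$ (a, m)) * Z \<gamma> $$ (b, m)) *\<^sub>C u \<gamma> $$ (a, b))" for \<gamma>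
  proof -
    have "block (co_antipode P \<gamma> * rho \<gamma>) \<gamma> = (\<Sum>a<n \<gamma>. \<Sum>b<n \<gamma>. \<Sum>m<n \<gamma>. (cnj (Z \<gamma> $$ (a, m)) * Z \<gamma> $$ (b, m)) *\<^sub>C u \<gamma> $$ (a, b))"
      unfolding block_def fac scaleC_sum_left[symmetric]
      using Zc[of \<gamma>] by (intro sum.cong refl arg_cong2[where f = scaleC])
        (simp add: index_mult_mat_sum[OF Zc mat_adjoint_carrier[OF Zc]] mult.commute del: index_mult_mat(1))
    also have "\<dots> = (\<Sum>a<n \<gamma>. \<Sum>m<n \<gamma>. \<Sum>b<n \<gamma>. (cnj (Z \<gamma> $$ (a, m)) * Z \<gamma> $$ (b, m)) *\<^sub>C u \<gamma> $$ (a, b))"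
      by (intro sum.cong refl sum.swap)
    finally show ?thesis by (subst sum.swap)
  qed
  have "kernel P = (\<Sum>\<gamma>\<in>F. \<Sum>m<n \<gamma>. \<Sum>a<n \<gamma>. \<Sum>b<n \<gamma>. (complex_of_real (d \<gamma>) * cnj (Z \<gamma> $$ (a, m)) * Z \<gamma> $$ (b, m)) *\<^sub>C u \<gamma> $$ (a, b))"
  proof -
    have "kernel P = (\<Sum>\<alpha>\<in>F. dimq rho \<alpha> *\<^sub>C block (co_antipode P \<alpha> * rho \<alpha>) \<alpha>)"
      unfolding kernel_eq_hat[OF P] by (rule hat_eq_sum[OF co_antipode_c00[OF P] F])
    then show ?thesis by (simp only: blk d(2) scaleC_sum_right scaleC_scaleC mult.assoc)
  qed
  then show ?thesis
    by (rule that[of F d "\<lambda>\<gamma> a m. Z \<gamma> $$ (a, m)", OF F(1) d(1)])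
qed

lemma linear_map_on_rtrans: "linear_map_on (linf n) (linf n) (rtrans c)"
  unfolding linear_map_on_def
proof (intro conjI ballI allI)
  fix x y assume x: "x \<in> linf n" and y: "y \<in> linf n"
  then show "rtrans c (fam_add x y) = fam_add (rtrans c x) (rtrans c y)"
    by (intro ext eq_matI) (simp_all add: rtrans_def fam_add_def[of "rtrans c x"] ev_add linf_fam_carrier)
next
  fix a x assume "x \<in> linf n"
  then show "rtrans c (fam_scale a x) = fam_scale a (rtrans c x)"
    by (intro ext eq_matI) (simp_all add: rtrans_def fam_scale_def[of _ "rtrans c x"] ev_scale linf_fam_carrier)
qed (rule rtrans_linf)

text \<open>Substituting the rank-one expansion of the kernel writes the form of the translated
  amplification as a nonnegative combination of forms of \<open>Delta\<close> applied to X.\<close>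

lemma rtrans_completely_positive:
  assumes P: "P \<in> c00 n" and proj: "is_projection P"
    and X: "\<And>i j. i < N \<Longrightarrow> j < N \<Longrightarrow> X i j \<in> linf n" and pos: "\<And>\<alpha>. psd (amplification n N X \<alpha>)"
  shows "psd (amplification n N (\<lambda>i j. rtrans (kernel P) (X i j)) k)"
proof (rule kernel_positive[OF P proj])
  fix F d Z
  assume F: "finite F" and d: "\<And>\<gamma>. 0 \<le> d \<gamma>"
    and kernel: "kernel P = (\<Sum>\<gamma>\<in>F. \<Sum>m<n \<gamma>. \<Sum>a<n \<gamma>. \<Sum>b<n \<gamma>. (complex_of_real (d \<gamma>) * cnj (Z \<gamma> a m) * Z \<gamma> b m) *\<^sub>C u \<gamma> $$ (a, b))"
  define A where "A x p q = rtrans (kernel P) x k $$ (p, q)" for x p q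
  have A: "A x p q = (\<Sum>\<gamma>\<in>F. \<Sum>m<n \<gamma>. \<Sum>a<n \<gamma>. \<Sum>b<n \<gamma>.
      complex_of_real (d \<gamma>) * (cnj (Z \<gamma> a m) * Z \<gamma> b m * Delta x (\<gamma>, k) $$ (a * n k + p, b * n k + q)))"
    if x: "x \<in> linf n" and pq: "p < n k" "q < n k" for x p q
  proof -
    have "A x p q = ev x (u k $$ (p, q) * kernel P)" using pq by (simp add: A_def rtrans_def)
    also have "\<dots> = (\<Sum>\<gamma>\<in>F. \<Sum>m<n \<gamma>. \<Sum>a<n \<gamma>. \<Sum>b<n \<gamma>. complex_of_real (d \<gamma>) * (cnj (Z \<gamma> a m) * Z \<gamma> b m * ev x (u k $$ (p, q) * u \<gamma> $$ (a, b))))"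
      unfolding kernel sum_distrib_left mult_scaleC_right clinear_sum[OF clinear_ev] clinear_scale[OF clinear_ev] scaleC_complex_def
      by (simp only: mult.assoc)
    also have "\<dots> = (\<Sum>\<gamma>\<in>F. \<Sum>m<n \<gamma>. \<Sum>a<n \<gamma>. \<Sum>b<n \<gamma>.
      complex_of_real (d \<gamma>) * (cnj (Z \<gamma> a m) * Z \<gamma> b m * Delta x (\<gamma>, k) $$ (a * n k + p, b * n k + q)))"
      by (intro sum.cong refl) (simp only: Delta_index[OF x _ _ pq] lessThan_iff)
    finally show ?thesis .
  qed
  have herm: "A (X j i) q p = cnj (A (X i j) p q)" if ij: "i < N" "j < N" and pq: "p < n k" "q < n k" for i j p q
  proof -
    have star: "fam_star (X i j) = X j i"
    proof (rule fam_eqI)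
      note c = linf_fam_carrier[OF X[OF ij]] and c' = linf_fam_carrier[OF X[OF ij(2,1)]]
      show "fam_carrier (fam_star (X i j))" unfolding fam_carrier_def fam_star_def using fam_carrierD[OF c] by blast
      show "fam_carrier (X j i)" by (rule c')
      fix \<alpha> a b assume ab: "a < n \<alpha>" "b < n \<alpha>"
      have "\<forall>i<N. \<forall>j<N. \<forall>a<n \<alpha>. \<forall>b<n \<alpha>. X j i \<alpha> $$ (b, a) = cnj (X i j \<alpha> $$ (a, b))"
        using pos[of \<alpha>] unfolding amplification_psd_iff[OF n_pos] by blast
      from this[rule_format, OF ij ab(2,1)] show "fam_star (X i j) \<alpha> $$ (a, b) = X j i \<alpha> $$ (a, b)"
        using ab fam_carrierD[OF c, of \<alpha>] by (simp only: fam_star_def) simp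
    qed
    have Dstar: "Delta (X j i) (\<gamma>, k) $$ (R, S) = cnj (Delta (X i j) (\<gamma>, k) $$ (S, R))" if "R < n \<gamma> * n k" "S < n \<gamma> * n k" for \<gamma> R S
      unfolding star[symmetric] Delta_star[OF X[OF ij]] using that Delta_carrier[OF X[OF ij], of \<gamma> k]
      by (simp add: fam_star_def)
    have "A (X j i) q p = (\<Sum>\<gamma>\<in>F. \<Sum>m<n \<gamma>. \<Sum>a<n \<gamma>. \<Sum>b<n \<gamma>.
      cnj (complex_of_real (d \<gamma>) * (cnj (Z \<gamma> b m) * Z \<gamma> a m * Delta (X i j) (\<gamma>, k) $$ (b * n k + p, a * n k + q))))"
      unfolding A[OF X[OF ij(2,1)] pq(2,1)]
      by (intro sum.cong refl) (simp add: Dstar pair_index_less pq)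
    also have "\<dots> = (\<Sum>\<gamma>\<in>F. \<Sum>m<n \<gamma>. \<Sum>b<n \<gamma>. \<Sum>a<n \<gamma>.
      cnj (complex_of_real (d \<gamma>) * (cnj (Z \<gamma> b m) * Z \<gamma> a m * Delta (X i j) (\<gamma>, k) $$ (b * n k + p, a * n k + q))))"
      by (intro sum.cong refl sum.swap)
    finally show ?thesis unfolding A[OF X[OF ij] pq] cnj_sum .
  qed
  have nonneg: "0 \<le> Re (\<Sum>i<N. \<Sum>p<n k. \<Sum>j<N. \<Sum>q<n k. cnj (w i p) * A (X i j) p q * w j q)" for w
  proof -
    \<comment> \<open>Column m of Z tensored with the test vector w, in the product index of block
      (\<gamma>, k).\<close>
    define \<eta> where "\<eta> \<gamma> m i R = Z \<gamma> (R div n k) m * w i (R mod n k)" for \<gamma> m i R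
    let ?f = "\<lambda>\<gamma> m. \<Sum>i<N. \<Sum>R<n \<gamma> * n k. \<Sum>j<N. \<Sum>S<n \<gamma> * n k. cnj (\<eta> \<gamma> m i R) * Delta (X i j) (\<gamma>, k) $$ (R, S) * \<eta> \<gamma> m j S"
    have f: "?f \<gamma> m = (\<Sum>i<N. \<Sum>p<n k. \<Sum>j<N. \<Sum>q<n k. \<Sum>a<n \<gamma>. \<Sum>b<n \<gamma>. cnj (w i p) *
        (cnj (Z \<gamma> a m) * Z \<gamma> b m * Delta (X i j) (\<gamma>, k) $$ (a * n k + p, b * n k + q)) * w j q)" for \<gamma> m
    proof -
      define G where "G i j a p b q = cnj (w i p) *
        (cnj (Z \<gamma> a m) * Z \<gamma> b m * Delta (X i j) (\<gamma>, k) $$ (a * n k + p, b * n k + q)) * w j q" for i j a p b q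
      have inner: "(\<Sum>S<n \<gamma> * n k. G i j a p (S div n k) (S mod n k)) = (\<Sum>b<n \<gamma>. \<Sum>q<n k. G i j a p b q)" for i j a p
        by (rule sum_lessThan_mult[OF n_pos])
      have "?f \<gamma> m = (\<Sum>i<N. \<Sum>R<n \<gamma> * n k. \<Sum>j<N. \<Sum>S<n \<gamma> * n k. G i j (R div n k) (R mod n k) (S div n k) (S mod n k))"
        by (intro sum.cong refl) (simp add: G_def \<eta>_def mult_ac)
      also have "\<dots> = (\<Sum>i<N. \<Sum>a<n \<gamma>. \<Sum>p<n k. \<Sum>j<N. \<Sum>b<n \<gamma>. \<Sum>q<n k. G i j a p b q)"
      proof (rule sum.cong[OF refl])
        fix i
        show "(\<Sum>R<n \<gamma> * n k. \<Sum>j<N. \<Sum>S<n \<gamma> * n k. G i j (R div n k) (R mod n k) (S div n k) (S mod n k))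
          = (\<Sum>a<n \<gamma>. \<Sum>p<n k. \<Sum>j<N. \<Sum>b<n \<gamma>. \<Sum>q<n k. G i j a p b q)"
          unfolding inner by (rule sum_lessThan_mult[OF n_pos, where f = "\<lambda>a p. \<Sum>j<N. \<Sum>b<n \<gamma>. \<Sum>q<n k. G i j a p b q"])
      qed
      also have "\<dots> = (\<Sum>i<N. \<Sum>p<n k. \<Sum>a<n \<gamma>. \<Sum>j<N. \<Sum>q<n k. \<Sum>b<n \<gamma>. G i j a p b q)"
        by (subst sum.swap[of _ "{..<n \<gamma>}" "{..<n k}"]) (intro sum.cong refl sum.swap)
      also have "\<dots> = (\<Sum>i<N. \<Sum>p<n k. \<Sum>j<N. \<Sum>q<n k. \<Sum>a<n \<gamma>. \<Sum>b<n \<gamma>. G i j a p b q)"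
      proof (rule sum.cong[OF refl], rule sum.cong[OF refl])
        fix i p
        have "(\<Sum>a<n \<gamma>. \<Sum>j<N. \<Sum>q<n k. \<Sum>b<n \<gamma>. G i j a p b q) = (\<Sum>j<N. \<Sum>a<n \<gamma>. \<Sum>q<n k. \<Sum>b<n \<gamma>. G i j a p b q)"
          by (rule sum.swap)
        also have "\<dots> = (\<Sum>j<N. \<Sum>q<n k. \<Sum>a<n \<gamma>. \<Sum>b<n \<gamma>. G i j a p b q)"
          by (intro sum.cong refl sum.swap)
        finally show "(\<Sum>a<n \<gamma>. \<Sum>j<N. \<Sum>q<n k. \<Sum>b<n \<gamma>. G i j a p b q) = \<dots>" .
      qed
      finally show ?thesis unfolding G_def .
    qed
    have swap: "(\<Sum>i<N. \<Sum>p<n k. \<Sum>j<N. \<Sum>q<n k. \<Sum>\<gamma>\<in>F. \<Sum>m<n \<gamma>. H i p j q \<gamma> m)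
      = (\<Sum>\<gamma>\<in>F. \<Sum>m<n \<gamma>. \<Sum>i<N. \<Sum>p<n k. \<Sum>j<N. \<Sum>q<n k. H i p j q \<gamma> m)" for H :: "nat \<Rightarrow> nat \<Rightarrow> nat \<Rightarrow> nat \<Rightarrow> 'i \<Rightarrow> nat \<Rightarrow> complex"
    proof -
      have "(\<Sum>i<N. \<Sum>p<n k. \<Sum>j<N. \<Sum>q<n k. \<Sum>\<gamma>\<in>F. \<Sum>m<n \<gamma>. H i p j q \<gamma> m)
        = (\<Sum>(i, p, j, q)\<in>{..<N} \<times> {..<n k} \<times> {..<N} \<times> {..<n k}. \<Sum>(\<gamma>, m)\<in>(SIGMA \<gamma>:F. {..<n \<gamma>}). H i p j q \<gamma> m)"
        by (simp add: sum.cartesian_product[symmetric] sum.Sigma[symmetric] F)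
      also have "\<dots> = (\<Sum>(\<gamma>, m)\<in>(SIGMA \<gamma>:F. {..<n \<gamma>}). \<Sum>(i, p, j, q)\<in>{..<N} \<times> {..<n k} \<times> {..<N} \<times> {..<n k}. H i p j q \<gamma> m)"
        unfolding split_def by (rule sum.swap)
      also have "\<dots> = (\<Sum>\<gamma>\<in>F. \<Sum>m<n \<gamma>. \<Sum>i<N. \<Sum>p<n k. \<Sum>j<N. \<Sum>q<n k. H i p j q \<gamma> m)"
        by (simp add: sum.cartesian_product[symmetric] sum.Sigma[symmetric] F)
      finally show ?thesis .
    qed
    have "(\<Sum>i<N. \<Sum>p<n k. \<Sum>j<N. \<Sum>q<n k. cnj (w i p) * A (X i j) p q * w j q)
      = (\<Sum>i<N. \<Sum>p<n k. \<Sum>j<N. \<Sum>q<n k. \<Sum>\<gamma>\<in>F. \<Sum>m<n \<gamma>. complex_of_real (d \<gamma>) * (\<Sum>a<n \<gamma>. \<Sum>b<n \<gamma>. cnj (w i p) *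
        (cnj (Z \<gamma> a m) * Z \<gamma> b m * Delta (X i j) (\<gamma>, k) $$ (a * n k + p, b * n k + q)) * w j q))"
      by (intro sum.cong refl) (simp add: A X sum_distrib_left sum_distrib_right mult_ac)
    also have "\<dots> = (\<Sum>\<gamma>\<in>F. \<Sum>m<n \<gamma>. complex_of_real (d \<gamma>) * ?f \<gamma> m)"
    proof -
      have "(\<Sum>i<N. \<Sum>p<n k. \<Sum>j<N. \<Sum>q<n k. \<Sum>\<gamma>\<in>F. \<Sum>m<n \<gamma>. complex_of_real (d \<gamma>) * H i p j q \<gamma> m)
        = (\<Sum>\<gamma>\<in>F. \<Sum>m<n \<gamma>. complex_of_real (d \<gamma>) * (\<Sum>i<N. \<Sum>p<n k. \<Sum>j<N. \<Sum>q<n k. H i p j q \<gamma> m))" for H :: "nat \<Rightarrow> nat \<Rightarrow> nat \<Rightarrow> nat \<Rightarrow> 'i \<Rightarrow> nat \<Rightarrow> complex"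
        unfolding swap[of "\<lambda>i p j q \<gamma> m. complex_of_real (d \<gamma>) * H i p j q \<gamma> m"] sum_distrib_left ..
      then show ?thesis unfolding f .
    qed
    finally have "(\<Sum>i<N. \<Sum>p<n k. \<Sum>j<N. \<Sum>q<n k. cnj (w i p) * A (X i j) p q * w j q)
      = (\<Sum>\<gamma>\<in>F. \<Sum>m<n \<gamma>. complex_of_real (d \<gamma>) * ?f \<gamma> m)" .
    then have eq: "Re (\<Sum>i<N. \<Sum>p<n k. \<Sum>j<N. \<Sum>q<n k. cnj (w i p) * A (X i j) p q * w j q) = (\<Sum>\<gamma>\<in>F. \<Sum>m<n \<gamma>. d \<gamma> * Re (?f \<gamma> m))"
      by (simp only: Re_sum[of _ F] Re_sum[of _ "{..<n _}"] Re_complex_of_real Im_complex_of_real times_complex.sel mult_zero_left diff_zero)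
    have nn: "0 \<le> Re (?f \<gamma> m)" for \<gamma> m
      using X pos by (rule Delta_completely_positive)
    show ?thesis
      unfolding eq
      by (rule sum_nonneg, rule sum_nonneg, rule mult_nonneg_nonneg[OF d nn])
  qed
  show ?thesis
    unfolding amplification_psd_iff[OF n_pos]
    by (intro conjI allI impI herm[unfolded A_def] nonneg[unfolded A_def])
qed

lemma quantum_adjacency_matrix_if_projection:
  assumes P: "P \<in> c00 n" and A: "\<And>x. x \<in> linf n \<Longrightarrow> A x = rtrans (kernel P) x" and proj: "is_projection P"
  shows "quantum_adjacency_matrix n rho A"
  unfolding quantum_adjacency_matrix_def
proof (intro conjI allI impI)
  have lin: "linear_map_on (linf n) (linf n) A"
    using linear_map_on_rtrans[of "kernel P"] unfolding linear_map_on_def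
    by (simp add: A linf_add linf_scale)
  have "psd (amplification n N (\<lambda>i j. A (X i j)) k)"
    if X: "\<forall>i<N. \<forall>j<N. X i j \<in> linf n" and pos: "\<forall>k. psd (amplification n N X k)" for N X k
  proof -
    \<comment> \<open>A is prescribed on bounded families only, so the replacement is made entry by
      entry for indices below N.\<close>
    have "amplification n N (\<lambda>i j. A (X i j)) k = amplification n N (\<lambda>i j. rtrans (kernel P) (X i j)) k"
    proof -
      have "A (X (r div n k) (s div n k)) = rtrans (kernel P) (X (r div n k) (s div n k))" if "r < N * n k" "s < N * n k" for r s
        using that X by (intro A) (auto simp: less_mult_imp_div_less)
      then show ?thesis unfolding amplification_def by (intro eq_matI) simp_all
    qed
    then show ?thesis using rtrans_completely_positive[OF P proj, of N X k] X pos by simp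
  qed
  then show "completely_positive n A"
    unfolding completely_positive_def using lin by blast
next
  fix \<alpha> i j \<gamma> assume ij: "i < n \<alpha>" "j < n \<alpha>"
  have unit: "mat_unit n \<alpha> i j \<in> linf n" and unit': "fam_mult (mat_unit n \<alpha> i j) (\<lambda>\<beta>. rinv \<beta>) \<in> linf n" for i j
    using mat_unit_c00 c00_fam_mult[OF mat_unit_c00 fam_carrier_rho(2)] c00_subset_linf by blast+
  show "(1 / dimq rho \<alpha>) \<cdot>\<^sub>m mat (n \<gamma>) (n \<gamma>) (\<lambda>(r, s). \<Sum>l<n \<alpha>.
      (A (fam_mult (mat_unit n \<alpha> i l) (\<lambda>\<beta>. rinv \<beta>)) \<gamma> * A (mat_unit n \<alpha> l j) \<gamma>) $$ (r, s)) = A (mat_unit n \<alpha> i j) \<gamma>"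
    unfolding A[OF unit] A[OF unit'] using proj
    by (intro rtrans_kernel_schur_idempotent[OF P _ ij]) (simp add: is_projection_def)
qed

section \<open>The trivial block, and the passage from adjacency matrices to projections\<close>

text \<open>In dimension one \<rho> and its inverse are scalars with equal trace, both equal to
  dim_q, so dim_q has square 1.\<close>

lemma rho_triv: "dimq rho triv * rinv triv $$ (0, 0) = dimq rho triv * dimq rho triv" "dimq rho triv * dimq rho triv = 1"
  using dimq_rinv[of triv] rho_rinv_sum[of 0 triv 0] by simp_all

text \<open>The Fourier transform of the unit of the trivial block is dim_q times \<rho>, that is
  dim_q squared, which is 1.\<close>

lemma rtrans_kernel_triv:
  assumes P: "P \<in> c00 n"
  shows "rtrans (kernel P) (mat_unit n triv 0 0) = P"
proof (rule haar_separates)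
  show "fam_carrier (rtrans (kernel P) (mat_unit n triv 0 0))" by (rule rtrans_fam_carrier)
  show "fam_carrier P" by (rule c00_fam_carrier[OF P])
  fix y assume y: "y \<in> c00 n"
  have "hat (mat_unit n triv 0 0) = (dimq rho triv * rho triv $$ (0, 0)) *\<^sub>C 1"
    using hat_mat_unit_rho[of 0 triv 0] by (simp add: u_triv scaleC_scaleC)
  then have "hat (mat_unit n triv 0 0) = 1"
    using dimq_rinv(2)[of triv] rho_triv(2) by (simp add: scaleC_one)
  then show "haar rho (fam_mult y (rtrans (kernel P) (mat_unit n triv 0 0))) = haar rho (fam_mult y P)"
    using ev_hat_mult_hat[OF mat_unit_c00 y, of triv 0 0 P] ev_hat[OF P c00_fam_carrier[OF y]]
    by (simp add: haar_rtrans[OF y])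
qed

lemma projection_if_quantum_adjacency_matrix:
  assumes P: "P \<in> c00 n" and A: "\<And>x. x \<in> linf n \<Longrightarrow> A x = rtrans (kernel P) x" and qam: "quantum_adjacency_matrix n rho A"
  shows "is_projection P"
proof -
  let ?e = "mat_unit n triv 0 0"
  note c = fam_carrierD[OF c00_fam_carrier[OF P]]
  have e: "?e \<in> linf n" using mat_unit_c00 c00_subset_linf by blast
  have Ae: "A ?e = P" by (simp add: A[OF e] rtrans_kernel_triv[OF P])
  have cp: "completely_positive n A" using qam by (simp add: quantum_adjacency_matrix_def)
  \<comment> \<open>Complete positivity is applied at N = 1, where the amplification of x is x
    itself; it makes the blocks of P positive, hence self-adjoint.\<close>
  have single: "amplification n 1 (\<lambda>i j. x) k = x k" if "fam_carrier x" for x k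
    using fam_carrierD[OF that, of k] by (intro eq_matI) (auto simp: amplification_def)
  have "psd (?e k)" for k
  proof (rule psd_mult_adjoint_self)
    show "?e k \<in> carrier_mat (n k) (n k)" by (rule fam_carrierD[OF c00_fam_carrier[OF mat_unit_c00]])
    show "mat_adjoint (?e k) = ?e k" by (intro eq_matI) (auto simp: mat_unit_def)
    show "?e k * ?e k = ?e k"
    proof (cases "k = triv")
      case True
      then show ?thesis by (intro eq_matI) (auto simp: mat_unit_def scalar_prod_def)
    next
      case False
      then have "?e k = 0\<^sub>m (n k) (n k)" by (intro eq_matI) (auto simp: mat_unit_def)
      then show ?thesis by simp
    qed
  qed
  then have "psd (amplification n 1 (\<lambda>i j. ?e) k)" for k
    unfolding single[OF c00_fam_carrier[OF mat_unit_c00]] .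
  then have "\<forall>k. psd (amplification n 1 (\<lambda>i j. A ?e) k)"
    using cp[unfolded completely_positive_def, THEN conjunct2, rule_format, of 1 "\<lambda>i j. ?e"] e by blast
  then have "psd (P k)" for k
    unfolding Ae single[OF c00_fam_carrier[OF P]] by blast
  then have star: "fam_star P = P"
    by (simp add: fam_star_def psd_def)
  \<comment> \<open>On the trivial block \<rho>^-1 is the scalar dim_q, which then cancels the
    prefactor 1 / dim_q of the adjacency relation.\<close>
  have "fam_mult ?e (\<lambda>\<beta>. rinv \<beta>) = fam_scale (dimq rho triv) ?e"
  proof (rule fam_eqI)
    show "fam_carrier (fam_mult ?e (\<lambda>\<beta>. rinv \<beta>))"
      by (rule c00_fam_carrier[OF c00_fam_mult[OF mat_unit_c00 fam_carrier_rho(2)]])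
    show "fam_carrier (fam_scale (dimq rho triv) ?e)"
      by (simp add: fam_carrier_def fam_scale_def mat_unit_def)
    fix \<alpha> i j assume ij: "i < n \<alpha>" "j < n \<alpha>"
    show "fam_mult ?e (\<lambda>\<beta>. rinv \<beta>) \<alpha> $$ (i, j) = fam_scale (dimq rho triv) ?e \<alpha> $$ (i, j)"
      unfolding fam_mult_def index_mult_mat_sum[OF fam_carrierD[OF c00_fam_carrier[OF mat_unit_c00]] rinv_carrier ij]
      using ij dimq_rinv(1)[of triv] by (cases "\<alpha> = triv") (simp_all add: fam_scale_def mat_unit_def)
  qed
  moreover have "linear_map_on (linf n) (linf n) A" using cp by (simp add: completely_positive_def)
  ultimately have Ae': "A (fam_mult ?e (\<lambda>\<beta>. rinv \<beta>)) = fam_scale (dimq rho triv) P"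
    using e by (simp add: linear_map_on_def Ae)
  have "P \<gamma> * P \<gamma> = P \<gamma>" for \<gamma>
  proof -
    have "(1 / dimq rho triv) \<cdot>\<^sub>m mat (n \<gamma>) (n \<gamma>) (\<lambda>(r, s). \<Sum>l<n triv.
      (A (fam_mult (mat_unit n triv 0 l) (\<lambda>\<beta>. rinv \<beta>)) \<gamma> * A (mat_unit n triv l 0) \<gamma>) $$ (r, s)) = A ?e \<gamma>"
      using qam n_pos[of triv] unfolding quantum_adjacency_matrix_def by blast
    then have eq: "(1 / dimq rho triv) \<cdot>\<^sub>m mat (n \<gamma>) (n \<gamma>) (\<lambda>(r, s). ((dimq rho triv \<cdot>\<^sub>m P \<gamma>) * P \<gamma>) $$ (r, s)) = P \<gamma>"
      by (simp add: Ae Ae' fam_scale_def)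
    show ?thesis
    proof (rule eq_matI)
      fix r s assume "r < dim_row (P \<gamma>)" "s < dim_col (P \<gamma>)"
      then have rs: "r < n \<gamma>" "s < n \<gamma>" using c[of \<gamma>] by auto
      have "P \<gamma> $$ (r, s) = (1 / dimq rho triv) * (dimq rho triv * (P \<gamma> * P \<gamma>) $$ (r, s))"
        using arg_cong[OF eq, of "\<lambda>M. M $$ (r, s)"] rs mult_smult_assoc_mat[OF c c, of "dimq rho triv" \<gamma>] mult_carrier_square[OF c c, of \<gamma>]
        by (simp add: carrier_matD[OF c[of \<gamma>]] dimq_nonzero del: index_mult_mat(1))
      then show "(P \<gamma> * P \<gamma>) $$ (r, s) = P \<gamma> $$ (r, s)"
        using dimq_nonzero[of triv] by simp
    qed (use c[of \<gamma>] in auto)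
  qed
  then show ?thesis unfolding is_projection_def using star by (simp add: fam_mult_def)
qed

end

theorem theorem4:
  fixes comul :: "'a::complex_star_algebra \<Rightarrow> ('a, 'a) tensor"
    and counit :: "'a \<Rightarrow> complex" and antipode :: "'a \<Rightarrow> 'a"
    and n :: "'i \<Rightarrow> nat" and u :: "'i \<Rightarrow> 'a mat" and rho :: "'i \<Rightarrow> complex mat"
    and Delta :: "('i \<Rightarrow> complex mat) \<Rightarrow> 'i \<times> 'i \<Rightarrow> complex mat"
    and S :: "('i \<Rightarrow> complex mat) \<Rightarrow> 'i \<Rightarrow> complex mat"
    and P :: "'i \<Rightarrow> complex mat"
    and A :: "('i \<Rightarrow> complex mat) \<Rightarrow> 'i \<Rightarrow> complex mat"
  assumes "discrete_quantum_group comul counit antipode n u rho Delta S"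
    and "P \<in> c00 n"
    and "\<And>x. x \<in> linf n \<Longrightarrow> A x = convolution n rho Delta P x"
  shows "(quantum_adjacency_matrix n rho A \<longleftrightarrow> is_projection P) \<and>
    (S P = P \<longrightarrow> GNS_symmetric n rho A) \<and>
    (unitary_antipode rho S P = P \<longrightarrow> KMS_symmetric n rho A)"
proof -
  interpret discrete_quantum_group comul counit antipode n u rho Delta S by (rule assms(1))
  note P = assms(2)
  have A: "A x = rtrans (kernel P) x" if "x \<in> linf n" for x
    unfolding assms(3)[OF that] by (rule convolution_eq[OF P that])
  show ?thesis
    using quantum_adjacency_matrix_if_projection[OF P A] projection_if_quantum_adjacency_matrix[OF P A]
      GNS_symmetric_if[OF P A] KMS_symmetric_if[OF P A] by blast
qed

end
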